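(* Assume $\diamondsuit(S)$ for some stationary co-stationary set $S\subseteq\omega_1$. Let $T=K_{\omega_1}$ be the final compactum of a realisation of Talagrand's construction such that no two disjoint non-metrisable closed subspaces of $T$ are homeomorphic (so that $T$ does not have 2DCP). Then the Banach space $C(T)$ has the Grothendieck property and the weak-star compact unit ball of $C(T)^*$ contains no (homeomorphic) copy of $\beta\omega$. In particular, $T$ contains neither a non-trivial convergent sequence nor a copy of $\beta\omega$.
   Context: For a stationary set $S\subseteq\omega_1$, $\diamondsuit(S)$ says: there are sets $D_\alpha\subseteq\alpha$ ($\alpha\in S$) such that for every $A\subseteq\omega_1$ the set $\{\alpha\in S: D_\alpha=A\cap\alpha\}$ is stationary. Co-stationary means that $\omega_1\setminus S$ is stationary. 2DCP: a Tychonoff space $X$ has the two-disjoint-copies property (2DCP) if there is a sequence $(K_n)_{n\in\omega}$ of non-empty compact subsets of $X$ such that each $K_n$ contains two disjoint subsets homeomorphic to $K_{n+1}$. A Banach space $E$ has the Grothendieck property if every weak-star convergent sequence in $E^*$ is weakly convergent. Notation. $2^\alpha=\{0,1\}^\alpha$ has the product topology; for $\beta\le\alpha$, $\pi_{\beta,\alpha}$ is restriction of coordinates from $\alpha$ to $\beta$. For compact $K$, $M(K)=C(K)^*$ is the space of signed Radon measures with total variation norm; $\lambda^+$ is the positive part of $\lambda$; $f_*\lambda$ is the push-forward. A realisation of Talagrand's construction consists of the following data. (1) Compact spaces $K_\alpha\subseteq 2^\alpha$ ($\omega\le\alpha\le\omega_1$) with $K_\omega=2^\omega$; $K_{\alpha+1}=(Y_\alpha\times\{0\})\cup(Z_\alpha\times\{1\})$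 with $Y_\alpha,Z_\alpha\subseteq K_\alpha$ closed and $Y_\alpha\cup Z_\alpha=K_\alpha$; and, for limit $\rho>\omega$, $K_\rho=\{t\in 2^\rho: t|_\beta\in K_\beta\text{ for all }\omega\le\beta<\rho\}$ (the inverse limit). The final compactum is $T=K_{\omega_1}$. (2) A scheduling map $\eta:[\omega,\omega_1)\to[\omega,\omega_1)\times\omega_1$ such that $\eta(\alpha)=(\theta,\delta)$ implies $\theta\le\alpha$ and $\delta\le\alpha$, and each pair $(\theta,\delta)\in[\omega,\omega_1)\times\omega_1$ equals $\eta(\alpha)$ for cofinally many $\alpha<\omega_1$ with $\alpha\ge\max\{\theta,\delta\}$. (3) For each $\beta\in[\omega,\omega_1)$, an enumeration $\big((U_n(\beta,\gamma))_{n\in\omega}\big)_{\gamma<\omega_1}$ of all sequences of pairwise disjoint non-empty clopen subsets of $K_\beta$. For $\theta\le\alpha$ and $\eta(\theta)=(\beta,\gamma)$ put $V_n(\theta,\alpha)=\pi_{\beta,\alpha}^{-1}(U_n(\beta,\gamma))\cap K_\alpha$. (4) For each $\theta\in[\omega,\omega_1)$, an enumeration $\big((\nu_n(\theta,\delta))_{n\in\omega}\big)_{\delta<\omega_1}$ of all admissible sequences in $M(K_\theta)$, i.e. those with $\|\nu_n\|=|\nu_n|(V_n(\theta,\theta))=1$ and $\|\nu_n^+\|\ge\frac12$ for all $n$. For $\theta\le\alpha$ put $B_n(\theta,\delta,\alpha)=\{\lambda\in M(K_\alpha):\|\lambda\|=1,\ (\pi_{\theta,\alpha})_*\lambda=\nu_n(\theta,\delta)\}$.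 (5) Sets $I(\theta,\alpha)$, $J(\theta,\delta,\alpha)$ (for $\omega\le\theta<\alpha<\omega_1$, $\delta<\alpha$) and $N_0(\theta,\delta),N_1(\theta,\delta)$, all subsets of $\omega$, such that: (A) $J(\theta,\delta,\alpha)\subseteq I(\theta,\alpha)$. (B) $N_0(\theta,\delta)\cap N_1(\theta,\delta)=\varnothing$. (C) $J(\theta,\delta,\alpha)\cap N_e(\theta,\delta)$ is infinite for $e=0,1$. (D) If $\alpha'\le\alpha$ and $\delta<\alpha'$, then $J(\theta,\delta,\alpha)\setminus J(\theta,\delta,\alpha')$ and $I(\theta,\alpha)\setminus I(\theta,\alpha')$ are finite whenever both sides are defined. (E) If $\omega\le\theta\le\alpha'<\alpha$, then for all sufficiently large $n\in I(\theta,\alpha)$: if $t,t'\in V_n(\theta,\alpha)$ and $\pi_{\theta,\alpha}(t)=\pi_{\theta,\alpha}(t')$, then $t(\alpha')=t'(\alpha')$. (F) For every choice $\lambda_n\in B_n(\theta,\delta,\alpha)$, the weak-star limit of $\lambda_n$ as $n\to\infty$ along $J(\theta,\delta,\alpha)$ exists. (G) If $\alpha=\alpha'+1$ and $\eta(\alpha')=(\theta,\delta)$, then for every choice $\lambda_n\in B_n(\theta,\delta,\alpha)$ both sets $\{n:\lambda_n(Z_{\alpha'}\times\{1\})\ge 1/6\}$ and $\{n:\lambda_n(Z_{\alpha'}\times\{1\})=0\}$ are infinite. *)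

theory Defs
  imports "HOL-Analysis.Analysis" "HOL-Library.Countable_Set_Type"
begin

section \<open>The ordinal \<open>\<omega>\<^sub>1\<close>\<close>

text \<open>
  The elements of the following well-ordered type are the countable ordinals; an ordinal
  \<open>\<alpha> < \<omega>\<^sub>1\<close>, regarded as a set, is \<open>{..<\<alpha>}\<close>, and \<open>\<omega>\<^sub>1\<close> itself is \<open>UNIV\<close>.
\<close>

typedef omega1 = "Field (cardSuc natLeq)"
proof -
  have "infinite (Field (cardSuc natLeq))"
    using cardSuc_finite[OF natLeq_Card_order] Field_natLeq by simp
  then have "Field (cardSuc natLeq) \<noteq> {}" by (metis finite.emptyI)
  then show ?thesis by blast
qed

lemma Well_order_cardSuc_natLeq: "Well_order (cardSuc natLeq)"
  using cardSuc_Card_order[OF natLeq_Card_order] card_order_on_well_order_on by blast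

instantiation omega1 :: wellorder
begin

definition less_eq_omega1 :: "omega1 \<Rightarrow> omega1 \<Rightarrow> bool" where
  "x \<le> y \<longleftrightarrow> (Rep_omega1 x, Rep_omega1 y) \<in> cardSuc natLeq"

definition less_omega1 :: "omega1 \<Rightarrow> omega1 \<Rightarrow> bool" where
  "x < y \<longleftrightarrow> x \<le> y \<and> x \<noteq> y" for x y :: omega1

instance
proof
  note wo = Well_order_cardSuc_natLeq
  have refl: "refl_on (Field (cardSuc natLeq)) (cardSuc natLeq)"
    and trans: "trans (cardSuc natLeq)" and antisym: "antisym (cardSuc natLeq)"
    and total: "total_on (Field (cardSuc natLeq)) (cardSuc natLeq)"
    and wf: "wf (cardSuc natLeq - Id)"
    using wo by (auto simp: order_on_defs)
  have antis: "x = y" if "x \<le> y" "y \<le> x" for x y :: omega1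
    using that antisym by (metis less_eq_omega1_def antisymD Rep_omega1_inject)
  fix x y z :: omega1
  show "(x < y) = (x \<le> y \<and> \<not> y \<le> x)"
    using antis refl Rep_omega1 by (auto simp: less_omega1_def less_eq_omega1_def refl_on_def)
  show "x \<le> x"
    using refl Rep_omega1 by (auto simp: less_eq_omega1_def refl_on_def)
  show "x \<le> z" if "x \<le> y" "y \<le> z"
    using that trans by (auto simp: less_eq_omega1_def trans_def)
  show "x = y" if "x \<le> y" "y \<le> x"
    using that by (rule antis)
  show "x \<le> y \<or> y \<le> x"
    using total refl Rep_omega1[of x] Rep_omega1[of y]
    unfolding less_eq_omega1_def total_on_def refl_on_def by metis
next
  fix P :: "omega1 \<Rightarrow> bool" and a :: omega1
  assume step: "\<And>x. (\<And>y. y < x \<Longrightarrow> P y) \<Longrightarrow> P x"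
  have wf: "wf (cardSuc natLeq - Id)"
    using Well_order_cardSuc_natLeq by (auto simp: order_on_defs)
  have "wf (inv_image (cardSuc natLeq - Id) Rep_omega1)"
    using wf by (rule wf_inv_image)
  then show "P a"
  proof (induction a rule: wf_induct_rule)
    case (less x)
    show ?case
      by (rule step, rule less)
        (auto simp: less_omega1_def less_eq_omega1_def Rep_omega1_inject)
  qed
qed

end

lemma countable_lessThan_omega1:
  includes cardinal_syntax
  shows "countable {..<\<alpha>::omega1}"
proof -
  let ?r = "cardSuc natLeq"
  have inj: "inj_on Rep_omega1 {..<\<alpha>}"
    by (simp add: inj_on_def Rep_omega1_inject)
  have sub: "Rep_omega1 ` {..<\<alpha>} \<subseteq> underS ?r (Rep_omega1 \<alpha>)"
    by (auto simp: underS_def less_omega1_def less_eq_omega1_def Rep_omega1_inject)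
  have co: "Card_order ?r" by (rule cardSuc_Card_order[OF natLeq_Card_order])
  have "|underS ?r (Rep_omega1 \<alpha>)| <o ?r"
    by (rule card_of_underS[OF co Rep_omega1])
  then have "|underS ?r (Rep_omega1 \<alpha>)| \<le>o natLeq"
    using cardSuc_ordLess_ordLeq[OF natLeq_Card_order card_of_Card_order, of "underS ?r (Rep_omega1 \<alpha>)"]
      cardSuc_ordLeq_ordLess[OF natLeq_Card_order card_of_Card_order, of "underS ?r (Rep_omega1 \<alpha>)"]
    by blast
  then have "countable (underS ?r (Rep_omega1 \<alpha>))"
    by (simp add: countable_card_le_natLeq)
  then show ?thesis
    using inj sub by (meson countable_image_inj_on countable_subset)
qed

lemma uncountable_omega1:
  includes cardinal_syntax
  shows "uncountable (UNIV :: omega1 set)"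
proof
  assume "countable (UNIV :: omega1 set)"
  moreover have "range Rep_omega1 = Field (cardSuc natLeq)"
    using type_definition.Rep_range[OF type_definition_omega1] .
  ultimately have "countable (Field (cardSuc natLeq))"
    by (metis countable_image)
  then have "|Field (cardSuc natLeq)| \<le>o natLeq"
    by (simp add: countable_card_le_natLeq)
  moreover have "|Field (cardSuc natLeq)| =o cardSuc natLeq"
    by (rule card_of_Field_ordIso[OF cardSuc_Card_order[OF natLeq_Card_order]])
  ultimately have "cardSuc natLeq \<le>o natLeq"
    by (metis ordIso_ordLeq_trans ordIso_symmetric)
  then show False
    using cardSuc_greater[OF natLeq_Card_order] not_ordLess_ordLeq by blast
qed

definition limit_ord :: "omega1 \<Rightarrow> bool" where
  "limit_ord \<alpha> \<longleftrightarrow> {..<\<alpha>} \<noteq> {} \<and> (\<forall>\<beta><\<alpha>. \<exists>\<gamma><\<alpha>. \<beta> < \<gamma>)"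

definition omega0 :: omega1 where
  "omega0 = (LEAST \<alpha>. limit_ord \<alpha>)"

definition osuc :: "omega1 \<Rightarrow> omega1" where
  "osuc \<alpha> = (LEAST \<beta>. \<alpha> < \<beta>)"

lemma less_osuc: "\<alpha> < osuc \<alpha>"
proof -
  have "\<exists>\<beta>. \<alpha> < \<beta>"
  proof (rule ccontr)
    assume "\<nexists>\<beta>. \<alpha> < \<beta>"
    then have "(UNIV :: omega1 set) = insert \<alpha> {..<\<alpha>}" by (auto simp: not_less order_le_less)
    then show False
      using countable_lessThan_omega1 uncountable_omega1 by (metis countable_insert)
  qed
  then show ?thesis unfolding osuc_def by (rule LeastI_ex)
qed

lemma lessThan_osuc: "{..<osuc \<alpha>} = {..\<alpha>}"
proof -
  have "\<beta> \<le> \<alpha>" if "\<beta> < osuc \<alpha>" for \<beta>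
    using that not_less_Least unfolding osuc_def not_less[symmetric] by blast
  then show ?thesis using less_osuc by (auto intro: le_less_trans)
qed

lemma limit_ord_omega0: "limit_ord omega0"
proof -
  have "\<exists>\<alpha>. limit_ord \<alpha>"
  proof (rule ccontr)
    assume neg: "\<nexists>\<alpha>. limit_ord \<alpha>"
    have "finite {..<\<alpha>}" for \<alpha> :: omega1
    proof (induction \<alpha> rule: less_induct)
      case (less \<alpha>)
      show ?case
      proof (cases "{..<\<alpha>} = {}")
        case False
        then obtain \<beta> where \<beta>: "\<beta> < \<alpha>" "\<forall>\<gamma><\<alpha>. \<gamma> \<le> \<beta>"
          using neg unfolding limit_ord_def by (meson not_less)
        then have "{..<\<alpha>} \<subseteq> insert \<beta> {..<\<beta>}" by (auto simp: order_le_less)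
        then show ?thesis using less[OF \<beta>(1)] by (meson finite_insert finite_subset)
      qed simp
    qed
    then have "inj (\<lambda>\<alpha>::omega1. card {..<\<alpha>})"
      by (intro linorder_injI) (metis less_imp_neq psubset_card_mono lessThan_strict_subset_iff)
    then show False
      using uncountable_omega1 by (metis countableI)
  qed
  then show ?thesis unfolding omega0_def by (rule LeastI_ex)
qed

definition club :: "omega1 set \<Rightarrow> bool" where
  "club C \<longleftrightarrow> (\<forall>\<beta>. \<exists>\<gamma>\<in>C. \<beta> < \<gamma>) \<and>
     (\<forall>\<alpha>. limit_ord \<alpha> \<and> (\<forall>\<beta><\<alpha>. \<exists>\<gamma>\<in>C. \<beta> < \<gamma> \<and> \<gamma> < \<alpha>) \<longrightarrow> \<alpha> \<in> C)"

definition stationary :: "omega1 set \<Rightarrow> bool" where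
  "stationary S \<longleftrightarrow> (\<forall>C. club C \<longrightarrow> S \<inter> C \<noteq> {})"

definition diamond :: "omega1 set \<Rightarrow> bool" where
  "diamond S \<longleftrightarrow> (\<exists>D :: omega1 \<Rightarrow> omega1 set. (\<forall>\<alpha>\<in>S. D \<alpha> \<subseteq> {..<\<alpha>}) \<and>
     (\<forall>A. stationary {\<alpha> \<in> S. D \<alpha> = A \<inter> {..<\<alpha>}}))"


section \<open>Topological notions\<close>

definition contains_copy :: "'a topology \<Rightarrow> 'b topology \<Rightarrow> bool" where
  "contains_copy X Y \<longleftrightarrow> (\<exists>A. A \<subseteq> topspace X \<and> subtopology X A homeomorphic_space Y)"

definition two_disjoint_copies :: "'a topology \<Rightarrow> bool" where
  "two_disjoint_copies X \<longleftrightarrow>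
     (\<exists>K :: nat \<Rightarrow> 'a set. \<forall>n. K n \<noteq> {} \<and> compactin X (K n) \<and>
        (\<exists>A B. A \<subseteq> K n \<and> B \<subseteq> K n \<and> A \<inter> B = {} \<and>
           subtopology X A homeomorphic_space subtopology X (K (Suc n)) \<and>
           subtopology X B homeomorphic_space subtopology X (K (Suc n))))"

definition nontrivial_convergent_sequence :: "'a topology \<Rightarrow> bool" where
  "nontrivial_convergent_sequence X \<longleftrightarrow>
     (\<exists>(x :: nat \<Rightarrow> 'a) l. range x \<subseteq> topspace X \<and> limitin X x l sequentially \<and>
        \<not> eventually (\<lambda>n. x n = l) sequentially)"

text \<open>
  The Stone--Cech compactification: the closure of the image of \<open>X\<close> under the evaluation map
  into the cube \<open>[0,1]\<^bsup>C(X,[0,1])\<^esup>\<close>.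
\<close>

definition unit_interval_maps :: "'a topology \<Rightarrow> ('a \<Rightarrow> real) set" where
  "unit_interval_maps X =
     {f \<in> extensional (topspace X). continuous_map X (top_of_set {0..1}) f}"

definition stone_cech :: "'a topology \<Rightarrow> (('a \<Rightarrow> real) \<Rightarrow> real) topology" where
  "stone_cech X =
     (let Q = product_topology (\<lambda>_. top_of_set {0..1}) (unit_interval_maps X)
      in subtopology Q (Q closure_of
           ((\<lambda>x. \<lambda>f\<in>unit_interval_maps X. f x) ` topspace X)))"

abbreviation beta_omega :: "((nat \<Rightarrow> real) \<Rightarrow> real) topology" where
  "beta_omega \<equiv> stone_cech (discrete_topology (UNIV :: nat set))"


section \<open>Normed spaces with an explicit carrier, duality\<close>

text \<open>
  The space \<open>C(T)\<close> depends on a parameter \<open>T\<close> and hence is not the universe of a type, so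
  real normed spaces are given by a carrier together with the operations on it.  Functionals are
  extensional on the carrier, so that they are determined by their values on it.
\<close>

record 'v nspace =
  vcarrier :: "'v set"
  vadd :: "'v \<Rightarrow> 'v \<Rightarrow> 'v"
  vscale :: "real \<Rightarrow> 'v \<Rightarrow> 'v"
  vnorm :: "'v \<Rightarrow> real"

definition dual_space :: "'v nspace \<Rightarrow> ('v \<Rightarrow> real) nspace" where
  "dual_space E =
     \<lparr> vcarrier = {\<phi> \<in> extensional (vcarrier E).
          (\<forall>x\<in>vcarrier E. \<forall>y\<in>vcarrier E. \<phi> (vadd E x y) = \<phi> x + \<phi> y) \<and>
          (\<forall>c. \<forall>x\<in>vcarrier E. \<phi> (vscale E c x) = c * \<phi> x) \<and>
          (\<exists>b. \<forall>x\<in>vcarrier E. \<bar>\<phi> x\<bar> \<le> b * vnorm E x)},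
       vadd = (\<lambda>\<phi> \<psi>. \<lambda>x\<in>vcarrier E. \<phi> x + \<psi> x),
       vscale = (\<lambda>c \<phi>. \<lambda>x\<in>vcarrier E. c * \<phi> x),
       vnorm = (\<lambda>\<phi>. Sup {\<bar>\<phi> x\<bar> |x. x \<in> vcarrier E \<and> vnorm E x \<le> 1}) \<rparr>"

definition weak_topology :: "'v nspace \<Rightarrow> 'v topology" where
  "weak_topology E = pullback_topology (vcarrier E) (\<lambda>x. \<lambda>\<phi>\<in>vcarrier (dual_space E). \<phi> x)
     (product_topology (\<lambda>_. euclideanreal) (vcarrier (dual_space E)))"

definition weak_star_topology :: "'v nspace \<Rightarrow> ('v \<Rightarrow> real) topology" where
  "weak_star_topology E =
     subtopology (product_topology (\<lambda>_. euclideanreal) (vcarrier E)) (vcarrier (dual_space E))"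

definition dual_ball :: "'v nspace \<Rightarrow> ('v \<Rightarrow> real) topology" where
  "dual_ball E = subtopology (weak_star_topology E)
     {\<phi> \<in> vcarrier (dual_space E). vnorm (dual_space E) \<phi> \<le> 1}"

definition grothendieck_property :: "'v nspace \<Rightarrow> bool" where
  "grothendieck_property E \<longleftrightarrow>
     (\<forall>\<phi> :: nat \<Rightarrow> 'v \<Rightarrow> real. range \<phi> \<subseteq> vcarrier (dual_space E) \<longrightarrow>
        (\<exists>\<psi>. limitin (weak_star_topology E) \<phi> \<psi> sequentially) \<longrightarrow>
        (\<exists>\<psi>. limitin (weak_topology (dual_space E)) \<phi> \<psi> sequentially))"

text \<open>The supremum norm below is meaningful for compact non-empty \<open>X\<close>, the only case used.\<close>

definition Cont :: "'a topology \<Rightarrow> ('a \<Rightarrow> real) nspace" where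
  "Cont X =
     \<lparr> vcarrier = {f \<in> extensional (topspace X). continuous_map X euclideanreal f},
       vadd = (\<lambda>f g. \<lambda>x\<in>topspace X. f x + g x),
       vscale = (\<lambda>c f. \<lambda>x\<in>topspace X. c * f x),
       vnorm = (\<lambda>f. SUP x\<in>topspace X. \<bar>f x\<bar>) \<rparr>"


section \<open>Signed Radon measures\<close>

definition borel_sets :: "'a topology \<Rightarrow> 'a set set" where
  "borel_sets X = sigma_sets (topspace X) {U. openin X U}"

definition total_variation :: "'a topology \<Rightarrow> ('a set \<Rightarrow> real) \<Rightarrow> 'a set \<Rightarrow> real" where
  "total_variation X \<mu> A =
     Sup {(\<Sum>B\<in>P. \<bar>\<mu> B\<bar>) |P. finite P \<and> P \<subseteq> borel_sets X \<and> disjoint P \<and> \<Union>P = A}"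

text \<open>Set functions are normalised to be \<open>0\<close> off the Borel sets.\<close>

definition radon_measures :: "'a topology \<Rightarrow> ('a set \<Rightarrow> real) set" where
  "radon_measures X =
     {\<mu>. (\<forall>A. A \<notin> borel_sets X \<longrightarrow> \<mu> A = 0) \<and>
         (\<forall>A :: nat \<Rightarrow> 'a set. range A \<subseteq> borel_sets X \<longrightarrow> disjoint_family A \<longrightarrow>
            (\<lambda>n. \<mu> (A n)) sums \<mu> (\<Union>n. A n)) \<and>
         (\<forall>A\<in>borel_sets X. \<forall>\<epsilon>>0. \<exists>C. compactin X C \<and> C \<subseteq> A \<and>
            total_variation X \<mu> (A - C) < \<epsilon>)}"

definition mnorm :: "'a topology \<Rightarrow> ('a set \<Rightarrow> real) \<Rightarrow> real" where
  "mnorm X \<mu> = total_variation X \<mu> (topspace X)"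

text \<open>Jordan decomposition: \<open>\<mu>\<^sup>+(A)\<close> is the supremum of \<open>\<mu>\<close> over the Borel subsets of \<open>A\<close>.\<close>

definition pos_part :: "'a topology \<Rightarrow> ('a set \<Rightarrow> real) \<Rightarrow> 'a set \<Rightarrow> real" where
  "pos_part X \<mu> A =
     (if A \<in> borel_sets X then Sup {\<mu> B |B. B \<in> borel_sets X \<and> B \<subseteq> A} else 0)"

definition neg_part :: "'a topology \<Rightarrow> ('a set \<Rightarrow> real) \<Rightarrow> 'a set \<Rightarrow> real" where
  "neg_part X \<mu> = pos_part X (\<lambda>A. - \<mu> A)"

definition signed_integral :: "'a topology \<Rightarrow> ('a set \<Rightarrow> real) \<Rightarrow> ('a \<Rightarrow> real) \<Rightarrow> real" where
  "signed_integral X \<mu> f =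
     integral\<^sup>L (measure_of (topspace X) (borel_sets X) (\<lambda>A. ennreal (pos_part X \<mu> A))) f -
     integral\<^sup>L (measure_of (topspace X) (borel_sets X) (\<lambda>A. ennreal (neg_part X \<mu> A))) f"

definition push_forward ::
  "'a topology \<Rightarrow> 'b topology \<Rightarrow> ('a \<Rightarrow> 'b) \<Rightarrow> ('a set \<Rightarrow> real) \<Rightarrow> 'b set \<Rightarrow> real" where
  "push_forward X Y f \<mu> =
     (\<lambda>A. if A \<in> borel_sets Y then \<mu> (f -` A \<inter> topspace X) else 0)"

definition weak_star_limit_exists_along ::
  "'a topology \<Rightarrow> nat set \<Rightarrow> (nat \<Rightarrow> 'a set \<Rightarrow> real) \<Rightarrow> bool" where
  "weak_star_limit_exists_along X J \<mu> \<longleftrightarrow>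
     (\<exists>\<kappa>\<in>radon_measures X. \<forall>f\<in>vcarrier (Cont X).
        ((\<lambda>n. signed_integral X (\<mu> n) f) \<longlongrightarrow> signed_integral X \<kappa> f)
          (inf sequentially (principal J)))"


section \<open>Talagrand's construction\<close>

text \<open>
  A point of \<open>2\<^sup>\<alpha>\<close> is a function on the countable ordinals that is extensional on \<open>{..<\<alpha>}\<close>,
  with \<open>False\<close> for 0 and \<open>True\<close> for 1.
\<close>

type_synonym point = "omega1 \<Rightarrow> bool"

definition cube :: "omega1 set \<Rightarrow> point topology" where
  "cube A = product_topology (\<lambda>_. discrete_topology UNIV) A"

definition proj :: "omega1 \<Rightarrow> point \<Rightarrow> point" where
  "proj \<beta> t = restrict t {..<\<beta>}"

definition app0 :: "omega1 \<Rightarrow> point set \<Rightarrow> point set" where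
  "app0 \<alpha> A = (\<lambda>t. t(\<alpha> := False)) ` A"

definition app1 :: "omega1 \<Rightarrow> point set \<Rightarrow> point set" where
  "app1 \<alpha> A = (\<lambda>t. t(\<alpha> := True)) ` A"

definition level :: "(omega1 \<Rightarrow> point set) \<Rightarrow> omega1 \<Rightarrow> point topology" where
  "level K \<alpha> = subtopology (cube {..<\<alpha>}) (K \<alpha>)"

text \<open>The compactum \<open>K\<^bsub>\<omega>\<^sub>1\<^esub>\<close>, the inverse limit of all countable levels.\<close>

definition final_compactum :: "(omega1 \<Rightarrow> point set) \<Rightarrow> point topology" where
  "final_compactum K =
     subtopology (cube UNIV) {t. \<forall>\<beta>\<ge>omega0. proj \<beta> t \<in> K \<beta>}"

definition Vset ::
  "(omega1 \<Rightarrow> point set) \<Rightarrow> (omega1 \<Rightarrow> omega1 \<times> omega1) \<Rightarrow>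
   (omega1 \<Rightarrow> omega1 \<Rightarrow> nat \<Rightarrow> point set) \<Rightarrow> omega1 \<Rightarrow> omega1 \<Rightarrow> nat \<Rightarrow> point set" where
  "Vset K \<eta> U \<theta> \<alpha> n =
     (case \<eta> \<theta> of (\<beta>, \<gamma>) \<Rightarrow> proj \<beta> -` U \<beta> \<gamma> n \<inter> K \<alpha>)"

definition admissible ::
  "point topology \<Rightarrow> (nat \<Rightarrow> point set) \<Rightarrow> (nat \<Rightarrow> point set \<Rightarrow> real) \<Rightarrow> bool" where
  "admissible X W \<mu> \<longleftrightarrow>
     (\<forall>n. \<mu> n \<in> radon_measures X \<and> mnorm X (\<mu> n) = 1 \<and>
          total_variation X (\<mu> n) (W n) = 1 \<and> mnorm X (pos_part X (\<mu> n)) \<ge> 1/2)"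

definition Bset ::
  "(omega1 \<Rightarrow> point set) \<Rightarrow> (omega1 \<Rightarrow> omega1 \<Rightarrow> nat \<Rightarrow> point set \<Rightarrow> real) \<Rightarrow>
   omega1 \<Rightarrow> omega1 \<Rightarrow> omega1 \<Rightarrow> nat \<Rightarrow> (point set \<Rightarrow> real) set" where
  "Bset K \<nu> \<theta> \<delta> \<alpha> n =
     {\<mu> \<in> radon_measures (level K \<alpha>). mnorm (level K \<alpha>) \<mu> = 1 \<and>
        push_forward (level K \<alpha>) (level K \<theta>) (proj \<theta>) \<mu> = \<nu> \<theta> \<delta> n}"

text \<open>
  The assumptions \<open>cond_A\<close> to \<open>cond_G\<close> on the index sets \<open>I\<close>, \<open>J\<close>, \<open>N0\<close>, \<open>N1\<close> are required exactly
  where \<open>I \<theta> \<alpha>\<close> (for \<open>\<omega> \<le> \<theta> < \<alpha>\<close>) and \<open>J \<theta> \<delta> \<alpha>\<close> (for moreover \<open>\<delta> < \<alpha>\<close>) are defined.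
  Only indices in the ranges occurring in the assumptions are meaningful; in particular the
  values of \<open>K\<close>, \<open>\<eta>\<close>, \<open>U\<close> and \<open>\<nu>\<close> at first arguments below \<open>\<omega>\<close> are irrelevant.
\<close>

locale talagrand_realisation =
  fixes K Y Z :: "omega1 \<Rightarrow> point set"
    and \<eta> :: "omega1 \<Rightarrow> omega1 \<times> omega1"
    and U :: "omega1 \<Rightarrow> omega1 \<Rightarrow> nat \<Rightarrow> point set"
    and \<nu> :: "omega1 \<Rightarrow> omega1 \<Rightarrow> nat \<Rightarrow> point set \<Rightarrow> real"
    and I :: "omega1 \<Rightarrow> omega1 \<Rightarrow> nat set"
    and J :: "omega1 \<Rightarrow> omega1 \<Rightarrow> omega1 \<Rightarrow> nat set"
    and N0 N1 :: "omega1 \<Rightarrow> omega1 \<Rightarrow> nat set"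
  assumes K_compact: "omega0 \<le> \<alpha> \<Longrightarrow> compactin (cube {..<\<alpha>}) (K \<alpha>)"
    and K_omega: "K omega0 = topspace (cube {..<omega0})"
    and YZ_closed: "omega0 \<le> \<alpha> \<Longrightarrow> closedin (level K \<alpha>) (Y \<alpha>) \<and> closedin (level K \<alpha>) (Z \<alpha>)"
    and YZ_cover: "omega0 \<le> \<alpha> \<Longrightarrow> Y \<alpha> \<union> Z \<alpha> = K \<alpha>"
    and K_suc: "omega0 \<le> \<alpha> \<Longrightarrow> K (osuc \<alpha>) = app0 \<alpha> (Y \<alpha>) \<union> app1 \<alpha> (Z \<alpha>)"
    and K_limit: "limit_ord \<rho> \<Longrightarrow> omega0 < \<rho> \<Longrightarrow>
          K \<rho> = {t \<in> topspace (cube {..<\<rho>}). \<forall>\<beta>. omega0 \<le> \<beta> \<and> \<beta> < \<rho> \<longrightarrow> proj \<beta> t \<in> K \<beta>}"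
    and eta_range: "omega0 \<le> \<alpha> \<Longrightarrow> \<eta> \<alpha> = (\<theta>, \<delta>) \<Longrightarrow> omega0 \<le> \<theta> \<and> \<theta> \<le> \<alpha> \<and> \<delta> \<le> \<alpha>"
    and eta_cofinal: "omega0 \<le> \<theta> \<Longrightarrow> \<exists>\<alpha>\<ge>\<xi>. max \<theta> \<delta> \<le> \<alpha> \<and> \<eta> \<alpha> = (\<theta>, \<delta>)"
    and U_enum: "omega0 \<le> \<beta> \<Longrightarrow>
          range (U \<beta>) = {u. disjoint_family u \<and>
            (\<forall>n. u n \<noteq> {} \<and> openin (level K \<beta>) (u n) \<and> closedin (level K \<beta>) (u n))}"
    and nu_enum: "omega0 \<le> \<theta> \<Longrightarrow>
          range (\<nu> \<theta>) = {\<kappa>. admissible (level K \<theta>) (Vset K \<eta> U \<theta> \<theta>) \<kappa>}"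
    and cond_A: "omega0 \<le> \<theta> \<Longrightarrow> \<theta> < \<alpha> \<Longrightarrow> \<delta> < \<alpha> \<Longrightarrow> J \<theta> \<delta> \<alpha> \<subseteq> I \<theta> \<alpha>"
    and cond_B: "omega0 \<le> \<theta> \<Longrightarrow> N0 \<theta> \<delta> \<inter> N1 \<theta> \<delta> = {}"
    and cond_C: "omega0 \<le> \<theta> \<Longrightarrow> \<theta> < \<alpha> \<Longrightarrow> \<delta> < \<alpha> \<Longrightarrow>
          infinite (J \<theta> \<delta> \<alpha> \<inter> N0 \<theta> \<delta>) \<and> infinite (J \<theta> \<delta> \<alpha> \<inter> N1 \<theta> \<delta>)"
    and cond_D: "omega0 \<le> \<theta> \<Longrightarrow> \<theta> < \<alpha>' \<Longrightarrow> \<alpha>' \<le> \<alpha> \<Longrightarrow> \<delta> < \<alpha>' \<Longrightarrow>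
          finite (J \<theta> \<delta> \<alpha> - J \<theta> \<delta> \<alpha>') \<and> finite (I \<theta> \<alpha> - I \<theta> \<alpha>')"
    and cond_E: "omega0 \<le> \<theta> \<Longrightarrow> \<theta> \<le> \<alpha>' \<Longrightarrow> \<alpha>' < \<alpha> \<Longrightarrow>
          \<exists>m. \<forall>n\<in>I \<theta> \<alpha>. n \<ge> m \<longrightarrow>
            (\<forall>t\<in>Vset K \<eta> U \<theta> \<alpha> n. \<forall>t'\<in>Vset K \<eta> U \<theta> \<alpha> n.
               proj \<theta> t = proj \<theta> t' \<longrightarrow> t \<alpha>' = t' \<alpha>')"
    and cond_F: "omega0 \<le> \<theta> \<Longrightarrow> \<theta> < \<alpha> \<Longrightarrow> \<delta> < \<alpha> \<Longrightarrow> (\<And>n. \<kappa> n \<in> Bset K \<nu> \<theta> \<delta> \<alpha> n) \<Longrightarrow>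
          weak_star_limit_exists_along (level K \<alpha>) (J \<theta> \<delta> \<alpha>) \<kappa>"
    and cond_G: "omega0 \<le> \<alpha>' \<Longrightarrow> \<alpha> = osuc \<alpha>' \<Longrightarrow> \<eta> \<alpha>' = (\<theta>, \<delta>) \<Longrightarrow>
          (\<And>n. \<kappa> n \<in> Bset K \<nu> \<theta> \<delta> \<alpha> n) \<Longrightarrow>
          infinite {n. \<kappa> n (app1 \<alpha>' (Z \<alpha>')) \<ge> 1/6} \<and> infinite {n. \<kappa> n (app1 \<alpha>' (Z \<alpha>')) = 0}"

end

theory Submission
  imports Defs "HOL-Complex_Analysis.Great_Picard"
begin

text \<open>Measures on \<open>T\<close> are handled as functionals on continuous functions. The heart of the proof
  is a subsequence splitting: a bounded sequence \<open>\<mu>\<^sub>n\<close> has a subsequence that is, up to a small error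
  in norm, of the form \<open>\<sigma>\<^sub>n + f\<^sub>n\<lambda>\<close>, where \<open>\<sigma>\<^sub>n\<close> is the restriction of \<open>\<mu>\<^sub>n\<close> to \<open>V\<^sub>n\<close> for disjoint clopen
  sets \<open>V\<^sub>n\<close>, \<open>\<lambda>\<close> is a fixed positive measure, and the \<open>f\<^sub>n\<close> are uniformly bounded and weakly convergent.
  Those \<open>\<sigma>\<^sub>n\<close> that are not small induce, after a change of sign and of scale, an admissible sequence
  on some \<open>K\<^sub>\<theta>\<close>.

  For a weak-star null sequence, (G) gives a clopen set on which the values of these parts oscillate,
  so they must be small, and \<open>f\<^sub>n\<lambda>\<close> converges weakly; this gives the Grothendieck property.
  In a copy of \<open>\<beta>\<omega>\<close>, any two disjoint subsets of \<open>\<omega>\<close> are separated by finitely many functions,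
  whereas by (B), (C), (D) and (F) there are disjoint \<open>N\<^sub>0\<close>, \<open>N\<^sub>1\<close> such that each finite set of clopen
  sets admits a subsequence meeting both infinitely often along which all its measures converge.

  A convergent sequence of distinct points of \<open>T\<close> would contradict (G) for the point masses. By
  rigidity, the second set of a sequence witnessing 2DCP is metrisable, and it is infinite, so it would
  contain such a convergent sequence.\<close>

section \<open>Functionals on spaces of continuous functions\<close>

text \<open>Functionals on C(T) are never represented by measures on T, so there is no Radon-Nikodym
  theorem and no exact Lebesgue decomposition. Every exact statement is replaced by one with an
  error proportional to the sup norm of the test function. This is enough because the obstruction is
  quantitative: parts of norm at least c take values of size at least c/6 and the value 0 infinitely
  often on one clopen set, so the splitting error only has to be small against c/6. Genuine measures
  are needed only to apply (F) and (G), and only on countable levels, where clopen sets generate the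
  Borel sets. Projection to a level can lose norm by cancellation. But the norms of countably many
  functionals are witnessed by countably many clopen sets, each depending on finitely many
  coordinates, so some countable level sees all the witnesses and the norms there are exactly 1, as
  admissibility demands. For \<beta>\<omega> the obstacle is the order of choices: the separation
  constant depends on the subset, while the splitting error must be fixed before the subset is
  known. Cutting \<omega> into infinitely many pieces yields a piece on which one constant serves
  all subsets.\<close>

definition linear_functional :: "'a topology \<Rightarrow> (('a \<Rightarrow> real) \<Rightarrow> real) \<Rightarrow> bool" where
  "linear_functional X \<phi> \<longleftrightarrow>
     (\<forall>f g. continuous_map X euclideanreal f \<longrightarrow> continuous_map X euclideanreal g \<longrightarrow>
        \<phi> (\<lambda>x. f x + g x) = \<phi> f + \<phi> g) \<and>
     (\<forall>c f. continuous_map X euclideanreal f \<longrightarrow> \<phi> (\<lambda>x. c * f x) = c * \<phi> f)"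

text \<open>Quantifying over all bounds s, instead of using a sup norm, includes s = 0. Hence the
  value depends only on f on the space, although test functions are arbitrary outside it.\<close>

definition bounded_functional :: "'a topology \<Rightarrow> real \<Rightarrow> (('a \<Rightarrow> real) \<Rightarrow> real) \<Rightarrow> bool" where
  "bounded_functional X b \<phi> \<longleftrightarrow> linear_functional X \<phi> \<and>
     (\<forall>f s. continuous_map X euclideanreal f \<longrightarrow> 0 \<le> s \<longrightarrow> (\<forall>x\<in>topspace X. \<bar>f x\<bar> \<le> s) \<longrightarrow>
        \<bar>\<phi> f\<bar> \<le> b * s)"

definition positive_functional :: "'a topology \<Rightarrow> (('a \<Rightarrow> real) \<Rightarrow> real) \<Rightarrow> bool" where
  "positive_functional X \<phi> \<longleftrightarrow> linear_functional X \<phi> \<and>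
     (\<forall>f. continuous_map X euclideanreal f \<longrightarrow> (\<forall>x\<in>topspace X. 0 \<le> f x) \<longrightarrow> 0 \<le> \<phi> f)"

definition clopenin :: "'a topology \<Rightarrow> 'a set \<Rightarrow> bool" where
  "clopenin X V \<longleftrightarrow> openin X V \<and> closedin X V"

lemma clopenin_empty [simp]: "clopenin X {}"
  and clopenin_topspace [simp]: "clopenin X (topspace X)"
  and clopenin_Un [intro]: "clopenin X V \<Longrightarrow> clopenin X W \<Longrightarrow> clopenin X (V \<union> W)"
  and clopenin_Int [intro]: "clopenin X V \<Longrightarrow> clopenin X W \<Longrightarrow> clopenin X (V \<inter> W)"
  and clopenin_Diff [intro]: "clopenin X V \<Longrightarrow> clopenin X W \<Longrightarrow> clopenin X (V - W)"
  and clopenin_subset: "clopenin X V \<Longrightarrow> V \<subseteq> topspace X"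
  by (auto simp: clopenin_def openin_subset)

lemma clopenin_Union_finite: "finite F \<Longrightarrow> (\<And>i. i \<in> F \<Longrightarrow> clopenin X (W i)) \<Longrightarrow> clopenin X (\<Union>i\<in>F. W i)"
  by (induction F rule: finite_induct) auto

lemma continuous_map_indicator:
  assumes "clopenin X V"
  shows "continuous_map X euclideanreal (indicator V)"
  unfolding continuous_map
proof (intro conjI allI impI)
  fix U :: "real set"
  assume "openin euclideanreal U"
  have "{x \<in> topspace X. indicator V x \<in> U} =
     (if (1::real) \<in> U then V else {}) \<union> (if (0::real) \<in> U then topspace X - V else {})"
    using clopenin_subset[OF assms] by (auto simp: indicator_def split: if_splits)
  then show "openin X {x \<in> topspace X. indicator V x \<in> U}"
    using assms by (auto simp: clopenin_def)
qed auto

locale compact_top =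
  fixes X :: "'a topology"
  assumes compact: "compact_space X"
begin

abbreviation cm :: "('a \<Rightarrow> real) \<Rightarrow> bool" where
  "cm f \<equiv> continuous_map X euclideanreal f"

lemma cm_const [simp]: "cm (\<lambda>x. c)" by simp

lemma cm_ops [intro, simp]:
  "cm f \<Longrightarrow> cm g \<Longrightarrow> cm (\<lambda>x. f x + g x)"
  "cm f \<Longrightarrow> cm g \<Longrightarrow> cm (\<lambda>x. f x - g x)"
  "cm f \<Longrightarrow> cm g \<Longrightarrow> cm (\<lambda>x. f x * g x)"
  "cm f \<Longrightarrow> cm g \<Longrightarrow> cm (\<lambda>x. max (f x) (g x))"
  "cm f \<Longrightarrow> cm g \<Longrightarrow> cm (\<lambda>x. min (f x) (g x))"
  "cm f \<Longrightarrow> cm (\<lambda>x. \<bar>f x\<bar>)"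
  "cm f \<Longrightarrow> cm (\<lambda>x. - f x)"
  "cm f \<Longrightarrow> cm (\<lambda>x. (f x)\<^sup>2)"
  by (auto intro!: continuous_intros continuous_map_real_pow)

lemma cm_indicator [intro, simp]: "clopenin X V \<Longrightarrow> cm (indicator V)" "clopenin X V \<Longrightarrow> cm (\<lambda>x. indicator V x)"
  using continuous_map_indicator by auto

lemma cm_bounded:
  assumes "cm f"
  obtains s where "0 \<le> s" "\<And>x. x \<in> topspace X \<Longrightarrow> \<bar>f x\<bar> \<le> s"
proof -
  have "compactin euclideanreal (f ` topspace X)"
    using assms compact image_compactin compact_space_def by blast
  then have "bounded (f ` topspace X)" by (simp add: compact_imp_bounded)
  then obtain s where "\<forall>x\<in>topspace X. \<bar>f x\<bar> \<le> s"
    by (auto simp: bounded_iff)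
  then show ?thesis using that[of "max s 0"] by force
qed

lemma linear_functional_simps:
  assumes "linear_functional X \<phi>"
  shows "cm f \<Longrightarrow> cm g \<Longrightarrow> \<phi> (\<lambda>x. f x + g x) = \<phi> f + \<phi> g"
    and "cm f \<Longrightarrow> cm g \<Longrightarrow> \<phi> (\<lambda>x. f x - g x) = \<phi> f - \<phi> g"
    and "cm f \<Longrightarrow> \<phi> (\<lambda>x. c * f x) = c * \<phi> f"
    and "cm f \<Longrightarrow> \<phi> (\<lambda>x. - f x) = - \<phi> f"
    and "\<phi> (\<lambda>x. 0) = 0"
proof -
  have add: "\<phi> (\<lambda>x. f x + g x) = \<phi> f + \<phi> g" if "cm f" "cm g" for f g
    using assms that by (simp add: linear_functional_def)
  have scale: "\<phi> (\<lambda>x. c * f x) = c * \<phi> f" if "cm f" for c f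
    using assms that by (simp add: linear_functional_def)
  show "cm f \<Longrightarrow> cm g \<Longrightarrow> \<phi> (\<lambda>x. f x + g x) = \<phi> f + \<phi> g" by (rule add)
  show "cm f \<Longrightarrow> \<phi> (\<lambda>x. c * f x) = c * \<phi> f" by (rule scale)
  show neg: "cm f \<Longrightarrow> \<phi> (\<lambda>x. - f x) = - \<phi> f" for f
    using scale[of f "-1"] by simp
  show "cm f \<Longrightarrow> cm g \<Longrightarrow> \<phi> (\<lambda>x. f x - g x) = \<phi> f - \<phi> g"
    using add[of f "\<lambda>x. - g x"] neg[of g] by simp
  show "\<phi> (\<lambda>x. 0) = 0"
    using scale[of "\<lambda>x. 0" 0] by simp
qed

lemma bounded_functional_linear: "bounded_functional X b \<phi> \<Longrightarrow> linear_functional X \<phi>"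
  and positive_functional_linear: "positive_functional X \<phi> \<Longrightarrow> linear_functional X \<phi>"
  by (auto simp: bounded_functional_def positive_functional_def)

lemmas bounded_functional_simps = linear_functional_simps[OF bounded_functional_linear]
lemmas positive_functional_simps = linear_functional_simps[OF positive_functional_linear]

lemma bounded_functionalD:
  "bounded_functional X b \<phi> \<Longrightarrow> cm f \<Longrightarrow> 0 \<le> s \<Longrightarrow> (\<And>x. x \<in> topspace X \<Longrightarrow> \<bar>f x\<bar> \<le> s) \<Longrightarrow>
     \<bar>\<phi> f\<bar> \<le> b * s"
  by (simp add: bounded_functional_def)

lemma bounded_functional_cong:
  assumes "bounded_functional X b \<phi>" "cm f" "cm g" "\<And>x. x \<in> topspace X \<Longrightarrow> f x = g x"
  shows "\<phi> f = \<phi> g"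
  using bounded_functionalD[OF assms(1), of "\<lambda>x. f x - g x" 0] bounded_functional_simps(2)[OF assms(1-3)] assms
  by simp

lemma positive_functional_nonneg:
  "positive_functional X L \<Longrightarrow> cm f \<Longrightarrow> (\<And>x. x \<in> topspace X \<Longrightarrow> 0 \<le> f x) \<Longrightarrow> 0 \<le> L f"
  by (simp add: positive_functional_def)

lemma positive_functional_mono:
  assumes "positive_functional X L" "cm f" "cm g" "\<And>x. x \<in> topspace X \<Longrightarrow> f x \<le> g x"
  shows "L f \<le> L g"
  using positive_functional_nonneg[OF assms(1), of "\<lambda>x. g x - f x"]
    positive_functional_simps(2)[OF assms(1,3,2)] assms by simp

lemma positive_functional_cong:
  assumes "positive_functional X L" "cm f" "cm g" "\<And>x. x \<in> topspace X \<Longrightarrow> f x = g x"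
  shows "L f = L g"
  using positive_functional_mono[OF assms(1-3)] positive_functional_mono[OF assms(1,3,2)] assms(4)
  by force

lemma positive_functional_bounded:
  assumes "positive_functional X L"
  shows "bounded_functional X (L (\<lambda>x. 1)) L"
  unfolding bounded_functional_def
proof (intro conjI allI impI)
  fix f s assume f: "cm f" "0 \<le> (s::real)" "\<forall>x\<in>topspace X. \<bar>f x\<bar> \<le> s"
  have c: "L (\<lambda>x. s * 1) = s * L (\<lambda>x. 1)" by (rule positive_functional_simps(3)[OF assms]) simp
  have "L f \<le> L (\<lambda>x. s * 1)" "L (\<lambda>x. - f x) \<le> L (\<lambda>x. s * 1)"
    using f by (force intro!: positive_functional_mono[OF assms])+
  then show "\<bar>L f\<bar> \<le> L (\<lambda>x. 1) * s"
    using positive_functional_simps(4)[OF assms f(1)] c by (simp add: mult.commute)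
qed (rule positive_functional_linear[OF assms])

subsection \<open>The modulus of a functional\<close>

text \<open>The Riesz formula for the modulus of \<phi>, meaningful for g >= 0;
  \<open>modulus\<close> extends it to all g by linearity.\<close>

definition pmod :: "(('a \<Rightarrow> real) \<Rightarrow> real) \<Rightarrow> ('a \<Rightarrow> real) \<Rightarrow> real" where
  "pmod \<phi> g = Sup {\<phi> h |h. cm h \<and> (\<forall>x\<in>topspace X. \<bar>h x\<bar> \<le> g x)}"

definition modulus :: "(('a \<Rightarrow> real) \<Rightarrow> real) \<Rightarrow> ('a \<Rightarrow> real) \<Rightarrow> real" where
  "modulus \<phi> g = pmod \<phi> (\<lambda>x. max (g x) 0) - pmod \<phi> (\<lambda>x. max (- g x) 0)"

context
  fixes b \<phi> assumes \<phi>: "bounded_functional X b \<phi>"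
begin

private lemma pmod_upper:
  assumes "cm g" "cm h" "\<And>x. x \<in> topspace X \<Longrightarrow> \<bar>h x\<bar> \<le> g x"
  shows "\<phi> h \<le> pmod \<phi> g"
proof -
  obtain s where s: "0 \<le> s" "\<And>x. x \<in> topspace X \<Longrightarrow> \<bar>g x\<bar> \<le> s" using cm_bounded[OF assms(1)] by blast
  show ?thesis unfolding pmod_def
  proof (rule cSup_upper)
    show "bdd_above {\<phi> h |h. cm h \<and> (\<forall>x\<in>topspace X. \<bar>h x\<bar> \<le> g x)}"
    proof (rule bdd_aboveI[of _ "b * s"], clarify)
      fix h assume h: "cm h" "\<forall>x\<in>topspace X. \<bar>h x\<bar> \<le> g x"
      have "\<bar>\<phi> h\<bar> \<le> b * s"
        using h s by (intro bounded_functionalD[OF \<phi>]) (auto, smt (verit))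
      then show "\<phi> h \<le> b * s" by simp
    qed
  qed (use assms in blast)
qed

private lemma pmod_least:
  assumes "\<And>x. x \<in> topspace X \<Longrightarrow> 0 \<le> g x"
    and "\<And>h. cm h \<Longrightarrow> (\<And>x. x \<in> topspace X \<Longrightarrow> \<bar>h x\<bar> \<le> g x) \<Longrightarrow> \<phi> h \<le> c"
  shows "pmod \<phi> g \<le> c"
  unfolding pmod_def
proof (rule cSup_least)
  have "\<phi> (\<lambda>x. 0) \<in> {\<phi> h |h. cm h \<and> (\<forall>x\<in>topspace X. \<bar>h x\<bar> \<le> g x)}"
    using assms(1) by (intro CollectI exI[of _ "\<lambda>x. 0"]) auto
  then show "{\<phi> h |h. cm h \<and> (\<forall>x\<in>topspace X. \<bar>h x\<bar> \<le> g x)} \<noteq> {}" by blast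
qed (use assms(2) in blast)

text \<open>Subadditivity is the Riesz decomposition property: \<open>u\<close> is h clipped to
  [-f, f], and the remainder h - u is bounded by g. For superadditivity the suprema over h and k are
  taken one after the other.\<close>

private lemma pmod_add:
  assumes f: "cm f" "\<And>x. x \<in> topspace X \<Longrightarrow> 0 \<le> f x" and g: "cm g" "\<And>x. x \<in> topspace X \<Longrightarrow> 0 \<le> g x"
  shows "pmod \<phi> (\<lambda>x. f x + g x) = pmod \<phi> f + pmod \<phi> g"
proof (rule antisym)
  show "pmod \<phi> (\<lambda>x. f x + g x) \<le> pmod \<phi> f + pmod \<phi> g"
  proof (rule pmod_least)
    fix h assume h: "cm h" "\<And>x. x \<in> topspace X \<Longrightarrow> \<bar>h x\<bar> \<le> f x + g x"
    define u where "u x = max (- f x) (min (f x) (h x))" for x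
    have u: "cm u" unfolding u_def using f(1) h(1) by auto
    have "\<phi> u \<le> pmod \<phi> f"
    proof (intro pmod_upper)
      show "\<bar>u x\<bar> \<le> f x" if "x \<in> topspace X" for x
        using f(2)[OF that] by (auto simp: u_def abs_le_iff)
    qed (use f u in auto)
    moreover have "\<phi> (\<lambda>x. h x - u x) \<le> pmod \<phi> g"
    proof (intro pmod_upper)
      fix x assume "x \<in> topspace X"
      then show "\<bar>h x - u x\<bar> \<le> g x"
        using h(2)[of x] f(2)[of x] g(2)[of x] by (auto simp: u_def max_def min_def abs_if split: if_splits)
    qed (use g h u in auto)
    ultimately show "\<phi> h \<le> pmod \<phi> f + pmod \<phi> g"
      using bounded_functional_simps(2)[OF \<phi> h(1) u] by simp
  qed (use f g in auto)
  have "pmod \<phi> f \<le> pmod \<phi> (\<lambda>x. f x + g x) - pmod \<phi> g"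
  proof (rule pmod_least)
    fix h assume h: "cm h" "\<And>x. x \<in> topspace X \<Longrightarrow> \<bar>h x\<bar> \<le> f x"
    have "pmod \<phi> g \<le> pmod \<phi> (\<lambda>x. f x + g x) - \<phi> h"
    proof (rule pmod_least)
      fix k assume k: "cm k" "\<And>x. x \<in> topspace X \<Longrightarrow> \<bar>k x\<bar> \<le> g x"
      have "\<phi> (\<lambda>x. h x + k x) \<le> pmod \<phi> (\<lambda>x. f x + g x)"
      proof (intro pmod_upper)
        fix x assume "x \<in> topspace X"
        then show "\<bar>h x + k x\<bar> \<le> f x + g x" using h(2)[of x] k(2)[of x] by linarith
      qed (use f g h k in auto)
      then show "\<phi> k \<le> pmod \<phi> (\<lambda>x. f x + g x) - \<phi> h"
        using bounded_functional_simps(1)[OF \<phi> h(1) k(1)] by simp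
    qed (use g in auto)
    then show "\<phi> h \<le> pmod \<phi> (\<lambda>x. f x + g x) - pmod \<phi> g" by simp
  qed (use f in auto)
  then show "pmod \<phi> f + pmod \<phi> g \<le> pmod \<phi> (\<lambda>x. f x + g x)" by simp
qed

private lemma pmod_cong:
  assumes "\<And>x. x \<in> topspace X \<Longrightarrow> f x = g x" shows "pmod \<phi> f = pmod \<phi> g"
  unfolding pmod_def using assms by (metis (no_types, lifting))

private lemma pmod_scale:
  assumes f: "cm f" "\<And>x. x \<in> topspace X \<Longrightarrow> 0 \<le> f x" and c: "0 \<le> c"
  shows "pmod \<phi> (\<lambda>x. c * f x) = c * pmod \<phi> f"
proof -
  have le: "pmod \<phi> (\<lambda>x. c * f x) \<le> c * pmod \<phi> f"
    if f: "cm f" "\<And>x. x \<in> topspace X \<Longrightarrow> 0 \<le> f x" and c: "0 < c" for c f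
  proof (rule pmod_least)
    fix h assume h: "cm h" "\<And>x. x \<in> topspace X \<Longrightarrow> \<bar>h x\<bar> \<le> c * f x"
    have ch: "cm (\<lambda>x. (1/c) * h x)" by (rule cm_ops(3)[OF cm_const h(1)])
    have "\<phi> (\<lambda>x. (1/c) * h x) \<le> pmod \<phi> f"
    proof (rule pmod_upper)
      show "\<bar>1 / c * h x\<bar> \<le> f x" if "x \<in> topspace X" for x
        using h(2)[OF that] c by (simp add: abs_mult field_simps)
    qed (use f ch in auto)
    then show "\<phi> h \<le> c * pmod \<phi> f"
      using bounded_functional_simps(3)[OF \<phi> h(1), of "1/c"] c by (simp add: pos_divide_le_eq mult.commute)
  qed (use f c in simp)
  show ?thesis
  proof (cases "c = 0")
    case True
    have "pmod \<phi> (\<lambda>x. 0) = 0"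
      using pmod_add[of "\<lambda>x. 0" "\<lambda>x. 0"] by simp
    then show ?thesis using True by simp
  next
    case False
    then have c: "c > 0" using c by simp
    have "pmod \<phi> f = pmod \<phi> (\<lambda>x. (1/c) * (c * f x))" using c by simp
    also have "\<dots> \<le> (1/c) * pmod \<phi> (\<lambda>x. c * f x)"
      by (rule le) (use f c in auto)
    finally have "c * pmod \<phi> f \<le> pmod \<phi> (\<lambda>x. c * f x)" using c by (simp add: field_simps)
    then show ?thesis using le[OF f c] by simp
  qed
qed

text \<open>Any representation of f as a difference of nonnegative functions may replace the
  canonical one: compare both sides of max f 0 + v = max (-f) 0 + u. The linearity cases below can
  thus choose u and v to suit them.\<close>

private lemma pmod_diff:
  assumes "cm u" "cm v" "cm f" "\<And>x. x \<in> topspace X \<Longrightarrow> 0 \<le> u x" "\<And>x. x \<in> topspace X \<Longrightarrow> 0 \<le> v x"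
    "\<And>x. x \<in> topspace X \<Longrightarrow> f x = u x - v x"
  shows "modulus \<phi> f = pmod \<phi> u - pmod \<phi> v"
proof -
  have "pmod \<phi> (\<lambda>x. max (f x) 0 + v x) = pmod \<phi> (\<lambda>x. max (- f x) 0 + u x)"
    using assms by (intro pmod_cong) (auto simp: max_def)
  moreover have "pmod \<phi> (\<lambda>x. max (f x) 0 + v x) = pmod \<phi> (\<lambda>x. max (f x) 0) + pmod \<phi> v"
    using assms by (intro pmod_add) auto
  moreover have "pmod \<phi> (\<lambda>x. max (- f x) 0 + u x) = pmod \<phi> (\<lambda>x. max (- f x) 0) + pmod \<phi> u"
    using assms by (intro pmod_add) auto
  ultimately show ?thesis by (simp add: modulus_def)
qed

private lemma modulus_eq_pmod:
  assumes "cm f" "\<And>x. x \<in> topspace X \<Longrightarrow> 0 \<le> f x"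
  shows "modulus \<phi> f = pmod \<phi> f"
  using pmod_diff[of f "\<lambda>x. 0" f] pmod_scale[of "\<lambda>x. 0" 0] assms by simp

lemma positive_functional_modulus: "positive_functional X (modulus \<phi>)"
  unfolding positive_functional_def linear_functional_def
proof (intro conjI allI impI)
  fix f g assume fg: "cm f" "cm g"
  have "modulus \<phi> (\<lambda>x. f x + g x) =
     pmod \<phi> (\<lambda>x. max (f x) 0 + max (g x) 0) - pmod \<phi> (\<lambda>x. max (- f x) 0 + max (- g x) 0)"
    using fg by (intro pmod_diff) auto
  also have "pmod \<phi> (\<lambda>x. max (f x) 0 + max (g x) 0) = pmod \<phi> (\<lambda>x. max (f x) 0) + pmod \<phi> (\<lambda>x. max (g x) 0)"
    using fg by (intro pmod_add) auto
  also have "pmod \<phi> (\<lambda>x. max (- f x) 0 + max (- g x) 0) = pmod \<phi> (\<lambda>x. max (- f x) 0) + pmod \<phi> (\<lambda>x. max (- g x) 0)"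
    using fg by (intro pmod_add) auto
  finally show "modulus \<phi> (\<lambda>x. f x + g x) = modulus \<phi> f + modulus \<phi> g"
    by (simp add: modulus_def)
next
  fix c f assume f: "cm f"
  have scale: "pmod \<phi> (\<lambda>x. \<bar>c\<bar> * max (f x) 0) = \<bar>c\<bar> * pmod \<phi> (\<lambda>x. max (f x) 0)"
    "pmod \<phi> (\<lambda>x. \<bar>c\<bar> * max (- f x) 0) = \<bar>c\<bar> * pmod \<phi> (\<lambda>x. max (- f x) 0)"
    using f by (auto intro!: pmod_scale)
  show "modulus \<phi> (\<lambda>x. c * f x) = c * modulus \<phi> f"
  proof (cases "0 \<le> c")
    case True
    have "modulus \<phi> (\<lambda>x. c * f x) = pmod \<phi> (\<lambda>x. \<bar>c\<bar> * max (f x) 0) - pmod \<phi> (\<lambda>x. \<bar>c\<bar> * max (- f x) 0)"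
    proof (rule pmod_diff)
      show "c * f x = \<bar>c\<bar> * max (f x) 0 - \<bar>c\<bar> * max (- f x) 0" for x
        using True by (cases "0 \<le> f x") auto
    qed (use f in auto)
    then show ?thesis unfolding scale using True by (simp add: modulus_def algebra_simps)
  next
    case False
    have "modulus \<phi> (\<lambda>x. c * f x) = pmod \<phi> (\<lambda>x. \<bar>c\<bar> * max (- f x) 0) - pmod \<phi> (\<lambda>x. \<bar>c\<bar> * max (f x) 0)"
    proof (rule pmod_diff)
      show "c * f x = \<bar>c\<bar> * max (- f x) 0 - \<bar>c\<bar> * max (f x) 0" for x
        using False by (cases "0 \<le> f x") auto
    qed (use f in auto)
    then show ?thesis unfolding scale using False by (simp add: modulus_def algebra_simps)
  qed
next
  fix f assume f: "cm f" "\<forall>x\<in>topspace X. 0 \<le> f x"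
  have "\<phi> (\<lambda>x. 0) \<le> pmod \<phi> f" using f by (intro pmod_upper) auto
  then show "0 \<le> modulus \<phi> f"
    using f modulus_eq_pmod bounded_functional_simps(5)[OF \<phi>] by simp
qed

lemma modulus_upper:
  assumes "cm g" "cm h" "\<And>x. x \<in> topspace X \<Longrightarrow> \<bar>h x\<bar> \<le> g x"
  shows "\<bar>\<phi> h\<bar> \<le> modulus \<phi> g"
proof -
  have "\<phi> h \<le> pmod \<phi> g" "\<phi> (\<lambda>x. - h x) \<le> pmod \<phi> g"
    using assms by (auto intro!: pmod_upper)
  moreover have "modulus \<phi> g = pmod \<phi> g"
    using assms by (intro modulus_eq_pmod) (auto, smt (verit))
  ultimately show ?thesis
    using bounded_functional_simps(4)[OF \<phi> assms(2)] by simp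
qed

lemma modulus_least:
  assumes "cm g" "\<And>x. x \<in> topspace X \<Longrightarrow> 0 \<le> g x"
    and "\<And>h. cm h \<Longrightarrow> (\<And>x. x \<in> topspace X \<Longrightarrow> \<bar>h x\<bar> \<le> g x) \<Longrightarrow> \<phi> h \<le> c"
  shows "modulus \<phi> g \<le> c"
  using modulus_eq_pmod[OF assms(1,2)] pmod_least[OF assms(2,3)] by simp

lemma modulus_le:
  assumes "cm g" "0 \<le> s" "\<And>x. x \<in> topspace X \<Longrightarrow> 0 \<le> g x" "\<And>x. x \<in> topspace X \<Longrightarrow> g x \<le> s"
  shows "modulus \<phi> g \<le> b * s"
proof (rule modulus_least)
  fix h assume h: "cm h" "\<And>x. x \<in> topspace X \<Longrightarrow> \<bar>h x\<bar> \<le> g x"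
  have "\<bar>\<phi> h\<bar> \<le> b * s"
    using h assms order_trans by (intro bounded_functionalD[OF \<phi>]) (auto, blast intro: order_trans)
  then show "\<phi> h \<le> b * s" by simp
qed (use assms in auto)

lemma abs_modulus_le:
  assumes "cm g" "0 \<le> s" "\<And>x. x \<in> topspace X \<Longrightarrow> \<bar>g x\<bar> \<le> s"
  shows "\<bar>modulus \<phi> g\<bar> \<le> b * s"
proof -
  have "\<bar>modulus \<phi> g\<bar> \<le> modulus \<phi> (\<lambda>x. 1) * s"
    by (rule bounded_functionalD[OF positive_functional_bounded[OF positive_functional_modulus]])
      (use assms in auto)
  also have "\<dots> \<le> b * s"
    using modulus_le[of "\<lambda>x. 1" 1] assms(2) by (intro mult_right_mono) auto
  finally show ?thesis .
qed

end

end


section \<open>Approximate densities and weak subsequences in place of L^2 theory\<close>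

lemma convergent_approx:
  fixes a :: "nat \<Rightarrow> real"
  assumes "\<And>e. e > 0 \<Longrightarrow> \<exists>c. convergent c \<and> (\<forall>n. \<bar>a n - c n\<bar> \<le> e)"
  shows "convergent a"
proof (rule Cauchy_convergent, rule CauchyI)
  fix e :: real assume "e > 0"
  then obtain c where c: "convergent c" "\<And>n. \<bar>a n - c n\<bar> \<le> e / 4"
    using assms[of "e/4"] by auto
  obtain M where M: "\<And>m n. m \<ge> M \<Longrightarrow> n \<ge> M \<Longrightarrow> norm (c m - c n) < e / 4"
    using CauchyD[OF convergent_Cauchy[OF c(1)], of "e/4"] \<open>e > 0\<close> by auto
  have "norm (a m - a n) < e" if "m \<ge> M" "n \<ge> M" for m n
    using M[OF that] c(2)[of m] c(2)[of n] \<open>e > 0\<close> by (simp add: abs_if split: if_splits)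
  then show "\<exists>M. \<forall>m\<ge>M. \<forall>n\<ge>M. norm (a m - a n) < e" by blast
qed

context compact_top
begin

text \<open>A near-minimiser \<open>f\<close> of \<open>L(f\<^sup>2)/2 - \<tau>(f)\<close> subject to \<open>\<bar>f\<bar> \<le> m\<close> is an approximate
  Radon--Nikodym density of \<open>\<tau>\<close>: clipping \<open>f + t g\<close> at height \<open>m\<close> costs at most \<open>\<epsilon> t\<close>.\<close>

lemma approximate_density:
  assumes L: "positive_functional X L" and \<tau>: "linear_functional X \<tau>" and m: "0 \<le> m" and \<epsilon>: "0 < \<epsilon>"
    and dom: "\<And>g s. cm g \<Longrightarrow> 0 \<le> s \<Longrightarrow> (\<And>x. x \<in> topspace X \<Longrightarrow> \<bar>g x\<bar> \<le> s) \<Longrightarrow>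
      \<bar>\<tau> g\<bar> \<le> m * L (\<lambda>x. \<bar>g x\<bar>) + \<epsilon> * s"
  obtains f where "cm f" "\<And>x. x \<in> topspace X \<Longrightarrow> \<bar>f x\<bar> \<le> m"
    "\<And>g s. cm g \<Longrightarrow> 0 \<le> s \<Longrightarrow> (\<And>x. x \<in> topspace X \<Longrightarrow> \<bar>g x\<bar> \<le> s) \<Longrightarrow>
      \<bar>\<tau> g - L (\<lambda>x. f x * g x)\<bar> \<le> 2 * \<epsilon> * s"
proof -
  note Ls = positive_functional_simps[OF L] and \<tau>s = linear_functional_simps[OF \<tau>]
  define L1 where "L1 = L (\<lambda>x. 1)"
  have L1: "0 \<le> L1" unfolding L1_def by (rule positive_functional_nonneg[OF L]) auto
  define J where "J f = L (\<lambda>x. (f x)\<^sup>2) / 2 - \<tau> f" for f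
  define S where "S = {J f |f. cm f \<and> (\<forall>x\<in>topspace X. \<bar>f x\<bar> \<le> m)}"
  have bdd: "bdd_below S"
  proof (rule bdd_belowI[of _ "- (m * (L1 * m) + \<epsilon> * m)"], unfold S_def, clarify)
    fix f assume f: "cm f" "\<forall>x\<in>topspace X. \<bar>f x\<bar> \<le> m"
    have "0 \<le> L (\<lambda>x. (f x)\<^sup>2)" using f by (intro positive_functional_nonneg[OF L]) auto
    moreover have "\<bar>L (\<lambda>x. \<bar>f x\<bar>)\<bar> \<le> L1 * m"
      unfolding L1_def using f m by (intro bounded_functionalD[OF positive_functional_bounded[OF L]]) auto
    then have "m * L (\<lambda>x. \<bar>f x\<bar>) \<le> m * (L1 * m)" using m by (intro mult_left_mono) auto
    moreover have "\<bar>\<tau> f\<bar> \<le> m * L (\<lambda>x. \<bar>f x\<bar>) + \<epsilon> * m" using f m by (intro dom) auto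
    ultimately show "- (m * (L1 * m) + \<epsilon> * m) \<le> J f" unfolding J_def by linarith
  qed
  \<comment> \<open>The step size makes the quadratic term t^2 L(g^2) / 2 at most \<epsilon> t / 2.
    With \<epsilon> t / 2 for near-minimality and \<epsilon> t for clipping this adds up to 2
    \<epsilon> t.\<close>
  define t where "t = \<epsilon> / (L1 + 1)"
  have t: "t > 0" "t * L1 \<le> \<epsilon>" using \<epsilon> L1 by (auto simp: t_def field_simps)
  have "J (\<lambda>x. 0) \<in> S" using m unfolding S_def by (intro CollectI exI[of _ "\<lambda>x. 0"]) auto
  then have "\<exists>y\<in>S. y < Inf S + \<epsilon> * t / 2"
    using cInf_lessD[of S "Inf S + \<epsilon> * t / 2"] \<epsilon> t by fastforce
  then obtain f where f: "cm f" "\<And>x. x \<in> topspace X \<Longrightarrow> \<bar>f x\<bar> \<le> m" and Jf: "J f < Inf S + \<epsilon> * t / 2"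
    unfolding S_def by blast
  have one: "\<tau> g - L (\<lambda>x. f x * g x) \<le> 2 * \<epsilon>" if g: "cm g" "\<And>x. x \<in> topspace X \<Longrightarrow> \<bar>g x\<bar> \<le> 1" for g
  proof -
    define u where "u x = f x + t * g x" for x
    define c where "c x = max (- m) (min m (u x))" for x
    define w where "w x = u x - c x" for x
    have cmt: "cm (\<lambda>x. t * g x)" using cm_ops(3)[OF cm_const g(1)] .
    have cont: "cm u" "cm c" "cm w"
      unfolding w_def c_def u_def using f(1) cmt by auto
    have w: "\<bar>w x\<bar> \<le> t" "(c x)\<^sup>2 + 2 * (m * \<bar>w x\<bar>) \<le> (u x)\<^sup>2" if x: "x \<in> topspace X" for x
    proof -
      have "\<bar>t * g x\<bar> \<le> t" using g(2)[OF x] t by (simp add: abs_mult mult_left_le)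
      then have "\<bar>u x\<bar> \<le> m + t" using f(2)[OF x] by (simp add: u_def)
      then show "\<bar>w x\<bar> \<le> t" using m t by (auto simp: w_def c_def abs_if max_def min_def split: if_splits)
      \<comment> \<open>The overshoot \<open>w\<close> is non-zero only where c = m or c = -m, and
        there it has the sign of c. So clipping lowers half the quadratic term by at least m L(|w|),
        which by \<open>dom\<close> pays for the change of \<tau> up to \<epsilon> t.\<close>
      have "c x * w x = m * \<bar>w x\<bar>"
        using m by (auto simp: w_def c_def abs_if max_def min_def algebra_simps split: if_splits)
      moreover have "(u x)\<^sup>2 = (c x)\<^sup>2 + 2 * (c x * w x) + (w x)\<^sup>2"
        by (simp add: w_def power2_eq_square algebra_simps)
      ultimately show "(c x)\<^sup>2 + 2 * (m * \<bar>w x\<bar>) \<le> (u x)\<^sup>2" by simp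
    qed
    have cw: "cm (\<lambda>x. 2 * (m * \<bar>w x\<bar>))" using cont by auto
    have "L (\<lambda>x. (c x)\<^sup>2 + 2 * (m * \<bar>w x\<bar>)) \<le> L (\<lambda>x. (u x)\<^sup>2)"
      using cont cw w(2) by (intro positive_functional_mono[OF L]) auto
    moreover have "L (\<lambda>x. (c x)\<^sup>2 + 2 * (m * \<bar>w x\<bar>)) = L (\<lambda>x. (c x)\<^sup>2) + 2 * (m * L (\<lambda>x. \<bar>w x\<bar>))"
      using cont by (subst Ls(1)) (auto simp: Ls(3))
    moreover have "\<bar>\<tau> w\<bar> \<le> m * L (\<lambda>x. \<bar>w x\<bar>) + \<epsilon> * t"
      using cont w t by (intro dom) auto
    moreover have "\<tau> w = \<tau> u - \<tau> c" unfolding w_def[abs_def] by (rule \<tau>s(2)) (fact cont)+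
    ultimately have "J c - \<epsilon> * t \<le> J u" unfolding J_def by linarith
    moreover have "Inf S \<le> J c"
      using cont m unfolding S_def by (intro cInf_lower[OF _ bdd[unfolded S_def]]) (auto simp: c_def)
    ultimately have low: "J f - \<epsilon> * t / 2 - \<epsilon> * t \<le> J u" using Jf by linarith
    have "(\<lambda>x. (u x)\<^sup>2) = (\<lambda>x. (f x)\<^sup>2 + (2 * t * (f x * g x) + t\<^sup>2 * (g x)\<^sup>2))"
      by (auto simp: u_def power2_eq_square algebra_simps)
    moreover have "L (\<lambda>x. (f x)\<^sup>2 + (2 * t * (f x * g x) + t\<^sup>2 * (g x)\<^sup>2)) =
       L (\<lambda>x. (f x)\<^sup>2) + (2 * t * L (\<lambda>x. f x * g x) + t\<^sup>2 * L (\<lambda>x. (g x)\<^sup>2))"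
      using f(1) g(1) by (simp add: Ls cm_ops(3)[OF cm_const])
    moreover have "\<tau> u = \<tau> f + t * \<tau> g" unfolding u_def[abs_def] using f(1) g(1) cmt by (simp add: \<tau>s)
    ultimately have Ju: "J u = J f + t * (L (\<lambda>x. f x * g x) - \<tau> g) + t\<^sup>2 * L (\<lambda>x. (g x)\<^sup>2) / 2"
      unfolding J_def by (simp add: algebra_simps add_divide_distrib)
    have "L (\<lambda>x. (g x)\<^sup>2) \<le> L1" unfolding L1_def
      using g abs_square_le_1 by (intro positive_functional_mono[OF L]) auto
    then have "t\<^sup>2 * L (\<lambda>x. (g x)\<^sup>2) \<le> t\<^sup>2 * L1" by (intro mult_left_mono) auto
    also have "\<dots> \<le> t * \<epsilon>" using t by (simp add: power2_eq_square)
    finally have "t * (\<tau> g - L (\<lambda>x. f x * g x)) \<le> t * (2 * \<epsilon>)"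
      using low Ju by (simp add: algebra_simps)
    then show ?thesis using t by simp
  qed
  have "\<bar>\<tau> g - L (\<lambda>x. f x * g x)\<bar> \<le> 2 * \<epsilon> * s"
    if g: "cm g" "0 \<le> s" "\<And>x. x \<in> topspace X \<Longrightarrow> \<bar>g x\<bar> \<le> s" for g s
  proof (cases "s = 0")
    case True
    then have g0: "\<And>x. x \<in> topspace X \<Longrightarrow> g x = 0" using g(3) by simp
    have "L (\<lambda>x. \<bar>g x\<bar>) = L (\<lambda>x. 0)" "L (\<lambda>x. f x * g x) = L (\<lambda>x. 0)"
      using g0 f(1) g(1) by (auto intro!: positive_functional_cong[OF L])
    moreover have "\<bar>\<tau> g\<bar> \<le> m * L (\<lambda>x. \<bar>g x\<bar>) + \<epsilon> * 0" using g0 g(1) by (intro dom) auto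
    ultimately show ?thesis using Ls(5) True by simp
  next
    case False
    then have s: "s > 0" using g by simp
    have c: "cm (\<lambda>x. c * g x)" for c using cm_ops(3)[OF cm_const g(1)] .
    have eq: "\<tau> (\<lambda>x. c * g x) - L (\<lambda>x. f x * (c * g x)) = c * (\<tau> g - L (\<lambda>x. f x * g x))" for c
    proof -
      have "L (\<lambda>x. f x * (c * g x)) = L (\<lambda>x. c * (f x * g x))" by (simp add: ac_simps)
      then show ?thesis using g(1) f(1) by (simp add: \<tau>s Ls algebra_simps)
    qed
    have "(1/s) * (\<tau> g - L (\<lambda>x. f x * g x)) \<le> 2 * \<epsilon>"
      unfolding eq[symmetric] using g(3) s by (intro one c) (simp add: abs_mult field_simps)
    moreover have "(-1/s) * (\<tau> g - L (\<lambda>x. f x * g x)) \<le> 2 * \<epsilon>"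
      unfolding eq[symmetric] using g(3) s by (intro one c) (simp add: abs_mult field_simps)
    ultimately show ?thesis using s by (simp add: field_simps abs_le_iff)
  qed
  with f that show thesis by blast
qed

text \<open>Weak sequential compactness of a bounded set in L^2, obtained without completing C(X). A
  diagonal subsequence settles the products with the f j. An arbitrary y is compared with a nearly
  best approximation v among the functions already settled; y - v is then almost orthogonal to all f
  j, uniformly in j.\<close>

lemma weak_subsequence:
  assumes L: "positive_functional X L" and f: "\<And>n::nat. cm (f n)"
    and m: "0 \<le> m" "\<And>n x. x \<in> topspace X \<Longrightarrow> \<bar>f n x\<bar> \<le> m"
  obtains r :: "nat \<Rightarrow> nat" where "strict_mono r" "\<And>y. cm y \<Longrightarrow> convergent (\<lambda>n. L (\<lambda>x. f (r n) x * y x))"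
proof -
  note Ls = positive_functional_simps[OF L]
  define L1 where "L1 = L (\<lambda>x. 1)"
  have L1: "0 \<le> L1" unfolding L1_def by (rule positive_functional_nonneg[OF L]) auto
  have ff: "\<bar>L (\<lambda>x. f n x * f j x)\<bar> \<le> L1 * (m * m)" for n j
    unfolding L1_def using f m
    by (intro bounded_functionalD[OF positive_functional_bounded[OF L]]) (auto simp: abs_mult intro: mult_mono)
  obtain k where k: "strict_mono k" and "\<And>j. \<exists>l. (\<lambda>n. L (\<lambda>x. f (k n) x * f j x)) \<longlonglongrightarrow> l"
    by (rule function_convergent_subsequence[of "UNIV::nat set" "\<lambda>n j. L (\<lambda>x. f n x * f j x)" "L1 * (m * m)"])
      (use ff in auto)
  then have kc: "convergent (\<lambda>n. L (\<lambda>x. f (k n) x * f j x))" for j by (auto simp: convergent_def)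
  define V where "V = {v. cm v \<and> convergent (\<lambda>n. L (\<lambda>x. f (k n) x * v x))}"
  have V_add: "(\<lambda>x. v x + t * f j x) \<in> V" if "v \<in> V" for v t j
  proof -
    have "cm v" "convergent (\<lambda>n. L (\<lambda>x. f (k n) x * v x))" using that by (auto simp: V_def)
    moreover have "L (\<lambda>x. f (k n) x * (v x + t * f j x)) = L (\<lambda>x. f (k n) x * v x) + t * L (\<lambda>x. f (k n) x * f j x)" for n
    proof -
      have "(\<lambda>x. f (k n) x * (v x + t * f j x)) = (\<lambda>x. f (k n) x * v x + t * (f (k n) x * f j x))"
        by (auto simp: algebra_simps)
      then show ?thesis using \<open>cm v\<close> f by (simp add: Ls cm_ops(3)[OF cm_const])
    qed
    ultimately show ?thesis
      using f kc[of j] unfolding V_def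
      by (auto intro!: convergent_add convergent_mult convergent_const cm_ops)
  qed
  have "convergent (\<lambda>n. L (\<lambda>x. f (k n) x * y x))" if y: "cm y" for y
  proof (rule convergent_approx)
    fix e :: real assume e: "e > 0"
    define t where "t = e / (L1 * (m * m) + 1)"
    have t: "t > 0" "t * (L1 * (m * m)) \<le> e" 
    proof -
      define q where "q = L1 * (m * m)"
      have "0 \<le> q" using L1 by (simp add: q_def)
      then show "t > 0" "t * (L1 * (m * m)) \<le> e"
        using e unfolding t_def q_def[symmetric] by (auto simp: field_simps)
    qed
    \<comment> \<open>Half the squared distance from y to v. Its infimum over V need not be
      attained, hence the slack e t / 2.\<close>
    define D where "D v = L (\<lambda>x. (y x - v x)\<^sup>2) / 2" for v
    have bdd: "bdd_below (D ` V)"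
    proof (rule bdd_belowI2)
      show "0 \<le> D v" if "v \<in> V" for v unfolding D_def using that y
        by (intro divide_nonneg_pos positive_functional_nonneg[OF L]) (auto simp: V_def)
    qed
    have "(\<lambda>x. 0) \<in> V" by (auto simp: V_def convergent_const Ls)
    then have "\<exists>d\<in>D ` V. d < Inf (D ` V) + e * t / 2"
      using cInf_lessD[of "D ` V" "Inf (D ` V) + e * t / 2"] e t by fastforce
    then obtain v where v: "v \<in> V" and Dv: "D v < Inf (D ` V) + e * t / 2" by blast
    then have cv: "cm v" by (simp add: V_def)
    \<comment> \<open>V is stable under adding multiples of f j, so near-minimality of v can be
      tested in the direction f j. The choices s = t and s = -t give the two-sided bound.\<close>
    have one: "s * L (\<lambda>x. f j x * (y x - v x)) \<le> t * e" if s: "\<bar>s\<bar> = t" for s j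
    proof -
      have "Inf (D ` V) \<le> D (\<lambda>x. v x + s * f j x)"
        by (rule cInf_lower[OF _ bdd]) (use V_add[OF v] in auto)
      then have 1: "D v - e * t / 2 \<le> D (\<lambda>x. v x + s * f j x)" using Dv by linarith
      have "(\<lambda>x. (y x - (v x + s * f j x))\<^sup>2) =
          (\<lambda>x. (y x - v x)\<^sup>2 - (2 * s * (f j x * (y x - v x)) - s\<^sup>2 * (f j x * f j x)))"
        by (auto simp: power2_eq_square algebra_simps)
      moreover have "L (\<lambda>x. (y x - v x)\<^sup>2 - (2 * s * (f j x * (y x - v x)) - s\<^sup>2 * (f j x * f j x))) =
        L (\<lambda>x. (y x - v x)\<^sup>2) - (2 * s * L (\<lambda>x. f j x * (y x - v x)) - s\<^sup>2 * L (\<lambda>x. f j x * f j x))"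
        using y cv f by (simp add: Ls cm_ops(3)[OF cm_const])
      ultimately have 2: "D (\<lambda>x. v x + s * f j x) =
          D v - s * L (\<lambda>x. f j x * (y x - v x)) + s\<^sup>2 * L (\<lambda>x. f j x * f j x) / 2"
        unfolding D_def by (simp add: field_simps)
      have "s\<^sup>2 = t * t" using s by (metis power2_abs power2_eq_square)
      then have "s\<^sup>2 * L (\<lambda>x. f j x * f j x) \<le> t * t * (L1 * (m * m))"
        using ff[of j j] t by (auto intro!: mult_left_mono)
      also have "\<dots> \<le> t * e" using t by (simp add: mult.assoc)
      finally show ?thesis using 1 2 by (simp add: algebra_simps)
    qed
    have "\<bar>L (\<lambda>x. f (k n) x * y x) - L (\<lambda>x. f (k n) x * v x)\<bar> \<le> e" for n
    proof -
      have "(\<lambda>x. f (k n) x * (y x - v x)) = (\<lambda>x. f (k n) x * y x - f (k n) x * v x)"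
        by (auto simp: algebra_simps)
      then have eq: "L (\<lambda>x. f (k n) x * (y x - v x)) = L (\<lambda>x. f (k n) x * y x) - L (\<lambda>x. f (k n) x * v x)"
        using y cv f by (simp add: Ls)
      have "t * L (\<lambda>x. f (k n) x * (y x - v x)) \<le> t * e" "t * (- L (\<lambda>x. f (k n) x * (y x - v x))) \<le> t * e"
        using one[of t "k n"] one[of "-t" "k n"] t by auto
      then show ?thesis using t eq by auto
    qed
    then show "\<exists>c. convergent c \<and> (\<forall>n. \<bar>L (\<lambda>x. f (k n) x * y x) - c n\<bar> \<le> e)"
      using v by (auto simp: V_def)
  qed
  with k that show thesis by blast
qed

lemma linear_functional_sum:
  assumes "linear_functional X \<phi>" "finite A" "\<And>i. i \<in> A \<Longrightarrow> cm (f i)"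
  shows "\<phi> (\<lambda>x. \<Sum>i\<in>A. f i x) = (\<Sum>i\<in>A. \<phi> (f i)) \<and> cm (\<lambda>x. \<Sum>i\<in>A. f i x)"
  using assms(2,3)
  by (induction A rule: finite_induct) (auto simp: linear_functional_simps[OF assms(1)])

end

section \<open>Compact zero-dimensional spaces: approximation by clopen sets\<close>

locale stone_space = compact_top +
  assumes clopen_base: "\<And>x U. openin X U \<Longrightarrow> x \<in> U \<Longrightarrow> \<exists>V. clopenin X V \<and> x \<in> V \<and> V \<subseteq> U"
begin

lemma clopen_between:
  assumes "closedin X C" "openin X U" "C \<subseteq> U"
  obtains V where "clopenin X V" "C \<subseteq> V" "V \<subseteq> U"
proof -
  have "compactin X C" using assms(1) compact closedin_compact_space by blast
  define \<V> where "\<V> = {V. clopenin X V \<and> V \<subseteq> U}"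
  have "(\<forall>V\<in>\<V>. openin X V) \<and> C \<subseteq> \<Union>\<V>"
    using clopen_base[OF assms(2)] assms(3) by (force simp: \<V>_def clopenin_def)
  then obtain \<F> where \<F>: "finite \<F>" "\<F> \<subseteq> \<V>" "C \<subseteq> \<Union>\<F>"
    using \<open>compactin X C\<close> unfolding compactin_def by meson
  then have "clopenin X (\<Union>\<F>)"
    using clopenin_Union_finite[of \<F> X "\<lambda>V. V"] by (auto simp: \<V>_def)
  then show ?thesis using \<F> that[of "\<Union>\<F>"] by (auto simp: \<V>_def)
qed

lemma clopen_level_set:
  assumes "cm f" "s < t"
  obtains W where "clopenin X W" "\<And>x. x \<in> topspace X \<Longrightarrow> t \<le> f x \<Longrightarrow> x \<in> W" "\<And>x. x \<in> W \<Longrightarrow> s < f x"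
proof (rule clopen_between)
  show "closedin X {x \<in> topspace X. f x \<in> {t..}}"
    by (rule closedin_continuous_map_preimage[OF assms(1)]) auto
  show "openin X {x \<in> topspace X. f x \<in> {s<..}}"
    by (rule openin_continuous_map_preimage[OF assms(1)]) auto
  show "{x \<in> topspace X. f x \<in> {t..}} \<subseteq> {x \<in> topspace X. f x \<in> {s<..}}"
    using assms by auto
  fix V assume "clopenin X V" "{x \<in> topspace X. f x \<in> {t..}} \<subseteq> V" "V \<subseteq> {x \<in> topspace X. f x \<in> {s<..}}"
  then show thesis using that[of V] by auto
qed

text \<open>A layer-cake sum: W i lies between {g >= T (i+1)} and {g > T i} for equally spaced
  thresholds, so the number of W i containing x differs from N (g x + 1) / 2 by at most 1. The
  approximant is written as an average of sign functions 2 1_W - 1, which is the form that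
  \<open>modulus_one_clopen\<close> exploits.\<close>

lemma simple_approximation:
  assumes g: "cm g" "\<And>x. x \<in> topspace X \<Longrightarrow> \<bar>g x\<bar> \<le> 1" and N: "N > 0"
  obtains W where "\<And>i. clopenin X (W i)"
    "\<And>x. x \<in> topspace X \<Longrightarrow> \<bar>g x - (\<Sum>i<N. (1 / real N) * (2 * indicator (W i) x - 1))\<bar> \<le> 2 / real N"
proof -
  define T where "T i = 2 * real i / real N - 1" for i
  have "\<exists>W. clopenin X W \<and> (\<forall>x\<in>topspace X. T (Suc i) \<le> g x \<longrightarrow> x \<in> W) \<and> (\<forall>x\<in>W. T i < g x)" for i
  proof -
    have "T i < T (Suc i)" using N by (simp add: T_def divide_strict_right_mono)
    from clopen_level_set[OF g(1) this] show ?thesis by metis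
  qed
  then obtain W where W: "\<And>i. clopenin X (W i)" "\<And>i x. x \<in> topspace X \<Longrightarrow> T (Suc i) \<le> g x \<Longrightarrow> x \<in> W i"
    "\<And>i x. x \<in> W i \<Longrightarrow> T i < g x" by metis
  have "\<bar>g x - (\<Sum>i<N. (1 / real N) * (2 * indicator (W i) x - 1))\<bar> \<le> 2 / real N" if x: "x \<in> topspace X" for x
  proof -
    define z where "z = real N * (g x + 1) / 2"
    define p where "p = nat \<lfloor>z\<rfloor>"
    have "real N * ((g x + 1) / 2) \<le> real N * 1" using g(2)[OF x] by (intro mult_left_mono) auto
    then have z: "0 \<le> z" "z \<le> real N" using g(2)[OF x] by (auto simp: z_def abs_le_iff)
    then have p: "real p \<le> z" "z < real p + 1" unfolding p_def by linarith+
    define c where "c = card {i \<in> {..<N}. x \<in> W i}"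
    have T: "T i < g x \<longleftrightarrow> real i < z" "T i \<le> g x \<longleftrightarrow> real i \<le> z" for i
      using N by (auto simp: T_def z_def field_simps)
    have "{..<p} \<subseteq> {i \<in> {..<N}. x \<in> W i}"
    proof (clarsimp, intro conjI)
      fix i assume "i < p"
      then have "real (Suc i) \<le> z" using p by linarith
      then show "x \<in> W i" using W(2)[OF x] T(2) by blast
      show "i < N" using \<open>real (Suc i) \<le> z\<close> z by linarith
    qed
    then have "card {..<p} \<le> c" unfolding c_def by (intro card_mono) auto
    moreover have "{i \<in> {..<N}. x \<in> W i} \<subseteq> {..<Suc p}"
    proof clarsimp
      fix i assume "x \<in> W i"
      then have "real i < z" using W(3) T(1) by blast
      then show "i < Suc p" using p by linarith
    qed
    then have "c \<le> card {..<Suc p}" unfolding c_def by (intro card_mono) auto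
    ultimately have cz: "\<bar>real c - z\<bar> \<le> 1" using p by auto
    have "(\<Sum>i<N. indicator (W i) x) = real c"
      unfolding c_def by (simp add: indicator_def sum.If_cases Int_def)
    then have "(\<Sum>i<N. (1 / real N) * (2 * indicator (W i) x - 1)) = (1 / real N) * (2 * real c - real N)"
      by (simp add: sum_distrib_left[symmetric] sum_subtractf sum_divide_distrib[symmetric])
    also have "\<dots> = 2 * real c / real N - 1" using N by (simp add: field_simps)
    finally have "g x - (\<Sum>i<N. (1 / real N) * (2 * indicator (W i) x - 1)) = 2 * (z - real c) / real N"
      using N by (simp add: z_def field_simps)
    also have "\<bar>\<dots>\<bar> \<le> 2 / real N"
      using cz by (simp add: abs_mult abs_minus_commute divide_right_mono)
    finally show ?thesis .
  qed
  with W(1) that show thesis by blast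
qed

lemma bounded_functional_simple_approximation:
  assumes g: "cm g" "\<And>x. x \<in> topspace X \<Longrightarrow> \<bar>g x\<bar> \<le> 1" and N: "N > 0"
  obtains W where "\<And>i. clopenin X (W i)"
    "\<And>b \<phi>. bounded_functional X b \<phi> \<Longrightarrow>
       \<bar>\<phi> g - (\<Sum>i<N. (1 / real N) * (2 * \<phi> (indicator (W i)) - \<phi> (\<lambda>x. 1)))\<bar> \<le> b * (2 / real N)"
proof -
  obtain W where W: "\<And>i. clopenin X (W i)"
    "\<And>x. x \<in> topspace X \<Longrightarrow> \<bar>g x - (\<Sum>i<N. (1 / real N) * (2 * indicator (W i) x - 1))\<bar> \<le> 2 / real N"
    using simple_approximation[OF g N] by blast
  have c: "cm (\<lambda>x. (1 / real N) * (2 * indicator (W i) x - 1))" for i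
    by (intro cm_ops cm_const cm_indicator W)
  have "\<bar>\<phi> g - (\<Sum>i<N. (1 / real N) * (2 * \<phi> (indicator (W i)) - \<phi> (\<lambda>x. 1)))\<bar> \<le> b * (2 / real N)"
    if \<phi>: "bounded_functional X b \<phi>" for b \<phi>
  proof -
    note s = linear_functional_sum[OF bounded_functional_linear[OF \<phi>], of "{..<N}" "\<lambda>i x. (1 / real N) * (2 * indicator (W i) x - 1)"]
    have "\<phi> (\<lambda>x. (1 / real N) * (2 * indicator (W i) x - 1)) = (1 / real N) * (2 * \<phi> (indicator (W i)) - \<phi> (\<lambda>x. 1))" for i
      using W(1)[of i] by (simp only: bounded_functional_simps[OF \<phi>] cm_ops cm_const cm_indicator)
    then have "(\<Sum>i<N. (1 / real N) * (2 * \<phi> (indicator (W i)) - \<phi> (\<lambda>x. 1))) =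
        \<phi> (\<lambda>x. \<Sum>i<N. (1 / real N) * (2 * indicator (W i) x - 1))"
      using s c by simp
    then have "\<phi> g - (\<Sum>i<N. (1 / real N) * (2 * \<phi> (indicator (W i)) - \<phi> (\<lambda>x. 1))) =
        \<phi> (\<lambda>x. g x - (\<Sum>i<N. (1 / real N) * (2 * indicator (W i) x - 1)))"
      using s c bounded_functional_simps(2)[OF \<phi> g(1)] by simp
    also have "\<bar>\<dots>\<bar> \<le> b * (2 / real N)"
      using s c g(1) W(2) by (intro bounded_functionalD[OF \<phi>]) auto
    finally show ?thesis .
  qed
  with W(1) that show thesis by blast
qed

text \<open>An average cannot exceed all of its terms: a bound for every sign function 2 1_W - 1 is,
  up to the approximation error, a bound for every h with |h| <= 1. Hence countably many clopen sets
  can witness the norms of a whole sequence.\<close>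

lemma modulus_one_clopen:
  assumes \<phi>: "bounded_functional X b \<phi>" and "0 < \<epsilon>"
  obtains W where "clopenin X W" "modulus \<phi> (\<lambda>x. 1) - \<epsilon> \<le> 2 * \<phi> (indicator W) - \<phi> (\<lambda>x. 1)"
proof -
  have "\<exists>W. clopenin X W \<and> modulus \<phi> (\<lambda>x. 1) - \<epsilon> \<le> 2 * \<phi> (indicator W) - \<phi> (\<lambda>x. 1)"
  proof (rule ccontr)
    assume neg: "\<not> ?thesis"
    have "modulus \<phi> (\<lambda>x. 1) \<le> modulus \<phi> (\<lambda>x. 1) - \<epsilon> / 2"
    proof (rule modulus_least[OF \<phi>])
      fix h assume h: "cm h" "\<And>x. x \<in> topspace X \<Longrightarrow> \<bar>h x\<bar> \<le> 1"
      have "(\<lambda>n. b * (2 / real n)) \<longlonglongrightarrow> 0"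
        by (intro tendsto_mult_right_zero lim_const_over_n)
      then have "\<forall>\<^sub>F n in sequentially. b * (2 / real n) < \<epsilon> / 2"
        using assms(2) by (intro order_tendstoD) auto
      then obtain N where N: "N > 0" "b * (2 / real N) < \<epsilon> / 2"
        using eventually_gt_at_top[of 0] by (metis (mono_tags, lifting) eventually_conj eventually_happens' sequentially_bot)
      obtain W where W: "\<And>i. clopenin X (W i)"
        "\<bar>\<phi> h - (\<Sum>i<N. (1 / real N) * (2 * \<phi> (indicator (W i)) - \<phi> (\<lambda>x. 1)))\<bar> \<le> b * (2 / real N)"
        using bounded_functional_simple_approximation[OF h N(1)] \<phi> by metis
      have "(\<Sum>i<N. (1 / real N) * (2 * \<phi> (indicator (W i)) - \<phi> (\<lambda>x. 1)))
         \<le> (\<Sum>i<N. (1 / real N) * (modulus \<phi> (\<lambda>x. 1) - \<epsilon>))"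
        using neg W(1) by (intro sum_mono mult_left_mono) (auto simp: not_le less_imp_le)
      also have "\<dots> = modulus \<phi> (\<lambda>x. 1) - \<epsilon>" using N by simp
      finally show "\<phi> h \<le> modulus \<phi> (\<lambda>x. 1) - \<epsilon> / 2" using W(2) N(2) by linarith
    qed auto
    then show False using assms(2) by simp
  qed
  with that show thesis by blast
qed

text \<open>Turns information about finitely many clopen sets, which is what a single level can
  provide, into information about a continuous function, uniformly over a ball of
  functionals.\<close>

lemma clopen_determines:
  assumes g: "cm g" and "0 < \<epsilon>" "0 \<le> b"
  obtains \<W> \<delta> where "finite \<W>" "\<And>W. W \<in> \<W> \<Longrightarrow> clopenin X W" "0 < \<delta>"
    "\<And>\<phi> \<psi>. bounded_functional X b \<phi> \<Longrightarrow> bounded_functional X b \<psi> \<Longrightarrow>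
       (\<And>W. W \<in> \<W> \<Longrightarrow> \<bar>\<phi> (indicator W) - \<psi> (indicator W)\<bar> \<le> \<delta>) \<Longrightarrow> \<bar>\<phi> g - \<psi> g\<bar> \<le> \<epsilon>"
proof -
  obtain s0 where s0: "0 \<le> s0" "\<And>x. x \<in> topspace X \<Longrightarrow> \<bar>g x\<bar> \<le> s0" using cm_bounded[OF g] by blast
  define s where "s = s0 + 1"
  have s: "s > 0" "\<And>x. x \<in> topspace X \<Longrightarrow> \<bar>g x\<bar> \<le> s" using s0 by (auto simp: s_def add_nonneg_pos) (smt (verit))
  define h where "h x = (1/s) * g x" for x
  have h: "cm h" "\<And>x. x \<in> topspace X \<Longrightarrow> \<bar>h x\<bar> \<le> 1"
    using cm_ops(3)[OF cm_const g] s unfolding h_def[abs_def] by (blast, simp add: abs_mult)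
  have "(\<lambda>n. s * (2 * (b * (2 / real n)))) \<longlonglongrightarrow> 0"
    by (intro tendsto_mult_right_zero lim_const_over_n)
  then have "\<forall>\<^sub>F n in sequentially. s * (2 * (b * (2 / real n))) < \<epsilon> / 2"
    using assms(2) by (intro order_tendstoD) auto
  then obtain N where N: "N > 0" "s * (2 * (b * (2 / real N))) < \<epsilon> / 2"
    using eventually_gt_at_top[of 0] by (metis (mono_tags, lifting) eventually_conj eventually_happens' sequentially_bot)
  obtain W where W: "\<And>i. clopenin X (W i)" "\<And>\<phi>. bounded_functional X b \<phi> \<Longrightarrow>
       \<bar>\<phi> h - (\<Sum>i<N. (1 / real N) * (2 * \<phi> (indicator (W i)) - \<phi> (\<lambda>x. 1)))\<bar> \<le> b * (2 / real N)"
    using bounded_functional_simple_approximation[OF h N(1)] by metis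
  \<comment> \<open>Each sign function changes by at most 3 \<delta>, so after scaling by s this
    part of the error is \<epsilon> / 2; the choice of N pays for the other half. The whole space
    joins the clopen sets below to control the constant function 1 in each sign function.\<close>
  define \<delta> where "\<delta> = \<epsilon> / (6 * s)"
  show thesis
  proof (rule that[of "insert (topspace X) (W ` {..<N})" \<delta>])
    fix \<phi> \<psi> assume \<phi>: "bounded_functional X b \<phi>" and \<psi>: "bounded_functional X b \<psi>"
      and eq: "\<And>V. V \<in> insert (topspace X) (W ` {..<N}) \<Longrightarrow> \<bar>\<phi> (indicator V) - \<psi> (indicator V)\<bar> \<le> \<delta>"
    have one: "\<phi> (\<lambda>x. 1) = \<phi> (indicator (topspace X))" "\<psi> (\<lambda>x. 1) = \<psi> (indicator (topspace X))"
      by (auto intro!: bounded_functional_cong[OF \<phi>] bounded_functional_cong[OF \<psi>])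
    have "\<bar>(\<Sum>i<N. (1 / real N) * (2 * \<phi> (indicator (W i)) - \<phi> (\<lambda>x. 1))) -
           (\<Sum>i<N. (1 / real N) * (2 * \<psi> (indicator (W i)) - \<psi> (\<lambda>x. 1)))\<bar> \<le> (\<Sum>i<N. (1 / real N) * (3 * \<delta>))"
      unfolding sum_subtractf[symmetric]
    proof (rule order_trans[OF sum_abs], rule sum_mono)
      fix i assume "i \<in> {..<N}"
      then have "\<bar>\<phi> (indicator (W i)) - \<psi> (indicator (W i))\<bar> \<le> \<delta>" "\<bar>\<phi> (\<lambda>x. 1) - \<psi> (\<lambda>x. 1)\<bar> \<le> \<delta>"
        using eq one by auto
      then have "\<bar>(2 * \<phi> (indicator (W i)) - \<phi> (\<lambda>x. 1)) - (2 * \<psi> (indicator (W i)) - \<psi> (\<lambda>x. 1))\<bar> \<le> 3 * \<delta>"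
        by linarith
      then show "\<bar>(1 / real N) * (2 * \<phi> (indicator (W i)) - \<phi> (\<lambda>x. 1)) -
           (1 / real N) * (2 * \<psi> (indicator (W i)) - \<psi> (\<lambda>x. 1))\<bar> \<le> (1 / real N) * (3 * \<delta>)"
        unfolding right_diff_distrib[symmetric] abs_mult by (intro mult_mono) auto
    qed
    also have "\<dots> = 3 * \<delta>" using N by simp
    finally have "\<bar>\<phi> h - \<psi> h\<bar> \<le> 3 * \<delta> + 2 * (b * (2 / real N))"
      using W(2)[OF \<phi>] W(2)[OF \<psi>] by linarith
    then have "s * \<bar>\<phi> h - \<psi> h\<bar> \<le> s * (3 * \<delta>) + s * (2 * (b * (2 / real N)))"
      unfolding distrib_left[symmetric] using s by (intro mult_left_mono) auto
    also have "\<dots> \<le> \<epsilon>" using N(2) s by (simp add: \<delta>_def field_simps)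
    finally show "\<bar>\<phi> g - \<psi> g\<bar> \<le> \<epsilon>"
      using bounded_functional_simps(3)[OF \<phi> g, of "1/s"] bounded_functional_simps(3)[OF \<psi> g, of "1/s"] s
      unfolding h_def[abs_def] by (simp add: abs_mult diff_divide_distrib[symmetric])
  qed (use W(1) s assms(2) in \<open>auto simp: \<delta>_def\<close>)
qed

end


section \<open>Splitting off disjointly supported parts\<close>

lemma sum_le_one_exists:
  fixes a :: "'i \<Rightarrow> real"
  assumes "finite F" "F \<noteq> {}" "(\<Sum>i\<in>F. a i) \<le> real (card F) * c"
  shows "\<exists>i\<in>F. a i \<le> c"
proof (rule ccontr)
  assume "\<not> ?thesis"
  then have "(\<Sum>i\<in>F. c) < (\<Sum>i\<in>F. a i)" using assms by (intro sum_strict_mono) auto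
  then show False using assms by simp
qed

context
  fixes X :: "'a topology" and a :: "nat \<Rightarrow> 'a set \<Rightarrow> real" and W :: "nat \<Rightarrow> 'a set" and b \<epsilon> :: real
  assumes a_add: "\<And>k A B. clopenin X A \<Longrightarrow> clopenin X B \<Longrightarrow> A \<inter> B = {} \<Longrightarrow> a k (A \<union> B) = a k A + a k B"
    and a_nonneg: "\<And>k A. clopenin X A \<Longrightarrow> 0 \<le> a k A"
    and a_le: "\<And>k A. clopenin X A \<Longrightarrow> a k A \<le> b"
    and W: "\<And>k. clopenin X (W k)"
    and W_small: "\<And>i k. i < k \<Longrightarrow> a i (W k) \<le> \<epsilon> * (1/2) ^ Suc k"
    and \<epsilon>: "0 < \<epsilon>"
begin

private lemma a_mono:
  assumes "clopenin X A" "clopenin X B" "A \<subseteq> B" shows "a k A \<le> a k B"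
proof -
  have "a k B = a k (A \<union> (B - A))" using assms by (simp add: Un_absorb1)
  also have "\<dots> = a k A + a k (B - A)" by (rule a_add) (use assms in auto)
  finally show ?thesis using a_nonneg[of "B - A" k] assms by auto
qed

private lemma a_subadd:
  assumes "clopenin X A" "clopenin X B" shows "a k (A \<union> B) \<le> a k A + a k B"
proof -
  have "a k (A \<union> B) = a k (A \<union> (B - A))" by simp
  also have "\<dots> = a k A + a k (B - A)" by (rule a_add) (use assms in auto)
  also have "a k (B - A) \<le> a k B" using assms by (intro a_mono) auto
  finally show ?thesis by simp
qed

private lemma a_empty: "a k {} = 0"
  using a_add[of "{}" "{}" k] by simp

private lemma a_UN_le:
  assumes "finite F" "\<And>i. i \<in> F \<Longrightarrow> clopenin X (V i)" shows "a k (\<Union>i\<in>F. V i) \<le> (\<Sum>i\<in>F. a k (V i))"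
  using assms
proof (induction F rule: finite_induct)
  case (insert x F)
  have "a k (V x \<union> (\<Union>i\<in>F. V i)) \<le> a k (V x) + a k (\<Union>i\<in>F. V i)"
    using insert by (intro a_subadd clopenin_Union_finite) auto
  then show ?case using insert by auto
qed (simp add: a_empty)

private lemma a_UN_disjoint:
  assumes "finite F" "\<And>i. i \<in> F \<Longrightarrow> clopenin X (V i)" "disjoint_family_on V F"
  shows "a k (\<Union>i\<in>F. V i) = (\<Sum>i\<in>F. a k (V i))"
  using assms
proof (induction F rule: finite_induct)
  case (insert x F)
  have "a k (V x \<union> (\<Union>i\<in>F. V i)) = a k (V x) + a k (\<Union>i\<in>F. V i)"
  proof (rule a_add)
    show "V x \<inter> (\<Union>i\<in>F. V i) = {}"
      using insert.prems(2) insert.hyps(2) by (fastforce simp: disjoint_family_on_def)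
  qed (use insert in \<open>auto intro: clopenin_Union_finite\<close>)
  then show ?case using insert by (auto simp: disjoint_family_on_def)
qed (simp add: a_empty)

text \<open>Take N of the sets W i with N \<eta> >= b. Removing from each one the later ones makes
  them disjoint and costs a i at most \<epsilon>, because later sets are small for earlier masses. A
  mass of total b cannot give more than \<eta> to each of N disjoint sets, so by pigeonhole one of
  them is small for infinitely many k.\<close>

private lemma step:
  assumes M: "infinite M" and G: "clopenin X G" and \<eta>: "0 < \<eta>"
  shows "\<exists>i\<in>M. \<exists>V. clopenin X V \<and> V \<subseteq> W i \<and> V \<inter> G = {} \<and> a i (W i - V) \<le> a i G + \<epsilon> \<and>
    (\<exists>M'\<subseteq>M. infinite M' \<and> (\<forall>k\<in>M'. i < k \<and> a k V \<le> \<eta>))"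
proof -
  obtain N :: nat where N: "N > 0" "b \<le> real N * \<eta>"
  proof -
    obtain N :: nat where "b / \<eta> \<le> real N" using real_arch_simple by blast
    then have "b \<le> real N * \<eta>" using \<eta> by (simp add: field_simps)
    also have "\<dots> \<le> real (Suc N) * \<eta>" using \<eta> by (simp add: algebra_simps)
    finally show ?thesis using that[of "Suc N"] by simp
  qed
  obtain F where F: "F \<subseteq> M" "finite F" "card F = N"
    using infinite_arbitrarily_large[OF M, of N] by auto
  have F0: "F \<noteq> {}" using F N by auto
  define L where "L i = {j \<in> F. i < j}" for i
  define V where "V i = W i - (G \<union> (\<Union>j\<in>L i. W j))" for i
  have L: "finite (L i)" for i using F by (simp add: L_def)
  have UL: "clopenin X (\<Union>j\<in>L i. W j)" for i by (rule clopenin_Union_finite) (use L W in auto)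
  have V: "clopenin X (V i)" for i unfolding V_def using UL W G by auto
  have disj: "disjoint_family_on V F"
    unfolding disjoint_family_on_def
  proof (intro ballI impI)
    fix m n assume "m \<in> F" "n \<in> F" "m \<noteq> n"
    then show "V m \<inter> V n = {}" by (cases m n rule: linorder_cases) (auto simp: V_def L_def)
  qed
  have loss: "a i (W i - V i) \<le> a i G + \<epsilon>" for i
  proof -
    have "a i (W i - V i) \<le> a i (G \<union> (\<Union>j\<in>L i. W j))"
      using V W G UL by (intro a_mono) (auto simp: V_def)
    also have "\<dots> \<le> a i G + a i (\<Union>j\<in>L i. W j)" by (intro a_subadd G UL)
    also have "a i (\<Union>j\<in>L i. W j) \<le> (\<Sum>j\<in>L i. a i (W j))" by (intro a_UN_le L W)
    also have "\<dots> \<le> (\<Sum>j\<in>L i. \<epsilon> * (1/2) ^ Suc j)"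
      by (intro sum_mono W_small) (simp add: L_def)
    also have "\<dots> = \<epsilon> * (\<Sum>j\<in>L i. (1/2) ^ Suc j)" by (simp add: sum_distrib_left)
    also have "(\<Sum>j\<in>L i. (1/2::real) ^ Suc j) \<le> (\<Sum>j. (1/2) ^ Suc j)"
      using power_half_series by (intro sum_le_suminf L) (auto simp: sums_iff)
    also have "\<dots> = 1" using power_half_series by (simp add: sums_iff)
    finally show ?thesis using \<epsilon> by simp
  qed
  have "\<exists>i\<in>F. a k (V i) \<le> \<eta>" for k
  proof (rule sum_le_one_exists[OF F(2) F0])
    have "(\<Sum>i\<in>F. a k (V i)) = a k (\<Union>i\<in>F. V i)"
      by (rule a_UN_disjoint[symmetric]) (use F V disj in auto)
    also have "\<dots> \<le> b" by (intro a_le clopenin_Union_finite) (use F V in auto)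
    finally show "(\<Sum>i\<in>F. a k (V i)) \<le> real (card F) * \<eta>" using N F by simp
  qed
  then have "\<exists>i\<in>F. infinite {k \<in> M. a k (V i) \<le> \<eta>}"
    using pigeonhole_infinite_rel[OF M F(2), of "\<lambda>k i. a k (V i) \<le> \<eta>"] by blast
  then obtain i where i: "i \<in> F" "infinite {k \<in> M. a k (V i) \<le> \<eta>}" by blast
  define M' where "M' = {k \<in> M. a k (V i) \<le> \<eta>} - {..i}"
  have "infinite M'" unfolding M'_def using i(2) by simp
  then show ?thesis
    using i F V[of i] loss[of i]
    by (intro bexI[of _ i] exI[of _ "V i"] conjI exI[of _ M']) (auto simp: M'_def V_def)
qed

text \<open>The W k are small for earlier masses, but later masses may charge earlier sets. The
  recursion therefore keeps the union G of the sets chosen so far together with an infinite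
  reservoir M of indices whose masses give G at most \<epsilon> (1 - 2^-s). Removing G from the next
  set then costs at most \<epsilon>, and making it disjoint from later candidates another
  \<epsilon>.\<close>

lemma disjoint_refinement:
  "\<exists>r V. strict_mono (r :: nat \<Rightarrow> nat) \<and> (\<forall>k. clopenin X (V k)) \<and> disjoint_family V \<and>
     (\<forall>k. V k \<subseteq> W (r k) \<and> a (r k) (W (r k) - V k) \<le> 2 * \<epsilon>)"
proof -
  define P where "P s x = (case x of (i::nat, V, M, G) \<Rightarrow> infinite M \<and> clopenin X G \<and> clopenin X V \<and>
     V \<subseteq> W i \<and> V \<subseteq> G \<and> a i (W i - V) \<le> 2 * \<epsilon> \<and> (\<forall>k\<in>M. i < k \<and> a k G \<le> \<epsilon> * (1 - (1/2) ^ s)))"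
    for s :: nat and x
  define Q where "Q (s::nat) x y = (case (x, y) of ((i::nat, V::'a set, M::nat set, G::'a set), (i'::nat, V'::'a set, M'::nat set, G'::'a set)) \<Rightarrow>
     i' \<in> M \<and> G \<subseteq> G' \<and> V' \<inter> G = {})" for s x y
  have "\<exists>f. \<forall>n. P (Suc n) (f n) \<and> Q n (f n) (f (Suc n))"
  proof (rule dependent_nat_choice)
    have "\<exists>i\<in>UNIV. \<exists>V. clopenin X V \<and> V \<subseteq> W i \<and> V \<inter> {} = {} \<and> a i (W i - V) \<le> a i {} + \<epsilon> \<and>
      (\<exists>M'\<subseteq>UNIV. infinite M' \<and> (\<forall>k\<in>M'. i < k \<and> a k V \<le> \<epsilon> / 2))"
      using \<epsilon> by (intro step) auto
    then obtain i V M' where "clopenin X V" "V \<subseteq> W i" "a i (W i - V) \<le> a i {} + \<epsilon>"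
      "infinite M'" "\<forall>k\<in>M'. i < k \<and> a k V \<le> \<epsilon> / 2" by blast
    then have "P (Suc 0) (i, V, M', V)" using \<epsilon> a_empty by (auto simp: P_def)
    then show "\<exists>x. P (Suc 0) x" by blast
  next
    fix x n assume "P (Suc n) x"
    obtain i0 V0 M G where x: "x = (i0, V0, M, G)" by (metis prod.exhaust)
    have h: "infinite M" "clopenin X G" "\<And>k. k \<in> M \<Longrightarrow> a k G \<le> \<epsilon> * (1 - (1/2) ^ Suc n)"
      using \<open>P (Suc n) x\<close> by (auto simp: x P_def)
    have "0 < \<epsilon> * (1/2) ^ Suc (Suc n)" using \<epsilon> by simp
    from step[OF h(1,2) this] obtain i V M' where *: "i \<in> M" "clopenin X V" "V \<subseteq> W i" "V \<inter> G = {}"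
      "a i (W i - V) \<le> a i G + \<epsilon>" "M' \<subseteq> M" "infinite M'"
      "\<And>k. k \<in> M' \<Longrightarrow> i < k \<and> a k V \<le> \<epsilon> * (1/2) ^ Suc (Suc n)" by blast
    have "\<epsilon> * (1 - (1/2) ^ Suc n) \<le> \<epsilon> * 1" using \<epsilon> by (intro mult_left_mono) auto
    then have "a i (W i - V) \<le> 2 * \<epsilon>" using *(5) h(3)[OF *(1)] by simp
    moreover have "a k (V \<union> G) \<le> \<epsilon> * (1 - (1/2) ^ Suc (Suc n))" if "k \<in> M'" for k
    proof -
      have "a k (V \<union> G) \<le> a k V + a k G" by (rule a_subadd) (use * h in auto)
      also have "\<dots> \<le> \<epsilon> * (1/2) ^ Suc (Suc n) + \<epsilon> * (1 - (1/2) ^ Suc n)"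
        using *(8)[OF that] h(3)[of k] *(6) that by (intro add_mono) auto
      also have "\<dots> = \<epsilon> * (1 - (1/2) ^ Suc (Suc n))" by (simp add: algebra_simps)
      finally show ?thesis .
    qed
    ultimately have "P (Suc (Suc n)) (i, V, M', V \<union> G) \<and> Q n x (i, V, M', V \<union> G)"
      using * h unfolding x P_def Q_def by auto
    then show "\<exists>y. P (Suc (Suc n)) y \<and> Q n x y" by blast
  qed
  then obtain f where f: "\<And>n. P (Suc n) (f n)" "\<And>n. Q n (f n) (f (Suc n))" by blast
  define r where "r n = fst (f n)" for n
  define V where "V n = fst (snd (f n))" for n
  define M where "M n = fst (snd (snd (f n)))" for n
  define G where "G n = snd (snd (snd (f n)))" for n
  have ff: "f n = (r n, V n, M n, G n)" for n by (simp add: r_def V_def M_def G_def)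
  have P: "clopenin X (V n)" "V n \<subseteq> W (r n)" "V n \<subseteq> G n" "a (r n) (W (r n) - V n) \<le> 2 * \<epsilon>"
    "\<And>k. k \<in> M n \<Longrightarrow> r n < k" for n
    using f(1)[of n] by (auto simp: ff P_def)
  have Q: "r (Suc n) \<in> M n" "G n \<subseteq> G (Suc n)" "V (Suc n) \<inter> G n = {}" for n
    using f(2)[of n] by (auto simp: ff Q_def)
  have G: "G m \<subseteq> G n" if "m \<le> n" for m n using lift_Suc_mono_le[of G, OF Q(2) that] .
  have Vd: "V m \<inter> V n = {}" if "m < n" for m n
  proof (cases n)
    case (Suc n')
    then have "V m \<subseteq> G n'" using P(3)[of m] G[of m n'] that by auto
    then show ?thesis using Q(3)[of n'] Suc by auto
  qed (use that in simp)
  have "strict_mono r" unfolding strict_mono_Suc_iff using P(5) Q(1) by blast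
  moreover have "disjoint_family V" unfolding disjoint_family_on_def
    using Vd by (metis Int_commute nat_neq_iff)
  ultimately show ?thesis using P by blast
qed

end

section \<open>The subsequence splitting\<close>

context stone_space
begin

lemma positive_functional_indicator_Un:
  assumes L: "positive_functional X L" "clopenin X A" "clopenin X B" "A \<inter> B = {}"
  shows "L (indicator (A \<union> B)) = L (indicator A) + L (indicator B)"
proof -
  have "L (indicator (A \<union> B)) = L (\<lambda>x. indicator A x + indicator B x)"
    using L by (intro positive_functional_cong[OF L(1)] cm_ops cm_indicator clopenin_Un) (auto simp: indicator_def)
  then show ?thesis using positive_functional_simps(1)[OF L(1)] L by (metis cm_indicator(1))
qed

text \<open>One positive functional L with |\<mu> n| <= 2^n L for all n. It stands in for a measure
  with respect to which all \<mu> n are absolutely continuous.\<close>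

definition dominating :: "(nat \<Rightarrow> ('a \<Rightarrow> real) \<Rightarrow> real) \<Rightarrow> ('a \<Rightarrow> real) \<Rightarrow> real" where
  "dominating \<mu> f = (\<Sum>n. (1/2) ^ n * modulus (\<mu> n) f)"

context
  fixes \<mu> :: "nat \<Rightarrow> ('a \<Rightarrow> real) \<Rightarrow> real" and b :: real
  assumes \<mu>: "\<And>n. bounded_functional X b (\<mu> n)"
begin

private lemma summable: "cm f \<Longrightarrow> summable (\<lambda>n. (1/2) ^ n * modulus (\<mu> n) f)"
proof -
  assume f: "cm f"
  obtain s where s: "0 \<le> s" "\<And>x. x \<in> topspace X \<Longrightarrow> \<bar>f x\<bar> \<le> s" using cm_bounded[OF f] by blast
  show ?thesis
  proof (rule summable_comparison_test')
    show "summable (\<lambda>n. (1/2::real) ^ n * (b * s))" by (intro summable_mult2 summable_geometric) simp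
    show "norm ((1/2) ^ n * modulus (\<mu> n) f) \<le> (1/2) ^ n * (b * s)" if "n \<ge> 0" for n
      using abs_modulus_le[OF \<mu> f s, of n] by (simp add: abs_mult)
  qed
qed

lemma positive_functional_dominating: "positive_functional X (dominating \<mu>)"
  unfolding positive_functional_def linear_functional_def
proof (intro conjI allI impI)
  note A = positive_functional_modulus[OF \<mu>]
  show "dominating \<mu> (\<lambda>x. f x + g x) = dominating \<mu> f + dominating \<mu> g" if "cm f" "cm g" for f g
    unfolding dominating_def using suminf_add[OF summable summable, OF that] positive_functional_simps(1)[OF A that]
    by (simp add: distrib_left)
  show "dominating \<mu> (\<lambda>x. c * f x) = c * dominating \<mu> f" if "cm f" for c f
    unfolding dominating_def using suminf_mult[OF summable[OF that], of c] positive_functional_simps(3)[OF A that]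
    by (simp add: ac_simps)
  show "0 \<le> dominating \<mu> f" if "cm f" "\<forall>x\<in>topspace X. 0 \<le> f x" for f
    unfolding dominating_def using positive_functional_nonneg[OF A] that summable
    by (intro suminf_nonneg) auto
qed

lemma modulus_le_dominating:
  assumes "cm f" "\<And>x. x \<in> topspace X \<Longrightarrow> 0 \<le> f x"
  shows "modulus (\<mu> n) f \<le> 2 ^ n * dominating \<mu> f"
proof -
  have "(\<Sum>i\<in>{n}. (1/2) ^ i * modulus (\<mu> i) f) \<le> dominating \<mu> f"
    unfolding dominating_def
    using assms positive_functional_nonneg[OF positive_functional_modulus[OF \<mu>]]
    by (intro sum_le_suminf summable) auto
  then show ?thesis by (simp add: power_divide field_simps)
qed

end

text \<open>The least asymptotic bound \<open>e\<close> for the mass that the \<open>\<mu>\<^sub>n\<close> concentrate on sets of small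
  \<open>L\<close>-measure is nearly attained on disjoint clopen sets; away from them the subsequence is uniformly
  absolutely continuous with respect to \<open>L\<close> up to a small error.\<close>

lemma splitting:
  assumes \<mu>: "\<And>n::nat. bounded_functional X b (\<mu> n)" and \<epsilon>: "0 < \<epsilon>"
  obtains r :: "nat \<Rightarrow> nat" and V L m f where "strict_mono r" "\<And>k. clopenin X (V k)" "disjoint_family V"
    "positive_functional X L" "0 \<le> m" "\<And>k::nat. cm (f k)" "\<And>k x. x \<in> topspace X \<Longrightarrow> \<bar>f k x\<bar> \<le> m"
    "\<And>y. cm y \<Longrightarrow> convergent (\<lambda>k. L (\<lambda>x. f k x * y x))"
    "\<And>k g s. cm g \<Longrightarrow> 0 \<le> s \<Longrightarrow> (\<And>x. x \<in> topspace X \<Longrightarrow> \<bar>g x\<bar> \<le> s) \<Longrightarrow>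
       \<bar>\<mu> (r k) g - \<mu> (r k) (\<lambda>x. indicator (V k) x * g x) - L (\<lambda>x. f k x * g x)\<bar> \<le> \<epsilon> * s"
proof -
  \<comment> \<open>12 = 2 * 6: \<open>dom01\<close> holds up to 6 \<kappa>, and
    \<open>approximate_density\<close> doubles the error.\<close>
  define \<kappa> where "\<kappa> = \<epsilon> / 12"
  have \<kappa>: "0 < \<kappa>" using \<epsilon> by (simp add: \<kappa>_def)
  define b' where "b' = max b 1"
  have b': "b' \<ge> 1" "b \<le> b'" by (auto simp: b'_def)
  define L where "L = dominating \<mu>"
  have L: "positive_functional X L" unfolding L_def by (rule positive_functional_dominating[OF \<mu>])
  define A where "A n = modulus (\<mu> n)" for n
  have A: "positive_functional X (A n)" for n unfolding A_def by (rule positive_functional_modulus[OF \<mu>])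
  note Ls = positive_functional_simps[OF L] and As = positive_functional_simps[OF A]
  have A_le: "A n h \<le> b'" if "cm h" "\<And>x. x \<in> topspace X \<Longrightarrow> 0 \<le> h x" "\<And>x. x \<in> topspace X \<Longrightarrow> h x \<le> 1" for n h
    using modulus_le[OF \<mu>, of h 1 n] that b' by (simp add: A_def)
  have AL: "A n h \<le> 2 ^ n * L h" if "cm h" "\<And>x. x \<in> topspace X \<Longrightarrow> 0 \<le> h x" for n h
    unfolding A_def L_def by (rule modulus_le_dominating[OF \<mu>]) (use that in auto)
  define H where "H = {h. cm h \<and> (\<forall>x\<in>topspace X. 0 \<le> h x \<and> h x \<le> 1)}"
  define E where "E = {c. 0 \<le> c \<and> (\<exists>\<delta>>0. \<exists>N. \<forall>n\<ge>N. \<forall>h\<in>H. L h < \<delta> \<longrightarrow> A n h \<le> c)}"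
  define e where "e = Inf E"
  have "b' \<in> E" unfolding E_def H_def using A_le b' by (intro CollectI conjI exI[of _ 1]) auto
  have bddE: "bdd_below E" by (rule bdd_belowI[of _ 0]) (auto simp: E_def)
  obtain c0 where "c0 \<in> E" "c0 < e + \<kappa>"
    using cInf_lessD[of E "e + \<kappa>"] \<open>b' \<in> E\<close> \<kappa> unfolding e_def by fastforce
  then obtain \<delta>0 N0 where \<delta>0: "\<delta>0 > 0" and up: "\<And>n h. n \<ge> N0 \<Longrightarrow> h \<in> H \<Longrightarrow> L h < \<delta>0 \<Longrightarrow> A n h \<le> e + \<kappa>"
    unfolding E_def by fastforce
  have low: "\<exists>n\<ge>N. \<exists>W. clopenin X W \<and> L (indicator W) < \<delta> \<and> e - 2 * \<kappa> < A n (indicator W)" if \<delta>: "\<delta> > 0" for \<delta> N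
  proof -
    \<comment> \<open>A concentrating function h is replaced by a clopen set close to {h >= t}. The
      part of h below t contributes at most t b' = \<kappa>, and L of the set is at most 2 L(h) / t;
      this is why h is sought with L h < \<delta> t / 2.\<close>
    define t where "t = \<kappa> / b'"
    have t: "t > 0" "t * b' = \<kappa>" using \<kappa> b' by (auto simp: t_def)
    have "\<exists>n\<ge>N. \<exists>h\<in>H. L h < \<delta> * t / 2 \<and> e - \<kappa> < A n h"
    proof (rule ccontr)
      assume neg: "\<not> ?thesis"
      \<comment> \<open>Without such an h a number below the infimum \<open>e\<close> would belong
        to E, unless e <= 0; in that case the zero function is itself a witness.\<close>
      have "max 0 (e - \<kappa>) \<in> E" unfolding E_def
      proof (intro CollectI conjI exI allI ballI impI)
        show "0 < \<delta> * t / 2" using \<delta> t by simp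
        show "A n h \<le> max 0 (e - \<kappa>)" if "N \<le> n" "h \<in> H" "L h < \<delta> * t / 2" for n h
          proof -
          have "\<not> e - \<kappa> < A n h" using neg that by blast
          then show ?thesis by simp
        qed
      qed simp
      then have "e \<le> max 0 (e - \<kappa>)" unfolding e_def by (rule cInf_lower[OF _ bddE])
      then have "e \<le> 0" using \<kappa> by (simp add: max_def split: if_splits)
      moreover have "(\<lambda>x. 0) \<in> H" by (auto simp: H_def)
      then have "\<not> e - \<kappa> < A N (\<lambda>x. 0)" using neg \<delta> t Ls(5) by fastforce
      ultimately show False using As(5) \<kappa> by auto
    qed
    then obtain n h where n: "n \<ge> N" and h: "h \<in> H" "L h < \<delta> * t / 2" "e - \<kappa> < A n h" by blast
    have ch: "cm h" and h01: "\<And>x. x \<in> topspace X \<Longrightarrow> 0 \<le> h x \<and> h x \<le> 1" using h by (auto simp: H_def)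
    obtain W where W: "clopenin X W" "\<And>x. x \<in> topspace X \<Longrightarrow> t \<le> h x \<Longrightarrow> x \<in> W" "\<And>x. x \<in> W \<Longrightarrow> t / 2 < h x"
      using clopen_level_set[OF ch, of "t/2" t] t by auto
    have "L (\<lambda>x. (t / 2) * indicator W x) \<le> L h"
      using W(3) h01 by (intro positive_functional_mono[OF L] cm_ops cm_const cm_indicator W(1) ch)
        (auto simp: indicator_def less_imp_le)
    then have "(t / 2) * L (indicator W) < (t / 2) * \<delta>" using Ls(3)[of "indicator W" "t/2"] W(1) h(2) by (simp add: mult.commute)
    then have 1: "L (indicator W) < \<delta>" using t by simp
    have "A n h \<le> A n (\<lambda>x. indicator W x + t * 1)"
    proof (rule positive_functional_mono[OF A ch])
      show "h x \<le> indicator W x + t * 1" if x: "x \<in> topspace X" for x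
      proof (cases "x \<in> W")
        case False
        then have "\<not> t \<le> h x" using W(2)[OF x] by blast
        then show ?thesis using False by simp
      qed (use h01[OF x] t(1) in simp)
    qed (use W in auto)
    also have "\<dots> = A n (indicator W) + t * A n (\<lambda>x. 1)"
      using W(1) As(3)[of "\<lambda>x. 1" n t] by (subst As(1)) auto
    also have "t * A n (\<lambda>x. 1) \<le> t * b'" using A_le[of "\<lambda>x. 1" n] t by (intro mult_left_mono) auto
    finally have "e - 2 * \<kappa> < A n (indicator W)" using h(3) t by linarith
    then show ?thesis using n W(1) 1 by blast
  qed
  \<comment> \<open>Since |\<mu> i| <= 2^i L, the second term gives the next set mass at most
    \<kappa> 2^-(k+1) for all functionals chosen before, as \<open>disjoint_refinement\<close>
    requires. The first term leaves half of \<delta>0 free for \<open>away\<close>.\<close>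
  define \<delta> where "\<delta> k n = min (\<delta>0 / 2) (\<kappa> * (1/2) ^ Suc k / 2 ^ n)" for k n :: nat
  have \<delta>: "\<delta> k n > 0" for k n using \<delta>0 \<kappa> by (simp add: \<delta>_def)
  define P where "P (k::nat) x = (case x of (n, W) \<Rightarrow> n \<ge> N0 \<and> clopenin X W \<and> L (indicator W) < \<delta>0 / 2 \<and>
     e - 2 * \<kappa> < A n (indicator W))" for k x
  define Q where "Q k x y = (case (x, y) of ((n::nat, W::'a set), (n'::nat, W')) \<Rightarrow> n < n' \<and>
     L (indicator W') < \<delta> (Suc k) n)" for k x y
  have "\<exists>F. \<forall>k. P k (F k) \<and> Q k (F k) (F (Suc k))"
  proof (rule dependent_nat_choice)
    show "\<exists>x. P 0 x" using low[of "\<delta>0 / 2" N0] \<delta>0 by (auto simp: P_def)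
    fix x k assume "P k x"
    obtain n W where x: "x = (n, W)" by (metis prod.exhaust)
    obtain n' W' where "n' \<ge> max N0 (Suc n)" "clopenin X W'" "L (indicator W') < \<delta> (Suc k) n"
      "e - 2 * \<kappa> < A n' (indicator W')"
      using low[OF \<delta>[of "Suc k" n], of "max N0 (Suc n)"] by blast
    then have "P (Suc k) (n', W') \<and> Q k x (n', W')" by (auto simp: P_def Q_def x \<delta>_def)
    then show "\<exists>y. P (Suc k) y \<and> Q k x y" by blast
  qed
  then obtain F where F: "\<And>k. P k (F k)" "\<And>k. Q k (F k) (F (Suc k))" by blast
  define n W where "n k = fst (F k)" and "W k = snd (F k)" for k
  have FF: "F k = (n k, W k)" for k by (simp add: n_def W_def)
  have nW: "n k \<ge> N0" "clopenin X (W k)" "L (indicator (W k)) < \<delta>0 / 2" "e - 2 * \<kappa> < A (n k) (indicator (W k))"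
    "n k < n (Suc k)" "L (indicator (W (Suc k))) < \<delta> (Suc k) (n k)" for k
    using F(1)[of k] F(2)[of k] by (auto simp: FF P_def Q_def)
  have n: "strict_mono n" using nW(5) by (simp add: strict_mono_Suc_iff)
  have small: "A (n i) (indicator (W k)) \<le> \<kappa> * (1/2) ^ Suc k" if ik: "i < k" for i k
  proof (cases k)
    case (Suc k')
    have "n i \<le> n k'" using n ik Suc by (simp add: strict_mono_less_eq)
    have L0: "0 \<le> L (indicator (W k))" using nW(2) by (intro positive_functional_nonneg[OF L]) auto
    have "A (n i) (indicator (W k)) \<le> 2 ^ n i * L (indicator (W k))"
      using nW(2) by (intro AL) auto
    also have "\<dots> \<le> 2 ^ n k' * L (indicator (W k))"
      using \<open>n i \<le> n k'\<close> L0 by (intro mult_right_mono power_increasing) auto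
    also have "\<dots> \<le> 2 ^ n k' * (\<kappa> * (1/2) ^ Suc k / 2 ^ n k')"
      using nW(6)[of k'] Suc by (intro mult_left_mono) (auto simp: \<delta>_def)
    finally show ?thesis by simp
  qed (use ik in simp)
  have 1: "A (n k) (indicator (U \<union> U')) = A (n k) (indicator U) + A (n k) (indicator U')"
    if "clopenin X U" "clopenin X U'" "U \<inter> U' = {}" for k U U'
    by (rule positive_functional_indicator_Un[OF A that])
  have 2: "0 \<le> A (n k) (indicator U)" if "clopenin X U" for k U
    using that by (intro positive_functional_nonneg[OF A]) auto
  have 3: "A (n k) (indicator U) \<le> b'" if "clopenin X U" for k U
    using that by (intro A_le) (auto simp: indicator_def)
  have "\<exists>r V. strict_mono (r :: nat \<Rightarrow> nat) \<and> (\<forall>k. clopenin X (V k)) \<and> disjoint_family V \<and>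
     (\<forall>k. V k \<subseteq> W (r k) \<and> A (n (r k)) (indicator (W (r k) - V k)) \<le> 2 * \<kappa>)"
    by (rule disjoint_refinement[of X "\<lambda>k U. A (n k) (indicator U)" b' W \<kappa>]) (fact 1 2 3 nW(2) small \<kappa>)+
  then obtain r :: "nat \<Rightarrow> nat" and V where r: "strict_mono r" and V: "\<And>k. clopenin X (V k)" "disjoint_family V"
    and VW: "\<And>k. V k \<subseteq> W (r k)" and loss: "\<And>k. A (n (r k)) (indicator (W (r k) - V k)) \<le> 2 * \<kappa>"
    by blast
  define R where "R k = n (r k)" for k
  have R: "strict_mono R" unfolding R_def using strict_mono_o[OF n r] by (simp add: o_def)
  have RN: "R k \<ge> N0" for k by (simp add: R_def nW)
  define u :: "nat \<Rightarrow> 'a \<Rightarrow> real" where "u k x = 1 - indicator (V k) x" for k x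
  have u: "cm (u k)" "0 \<le> u k x" "u k x \<le> 1" for k x
    unfolding u_def[abs_def] using V(1) by (intro cm_ops cm_const cm_indicator) (auto simp: indicator_def)
  have LV: "L (indicator (V k)) < \<delta>0 / 2" for k
  proof -
    have "L (indicator (V k)) \<le> L (indicator (W (r k)))"
      using VW[of k] by (intro positive_functional_mono[OF L] cm_indicator V nW) (auto simp: indicator_def)
    then show ?thesis using nW(3)[of "r k"] by linarith
  qed
  have AV: "e - 4 * \<kappa> < A (R k) (indicator (V k))" for k
  proof -
    have "A (R k) (indicator (V k \<union> (W (r k) - V k))) =
        A (R k) (indicator (V k)) + A (R k) (indicator (W (r k) - V k))"
      by (intro positive_functional_indicator_Un[OF A] clopenin_Diff V nW) auto
    moreover have "V k \<union> (W (r k) - V k) = W (r k)" using VW[of k] by auto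
    ultimately have "A (R k) (indicator (W (r k))) = A (R k) (indicator (V k)) + A (R k) (indicator (W (r k) - V k))"
      by simp
    then show ?thesis using nW(4)[of "r k"] loss[of k] by (simp add: R_def)
  qed
  \<comment> \<open>V k alone carries more than e - 4 \<kappa>, with 2 \<kappa> lost in
    \<open>low\<close> and 2 \<kappa> in the refinement. Together with h it still has L-mass below
    \<delta>0 and so carries at most e + \<kappa>. What h carries off V k is therefore at most 5
    \<kappa>.\<close>
  have away: "A (R k) (\<lambda>x. u k x * h x) \<le> 5 * \<kappa>" if h: "h \<in> H" "L h < \<delta>0 / 2" for k h
  proof -
    have ch: "cm h" and h01: "\<And>x. x \<in> topspace X \<Longrightarrow> 0 \<le> h x \<and> h x \<le> 1" using h by (auto simp: H_def)
    have V': "cm (indicator (V k))" using V by auto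
    define h' where "h' x = indicator (V k) x + u k x * h x" for x
    have ch': "cm h'" unfolding h'_def[abs_def] using u V' ch by auto
    have "h' \<in> H" unfolding H_def using ch' h01 by (auto simp: h'_def u_def indicator_def)
    have "L h' \<le> L (\<lambda>x. indicator (V k) x + h x)"
      using h01 by (intro positive_functional_mono[OF L] cm_ops ch' ch V') (auto simp: h'_def u_def indicator_def)
    also have "\<dots> = L (indicator (V k)) + L h" by (rule Ls(1)[OF V' ch])
    finally have "L h' < \<delta>0" using LV[of k] h by linarith
    then have "A (R k) h' \<le> e + \<kappa>" by (intro up RN \<open>h' \<in> H\<close>)
    moreover have "A (R k) h' = A (R k) (indicator (V k)) + A (R k) (\<lambda>x. u k x * h x)"
      unfolding h'_def[abs_def] by (rule As(1)) (use u ch V' in auto)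
    ultimately show ?thesis using AV[of k] by linarith
  qed
  \<comment> \<open>Large enough that m L h < b' + \<kappa> forces L h < \<delta>0 / 2, the range in
    which \<open>away\<close> applies.\<close>
  define m where "m = 2 * (b' + \<kappa> + 1) / \<delta>0"
  have m: "m > 0" using b' \<kappa> \<delta>0 by (simp add: m_def)
  define \<tau> where "\<tau> k g = \<mu> (R k) (\<lambda>x. u k x * g x)" for k g
  have \<tau>lin: "linear_functional X (\<tau> k)" for k
  proof -
    note s = bounded_functional_simps[OF \<mu>]
    have "(\<lambda>x. u k x * (f x + g x)) = (\<lambda>x. u k x * f x + u k x * g x)"
      "(\<lambda>x. u k x * (c * f x)) = (\<lambda>x. c * (u k x * f x))" for f g c
      by (auto simp: algebra_simps)
    then show ?thesis using u unfolding linear_functional_def \<tau>_def by (simp add: s)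
  qed
  \<comment> \<open>\<open>h\<close> nearly maximises \<open>D\<close>, the excess of the mass off V
    k over m L, and so plays the part of the positive set in a Hahn decomposition. On h the mass is
    at most 5 \<kappa> by \<open>away\<close>; beyond h near-maximality bounds it by m L up to
    \<kappa>.\<close>
  have dom01: "A (R k) (\<lambda>x. u k x * g x) \<le> m * L g + 6 * \<kappa>" if g: "g \<in> H" for k g
  proof -
    define D where "D h = A (R k) (\<lambda>x. u k x * h x) - m * L h" for h
    have bdd: "bdd_above (D ` H)"
    proof (rule bdd_aboveI2)
      fix h assume h: "h \<in> H"
      have "A (R k) (\<lambda>x. u k x * h x) \<le> b'"
        using h u by (intro A_le) (auto simp: H_def mult_le_one)
      moreover have "0 \<le> L h" using h by (intro positive_functional_nonneg[OF L]) (auto simp: H_def)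
      ultimately show "D h \<le> b'" unfolding D_def using m by (smt (verit) mult_nonneg_nonneg)
    qed
    have 0: "(\<lambda>x. 0) \<in> H" by (auto simp: H_def)
    then have "\<exists>d\<in>D ` H. Sup (D ` H) - \<kappa> < d"
      using less_cSupD[of "D ` H" "Sup (D ` H) - \<kappa>"] \<kappa> by fastforce
    then obtain h where h: "h \<in> H" and Dh: "Sup (D ` H) - \<kappa> < D h" by blast
    have ch: "cm h" and h01: "\<And>x. x \<in> topspace X \<Longrightarrow> 0 \<le> h x \<and> h x \<le> 1" using h by (auto simp: H_def)
    have cg: "cm g" and g01: "\<And>x. x \<in> topspace X \<Longrightarrow> 0 \<le> g x \<and> g x \<le> 1" using g by (auto simp: H_def)
    have Ah: "A (R k) (\<lambda>x. u k x * h x) \<le> b'"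
      using h u by (intro A_le) (auto simp: H_def mult_le_one)
    have "D (\<lambda>x. 0) \<le> Sup (D ` H)" using 0 by (intro cSup_upper bdd) auto
    then have "m * L h < b' + \<kappa>" using Dh Ah As(5) Ls(5) by (simp add: D_def)
    moreover have "m * (\<delta>0 / 2) = b' + \<kappa> + 1" using \<delta>0 by (simp add: m_def)
    ultimately have "m * L h < m * (\<delta>0 / 2)" by linarith
    then have "L h < \<delta>0 / 2" using m by simp
    then have h5: "A (R k) (\<lambda>x. u k x * h x) \<le> 5 * \<kappa>" by (rule away[OF h])
    define w where "w x = max (g x) (h x) - h x" for x
    have cw: "cm w" unfolding w_def[abs_def] using cg ch by auto
    have "(\<lambda>x. max (g x) (h x)) \<in> H" using cg ch g01 h01 by (auto simp: H_def le_max_iff_disj)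
    then have "D (\<lambda>x. max (g x) (h x)) \<le> Sup (D ` H)" by (intro cSup_upper bdd) auto
    then have "D (\<lambda>x. max (g x) (h x)) \<le> D h + \<kappa>" using Dh by simp
    moreover have "(\<lambda>x. max (g x) (h x)) = (\<lambda>x. w x + h x)" by (simp add: w_def)
    moreover have "(\<lambda>x. u k x * max (g x) (h x)) = (\<lambda>x. u k x * w x + u k x * h x)"
      by (auto simp: w_def algebra_simps)
    ultimately have "A (R k) (\<lambda>x. u k x * w x + u k x * h x) - m * L (\<lambda>x. w x + h x) \<le>
        A (R k) (\<lambda>x. u k x * h x) - m * L h + \<kappa>"
      unfolding D_def by simp
    then have "A (R k) (\<lambda>x. u k x * w x) \<le> m * L w + \<kappa>"
      using cw ch u(1)[of k] by (simp add: As(1) Ls(1) distrib_left)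
    moreover have "m * L w \<le> m * L g"
    proof (intro mult_left_mono positive_functional_mono[OF L] cw cg)
      show "w x \<le> g x" if "x \<in> topspace X" for x
        using g01[OF that] h01[OF that] by (simp add: w_def max_def)
    qed (use m in simp)
    moreover have "A (R k) (\<lambda>x. u k x * g x) \<le> A (R k) (\<lambda>x. u k x * w x + u k x * h x)"
    proof (rule positive_functional_mono[OF A])
      show "u k x * g x \<le> u k x * w x + u k x * h x" for x
        unfolding distrib_left[symmetric] by (intro mult_left_mono u) (simp add: w_def)
    qed (use u cw cg ch in auto)
    moreover have "A (R k) (\<lambda>x. u k x * w x + u k x * h x) = A (R k) (\<lambda>x. u k x * w x) + A (R k) (\<lambda>x. u k x * h x)"
      by (rule As(1)) (use u cw ch in auto)
    ultimately show ?thesis using h5 by linarith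
  qed
  have dom: "\<bar>\<tau> k g\<bar> \<le> m * L (\<lambda>x. \<bar>g x\<bar>) + (6 * \<kappa>) * s"
    if g: "cm g" "0 \<le> s" "\<And>x. x \<in> topspace X \<Longrightarrow> \<bar>g x\<bar> \<le> s" for k g s
  proof -
    have "\<bar>\<tau> k g\<bar> \<le> A (R k) (\<lambda>x. u k x * \<bar>g x\<bar>)"
      unfolding \<tau>_def A_def using g u by (intro modulus_upper[OF \<mu>]) (auto simp: abs_mult)
    also have "\<dots> \<le> m * L (\<lambda>x. \<bar>g x\<bar>) + (6 * \<kappa>) * s"
    proof (cases "s = 0")
      case True
      then have "A (R k) (\<lambda>x. u k x * \<bar>g x\<bar>) = A (R k) (\<lambda>x. 0)" "L (\<lambda>x. \<bar>g x\<bar>) = L (\<lambda>x. 0)"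
        using g u by (auto intro!: positive_functional_cong[OF A] positive_functional_cong[OF L])
      then show ?thesis using As(5) Ls(5) True by simp
    next
      case False
      then have s: "s > 0" using g by simp
      define h where "h x = (1/s) * \<bar>g x\<bar>" for x
      have ch: "cm h" unfolding h_def[abs_def] by (rule cm_ops(3)[OF cm_const]) (use g in auto)
      then have "h \<in> H" unfolding H_def using g(3) s by (auto simp: h_def)
      then have "A (R k) (\<lambda>x. u k x * h x) \<le> m * L h + 6 * \<kappa>" by (rule dom01)
      then have "s * A (R k) (\<lambda>x. u k x * h x) \<le> m * (s * L h) + 6 * \<kappa> * s"
        using mult_left_mono[of _ _ s] s by (fastforce simp: algebra_simps)
      moreover have "s * A (R k) (\<lambda>x. u k x * h x) = A (R k) (\<lambda>x. s * (u k x * h x))"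
        by (rule As(3)[symmetric]) (use u ch in auto)
      moreover have "(\<lambda>x. s * (u k x * h x)) = (\<lambda>x. u k x * \<bar>g x\<bar>)" using s by (auto simp: h_def)
      moreover have "s * L h = L (\<lambda>x. s * h x)" by (rule Ls(3)[symmetric, OF ch])
      moreover have "(\<lambda>x. s * h x) = (\<lambda>x. \<bar>g x\<bar>)" using s by (auto simp: h_def)
      ultimately show ?thesis by simp
    qed
    finally show ?thesis .
  qed
  define PP where "PP k f \<longleftrightarrow> cm f \<and> (\<forall>x\<in>topspace X. \<bar>f x\<bar> \<le> m) \<and>
     (\<forall>g s. cm g \<longrightarrow> 0 \<le> s \<longrightarrow> (\<forall>x\<in>topspace X. \<bar>g x\<bar> \<le> s) \<longrightarrow>
       \<bar>\<tau> k g - L (\<lambda>x. f x * g x)\<bar> \<le> \<epsilon> * s)" for k f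
  have "\<exists>f. PP k f" for k
  proof (rule approximate_density[OF L \<tau>lin[of k] less_imp_le[OF m], of "6 * \<kappa>"])
    show "0 < 6 * \<kappa>" using \<kappa> by simp
    show "\<bar>\<tau> k g\<bar> \<le> m * L (\<lambda>x. \<bar>g x\<bar>) + 6 * \<kappa> * s"
      if "cm g" "0 \<le> s" "\<And>x. x \<in> topspace X \<Longrightarrow> \<bar>g x\<bar> \<le> s" for g s
      by (rule dom[OF that])
    fix f assume f: "cm f" "\<And>x. x \<in> topspace X \<Longrightarrow> \<bar>f x\<bar> \<le> m"
      "\<And>g s. cm g \<Longrightarrow> 0 \<le> s \<Longrightarrow> (\<And>x. x \<in> topspace X \<Longrightarrow> \<bar>g x\<bar> \<le> s) \<Longrightarrow>
        \<bar>\<tau> k g - L (\<lambda>x. f x * g x)\<bar> \<le> 2 * (6 * \<kappa>) * s"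
    have "2 * (6 * \<kappa>) = \<epsilon>" by (simp add: \<kappa>_def)
    then have "PP k f" using f unfolding PP_def by auto
    then show ?thesis by blast
  qed
  then obtain f where "\<And>k. PP k (f k)" by metis
  then have f: "\<And>k. cm (f k)" "\<And>k x. x \<in> topspace X \<Longrightarrow> \<bar>f k x\<bar> \<le> m"
    "\<And>k g s. cm g \<Longrightarrow> 0 \<le> s \<Longrightarrow> (\<And>x. x \<in> topspace X \<Longrightarrow> \<bar>g x\<bar> \<le> s) \<Longrightarrow>
      \<bar>\<tau> k g - L (\<lambda>x. f k x * g x)\<bar> \<le> \<epsilon> * s"
    by (auto simp: PP_def)
  have "\<exists>q. strict_mono (q :: nat \<Rightarrow> nat) \<and> (\<forall>y. cm y \<longrightarrow> convergent (\<lambda>k. L (\<lambda>x. f (q k) x * y x)))"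
  proof (rule weak_subsequence[OF L, of f m])
    fix q :: "nat \<Rightarrow> nat"
    assume "strict_mono q" "\<And>y. cm y \<Longrightarrow> convergent (\<lambda>k. L (\<lambda>x. f (q k) x * y x))"
    then show ?thesis by blast
  qed (use f(1,2) m in auto)
  then obtain q where q: "strict_mono q" "\<And>y. cm y \<Longrightarrow> convergent (\<lambda>k. L (\<lambda>x. f (q k) x * y x))"
    by blast
  have "\<bar>\<mu> (R (q k)) g - \<mu> (R (q k)) (\<lambda>x. indicator (V (q k)) x * g x) - L (\<lambda>x. f (q k) x * g x)\<bar> \<le> \<epsilon> * s"
    if g: "cm g" "0 \<le> s" "\<And>x. x \<in> topspace X \<Longrightarrow> \<bar>g x\<bar> \<le> s" for k g s
  proof -
    have "\<tau> (q k) g = \<mu> (R (q k)) (\<lambda>x. g x - indicator (V (q k)) x * g x)"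
      by (simp add: \<tau>_def u_def algebra_simps)
    also have "\<dots> = \<mu> (R (q k)) g - \<mu> (R (q k)) (\<lambda>x. indicator (V (q k)) x * g x)"
      using bounded_functional_simps(2)[OF \<mu>] g(1) V(1) by auto
    finally show ?thesis using f(3)[OF g, of "q k"] by simp
  qed
  moreover have "strict_mono (\<lambda>k. R (q k))" using strict_mono_o[OF R q(1)] by (simp add: o_def)
  moreover have "disjoint_family (\<lambda>k. V (q k))"
    using V(2) strict_mono_eq[OF q(1)] unfolding disjoint_family_on_def by simp
  ultimately show thesis
    using that[of "\<lambda>k. R (q k)" "\<lambda>k. V (q k)" L m "\<lambda>k. f (q k)"] V(1) L less_imp_le[OF m] f(1,2) q(2)
    by simp
qed

end


section \<open>Signed measures\<close>

lemma borel_sets_sigma_algebra: "sigma_algebra (topspace X) (borel_sets X)"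
  unfolding borel_sets_def by (rule sigma_algebra_sigma_sets) (auto dest: openin_subset)

lemma openin_borel_sets: "openin X U \<Longrightarrow> U \<in> borel_sets X"
  unfolding borel_sets_def by (rule sigma_sets.Basic) simp

lemma clopenin_borel_sets: "clopenin X U \<Longrightarrow> U \<in> borel_sets X"
  by (simp add: clopenin_def openin_borel_sets)

lemma closedin_borel_sets:
  assumes "closedin X C" shows "C \<in> borel_sets X"
proof -
  interpret sigma_algebra "topspace X" "borel_sets X" by (rule borel_sets_sigma_algebra)
  have "topspace X - (topspace X - C) \<in> borel_sets X"
    using assms by (intro compl_sets openin_borel_sets) auto
  then show ?thesis using closedin_subset[OF assms] by (simp add: double_diff)
qed

definition signed_measure :: "'a topology \<Rightarrow> 'a measure \<Rightarrow> 'a measure \<Rightarrow> 'a set \<Rightarrow> real" where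
  "signed_measure X M N A = (if A \<in> borel_sets X then measure M A - measure N A else 0)"

text \<open>M and N may overlap, so M + N bounds the variation of M - N only from above; lower
  bounds come from explicit partitions.\<close>

locale signed_pair = M: finite_measure M + N: finite_measure N
  for X :: "'a topology" and M N :: "'a measure" +
  assumes sets_M: "sets M = borel_sets X" and sets_N: "sets N = borel_sets X"
begin

sublocale B: sigma_algebra "topspace X" "borel_sets X" by (rule borel_sets_sigma_algebra)

abbreviation \<kappa> :: "'a set \<Rightarrow> real" where "\<kappa> \<equiv> signed_measure X M N"

lemma \<kappa>_eq: "A \<in> borel_sets X \<Longrightarrow> \<kappa> A = measure M A - measure N A"
  by (simp add: signed_measure_def)

lemma \<kappa>_Un: 
  assumes "A \<in> borel_sets X" "B \<in> borel_sets X" "A \<inter> B = {}"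
  shows "\<kappa> (A \<union> B) = \<kappa> A + \<kappa> B"
  using assms M.finite_measure_Union[of A B] N.finite_measure_Union[of A B]
  by (simp add: \<kappa>_eq sets_M sets_N B.Un)

lemma \<kappa>_sums:
  assumes "range A \<subseteq> borel_sets X" "disjoint_family A"
  shows "(\<lambda>n. \<kappa> (A n)) sums \<kappa> (\<Union>n. A n)"
proof -
  have "(\<lambda>n. measure M (A n) - measure N (A n)) sums (measure M (\<Union>n. A n) - measure N (\<Union>n. A n))"
    using assms by (intro sums_diff M.finite_measure_UNION N.finite_measure_UNION) (auto simp: sets_M sets_N)
  moreover have "(\<Union>n. A n) \<in> borel_sets X" using assms(1) by auto
  ultimately show ?thesis using assms(1) by (simp add: \<kappa>_eq range_subsetD)
qed

lemma variation_sum_le: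
  assumes "finite P" "P \<subseteq> borel_sets X" "disjoint P"
  shows "(\<Sum>B\<in>P. \<bar>\<kappa> B\<bar>) \<le> measure M (\<Union>P) + measure N (\<Union>P)"
proof -
  have "(\<Sum>B\<in>P. \<bar>\<kappa> B\<bar>) \<le> (\<Sum>B\<in>P. measure M B + measure N B)"
    using assms by (intro sum_mono) (auto simp: \<kappa>_eq abs_if subset_iff)
  also have "\<dots> = measure M (\<Union>P) + measure N (\<Union>P)"
    using M.finite_measure_finite_Union[of P "\<lambda>B. B"] N.finite_measure_finite_Union[of P "\<lambda>B. B"] assms
    by (simp add: sum.distrib sets_M sets_N disjoint_family_on_def disjoint_def)
  finally show ?thesis .
qed

lemma total_variation_le:
  assumes "A \<in> borel_sets X" shows "total_variation X \<kappa> A \<le> measure M A + measure N A"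
  unfolding total_variation_def
proof (rule cSup_least)
  show "{(\<Sum>B\<in>P. \<bar>\<kappa> B\<bar>) |P. finite P \<and> P \<subseteq> borel_sets X \<and> disjoint P \<and> \<Union>P = A} \<noteq> {}"
    using assms by (auto intro!: exI[of _ "{A}"])
qed (use variation_sum_le in auto)

lemma total_variation_ge:
  assumes "A \<in> borel_sets X" "B \<in> borel_sets X"
  shows "\<kappa> (A \<inter> B) - \<kappa> (A - B) \<le> total_variation X \<kappa> A"
\<comment> \<open>If the two pieces coincide they are empty, and the set consisting of them has one
  element, so the sum over it would not have two terms. This happens only for A = {}.\<close>
proof (cases "A \<inter> B = A - B")
  case True
  then have "A = {}" by auto
  then have "total_variation X \<kappa> A = Sup {(\<Sum>B\<in>P. \<bar>\<kappa> B\<bar>) |P. finite P \<and> P \<subseteq> borel_sets X \<and> disjoint P \<and> \<Union>P = {}}"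
    by (simp add: total_variation_def)
  have "(\<Sum>B\<in>{{}}. \<bar>\<kappa> B\<bar>) \<le> total_variation X \<kappa> A"
    unfolding total_variation_def
  proof (rule cSup_upper)
    show "(\<Sum>B\<in>{{}}. \<bar>\<kappa> B\<bar>) \<in> {(\<Sum>B\<in>P. \<bar>\<kappa> B\<bar>) |P. finite P \<and> P \<subseteq> borel_sets X \<and> disjoint P \<and> \<Union>P = A}"
      using \<open>A = {}\<close> by (intro CollectI exI[of _ "{{}}"]) auto
    show "bdd_above {(\<Sum>B\<in>P. \<bar>\<kappa> B\<bar>) |P. finite P \<and> P \<subseteq> borel_sets X \<and> disjoint P \<and> \<Union>P = A}"
      using variation_sum_le by (intro bdd_aboveI[of _ "measure M A + measure N A"]) auto
  qed
  then show ?thesis using \<open>A = {}\<close> by simp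
next
  case False
  have "(\<Sum>B\<in>{A \<inter> B, A - B}. \<bar>\<kappa> B\<bar>) \<le> total_variation X \<kappa> A"
    unfolding total_variation_def
  proof (rule cSup_upper)
    show "(\<Sum>B\<in>{A \<inter> B, A - B}. \<bar>\<kappa> B\<bar>) \<in> {(\<Sum>B\<in>P. \<bar>\<kappa> B\<bar>) |P. finite P \<and> P \<subseteq> borel_sets X \<and> disjoint P \<and> \<Union>P = A}"
      using assms by (intro CollectI exI[of _ "{A \<inter> B, A - B}"]) (auto simp: disjoint_def)
    show "bdd_above {(\<Sum>B\<in>P. \<bar>\<kappa> B\<bar>) |P. finite P \<and> P \<subseteq> borel_sets X \<and> disjoint P \<and> \<Union>P = A}"
      using variation_sum_le by (intro bdd_aboveI[of _ "measure M A + measure N A"]) auto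
  qed
  then show ?thesis using False by simp
qed

lemma pos_part_ge:
  assumes "A \<in> borel_sets X" "B \<in> borel_sets X" "B \<subseteq> A"
  shows "\<kappa> B \<le> pos_part X \<kappa> A"
proof -
  have "\<kappa> B \<le> Sup {\<kappa> B |B. B \<in> borel_sets X \<and> B \<subseteq> A}"
  proof (rule cSup_upper)
    have "\<kappa> B \<le> measure M (space M)" if "B \<in> borel_sets X" for B
      using that M.bounded_measure[of B] measure_nonneg[of N B] by (simp add: \<kappa>_eq del: measure_nonneg)
    then show "bdd_above {\<kappa> B |B. B \<in> borel_sets X \<and> B \<subseteq> A}" by (intro bdd_aboveI[of _ "measure M (space M)"]) auto
  qed (use assms in auto)
  then show ?thesis using assms by (simp add: pos_part_def)
qed

lemma pos_part_bounds:
  assumes "A \<in> borel_sets X" shows "0 \<le> pos_part X \<kappa> A" "pos_part X \<kappa> A \<le> measure M A"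
proof -
  have "\<kappa> {} \<le> pos_part X \<kappa> A" using assms by (intro pos_part_ge) auto
  then show "0 \<le> pos_part X \<kappa> A" by (simp add: \<kappa>_eq)
  have "Sup {\<kappa> B |B. B \<in> borel_sets X \<and> B \<subseteq> A} \<le> measure M A"
  proof (rule cSup_least)
    show "{\<kappa> B |B. B \<in> borel_sets X \<and> B \<subseteq> A} \<noteq> {}" using assms by auto
    fix y assume "y \<in> {\<kappa> B |B. B \<in> borel_sets X \<and> B \<subseteq> A}"
    then obtain B where B: "B \<in> borel_sets X" "B \<subseteq> A" "y = \<kappa> B" by blast
    then have "measure M B \<le> measure M A" using assms by (intro M.finite_measure_mono) (auto simp: sets_M)
    then show "y \<le> measure M A" using B measure_nonneg[of N B] by (simp add: \<kappa>_eq del: measure_nonneg)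
  qed
  then show "pos_part X \<kappa> A \<le> measure M A" using assms by (simp add: pos_part_def)
qed

lemma mnorm_pos_part_ge:
  assumes "B \<in> borel_sets X" shows "\<kappa> B \<le> mnorm X (pos_part X \<kappa>)"
proof -
  have "\<kappa> B \<le> pos_part X \<kappa> (topspace X)" using assms B.sets_into_space by (intro pos_part_ge) auto
  also have "\<dots> \<le> (\<Sum>B\<in>{topspace X}. \<bar>pos_part X \<kappa> B\<bar>)" by simp
  also have "\<dots> \<le> mnorm X (pos_part X \<kappa>)"
    unfolding mnorm_def total_variation_def
  proof (rule cSup_upper)
    let ?S = "{(\<Sum>B\<in>P. \<bar>pos_part X \<kappa> B\<bar>) |P. finite P \<and> P \<subseteq> borel_sets X \<and> disjoint P \<and> \<Union>P = topspace X}"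
    show "(\<Sum>B\<in>{topspace X}. \<bar>pos_part X \<kappa> B\<bar>) \<in> ?S" by (intro CollectI exI[of _ "{topspace X}"]) auto
    show "bdd_above ?S"
    proof (rule bdd_aboveI, clarify)
      fix P assume P: "finite P" "P \<subseteq> borel_sets X" "disjoint P" "\<Union>P = topspace X"
      have "(\<Sum>B\<in>P. \<bar>pos_part X \<kappa> B\<bar>) \<le> (\<Sum>B\<in>P. measure M B)"
        using P pos_part_bounds by (intro sum_mono) (auto simp: subset_iff)
      also have "\<dots> = measure M (\<Union>P)"
        using M.finite_measure_finite_Union[of P "\<lambda>B. B"] P
        by (simp add: sets_M disjoint_family_on_def disjoint_def)
      finally show "(\<Sum>B\<in>P. \<bar>pos_part X \<kappa> B\<bar>) \<le> measure M (topspace X)" using P by simp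
    qed
  qed
  finally show ?thesis .
qed

lemma pos_part_Hahn:
  assumes Y: "Y \<in> borel_sets X" "\<And>A. A \<in> borel_sets X \<Longrightarrow> A \<subseteq> Y \<Longrightarrow> 0 \<le> \<kappa> A"
    "\<And>A. A \<in> borel_sets X \<Longrightarrow> A \<inter> Y = {} \<Longrightarrow> \<kappa> A \<le> 0" and A: "A \<in> borel_sets X"
  shows "pos_part X \<kappa> A = \<kappa> (A \<inter> Y)"
proof (rule antisym)
  have "Sup {\<kappa> B |B. B \<in> borel_sets X \<and> B \<subseteq> A} \<le> \<kappa> (A \<inter> Y)"
  proof (rule cSup_least)
    show "{\<kappa> B |B. B \<in> borel_sets X \<and> B \<subseteq> A} \<noteq> {}" using A by auto
    fix y assume "y \<in> {\<kappa> B |B. B \<in> borel_sets X \<and> B \<subseteq> A}"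
    then obtain B where B: "B \<in> borel_sets X" "B \<subseteq> A" "y = \<kappa> B" by blast
    have "\<kappa> B = \<kappa> ((B \<inter> Y) \<union> (B - Y))" by (simp add: Int_Diff_Un)
    also have "\<dots> = \<kappa> (B \<inter> Y) + \<kappa> (B - Y)" using B Y by (intro \<kappa>_Un) auto
    also have "\<kappa> (B - Y) \<le> 0" using B Y by (intro Y) auto
    finally have 1: "\<kappa> B \<le> \<kappa> (B \<inter> Y)" by simp
    have "\<kappa> (A \<inter> Y) = \<kappa> ((B \<inter> Y) \<union> (A \<inter> Y - B))" using B by (intro arg_cong[of _ _ \<kappa>]) auto
    also have "\<dots> = \<kappa> (B \<inter> Y) + \<kappa> (A \<inter> Y - B)" using A B Y by (intro \<kappa>_Un) auto
    finally have 2: "\<kappa> (A \<inter> Y) = \<kappa> (B \<inter> Y) + \<kappa> (A \<inter> Y - B)" .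
    have "0 \<le> \<kappa> (A \<inter> Y - B)" using A B Y by (intro Y) auto
    then show "y \<le> \<kappa> (A \<inter> Y)" using 1 2 B by simp
  qed
  then show "pos_part X \<kappa> A \<le> \<kappa> (A \<inter> Y)" using A by (simp add: pos_part_def)
  show "\<kappa> (A \<inter> Y) \<le> pos_part X \<kappa> A" using A Y by (intro pos_part_ge) auto
qed

text \<open>\<open>measure_of\<close> yields the intended measure only for a countably additive set
  function. The positive part, defined as a supremum, must therefore first be recognised through the
  Hahn set Y as the map from A to \<kappa> (A \<inter> Y).\<close>

lemma integral_pos_part:
  assumes Y: "Y \<in> borel_sets X" "\<And>A. A \<in> borel_sets X \<Longrightarrow> A \<subseteq> Y \<Longrightarrow> 0 \<le> \<kappa> A"
    "\<And>A. A \<in> borel_sets X \<Longrightarrow> A \<inter> Y = {} \<Longrightarrow> \<kappa> A \<le> 0" and C: "C \<in> borel_sets X"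
  shows "integral\<^sup>L (measure_of (topspace X) (borel_sets X) (\<lambda>A. ennreal (pos_part X \<kappa> A))) (restrict (indicator C) (topspace X))
     = \<kappa> (C \<inter> Y)"
proof -
  have PH: "pos_part X \<kappa> A = \<kappa> (A \<inter> Y)" if "A \<in> borel_sets X" for A
    by (rule pos_part_Hahn[OF Y(1) _ _ that]) (fact Y(2,3))+
  let ?\<mu> = "\<lambda>A. ennreal (pos_part X \<kappa> A)"
  let ?P = "measure_of (topspace X) (borel_sets X) ?\<mu>"
  have sub: "borel_sets X \<subseteq> Pow (topspace X)" by (rule B.space_closed)
  have spP: "space ?P = topspace X" by (simp add: space_measure_of[OF sub])
  have em: "emeasure ?P A = ?\<mu> A" if A: "A \<in> borel_sets X" for A
  proof (rule emeasure_measure_of_sigma[OF borel_sets_sigma_algebra _ _ A])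
    show "positive (borel_sets X) ?\<mu>"
      unfolding positive_def using PH[of "{}"] by (simp add: \<kappa>_eq)
    show "countably_additive (borel_sets X) ?\<mu>"
    proof (rule countably_additiveI)
      fix F :: "nat \<Rightarrow> 'a set" assume F: "range F \<subseteq> borel_sets X" "disjoint_family F" "(\<Union>i. F i) \<in> borel_sets X"
      have Fi: "F i \<in> borel_sets X" for i using F(1) by auto
      have "(\<lambda>n. \<kappa> (F n \<inter> Y)) sums \<kappa> (\<Union>n. F n \<inter> Y)"
      proof (rule \<kappa>_sums)
        show "range (\<lambda>n. F n \<inter> Y) \<subseteq> borel_sets X" using Fi Y(1) by blast
        show "disjoint_family (\<lambda>n. F n \<inter> Y)" using F(2) unfolding disjoint_family_on_def by blast
      qed
      moreover have "(\<Union>n. F n \<inter> Y) = (\<Union>n. F n) \<inter> Y" by blast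
      ultimately have "(\<lambda>n. pos_part X \<kappa> (F n)) sums pos_part X \<kappa> (\<Union>n. F n)"
        unfolding PH[OF Fi] PH[OF F(3)] by simp
      then show "(\<Sum>i. ?\<mu> (F i)) = ?\<mu> (\<Union>i. F i)"
        by (intro suminf_ennreal_eq pos_part_bounds Fi)
    qed
  qed
  have "integral\<^sup>L ?P (restrict (indicator C) (topspace X)) = integral\<^sup>L ?P (indicator C)"
    by (rule Bochner_Integration.integral_cong) (auto simp: spP)
  also have "\<dots> = measure ?P (C \<inter> space ?P)" by (rule Bochner_Integration.integral_indicator)
  also have "C \<inter> space ?P = C" using C sub by (auto simp: spP)
  also have "measure ?P C = pos_part X \<kappa> C" using em[OF C] pos_part_bounds[OF C] by (simp add: measure_def)
  also have "\<dots> = \<kappa> (C \<inter> Y)" by (rule PH[OF C])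
  finally show ?thesis .
qed

lemma swap: "signed_pair X N M"
  by (simp add: signed_pair_def signed_pair_axioms_def sets_M sets_N M.finite_measure_axioms N.finite_measure_axioms)

lemma uminus_\<kappa>: "(\<lambda>A. - \<kappa> A) = signed_measure X N M"
  by (rule ext) (simp add: signed_measure_def)

text \<open>Through this (F), which speaks of integrals of continuous functions, becomes a statement
  about values on clopen sets. The indicator is restricted to the space because the members of
  \<open>Cont\<close> are extensional.\<close>

lemma signed_integral_indicator:
  assumes C: "C \<in> borel_sets X"
  shows "signed_integral X \<kappa> (restrict (indicator C) (topspace X)) = \<kappa> C"
proof -
  have "\<exists>Y\<in>sets M. (\<forall>A\<in>sets M. A \<subseteq> Y \<longrightarrow> N A \<le> M A) \<and> (\<forall>A\<in>sets M. A \<inter> Y = {} \<longrightarrow> M A \<le> N A)"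
    by (rule finite_unsigned_Hahn_decomposition[OF M.finite_measure_axioms N.finite_measure_axioms])
      (simp add: sets_M sets_N)
  then obtain Y where Y0: "Y \<in> sets M" "\<forall>A\<in>sets M. A \<subseteq> Y \<longrightarrow> N A \<le> M A"
    "\<forall>A\<in>sets M. A \<inter> Y = {} \<longrightarrow> M A \<le> N A" by (elim bexE conjE)
  have Y: "Y \<in> borel_sets X" using Y0(1) by (simp only: sets_M)
  have Y2: "0 \<le> \<kappa> A" if "A \<in> borel_sets X" "A \<subseteq> Y" for A
    using Y0(2) that by (simp add: sets_M \<kappa>_eq M.emeasure_eq_measure N.emeasure_eq_measure)
  have Y3: "\<kappa> A \<le> 0" if "A \<in> borel_sets X" "A \<inter> Y = {}" for A
    using Y0(3) that by (simp add: sets_M \<kappa>_eq M.emeasure_eq_measure N.emeasure_eq_measure)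
  \<comment> \<open>The negative part is the positive part for the exchanged pair, with the
    complement of Y as Hahn set.\<close>
  interpret S: signed_pair X N M by (rule swap)
  have sw: "signed_measure X N M A = - \<kappa> A" for A by (simp add: signed_measure_def)
  have pos: "integral\<^sup>L (measure_of (topspace X) (borel_sets X) (\<lambda>A. ennreal (pos_part X \<kappa> A)))
      (restrict (indicator C) (topspace X)) = \<kappa> (C \<inter> Y)"
    by (rule integral_pos_part[OF Y _ _ C]) (fact Y2 Y3)+
  have neg: "integral\<^sup>L (measure_of (topspace X) (borel_sets X) (\<lambda>A. ennreal (pos_part X (signed_measure X N M) A)))
      (restrict (indicator C) (topspace X)) = signed_measure X N M (C \<inter> (topspace X - Y))"
  proof (rule S.integral_pos_part[OF _ _ _ C])
    show "topspace X - Y \<in> borel_sets X" by (rule B.compl_sets[OF Y])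
    show "0 \<le> signed_measure X N M A" if A: "A \<in> borel_sets X" "A \<subseteq> topspace X - Y" for A
    proof -
      have "A \<inter> Y = {}" using A(2) by blast
      from Y3[OF A(1) this] show ?thesis unfolding sw by simp
    qed
    show "signed_measure X N M A \<le> 0" if A: "A \<in> borel_sets X" "A \<inter> (topspace X - Y) = {}" for A
    proof -
      have "A \<subseteq> Y" using A B.sets_into_space by blast
      from Y2[OF A(1) this] show ?thesis unfolding sw by simp
    qed
  qed
  have "signed_integral X \<kappa> (restrict (indicator C) (topspace X)) =
      \<kappa> (C \<inter> Y) - signed_measure X N M (C \<inter> (topspace X - Y))"
    unfolding signed_integral_def neg_part_def uminus_\<kappa> pos neg ..
  also have "\<dots> = \<kappa> (C \<inter> Y) + \<kappa> (C \<inter> (topspace X - Y))" by (simp add: sw)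
  also have "\<dots> = \<kappa> ((C \<inter> Y) \<union> (C \<inter> (topspace X - Y)))"
    using C Y by (intro \<kappa>_Un[symmetric]) auto
  also have "(C \<inter> Y) \<union> (C \<inter> (topspace X - Y)) = C" using C B.sets_into_space by auto
  finally show ?thesis .
qed

end

section \<open>Measures on second countable Boolean spaces\<close>

locale countable_stone_space = stone_space +
  assumes Hausdorff: "Hausdorff_space X"
    and countable_clopen_base: "\<exists>\<B>. countable \<B> \<and> (\<forall>B\<in>\<B>. clopenin X B) \<and>
      (\<forall>U x. openin X U \<longrightarrow> x \<in> U \<longrightarrow> (\<exists>B\<in>\<B>. x \<in> B \<and> B \<subseteq> U))"
begin

lemma open_as_clopen_union:
  assumes "openin X U"
  obtains D :: "nat \<Rightarrow> 'a set" where "\<And>n. clopenin X (D n)" "U = (\<Union>n. D n)" "incseq D"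
proof -
  obtain \<B> where \<B>: "countable \<B>" "\<And>B. B \<in> \<B> \<Longrightarrow> clopenin X B"
    "\<And>U x. openin X U \<Longrightarrow> x \<in> U \<Longrightarrow> \<exists>B\<in>\<B>. x \<in> B \<and> B \<subseteq> U" using countable_clopen_base by metis
  define \<C> where "\<C> = insert {} {B \<in> \<B>. B \<subseteq> U}"
  have "countable \<C>" "\<C> \<noteq> {}" using \<B>(1) by (auto simp: \<C>_def)
  then obtain c :: "nat \<Rightarrow> 'a set" where c: "range c = \<C>" by (metis uncountable_def)
  have cc: "clopenin X (c n)" for n
  proof -
    have "c n \<in> \<C>" using c by auto
    then show ?thesis using \<B>(2) by (auto simp: \<C>_def)
  qed
  have "\<Union>\<C> = U"
  proof
    show "U \<subseteq> \<Union>\<C>"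
    proof
      fix x assume "x \<in> U"
      then obtain B where "B \<in> \<B>" "x \<in> B" "B \<subseteq> U" using \<B>(3)[OF assms] by blast
      then show "x \<in> \<Union>\<C>" by (auto simp: \<C>_def)
    qed
  qed (auto simp: \<C>_def)
  then have U: "(\<Union>n. c n) = U" using c by simp
  show thesis
  proof (rule that[of "\<lambda>n. \<Union>i\<in>{..n}. c i"])
    show "clopenin X (\<Union>i\<in>{..n}. c i)" for n by (rule clopenin_Union_finite) (use cc in auto)
    show "incseq (\<lambda>n. \<Union>i\<in>{..n}. c i)" unfolding incseq_def by (intro allI impI UN_mono) auto
    show "U = (\<Union>n. \<Union>i\<in>{..n}. c i)" unfolding U[symmetric] by auto
  qed
qed

lemma borel_sets_clopen: "borel_sets X = sigma_sets (topspace X) {C. clopenin X C}"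
  unfolding borel_sets_def
proof (rule sigma_sets_eqI)
  fix U assume "U \<in> {U. openin X U}"
  then obtain D :: "nat \<Rightarrow> 'a set" where D: "\<And>n. clopenin X (D n)" "U = (\<Union>n. D n)"
    using open_as_clopen_union by blast
  then show "U \<in> sigma_sets (topspace X) {C. clopenin X C}"
    unfolding D(2) by (intro sigma_sets.Union sigma_sets.Basic) (simp add: D)
qed (auto simp: clopenin_def intro: sigma_sets.Basic)

lemma clopen_algebra: "algebra (topspace X) {C. clopenin X C}"
  unfolding algebra_iff_Un by (auto dest: clopenin_subset)

text \<open>Continuity at the empty set, the hypothesis of Caratheodory's theorem, comes for free:
  by compactness a decreasing sequence of clopen sets with empty intersection is eventually
  empty.\<close>

lemma measure_extension:
  assumes a_add: "\<And>A B. clopenin X A \<Longrightarrow> clopenin X B \<Longrightarrow> A \<inter> B = {} \<Longrightarrow> a (A \<union> B) = a A + a B"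
    and a_nonneg: "\<And>A. clopenin X A \<Longrightarrow> 0 \<le> a A"
  obtains M where "finite_measure M" "sets M = borel_sets X" "\<And>C. clopenin X C \<Longrightarrow> measure M C = a C"
proof -
  interpret A: algebra "topspace X" "{C. clopenin X C}" by (rule clopen_algebra)
  have a0: "a {} = 0" using a_add[of "{}" "{}"] by simp
  have "\<exists>\<mu> :: 'a set \<Rightarrow> ennreal. (\<forall>s \<in> {C. clopenin X C}. \<mu> s = ennreal (a s)) \<and>
    measure_space (topspace X) (sigma_sets (topspace X) {C. clopenin X C}) \<mu>"
  proof (rule A.caratheodory_empty_continuous)
    show "positive {C. clopenin X C} (\<lambda>s. ennreal (a s))" by (simp add: positive_def a0)
    show "Measure_Space.additive {C. clopenin X C} (\<lambda>s. ennreal (a s))"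
      unfolding Measure_Space.additive_def
    proof (intro ballI impI)
      fix A B assume "A \<in> {C. clopenin X C}" "B \<in> {C. clopenin X C}" "A \<inter> B = {}"
      then show "ennreal (a (A \<union> B)) = ennreal (a A) + ennreal (a B)"
        using a_add[of A B] a_nonneg[of A] a_nonneg[of B] by (simp add: ennreal_plus)
    qed
    fix A :: "nat \<Rightarrow> 'a set"
    assume A: "range A \<subseteq> {C. clopenin X C}" "decseq A" "(\<Inter>i. A i) = {}"
    have "\<exists>n. A n = {}"
    proof (rule ccontr)
      assume "\<nexists>n. A n = {}"
      then have "(\<Inter>n. A n) \<noteq> {}"
        using A by (intro compact_space_imp_nest[OF compact]) (auto simp: clopenin_def decseq_def)
      then show False using A by simp
    qed
    then obtain n where n: "A n = {}" by blast
    then have "\<forall>m\<ge>n. A m = {}" using A(2) by (auto simp: decseq_def)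
    then have "\<forall>\<^sub>F m in sequentially. ennreal (a (A m)) = 0"
      unfolding eventually_sequentially by (intro exI[of _ n]) (auto simp: a0)
    then show "(\<lambda>i. ennreal (a (A i))) \<longlonglongrightarrow> 0" by (rule tendsto_eventually)
  qed auto
  then obtain \<mu> :: "'a set \<Rightarrow> ennreal" where \<mu>: "\<And>C. clopenin X C \<Longrightarrow> \<mu> C = ennreal (a C)"
    "measure_space (topspace X) (borel_sets X) \<mu>" unfolding borel_sets_clopen[symmetric] by blast
  define M where "M = measure_of (topspace X) (borel_sets X) \<mu>"
  interpret B: sigma_algebra "topspace X" "borel_sets X" by (rule borel_sets_sigma_algebra)
  have sets: "sets M = borel_sets X" by (simp add: M_def sets_measure_of[OF B.space_closed] B.sigma_sets_eq)
  have space: "space M = topspace X" by (simp add: M_def space_measure_of[OF B.space_closed])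
  have em: "emeasure M A = \<mu> A" if "A \<in> borel_sets X" for A
    unfolding M_def using \<mu>(2) that
    by (intro emeasure_measure_of_sigma[OF borel_sets_sigma_algebra]) (auto simp: measure_space_def)
  show thesis
  proof (rule that)
    show "finite_measure M"
      by (rule finite_measureI) (simp add: space em \<mu>(1))
    show "sets M = borel_sets X" by (rule sets)
    show "measure M C = a C" if "clopenin X C" for C
      using em[OF clopenin_borel_sets[OF that]] \<mu>(1)[OF that] a_nonneg[OF that] by (simp add: measure_def)
  qed
qed

lemma measure_eq_of_clopen_eq:
  assumes "finite_measure M" "finite_measure N" "sets M = borel_sets X" "sets N = borel_sets X"
    and eq: "\<And>C. clopenin X C \<Longrightarrow> measure M C = measure N C"
  shows "M = N"
proof (rule measure_eqI_generator_eq[of "{C. clopenin X C}" "topspace X" M N "\<lambda>_. topspace X"])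
  interpret M: finite_measure M by fact
  interpret N: finite_measure N by fact
  show "Int_stable {C. clopenin X C}" by (auto simp: Int_stable_def)
  show "{C. clopenin X C} \<subseteq> Pow (topspace X)" by (auto dest: clopenin_subset)
  show "emeasure M C = emeasure N C" if "C \<in> {C. clopenin X C}" for C
    using that eq by (simp add: M.emeasure_eq_measure N.emeasure_eq_measure)
  show "emeasure M (topspace X) \<noteq> \<infinity>" for i :: nat by simp
qed (use assms borel_sets_clopen in auto)

lemma inner_regular_finite_measure:
  assumes "finite_measure M" "sets M = borel_sets X" "A \<in> borel_sets X" "0 < \<epsilon>"
  obtains C where "closedin X C" "C \<subseteq> A" "measure M (A - C) < \<epsilon>"
proof -
  interpret M: finite_measure M by fact
  interpret B: sigma_algebra "topspace X" "borel_sets X" by (rule borel_sets_sigma_algebra)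
  note [simp] = assms(2)
  \<comment> \<open>Approximation from inside alone does not pass to complements, so the induction
    carries an open superset as well.\<close>
  have "\<forall>\<epsilon>>0. \<exists>C U. closedin X C \<and> openin X U \<and> C \<subseteq> A \<and> A \<subseteq> U \<and> measure M (U - C) < \<epsilon>"
    using assms(3) unfolding borel_sets_def
  proof (induction rule: sigma_sets.induct)
    case (Basic U)
    then have U: "openin X U" by simp
    obtain D :: "nat \<Rightarrow> 'a set" where D: "\<And>n. clopenin X (D n)" "U = (\<Union>n. D n)" "incseq D"
      using open_as_clopen_union[OF U] by blast
    show ?case
    proof (intro allI impI)
      fix \<epsilon> :: real assume "\<epsilon> > 0"
      have "(\<lambda>n. measure M (D n)) \<longlonglongrightarrow> measure M (\<Union>n. D n)"
        using D clopenin_borel_sets by (intro M.finite_Lim_measure_incseq) auto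
      then have "\<forall>\<^sub>F n in sequentially. measure M U - \<epsilon> < measure M (D n)"
        using \<open>\<epsilon> > 0\<close> D(2) by (intro order_tendstoD(1)[of _ "measure M U"]) auto
      then obtain n where n: "measure M U - \<epsilon> < measure M (D n)" by (auto simp: eventually_sequentially)
      have "D n \<subseteq> U" using D by auto
      then have "measure M (U - D n) = measure M U - measure M (D n)"
        using D(1) U clopenin_borel_sets openin_borel_sets by (intro M.finite_measure_Diff) auto
      then show "\<exists>C V. closedin X C \<and> openin X V \<and> C \<subseteq> U \<and> U \<subseteq> V \<and> measure M (V - C) < \<epsilon>"
        using n U D \<open>D n \<subseteq> U\<close> by (intro exI[of _ "D n"] exI[of _ U]) (auto simp: clopenin_def)
    qed
  next
    case Empty
    show ?case by (intro allI impI, rule exI[of _ "{}"], rule exI[of _ "{}"]) simp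
  next
    case (Compl A)
    show ?case
    proof (intro allI impI)
      fix \<epsilon> :: real assume "\<epsilon> > 0"
      from Compl.IH[rule_format, OF this]
      obtain C U where CU: "closedin X C" "openin X U" "C \<subseteq> A" "A \<subseteq> U" "measure M (U - C) < \<epsilon>"
        by (elim exE conjE)
      have "(topspace X - C) - (topspace X - U) = U - C" using openin_subset[OF CU(2)] by auto
      then show "\<exists>C V. closedin X C \<and> openin X V \<and> C \<subseteq> topspace X - A \<and> topspace X - A \<subseteq> V \<and> measure M (V - C) < \<epsilon>"
      proof (intro exI conjI)
        show "closedin X (topspace X - U)" "openin X (topspace X - C)" using CU(1,2) by blast+
        show "topspace X - U \<subseteq> topspace X - A" "topspace X - A \<subseteq> topspace X - C" using CU(3,4) by blast+
      qed (use CU(5) in simp)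
    qed
  next
    case (Union A)
    show ?case
    proof (intro allI impI)
      fix \<epsilon> :: real assume \<epsilon>: "\<epsilon> > 0"
      \<comment> \<open>Half of \<epsilon> is spread over the A i. The other half pays for replacing
        the union of the C i, which need not be closed, by a finite union.\<close>
      define e where "e i = \<epsilon> / 2 * (1/2) ^ Suc i" for i :: nat
      have e0: "0 < e i" for i using \<epsilon> by (simp add: e_def)
      have "\<forall>i. \<exists>C U. closedin X C \<and> openin X U \<and> C \<subseteq> A i \<and> A i \<subseteq> U \<and> measure M (U - C) < e i"
        using Union.IH \<epsilon> e0 by blast
      then obtain C U where CU: "\<And>i. closedin X (C i)" "\<And>i. openin X (U i)" "\<And>i. C i \<subseteq> A i" "\<And>i. A i \<subseteq> U i"
        "\<And>i. measure M (U i - C i) < e i" by metis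
      have bs: "U i \<in> borel_sets X" "C i \<in> borel_sets X" for i
        by (rule openin_borel_sets[OF CU(2)], rule closedin_borel_sets[OF CU(1)])
      define V where "V = (\<Union>i. U i)"
      define F where "F n = (\<Union>i\<in>{..n}. C i)" for n
      have Vb: "V \<in> borel_sets X" and Fb: "F n \<in> borel_sets X" for n
        unfolding V_def F_def using bs by blast+
      have "e sums (\<epsilon> / 2 * 1)" unfolding e_def using sums_mult[OF power_half_series] by blast
      then have e: "summable e" "suminf e = \<epsilon> / 2" by (auto simp: sums_iff)
      have sm: "summable (\<lambda>i. measure M (U i - C i))"
        by (rule summable_comparison_test'[OF e(1), of 0]) (use CU(5) in \<open>simp add: less_imp_le\<close>)
      have "(\<Union>i. U i - C i) \<in> borel_sets X" using bs by blast
      then have "measure M (V - (\<Union>i. C i)) \<le> measure M (\<Union>i. U i - C i)"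
        by (intro M.finite_measure_mono) (auto simp: V_def)
      also have "\<dots> \<le> (\<Sum>i. measure M (U i - C i))"
      proof (rule M.finite_measure_subadditive_countably[OF _ sm])
        show "range (\<lambda>i. U i - C i) \<subseteq> sets M" using bs by (auto intro: B.Diff)
      qed
      also have "\<dots> \<le> suminf e"
        by (rule suminf_le[OF less_imp_le[OF CU(5)] sm e(1)])
      finally have 1: "measure M (V - (\<Union>i. C i)) \<le> \<epsilon> / 2" using e by simp
      have "(\<lambda>n. measure M (V - F n)) \<longlonglongrightarrow> measure M (\<Inter>n. V - F n)"
        using Vb Fb by (intro M.finite_Lim_measure_decseq) (auto simp: decseq_def F_def dest: order_trans)
      moreover have "(\<Inter>n. V - F n) = V - (\<Union>i. C i)" by (auto simp: F_def)
      ultimately have "\<forall>\<^sub>F n in sequentially. measure M (V - F n) < \<epsilon>"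
        using 1 \<epsilon> by (intro order_tendstoD(2)[of _ "measure M (V - (\<Union>i. C i))"]) auto
      then obtain n where "measure M (V - F n) < \<epsilon>" by (auto simp: eventually_sequentially)
      moreover have "closedin X (F n)" unfolding F_def using CU(1) by (intro closedin_Union) blast+
      moreover have "openin X V" unfolding V_def using CU(2) by (intro openin_Union) blast
      ultimately show "\<exists>C W. closedin X C \<and> openin X W \<and> C \<subseteq> \<Union>(range A) \<and> \<Union>(range A) \<subseteq> W \<and> measure M (W - C) < \<epsilon>"
      proof (intro exI conjI)
        show "F n \<subseteq> \<Union>(range A)" using CU(3) by (auto simp: F_def)
        show "\<Union>(range A) \<subseteq> V" using CU(4) by (auto simp: V_def)
      qed
    qed
  qed
  from this[rule_format, OF assms(4)]
  obtain C U where CU: "closedin X C" "openin X U" "C \<subseteq> A" "A \<subseteq> U" "measure M (U - C) < \<epsilon>"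
    by (elim exE conjE)
  have "measure M (A - C) \<le> measure M (U - C)"
  proof (rule M.finite_measure_mono)
    show "U - C \<in> sets M"
      using openin_borel_sets[OF CU(2)] closedin_borel_sets[OF CU(1)] by (simp add: B.Diff)
  qed (use CU(4) in blast)
  then show thesis using CU(5) by (intro that[OF CU(1,3)]) linarith
qed

lemma radon_signed_measure:
  assumes "signed_pair X M N"
  shows "signed_measure X M N \<in> radon_measures X"
proof -
  interpret signed_pair X M N by fact
  have "\<exists>C. compactin X C \<and> C \<subseteq> A \<and> total_variation X \<kappa> (A - C) < \<epsilon>"
    if A: "A \<in> borel_sets X" and \<epsilon>: "\<epsilon> > 0" for A \<epsilon>
  proof -
    have half: "0 < \<epsilon> / 2" using \<epsilon> by simp
    obtain C where C: "closedin X C" "C \<subseteq> A" "measure M (A - C) < \<epsilon> / 2"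
      by (rule inner_regular_finite_measure[OF M.finite_measure_axioms sets_M A half])
    obtain D where D: "closedin X D" "D \<subseteq> A" "measure N (A - D) < \<epsilon> / 2"
      by (rule inner_regular_finite_measure[OF N.finite_measure_axioms sets_N A half])
    have b: "A - (C \<union> D) \<in> borel_sets X" "A - C \<in> borel_sets X" "A - D \<in> borel_sets X"
      using A closedin_borel_sets[OF C(1)] closedin_borel_sets[OF D(1)] by blast+
    have "total_variation X \<kappa> (A - (C \<union> D)) \<le> measure M (A - (C \<union> D)) + measure N (A - (C \<union> D))"
      by (rule total_variation_le[OF b(1)])
    also have "\<dots> \<le> measure M (A - C) + measure N (A - D)"
      using b by (intro add_mono M.finite_measure_mono N.finite_measure_mono) (auto simp: sets_M sets_N)
    also have "\<dots> < \<epsilon>" using C D by simp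
    finally have "total_variation X \<kappa> (A - (C \<union> D)) < \<epsilon>" .
    moreover have "compactin X (C \<union> D)" by (rule closedin_compact_space[OF compact closedin_Un[OF C(1) D(1)]])
    ultimately show ?thesis using C(2) D(2) by blast
  qed
  moreover have "\<kappa> A = 0" if "A \<notin> borel_sets X" for A using that by (simp add: signed_measure_def)
  ultimately show ?thesis unfolding radon_measures_def using \<kappa>_sums by blast
qed

end


section \<open>Compact subspaces of Cantor cubes\<close>

lemma topspace_cube: "topspace (cube A) = extensional A"
  by (auto simp: cube_def PiE_def)

lemma Hausdorff_cube: "Hausdorff_space (cube A)"
  unfolding cube_def by (simp add: Hausdorff_space_product_topology)

lemma compact_cube: "compact_space (cube A)"
  unfolding cube_def by (simp add: compact_space_product_topology compact_space_discrete_topology)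

lemma cube_neighbourhood:
  assumes "openin (cube A) U" "t \<in> U"
  obtains F where "finite F" "F \<subseteq> A" "\<And>s. s \<in> extensional A \<Longrightarrow> (\<And>i. i \<in> F \<Longrightarrow> s i = t i) \<Longrightarrow> s \<in> U"
proof -
  obtain V where V: "finite {i \<in> A. V i \<noteq> UNIV}" "t \<in> Pi\<^sub>E A V" "Pi\<^sub>E A V \<subseteq> U"
    using assms unfolding cube_def openin_product_topology_alt by auto
  show thesis
  proof (rule that[OF V(1)])
    fix s assume s: "s \<in> extensional A" "\<And>i. i \<in> {i \<in> A. V i \<noteq> UNIV} \<Longrightarrow> s i = t i"
    have "s i \<in> V i" if "i \<in> A" for i
    proof (cases "V i = UNIV")
      case False
      then have "s i = t i" using s(2) that by blast
      then show ?thesis using V(2) that by (simp add: PiE_iff)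
    qed simp
    then have "s \<in> Pi\<^sub>E A V" using s(1) by (simp add: PiE_iff)
    then show "s \<in> U" using V(3) by blast
  qed blast
qed

lemma continuous_map_coordinate: "i \<in> A \<Longrightarrow> continuous_map (cube A) (discrete_topology UNIV) (\<lambda>t. t i)"
  unfolding cube_def by (rule continuous_map_product_projection)

lemma clopenin_coordinate:
  assumes "S \<subseteq> extensional A" "i \<in> A"
  shows "clopenin (subtopology (cube A) S) {t \<in> S. t i = b}"
proof -
  have c: "continuous_map (subtopology (cube A) S) (discrete_topology UNIV) (\<lambda>t. t i)"
    by (rule continuous_map_from_subtopology[OF continuous_map_coordinate[OF assms(2)]])
  have S: "topspace (subtopology (cube A) S) = S" using assms(1) by (auto simp: topspace_cube)
  show ?thesis
    using openin_continuous_map_preimage[OF c, of "{b}"] closedin_continuous_map_preimage[OF c, of "{b}"]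
    unfolding clopenin_def S by simp
qed

lemma clopenin_cylinder:
  assumes "S \<subseteq> extensional A" "finite F" "F \<subseteq> A"
  shows "clopenin (subtopology (cube A) S) {s \<in> S. \<forall>i\<in>F. s i = t i}"
  using assms(2,3)
proof (induction F rule: finite_induct)
  case empty
  have "topspace (subtopology (cube A) S) = S" using assms(1) by (auto simp: topspace_cube)
  then show ?case using clopenin_topspace[of "subtopology (cube A) S"] by simp
next
  case (insert i F)
  have "{s \<in> S. \<forall>i\<in>insert i F. s i = t i} = {s \<in> S. s i = t i} \<inter> {s \<in> S. \<forall>i\<in>F. s i = t i}" by blast
  moreover have "clopenin (subtopology (cube A) S) {s \<in> S. s i = t i}"
    using insert.prems by (intro clopenin_coordinate[OF assms(1)]) blast
  ultimately show ?case using insert by (simp add: clopenin_Int)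
qed

lemma cylinder_neighbourhood:
  assumes "S \<subseteq> extensional A" "openin (subtopology (cube A) S) U" "t \<in> U"
  obtains F where "finite F" "F \<subseteq> A" "t \<in> S" "{s \<in> S. \<forall>i\<in>F. s i = t i} \<subseteq> U"
proof -
  obtain V where V: "openin (cube A) V" "U = V \<inter> S" using assms(2) by (auto simp: openin_subtopology)
  obtain F where F: "finite F" "F \<subseteq> A" "\<And>s. s \<in> extensional A \<Longrightarrow> (\<And>i. i \<in> F \<Longrightarrow> s i = t i) \<Longrightarrow> s \<in> V"
    using cube_neighbourhood[OF V(1), of t] assms(3) V(2) by blast
  have "{s \<in> S. \<forall>i\<in>F. s i = t i} \<subseteq> U" using F(3) assms(1) V(2) by blast
  then show thesis using that F(1,2) assms(3) V(2) by blast
qed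

lemma stone_space_cube:
  assumes "compactin (cube A) S"
  shows "stone_space (subtopology (cube A) S)"
proof
  have S: "S \<subseteq> extensional A" using compactin_subset_topspace[OF assms] by (simp add: topspace_cube)
  show "compact_space (subtopology (cube A) S)" using assms by (simp add: compact_space_subtopology)
  fix x U assume "openin (subtopology (cube A) S) U" "x \<in> U"
  then obtain F where F: "finite F" "F \<subseteq> A" "x \<in> S" "{s \<in> S. \<forall>i\<in>F. s i = x i} \<subseteq> U"
    using cylinder_neighbourhood[OF S] by blast
  show "\<exists>V. clopenin (subtopology (cube A) S) V \<and> x \<in> V \<and> V \<subseteq> U"
    using clopenin_cylinder[OF S F(1,2), of x] F(3,4) by (intro exI[of _ "{s \<in> S. \<forall>i\<in>F. s i = x i}"]) blast
qed

lemma countable_stone_space_cube: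
  assumes "compactin (cube A) S" "countable A"
  shows "countable_stone_space (subtopology (cube A) S)"
proof -
  have S: "S \<subseteq> extensional A" using compactin_subset_topspace[OF assms(1)] by (simp add: topspace_cube)
  \<comment> \<open>A cylinder is coded by its finite support F and a finite set G of the
    coordinates that are to be 1, which makes the family visibly countable.\<close>
  define \<B> where "\<B> = (\<lambda>(F, G). {s \<in> S. \<forall>i\<in>F. s i = (i \<in> G)}) ` ({F. finite F \<and> F \<subseteq> A} \<times> {F. finite F \<and> F \<subseteq> A})"
  have "countable \<B>" unfolding \<B>_def
    by (intro countable_image countable_SIGMA countable_Collect_finite_subset assms)
  moreover have "clopenin (subtopology (cube A) S) B" if B: "B \<in> \<B>" for B
  proof -
    obtain F G where "finite F" "F \<subseteq> A" "B = {s \<in> S. \<forall>i\<in>F. s i = (i \<in> G)}" using B by (auto simp: \<B>_def)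
    then show ?thesis using clopenin_cylinder[OF S, of F "\<lambda>i. i \<in> G"] by simp
  qed
  moreover have "\<exists>B\<in>\<B>. x \<in> B \<and> B \<subseteq> U" if Ux: "openin (subtopology (cube A) S) U" "x \<in> U" for U x
  proof -
    obtain F where F: "finite F" "F \<subseteq> A" "x \<in> S" "{s \<in> S. \<forall>i\<in>F. s i = x i} \<subseteq> U"
      using cylinder_neighbourhood[OF S Ux] by blast
    define G where "G = {i \<in> F. x i}"
    have G: "finite G" "G \<subseteq> A" using F by (auto simp: G_def)
    have eq: "{s \<in> S. \<forall>i\<in>F. s i = (i \<in> G)} = {s \<in> S. \<forall>i\<in>F. s i = x i}" by (auto simp: G_def)
    have "(F, G) \<in> {F. finite F \<and> F \<subseteq> A} \<times> {F. finite F \<and> F \<subseteq> A}" using F G by blast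
    then have "{s \<in> S. \<forall>i\<in>F. s i = (i \<in> G)} \<in> \<B>" unfolding \<B>_def by (intro rev_image_eqI[of "(F, G)"]) simp_all
    then show ?thesis using F eq by (intro bexI[of _ "{s \<in> S. \<forall>i\<in>F. s i = (i \<in> G)}"]) auto
  qed
  ultimately have "\<exists>\<B>. countable \<B> \<and> (\<forall>B\<in>\<B>. clopenin (subtopology (cube A) S) B) \<and>
      (\<forall>U x. openin (subtopology (cube A) S) U \<longrightarrow> x \<in> U \<longrightarrow> (\<exists>B\<in>\<B>. x \<in> B \<and> B \<subseteq> U))" by blast
  then show ?thesis
    by (intro countable_stone_space.intro stone_space_cube assms(1) countable_stone_space_axioms.intro
        Hausdorff_space_subtopology Hausdorff_cube)
qed

text \<open>A clopen set is open and compact, hence a finite union of cylinders, and their finitely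
  many supports together decide membership.\<close>

lemma clopen_finite_coordinates:
  assumes S: "compactin (cube A) S" and W: "clopenin (subtopology (cube A) S) W"
  obtains F where "finite F" "F \<subseteq> A"
    "\<And>s t. s \<in> S \<Longrightarrow> t \<in> S \<Longrightarrow> (\<And>i. i \<in> F \<Longrightarrow> s i = t i) \<Longrightarrow> s \<in> W \<Longrightarrow> t \<in> W"
proof -
  let ?X = "subtopology (cube A) S"
  have Se: "S \<subseteq> extensional A" using compactin_subset_topspace[OF S] by (simp add: topspace_cube)
  have Wo: "openin ?X W" using W by (simp add: clopenin_def)
  have Wc: "closedin ?X W" using W unfolding clopenin_def by blast
  have cs: "compact_space ?X" using S by (rule compact_space_subtopology)
  have "compactin ?X W" by (rule closedin_compact_space[OF cs Wc])
  have "\<exists>F. finite F \<and> F \<subseteq> A \<and> {s \<in> S. \<forall>i\<in>F. s i = t i} \<subseteq> W" if "t \<in> W" for t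
  proof -
    obtain F where "finite F" "F \<subseteq> A" "t \<in> S" "{s \<in> S. \<forall>i\<in>F. s i = t i} \<subseteq> W"
      by (rule cylinder_neighbourhood[OF Se Wo \<open>t \<in> W\<close>])
    then show ?thesis by blast
  qed
  then have "\<forall>t\<in>W. \<exists>F. finite F \<and> F \<subseteq> A \<and> {s \<in> S. \<forall>i\<in>F. s i = t i} \<subseteq> W" ..
  from bchoice[OF this] obtain F
    where F0: "\<forall>t\<in>W. finite (F t) \<and> F t \<subseteq> A \<and> {s \<in> S. \<forall>i\<in>F t. s i = t i} \<subseteq> W" ..
  have F: "finite (F t)" "F t \<subseteq> A" "{s \<in> S. \<forall>i\<in>F t. s i = t i} \<subseteq> W" if "t \<in> W" for t
    using bspec[OF F0 that] by simp_all
  define cyl where "cyl t = {s \<in> S. \<forall>i\<in>F t. s i = t i}" for t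
  have WS: "W \<subseteq> S" using clopenin_subset[OF W] by auto
  have "openin ?X U" if "U \<in> cyl ` W" for U
  proof -
    obtain t where "t \<in> W" "U = cyl t" using \<open>U \<in> cyl ` W\<close> by blast
    then show ?thesis using clopenin_cylinder[OF Se F(1,2)] unfolding cyl_def clopenin_def by simp
  qed
  moreover have "W \<subseteq> \<Union>(cyl ` W)" using WS by (auto simp: cyl_def)
  ultimately obtain \<F> where \<F>: "finite \<F>" "\<F> \<subseteq> cyl ` W" "W \<subseteq> \<Union>\<F>"
    using \<open>compactin ?X W\<close> unfolding compactin_def by meson
  obtain W0 where W0: "W0 \<subseteq> W" "finite W0" "\<F> = cyl ` W0" using finite_subset_image[OF \<F>(1,2)] by blast
  show thesis
  proof (rule that[of "\<Union>t\<in>W0. F t"])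
    show "finite (\<Union>t\<in>W0. F t)" using W0(1,2) F(1) by blast
    show "(\<Union>t\<in>W0. F t) \<subseteq> A" using W0(1) F(2) by blast
    fix s t assume st: "s \<in> S" "t \<in> S" "\<And>i. i \<in> (\<Union>t\<in>W0. F t) \<Longrightarrow> s i = t i" "s \<in> W"
    then obtain u where u: "u \<in> W0" "s \<in> cyl u" using \<F>(3) W0(3) by blast
    have "t \<in> cyl u" using u st unfolding cyl_def by auto
    then show "t \<in> W" using F(3)[of u] u W0(1) unfolding cyl_def by blast
  qed
qed

section \<open>Countable ordinals\<close>

lemma countable_bounded_omega1:
  assumes "countable (A :: omega1 set)"
  obtains \<alpha> where "\<beta> \<le> \<alpha>" "\<And>a. a \<in> A \<Longrightarrow> a < \<alpha>"
proof -
  have "countable (\<Union>a\<in>insert \<beta> A. {..a})"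
  proof (rule countable_UN)
    show "countable {..a}" for a :: omega1 using countable_lessThan_omega1[of "osuc a"] by (simp add: lessThan_osuc)
  qed (use assms in simp)
  then have "(\<Union>a\<in>insert \<beta> A. {..a}) \<noteq> UNIV" using uncountable_omega1 by metis
  then obtain \<alpha> where "\<alpha> \<notin> (\<Union>a\<in>insert \<beta> A. {..a})" by blast
  then have "\<beta> < \<alpha>" "\<And>a. a \<in> A \<Longrightarrow> a < \<alpha>" by (auto simp: not_le)
  then show thesis using that[of \<alpha>] by auto
qed

lemma less_osuc_iff: "\<beta> < osuc \<alpha> \<longleftrightarrow> \<beta> \<le> \<alpha>"
  using lessThan_osuc[of \<alpha>] by blast

lemma osuc_or_limit:
  assumes "\<beta> < \<alpha>"
  obtains \<gamma> where "\<alpha> = osuc \<gamma>" | "limit_ord \<alpha>"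
proof (cases "limit_ord \<alpha>")
  case False
  then obtain \<gamma> where \<gamma>: "\<gamma> < \<alpha>" "\<And>\<delta>. \<delta> < \<alpha> \<Longrightarrow> \<delta> \<le> \<gamma>"
    using assms unfolding limit_ord_def by (metis empty_iff lessThan_iff not_le)
  have "osuc \<gamma> = \<alpha>"
  proof (rule antisym)
    show "osuc \<gamma> \<le> \<alpha>" using \<gamma>(1) unfolding osuc_def by (rule Least_le)
    show "\<alpha> \<le> osuc \<gamma>" using \<gamma>(2)[of "osuc \<gamma>"] less_osuc[of \<gamma>] by (meson not_le)
  qed
  then show thesis using that(1) by blast
qed (rule that(2))

lemma proj_proj: "\<beta> \<le> \<alpha> \<Longrightarrow> proj \<beta> (proj \<alpha> t) = proj \<beta> t"
  by (auto simp: proj_def restrict_def fun_eq_iff)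

lemma proj_ident: "t \<in> extensional {..<\<alpha>} \<Longrightarrow> proj \<alpha> t = t"
  by (simp add: proj_def extensional_restrict)

lemma proj_extensional: "proj \<alpha> t \<in> extensional {..<\<alpha>}"
  by (simp add: proj_def)

lemma proj_eq_iff: "proj \<alpha> s = proj \<alpha> t \<longleftrightarrow> (\<forall>i<\<alpha>. s i = t i)"
  by (auto simp: proj_def restrict_def fun_eq_iff)

lemma continuous_map_proj:
  assumes "{..<\<beta>} \<subseteq> A" shows "continuous_map (cube A) (cube {..<\<beta>}) (proj \<beta>)"
  unfolding cube_def[of "{..<\<beta>}"] continuous_map_componentwise
proof (intro conjI ballI)
  show "proj \<beta> ` topspace (cube A) \<subseteq> extensional {..<\<beta>}" using proj_extensional by blast
  fix k assume k: "k \<in> {..<\<beta>}"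
  have "(\<lambda>x. proj \<beta> x k) = (\<lambda>x. x k)" using k by (simp add: proj_def)
  then show "continuous_map (cube A) (discrete_topology UNIV) (\<lambda>x. proj \<beta> x k)"
    using continuous_map_coordinate[of k A] assms k by auto
qed

section \<open>The levels of a realisation\<close>

context talagrand_realisation
begin

definition carrier :: "point set" where
  "carrier = {t. \<forall>\<beta>\<ge>omega0. proj \<beta> t \<in> K \<beta>}"

abbreviation T :: "point topology" where "T \<equiv> final_compactum K"

lemma K_ext: "omega0 \<le> \<alpha> \<Longrightarrow> K \<alpha> \<subseteq> extensional {..<\<alpha>}"
  using compactin_subset_topspace[OF K_compact] by (simp add: topspace_cube)

lemma topspace_level: "omega0 \<le> \<alpha> \<Longrightarrow> topspace (level K \<alpha>) = K \<alpha>"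
  using K_ext by (auto simp: level_def topspace_cube)

lemma T_eq: "T = subtopology (cube UNIV) carrier"
  by (simp add: final_compactum_def carrier_def)

lemma topspace_T: "topspace T = carrier"
  by (simp add: T_eq topspace_cube)

lemma K_osuc_iff:
  assumes "omega0 \<le> \<alpha>" "t \<in> K (osuc \<alpha>)"
  shows "proj \<alpha> t \<in> K \<alpha>"
proof -
  obtain s b where s: "s \<in> K \<alpha>" "t = s(\<alpha> := b)"
    using assms(2) YZ_cover[OF assms(1)] unfolding K_suc[OF assms(1)] app0_def app1_def by blast
  have "proj \<alpha> t = proj \<alpha> s" by (simp add: s proj_eq_iff)
  also have "\<dots> = s" using K_ext[OF assms(1)] s(1) by (intro proj_ident) blast
  finally show ?thesis using s by simp
qed

lemma K_osuc_lift:
  assumes "omega0 \<le> \<alpha>" "s \<in> K \<alpha>"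
  obtains t where "t \<in> K (osuc \<alpha>)" "proj \<alpha> t = s"
proof -
  obtain b where "s(\<alpha> := b) \<in> K (osuc \<alpha>)"
    using assms(2) YZ_cover[OF assms(1)] unfolding K_suc[OF assms(1)] app0_def app1_def by blast
  moreover have "proj \<alpha> (s(\<alpha> := b)) = proj \<alpha> s" by (simp add: proj_eq_iff)
  moreover have "proj \<alpha> s = s" using K_ext[OF assms(1)] assms(2) by (intro proj_ident) blast
  ultimately show thesis using that by simp
qed

lemma K_proj:
  assumes "omega0 \<le> \<beta>" "\<beta> \<le> \<alpha>" "t \<in> K \<alpha>" shows "proj \<beta> t \<in> K \<beta>"
  using assms(2,3)
proof (induction \<alpha> arbitrary: t rule: less_induct)
  case (less \<alpha>)
  show ?case
  proof (cases "\<beta> = \<alpha>")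
    case True
    have "t \<in> extensional {..<\<alpha>}"
      by (rule subsetD[OF K_ext[OF order_trans[OF assms(1) less.prems(1)]] less.prems(2)])
    then show ?thesis using less.prems True by (simp add: proj_ident)
  next
    case False
    then have lt: "\<beta> < \<alpha>" using less.prems by simp
    then show ?thesis
    proof (cases rule: osuc_or_limit)
      case (1 \<gamma>)
      have \<gamma>: "\<beta> \<le> \<gamma>" "\<gamma> < \<alpha>" using lt 1 less_osuc_iff less_osuc by auto
      then have "proj \<gamma> t \<in> K \<gamma>" using K_osuc_iff[of \<gamma> t] less.prems 1 assms(1) by simp
      from less.IH[OF \<gamma>(2) \<gamma>(1) this] show ?thesis using \<gamma>(1) by (simp add: proj_proj)
    next
      case 2
      have "omega0 < \<alpha>" using lt assms(1) by simp
      then show ?thesis using K_limit[OF 2] less.prems lt assms(1) by blast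
    qed
  qed
qed

lemma closedin_K: "omega0 \<le> \<alpha> \<Longrightarrow> closedin (cube {..<\<alpha>}) (K \<alpha>)"
  by (rule compactin_imp_closedin[OF Hausdorff_cube K_compact])

text \<open>Compactness of the cube over D turns separate lifts of s to the levels in \<Gamma> into
  a simultaneous one. D is left free so that the lemma serves limit levels and, with D =
  \<open>UNIV\<close>, the final compactum.\<close>

lemma inverse_limit_nonempty:
  assumes \<beta>: "omega0 \<le> \<beta>" "s \<in> K \<beta>" and \<Gamma>: "\<And>\<gamma>. \<gamma> \<in> \<Gamma> \<Longrightarrow> \<beta> \<le> \<gamma> \<and> {..<\<gamma>} \<subseteq> D"
    and ne: "\<And>\<gamma>. \<gamma> \<in> \<Gamma> \<Longrightarrow> \<exists>u\<in>K \<gamma>. proj \<beta> u = s" and "\<Gamma> \<noteq> {}"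
  obtains t where "t \<in> extensional D" "\<And>\<gamma>. \<gamma> \<in> \<Gamma> \<Longrightarrow> proj \<gamma> t \<in> K \<gamma>" "proj \<beta> t = s"
proof -
  define P where "P \<gamma> = {u \<in> K \<gamma>. proj \<beta> u = s}" for \<gamma>
  define C where "C \<gamma> = {t \<in> topspace (cube D). proj \<gamma> t \<in> P \<gamma>}" for \<gamma>
  have "closedin (cube {..<\<beta>}) {s}"
    using closedin_Hausdorff_sing_eq[OF Hausdorff_cube] K_ext[OF \<beta>(1)] \<beta>(2) by (auto simp: topspace_cube)
  then have closedP: "closedin (cube {..<\<gamma>}) (P \<gamma>)" if "\<gamma> \<in> \<Gamma>" for \<gamma>
  proof -
    have g: "\<beta> \<le> \<gamma>" "omega0 \<le> \<gamma>" using \<Gamma>[OF that] \<beta>(1) by auto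
    have "closedin (cube {..<\<gamma>}) {u \<in> topspace (cube {..<\<gamma>}). proj \<beta> u \<in> {s}}"
      by (rule closedin_continuous_map_preimage[OF continuous_map_proj]) (use g \<open>closedin (cube {..<\<beta>}) {s}\<close> in auto)
    then have "closedin (cube {..<\<gamma>}) (K \<gamma> \<inter> {u \<in> topspace (cube {..<\<gamma>}). proj \<beta> u \<in> {s}})"
      using closedin_K[OF g(2)] by blast
    moreover have "K \<gamma> \<inter> {u \<in> topspace (cube {..<\<gamma>}). proj \<beta> u \<in> {s}} = P \<gamma>"
      using K_ext[OF g(2)] by (auto simp: P_def topspace_cube)
    ultimately show ?thesis by simp
  qed
  have closedC: "closedin (cube D) (C \<gamma>)" if "\<gamma> \<in> \<Gamma>" for \<gamma>
    unfolding C_def by (rule closedin_continuous_map_preimage[OF continuous_map_proj closedP[OF that]])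
      (use \<Gamma>[OF that] in blast)
  have neC: "\<exists>t. t \<in> C \<gamma>" if g: "\<gamma> \<in> \<Gamma>" for \<gamma>
  proof -
    obtain u where u: "u \<in> K \<gamma>" "proj \<beta> u = s" using ne[OF g] by blast
    have "omega0 \<le> \<gamma>" using \<Gamma>[OF g] \<beta>(1) by auto
    then have uext: "proj \<gamma> u = u" using K_ext u(1) proj_ident by blast
    \<comment> \<open>From \<gamma> on the coordinates of \<open>u\<close> are
      \<open>undefined\<close>, an arbitrary bit. Restriction to D gives a point of the cube over D
      with the same projection to \<gamma>.\<close>
    have "proj \<gamma> (restrict u D) = proj \<gamma> u" using \<Gamma>[OF g] by (auto simp: proj_eq_iff)
    then have "restrict u D \<in> C \<gamma>" using u uext by (simp add: C_def P_def topspace_cube)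
    then show ?thesis by blast
  qed
  have monoC: "C \<gamma> \<subseteq> C \<gamma>'" if g: "\<gamma> \<in> \<Gamma>" "\<gamma>' \<in> \<Gamma>" "\<gamma>' \<le> \<gamma>" for \<gamma> \<gamma>'
  proof
    fix t assume t: "t \<in> C \<gamma>"
    then have "proj \<gamma> t \<in> K \<gamma>" "proj \<beta> (proj \<gamma> t) = s" by (auto simp: C_def P_def)
    moreover have "proj \<gamma>' (proj \<gamma> t) = proj \<gamma>' t" using g by (simp add: proj_proj)
    moreover have "proj \<beta> (proj \<gamma> t) = proj \<beta> t" "proj \<beta> (proj \<gamma>' t) = proj \<beta> t"
      using \<Gamma>[OF g(1)] \<Gamma>[OF g(2)] by (simp_all add: proj_proj)
    moreover have "omega0 \<le> \<gamma>'" using \<Gamma>[OF g(2)] \<beta>(1) by auto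
    ultimately show "t \<in> C \<gamma>'" using K_proj[of \<gamma>' \<gamma> "proj \<gamma> t"] g t by (simp add: C_def P_def)
  qed
  have "\<Inter>(C ` \<Gamma>) \<noteq> {}"
  proof -
    have fip: "\<Inter>\<F> \<noteq> {}" if f: "finite \<F>" "\<F> \<subseteq> C ` \<Gamma>" for \<F>
    proof (cases "\<F> = {}")
      case False
      obtain G where G: "G \<subseteq> \<Gamma>" "finite G" "\<F> = C ` G" using finite_subset_image[OF f] by blast
      then have "G \<noteq> {}" using False by auto
      then have M: "Max G \<in> G" using G by simp
      obtain t where t: "t \<in> C (Max G)" using neC M G by blast
      have "t \<in> C \<gamma>" if "\<gamma> \<in> G" for \<gamma>
        using monoC[of "Max G" \<gamma>] t M G that Max_ge[OF G(2) that] by blast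
      then show ?thesis unfolding G(3) by blast
    qed simp
    have "\<forall>C\<in>C ` \<Gamma>. closedin (cube D) C" using closedC by blast
    then show ?thesis using compact_cube[of D] fip unfolding compact_space_fip by blast
  qed
  then obtain t where t: "\<And>\<gamma>. \<gamma> \<in> \<Gamma> \<Longrightarrow> t \<in> C \<gamma>" by blast
  obtain \<gamma> where g: "\<gamma> \<in> \<Gamma>" using \<open>\<Gamma> \<noteq> {}\<close> by blast
  have "proj \<beta> t = s" using t[OF g] \<Gamma>[OF g] proj_proj[of \<beta> \<gamma> t] by (auto simp: C_def P_def)
  moreover have "t \<in> extensional D" using t[OF g] by (auto simp: C_def topspace_cube)
  ultimately show thesis using that t by (auto simp: C_def P_def)
qed

text \<open>A point lifts to a successor level because Y and Z cover the level below; at limits the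
  lifts to all smaller levels are combined by \<open>inverse_limit_nonempty\<close>.\<close>

lemma K_surj:
  assumes "omega0 \<le> \<beta>" "\<beta> \<le> \<alpha>" "s \<in> K \<beta>" shows "\<exists>t\<in>K \<alpha>. proj \<beta> t = s"
  using assms(2)
proof (induction \<alpha> rule: less_induct)
  case (less \<alpha>)
  show ?case
  proof (cases "\<beta> = \<alpha>")
    case True
    have "s \<in> extensional {..<\<alpha>}" using subsetD[OF K_ext[OF assms(1)] assms(3)] True by simp
    then show ?thesis using assms(3) True by (intro bexI[of _ s]) (auto simp: proj_ident)
  next
    case False
    then have lt: "\<beta> < \<alpha>" using less.prems by simp
    then show ?thesis
    proof (cases rule: osuc_or_limit)
      case (1 \<gamma>)
      have \<gamma>: "\<beta> \<le> \<gamma>" "\<gamma> < \<alpha>" "omega0 \<le> \<gamma>" using lt 1 less_osuc_iff less_osuc assms(1) by auto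
      then obtain u where u: "u \<in> K \<gamma>" "proj \<beta> u = s" using less.IH by blast
      obtain t where t: "t \<in> K \<alpha>" "proj \<gamma> t = u" using K_osuc_lift[OF \<gamma>(3) u(1)] 1 by blast
      have "proj \<beta> t = s" using proj_proj[OF \<gamma>(1), of t] t u by simp
      then show ?thesis using t by blast
    next
      case 2
      have o: "omega0 < \<alpha>" using lt assms(1) by simp
      obtain t where t: "t \<in> extensional {..<\<alpha>}" "\<And>\<gamma>. \<gamma> \<in> {\<beta>..<\<alpha>} \<Longrightarrow> proj \<gamma> t \<in> K \<gamma>" "proj \<beta> t = s"
      proof (rule inverse_limit_nonempty[OF assms(1,3), of "{\<beta>..<\<alpha>}" "{..<\<alpha>}"])
        show "\<exists>u\<in>K \<gamma>. proj \<beta> u = s" if "\<gamma> \<in> {\<beta>..<\<alpha>}" for \<gamma> using less.IH that by auto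
      qed (use lt in auto)
      have "proj \<gamma> t \<in> K \<gamma>" if "omega0 \<le> \<gamma>" "\<gamma> < \<alpha>" for \<gamma>
      proof (cases "\<beta> \<le> \<gamma>")
        case True then show ?thesis using t(2) that by simp
      next
        case False
        then have "proj \<gamma> (proj \<beta> t) = proj \<gamma> t" by (simp add: proj_proj)
        then show ?thesis using K_proj[OF that(1), of \<beta> s] assms(3) t(3) False by simp
      qed
      then have "t \<in> K \<alpha>" using K_limit[OF 2 o] t(1) by (simp add: topspace_cube)
      then show ?thesis using t(3) by blast
    qed
  qed
qed

lemma carrier_surj:
  assumes "omega0 \<le> \<beta>" "s \<in> K \<beta>" shows "\<exists>t\<in>carrier. proj \<beta> t = s"
proof -
  obtain t where t: "\<And>\<gamma>. \<gamma> \<in> {\<beta>..} \<Longrightarrow> proj \<gamma> t \<in> K \<gamma>" "proj \<beta> t = s"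
  proof (rule inverse_limit_nonempty[OF assms, of "{\<beta>..}" UNIV])
    show "\<exists>u\<in>K \<gamma>. proj \<beta> u = s" if "\<gamma> \<in> {\<beta>..}" for \<gamma> using K_surj[OF assms(1) _ assms(2)] that by auto
  qed auto
  have "proj \<gamma> t \<in> K \<gamma>" if "omega0 \<le> \<gamma>" for \<gamma>
  proof (cases "\<beta> \<le> \<gamma>")
    case True then show ?thesis using t(1) by simp
  next
    case False
    then have "proj \<gamma> (proj \<beta> t) = proj \<gamma> t" by (simp add: proj_proj)
    then show ?thesis using K_proj[OF that(1), of \<beta> s] assms t(2) False by simp
  qed
  then show ?thesis using t(2) by (auto simp: carrier_def)
qed

lemma compactin_carrier: "compactin (cube UNIV) carrier"
proof (rule closedin_compact_space[OF compact_cube])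
  have "carrier = (\<Inter>\<beta>\<in>{omega0..}. {t \<in> topspace (cube UNIV). proj \<beta> t \<in> K \<beta>})"
    by (auto simp: carrier_def topspace_cube)
  moreover have "closedin (cube UNIV) {t \<in> topspace (cube UNIV). proj \<beta> t \<in> K \<beta>}" if "\<beta> \<in> {omega0..}" for \<beta>
    by (rule closedin_continuous_map_preimage[OF continuous_map_proj closedin_K]) (use that in auto)
  ultimately show "closedin (cube UNIV) carrier" by (auto intro!: closedin_INT)
qed

lemma stone_space_T: "stone_space T"
  unfolding T_eq by (rule stone_space_cube[OF compactin_carrier])

lemma Hausdorff_T: "Hausdorff_space T"
  unfolding T_eq by (intro Hausdorff_space_subtopology Hausdorff_cube)

sublocale T: stone_space T by (rule stone_space_T)

lemma countable_stone_space_level: "omega0 \<le> \<alpha> \<Longrightarrow> countable_stone_space (level K \<alpha>)"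
  unfolding level_def by (intro countable_stone_space_cube K_compact countable_lessThan_omega1)

lemma continuous_map_proj_level:
  assumes "omega0 \<le> \<beta>" "\<beta> \<le> \<alpha>" shows "continuous_map (level K \<alpha>) (level K \<beta>) (proj \<beta>)"
  unfolding level_def
  by (intro continuous_map_into_subtopology continuous_map_from_subtopology continuous_map_proj)
    (use assms K_proj in auto)

lemma continuous_map_proj_T:
  assumes "omega0 \<le> \<beta>" shows "continuous_map T (level K \<beta>) (proj \<beta>)"
  unfolding level_def T_eq
  by (intro continuous_map_into_subtopology continuous_map_from_subtopology continuous_map_proj)
    (use assms in \<open>auto simp: carrier_def\<close>)

definition cyl :: "omega1 \<Rightarrow> point set \<Rightarrow> point set" where
  "cyl \<alpha> C = {t \<in> carrier. proj \<alpha> t \<in> C}"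

lemma cyl_simps:
  "cyl \<alpha> (C \<union> D) = cyl \<alpha> C \<union> cyl \<alpha> D" "cyl \<alpha> (C \<inter> D) = cyl \<alpha> C \<inter> cyl \<alpha> D"
  "cyl \<alpha> (C - D) = cyl \<alpha> C - cyl \<alpha> D" "cyl \<alpha> {} = {}"
  by (auto simp: cyl_def)

lemma cyl_K: "omega0 \<le> \<alpha> \<Longrightarrow> cyl \<alpha> (K \<alpha>) = carrier"
  by (auto simp: cyl_def carrier_def)

lemma clopenin_cyl:
  assumes "omega0 \<le> \<alpha>" "clopenin (level K \<alpha>) C" shows "clopenin T (cyl \<alpha> C)"
  using openin_continuous_map_preimage[OF continuous_map_proj_T[OF assms(1)], of C]
    closedin_continuous_map_preimage[OF continuous_map_proj_T[OF assms(1)], of C] assms(2)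
  by (simp add: clopenin_def cyl_def topspace_T)

text \<open>A clopen subset of \<open>T\<close> is a cylinder over all large levels; surjectivity of the projection
  makes the images of a cylinder and of its complement disjoint.\<close>

lemma clopen_is_cyl:
  assumes W: "clopenin T W"
  obtains F where "finite F" "\<And>\<alpha>. omega0 \<le> \<alpha> \<Longrightarrow> F \<subseteq> {..<\<alpha>} \<Longrightarrow>
    clopenin (level K \<alpha>) (proj \<alpha> ` W) \<and> cyl \<alpha> (proj \<alpha> ` W) = W"
proof -
  obtain F where F: "finite F" "\<And>s t. s \<in> carrier \<Longrightarrow> t \<in> carrier \<Longrightarrow> (\<And>i. i \<in> F \<Longrightarrow> s i = t i) \<Longrightarrow> s \<in> W \<Longrightarrow> t \<in> W"
    using clopen_finite_coordinates[OF compactin_carrier W[unfolded T_eq]] by metis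
  have WC: "W \<subseteq> carrier" using clopenin_subset[OF W] by (simp add: topspace_T)
  have "clopenin (level K \<alpha>) (proj \<alpha> ` W) \<and> cyl \<alpha> (proj \<alpha> ` W) = W" if \<alpha>: "omega0 \<le> \<alpha>" "F \<subseteq> {..<\<alpha>}" for \<alpha>
  proof -
    have dep: "t \<in> W" if "s \<in> W" "t \<in> carrier" "proj \<alpha> s = proj \<alpha> t" for s t
    proof (rule F(2)[of s t])
      show "s i = t i" if "i \<in> F" for i using \<open>proj \<alpha> s = proj \<alpha> t\<close> that \<alpha>(2) by (auto simp: proj_eq_iff)
    qed (use that WC in auto)
    interpret L: countable_stone_space "level K \<alpha>" by (rule countable_stone_space_level[OF \<alpha>(1)])
    have closed: "closedin (level K \<alpha>) (proj \<alpha> ` V)" if "clopenin T V" for V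
    proof -
      have "compactin T V" using that T.compact by (intro closedin_compact_space) (auto simp: clopenin_def)
      then have "compactin (level K \<alpha>) (proj \<alpha> ` V)"
        by (rule image_compactin[OF _ continuous_map_proj_T[OF \<alpha>(1)]])
      then show ?thesis by (rule compactin_imp_closedin[OF L.Hausdorff])
    qed
    have "K \<alpha> - proj \<alpha> ` W = proj \<alpha> ` (carrier - W)"
    proof
      show "K \<alpha> - proj \<alpha> ` W \<subseteq> proj \<alpha> ` (carrier - W)"
      proof
        fix s assume s: "s \<in> K \<alpha> - proj \<alpha> ` W"
        then obtain t where "t \<in> carrier" "proj \<alpha> t = s" using carrier_surj[OF \<alpha>(1)] by blast
        then show "s \<in> proj \<alpha> ` (carrier - W)" using s by blast
      qed
      show "proj \<alpha> ` (carrier - W) \<subseteq> K \<alpha> - proj \<alpha> ` W"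
        using dep WC \<alpha>(1) unfolding carrier_def by fastforce
    qed
    moreover have "closedin (level K \<alpha>) (proj \<alpha> ` (carrier - W))"
      using closed[of "carrier - W"] W clopenin_Diff[OF clopenin_topspace W] by (simp add: topspace_T)
    moreover have "proj \<alpha> ` W \<subseteq> K \<alpha>" using WC \<alpha>(1) unfolding carrier_def by blast
    ultimately have "openin (level K \<alpha>) (proj \<alpha> ` W)"
      by (simp add: openin_closedin_eq topspace_level[OF \<alpha>(1)])
    moreover have "cyl \<alpha> (proj \<alpha> ` W) = W" using dep WC unfolding cyl_def by auto
    ultimately show ?thesis using closed[OF W] by (simp add: clopenin_def)
  qed
  with F(1) that show thesis by blast
qed

end


context compact_top
begin

lemma bounded_functional_indicator_Un:
  assumes \<phi>: "bounded_functional X b \<phi>" and A: "clopenin X A" and B: "clopenin X B" and "A \<inter> B = {}"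
  shows "\<phi> (indicator (A \<union> B)) = \<phi> (indicator A) + \<phi> (indicator B)"
proof -
  have "\<phi> (indicator (A \<union> B)) = \<phi> (\<lambda>x. indicator A x + indicator B x)"
    using assms(4) by (intro bounded_functional_cong[OF \<phi>] cm_ops cm_indicator clopenin_Un A B)
      (auto simp: indicator_def)
  also have "\<dots> = \<phi> (indicator A) + \<phi> (indicator B)"
    by (rule bounded_functional_simps(1)[OF \<phi>]) (intro cm_indicator A B)+
  finally show ?thesis .
qed

lemma bounded_functional_indicator_compl:
  assumes \<phi>: "bounded_functional X b \<phi>" and A: "clopenin X A"
  shows "\<phi> (indicator (topspace X - A)) = \<phi> (\<lambda>x. 1) - \<phi> (indicator A)"
proof -
  have "\<phi> (indicator (topspace X - A)) = \<phi> (\<lambda>x. 1 - indicator A x)"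
    by (intro bounded_functional_cong[OF \<phi>] cm_ops cm_const cm_indicator clopenin_Diff clopenin_topspace A)
      (auto simp: indicator_def)
  also have "\<dots> = \<phi> (\<lambda>x. 1) - \<phi> (indicator A)"
    by (rule bounded_functional_simps(2)[OF \<phi> cm_const]) (intro cm_indicator A)
  finally show ?thesis .
qed

end

section \<open>Measures induced on the levels\<close>

context talagrand_realisation
begin

text \<open>For s = 1 and s = -1 these are the values of the positive and the negative part of \<mu>
  on a clopen set.\<close>

definition signed_half :: "real \<Rightarrow> ((point \<Rightarrow> real) \<Rightarrow> real) \<Rightarrow> point set \<Rightarrow> real" where
  "signed_half s \<mu> C = (T.modulus \<mu> (indicator C) + s * \<mu> (indicator C)) / 2"

definition level_measure :: "real \<Rightarrow> ((point \<Rightarrow> real) \<Rightarrow> real) \<Rightarrow> omega1 \<Rightarrow> point measure" where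
  "level_measure s \<mu> \<alpha> = (SOME M. finite_measure M \<and> sets M = borel_sets (level K \<alpha>) \<and>
     (\<forall>C. clopenin (level K \<alpha>) C \<longrightarrow> measure M C = signed_half s \<mu> (cyl \<alpha> C)))"

text \<open>The push-forward of \<mu> to level \<alpha>, built from the values of \<mu> on
  cylinders, without a measure on T.\<close>

definition trace :: "((point \<Rightarrow> real) \<Rightarrow> real) \<Rightarrow> omega1 \<Rightarrow> point set \<Rightarrow> real" where
  "trace \<mu> \<alpha> = signed_measure (level K \<alpha>) (level_measure 1 \<mu> \<alpha>) (level_measure (-1) \<mu> \<alpha>)"

definition based :: "omega1 \<Rightarrow> point set \<Rightarrow> bool" where
  "based \<alpha> W \<longleftrightarrow> clopenin (level K \<alpha>) (proj \<alpha> ` W) \<and> cyl \<alpha> (proj \<alpha> ` W) = W"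

context
  fixes b :: real and \<mu> :: "(point \<Rightarrow> real) \<Rightarrow> real"
  assumes \<mu>: "bounded_functional T b \<mu>"
begin

lemma level_measure:
  assumes \<alpha>: "omega0 \<le> \<alpha>" and s: "\<bar>s\<bar> = 1"
  shows "finite_measure (level_measure s \<mu> \<alpha>)" "sets (level_measure s \<mu> \<alpha>) = borel_sets (level K \<alpha>)"
    "\<And>C. clopenin (level K \<alpha>) C \<Longrightarrow> measure (level_measure s \<mu> \<alpha>) C = signed_half s \<mu> (cyl \<alpha> C)"
proof -
  interpret L: countable_stone_space "level K \<alpha>" by (rule countable_stone_space_level[OF \<alpha>])
  have "\<exists>M. finite_measure M \<and> sets M = borel_sets (level K \<alpha>) \<and>
     (\<forall>C. clopenin (level K \<alpha>) C \<longrightarrow> measure M C = signed_half s \<mu> (cyl \<alpha> C))"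
  proof (rule L.measure_extension[of "\<lambda>C. signed_half s \<mu> (cyl \<alpha> C)"])
    fix A B assume AB: "clopenin (level K \<alpha>) A" "clopenin (level K \<alpha>) B" "A \<inter> B = {}"
    have c: "clopenin T (cyl \<alpha> A)" "clopenin T (cyl \<alpha> B)" using clopenin_cyl[OF \<alpha>] AB by blast+
    have d: "cyl \<alpha> A \<inter> cyl \<alpha> B = {}" using AB(3) by (auto simp: cyl_def)
    show "signed_half s \<mu> (cyl \<alpha> (A \<union> B)) = signed_half s \<mu> (cyl \<alpha> A) + signed_half s \<mu> (cyl \<alpha> B)"
      unfolding signed_half_def cyl_simps
        T.positive_functional_indicator_Un[OF T.positive_functional_modulus[OF \<mu>] c d]
        T.bounded_functional_indicator_Un[OF \<mu> c d]
      by (simp add: algebra_simps add_divide_distrib)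
  next
    fix A assume "clopenin (level K \<alpha>) A"
    then have c: "clopenin T (cyl \<alpha> A)" by (rule clopenin_cyl[OF \<alpha>])
    have "\<bar>\<mu> (indicator (cyl \<alpha> A))\<bar> \<le> T.modulus \<mu> (indicator (cyl \<alpha> A))"
      by (rule T.modulus_upper[OF \<mu>]) (simp_all add: c T.cm_indicator)
    moreover have "\<bar>s * \<mu> (indicator (cyl \<alpha> A))\<bar> = \<bar>\<mu> (indicator (cyl \<alpha> A))\<bar>" using s by (simp add: abs_mult)
    ultimately have "0 \<le> T.modulus \<mu> (indicator (cyl \<alpha> A)) + s * \<mu> (indicator (cyl \<alpha> A))"
      using abs_ge_minus_self[of "s * \<mu> (indicator (cyl \<alpha> A))"] by linarith
    then show "0 \<le> signed_half s \<mu> (cyl \<alpha> A)" unfolding signed_half_def by simp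
  next
    fix M assume "finite_measure M" "sets M = borel_sets (level K \<alpha>)"
      "\<And>C. clopenin (level K \<alpha>) C \<Longrightarrow> measure M C = signed_half s \<mu> (cyl \<alpha> C)"
    then show ?thesis by blast
  qed
  from someI_ex[OF this] show "finite_measure (level_measure s \<mu> \<alpha>)"
    "sets (level_measure s \<mu> \<alpha>) = borel_sets (level K \<alpha>)"
    "\<And>C. clopenin (level K \<alpha>) C \<Longrightarrow> measure (level_measure s \<mu> \<alpha>) C = signed_half s \<mu> (cyl \<alpha> C)"
    unfolding level_measure_def by blast+
qed

lemma signed_pair_level_measure:
  assumes "omega0 \<le> \<alpha>" shows "signed_pair (level K \<alpha>) (level_measure 1 \<mu> \<alpha>) (level_measure (-1) \<mu> \<alpha>)"
proof -
  have 1: "\<bar>1::real\<bar> = 1" "\<bar>-1::real\<bar> = 1" by simp_all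
  show ?thesis
    by (intro signed_pair.intro signed_pair_axioms.intro level_measure assms 1)
qed

lemma radon_trace: "omega0 \<le> \<alpha> \<Longrightarrow> trace \<mu> \<alpha> \<in> radon_measures (level K \<alpha>)"
  unfolding trace_def
  by (rule countable_stone_space.radon_signed_measure[OF countable_stone_space_level signed_pair_level_measure])

lemma trace_clopen:
  assumes \<alpha>: "omega0 \<le> \<alpha>" and C: "clopenin (level K \<alpha>) C"
  shows "trace \<mu> \<alpha> C = \<mu> (indicator (cyl \<alpha> C))"
proof -
  have "trace \<mu> \<alpha> C = signed_half 1 \<mu> (cyl \<alpha> C) - signed_half (-1) \<mu> (cyl \<alpha> C)"
    unfolding trace_def using level_measure(3)[OF \<alpha> _ C, of 1] level_measure(3)[OF \<alpha> _ C, of "-1"]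
    by (simp add: signed_measure_def clopenin_borel_sets[OF C])
  then show ?thesis by (simp add: signed_half_def add_divide_distrib diff_divide_distrib)
qed

text \<open>Only an inequality, because masses of opposite sign may be projected onto each other and
  cancel.\<close>

lemma variation_clopen:
  assumes \<alpha>: "omega0 \<le> \<alpha>" and C: "clopenin (level K \<alpha>) C"
  shows "total_variation (level K \<alpha>) (trace \<mu> \<alpha>) C \<le> T.modulus \<mu> (indicator (cyl \<alpha> C))"
proof -
  interpret signed_pair "level K \<alpha>" "level_measure 1 \<mu> \<alpha>" "level_measure (-1) \<mu> \<alpha>"
    by (rule signed_pair_level_measure[OF \<alpha>])
  have "total_variation (level K \<alpha>) (trace \<mu> \<alpha>) C \<le> signed_half 1 \<mu> (cyl \<alpha> C) + signed_half (-1) \<mu> (cyl \<alpha> C)"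
    using total_variation_le[OF clopenin_borel_sets[OF C]]
      level_measure(3)[OF \<alpha> _ C, of 1] level_measure(3)[OF \<alpha> _ C, of "-1"]
    by (simp add: trace_def)
  then show ?thesis by (simp add: signed_half_def add_divide_distrib diff_divide_distrib)
qed

lemma variation_clopen_ge:
  assumes \<alpha>: "omega0 \<le> \<alpha>" and C: "clopenin (level K \<alpha>) C" and D: "clopenin (level K \<alpha>) D"
  shows "\<mu> (indicator (cyl \<alpha> C \<inter> cyl \<alpha> D)) - \<mu> (indicator (cyl \<alpha> C - cyl \<alpha> D)) \<le>
    total_variation (level K \<alpha>) (trace \<mu> \<alpha>) C"
proof -
  interpret signed_pair "level K \<alpha>" "level_measure 1 \<mu> \<alpha>" "level_measure (-1) \<mu> \<alpha>"
    by (rule signed_pair_level_measure[OF \<alpha>])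
  have "trace \<mu> \<alpha> (C \<inter> D) - trace \<mu> \<alpha> (C - D) \<le> total_variation (level K \<alpha>) (trace \<mu> \<alpha>) C"
    using total_variation_ge[OF clopenin_borel_sets[OF C] clopenin_borel_sets[OF D]] by (simp add: trace_def)
  moreover have "trace \<mu> \<alpha> (C \<inter> D) = \<mu> (indicator (cyl \<alpha> C \<inter> cyl \<alpha> D))"
    unfolding cyl_simps(2)[symmetric] by (rule trace_clopen[OF \<alpha> clopenin_Int[OF C D]])
  moreover have "trace \<mu> \<alpha> (C - D) = \<mu> (indicator (cyl \<alpha> C - cyl \<alpha> D))"
    unfolding cyl_simps(3)[symmetric] by (rule trace_clopen[OF \<alpha> clopenin_Diff[OF C D]])
  ultimately show ?thesis by simp
qed

lemma signed_integral_trace: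
  assumes \<alpha>: "omega0 \<le> \<alpha>" and C: "clopenin (level K \<alpha>) C"
  shows "signed_integral (level K \<alpha>) (trace \<mu> \<alpha>) (restrict (indicator C) (topspace (level K \<alpha>))) =
    \<mu> (indicator (cyl \<alpha> C))"
proof -
  interpret signed_pair "level K \<alpha>" "level_measure 1 \<mu> \<alpha>" "level_measure (-1) \<mu> \<alpha>"
    by (rule signed_pair_level_measure[OF \<alpha>])
  show ?thesis
    using signed_integral_indicator[OF clopenin_borel_sets[OF C]] trace_clopen[OF \<alpha> C] by (simp add: trace_def)
qed

text \<open>The image measure and the measure built at level \<theta> agree on clopen sets, because
  a clopen subset of K \<theta> and its preimage in K \<alpha> span the same cylinder in T. Clopen
  sets determine a finite Borel measure.\<close>

lemma push_forward_level_measure: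
  assumes \<theta>: "omega0 \<le> \<theta>" "\<theta> \<le> \<alpha>" and s: "\<bar>s\<bar> = 1" and A: "A \<in> borel_sets (level K \<theta>)"
  shows "proj \<theta> -` A \<inter> K \<alpha> \<in> borel_sets (level K \<alpha>)"
    "measure (level_measure s \<mu> \<alpha>) (proj \<theta> -` A \<inter> K \<alpha>) = measure (level_measure s \<mu> \<theta>) A"
proof -
  have \<alpha>: "omega0 \<le> \<alpha>" using \<theta> by simp
  interpret L: countable_stone_space "level K \<theta>" by (rule countable_stone_space_level[OF \<theta>(1)])
  note M = level_measure[OF \<alpha> s] and N = level_measure[OF \<theta>(1) s]
  interpret M: finite_measure "level_measure s \<mu> \<alpha>" by (rule M(1))
  interpret B: sigma_algebra "topspace (level K \<alpha>)" "borel_sets (level K \<alpha>)" by (rule borel_sets_sigma_algebra)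
  have space: "space (level_measure s \<mu> \<alpha>) = K \<alpha>"
  proof
    show "space (level_measure s \<mu> \<alpha>) \<subseteq> K \<alpha>"
      using B.sets_into_space sets.top[of "level_measure s \<mu> \<alpha>"] unfolding M(2) topspace_level[OF \<alpha>] by blast
    have "K \<alpha> \<in> sets (level_measure s \<mu> \<alpha>)" using B.top unfolding M(2) topspace_level[OF \<alpha>] .
    then show "K \<alpha> \<subseteq> space (level_measure s \<mu> \<alpha>)" by (rule sets.sets_into_space)
  qed
  have cont: "continuous_map (level K \<alpha>) (level K \<theta>) (proj \<theta>)" by (rule continuous_map_proj_level[OF \<theta>])
  have meas: "proj \<theta> \<in> measurable (level_measure s \<mu> \<alpha>) (level_measure s \<mu> \<theta>)"
  proof (rule measurable_sigma_sets)
    show "sets (level_measure s \<mu> \<theta>) = sigma_sets (topspace (level K \<theta>)) {U. openin (level K \<theta>) U}"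
      using N(2) by (simp add: borel_sets_def)
    show "{U. openin (level K \<theta>) U} \<subseteq> Pow (topspace (level K \<theta>))" using openin_subset by blast
    show "proj \<theta> \<in> space (level_measure s \<mu> \<alpha>) \<rightarrow> topspace (level K \<theta>)"
      using K_proj[OF \<theta>] by (simp add: space topspace_level[OF \<theta>(1)])
    fix U assume "U \<in> {U. openin (level K \<theta>) U}"
    then have "openin (level K \<alpha>) {x \<in> topspace (level K \<alpha>). proj \<theta> x \<in> U}"
      using openin_continuous_map_preimage[OF cont] by blast
    moreover have "{x \<in> topspace (level K \<alpha>). proj \<theta> x \<in> U} = proj \<theta> -` U \<inter> K \<alpha>"
      using topspace_level[OF \<alpha>] by blast
    ultimately show "proj \<theta> -` U \<inter> space (level_measure s \<mu> \<alpha>) \<in> sets (level_measure s \<mu> \<alpha>)"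
      using openin_borel_sets by (metis M(2) space)
  qed
  have A': "A \<in> sets (level_measure s \<mu> \<theta>)" using A N(2) by simp
  show "proj \<theta> -` A \<inter> K \<alpha> \<in> borel_sets (level K \<alpha>)"
    using measurable_sets[OF meas A'] by (simp add: space M(2))
  define D where "D = distr (level_measure s \<mu> \<alpha>) (level_measure s \<mu> \<theta>) (proj \<theta>)"
  have D: "measure D B = measure (level_measure s \<mu> \<alpha>) (proj \<theta> -` B \<inter> K \<alpha>)" if "B \<in> borel_sets (level K \<theta>)" for B
    unfolding D_def using measure_distr[OF meas, of B] that N(2) by (simp add: space)
  have "D = level_measure s \<mu> \<theta>"
  proof (rule L.measure_eq_of_clopen_eq)
    show "finite_measure D" unfolding D_def by (rule M.finite_measure_distr[OF meas])
    show "sets D = borel_sets (level K \<theta>)" using N(2) by (simp add: D_def)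
    fix C assume C: "clopenin (level K \<theta>) C"
    have "clopenin (level K \<alpha>) {x \<in> topspace (level K \<alpha>). proj \<theta> x \<in> C}"
      using openin_continuous_map_preimage[OF cont] closedin_continuous_map_preimage[OF cont] C
      unfolding clopenin_def by blast
    moreover have "{x \<in> topspace (level K \<alpha>). proj \<theta> x \<in> C} = proj \<theta> -` C \<inter> K \<alpha>"
      using topspace_level[OF \<alpha>] by blast
    ultimately have "clopenin (level K \<alpha>) (proj \<theta> -` C \<inter> K \<alpha>)" by simp
    then have "measure D C = signed_half s \<mu> (cyl \<alpha> (proj \<theta> -` C \<inter> K \<alpha>))"
      using D[OF clopenin_borel_sets[OF C]] M(3) by simp
    moreover have "cyl \<alpha> (proj \<theta> -` C \<inter> K \<alpha>) = cyl \<theta> C"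
      using \<alpha> \<theta>(2) by (auto simp: cyl_def carrier_def proj_proj)
    ultimately show "measure D C = measure (level_measure s \<mu> \<theta>) C" using N(3)[OF C] by simp
  qed (fact N(1,2))+
  then show "measure (level_measure s \<mu> \<alpha>) (proj \<theta> -` A \<inter> K \<alpha>) = measure (level_measure s \<mu> \<theta>) A"
    using D[OF A] by simp
qed

lemma push_forward_trace:
  assumes \<theta>: "omega0 \<le> \<theta>" "\<theta> \<le> \<alpha>"
  shows "push_forward (level K \<alpha>) (level K \<theta>) (proj \<theta>) (trace \<mu> \<alpha>) = trace \<mu> \<theta>"
proof
  fix A
  have \<alpha>: "omega0 \<le> \<alpha>" using \<theta> by simp
  have s: "\<bar>1::real\<bar> = 1" "\<bar>-1::real\<bar> = 1" by simp_all
  show "push_forward (level K \<alpha>) (level K \<theta>) (proj \<theta>) (trace \<mu> \<alpha>) A = trace \<mu> \<theta> A"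
  proof (cases "A \<in> borel_sets (level K \<theta>)")
    case True
    note p = push_forward_level_measure[OF \<theta> s(1) True] push_forward_level_measure[OF \<theta> s(2) True]
    show ?thesis using True p
      by (simp add: push_forward_def trace_def signed_measure_def topspace_level[OF \<alpha>])
  qed (simp add: push_forward_def trace_def signed_measure_def)
qed

text \<open>The hypothesis \<open>W\<close> rules out cancellation: sign functions that nearly
  attain the norm of \<mu> are visible at level \<alpha>. The bound 1/2 of admissibility arises from
  2 \<mu>(W) >= 1 - \<epsilon> + \<mu>(1), where \<mu>(1) >= 0 by the choice of sign.\<close>

lemma mnorm_trace:
  assumes \<alpha>: "omega0 \<le> \<alpha>" and norm: "T.modulus \<mu> (\<lambda>x. 1) = 1"
    and W: "\<And>\<epsilon>. \<epsilon> > 0 \<Longrightarrow> \<exists>W. clopenin T W \<and> based \<alpha> W \<and> 1 - \<epsilon> \<le> 2 * \<mu> (indicator W) - \<mu> (\<lambda>x. 1)"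
  shows "mnorm (level K \<alpha>) (trace \<mu> \<alpha>) = 1"
    and "0 \<le> \<mu> (\<lambda>x. 1) \<Longrightarrow> 1/2 \<le> mnorm (level K \<alpha>) (pos_part (level K \<alpha>) (trace \<mu> \<alpha>))"
    and "\<And>V. clopenin T V \<Longrightarrow> based \<alpha> V \<Longrightarrow> (\<And>g. T.cm g \<Longrightarrow> \<mu> (\<lambda>x. indicator V x * g x) = \<mu> g) \<Longrightarrow>
      total_variation (level K \<alpha>) (trace \<mu> \<alpha>) (proj \<alpha> ` V) = 1"
proof -
  have top: "topspace (level K \<alpha>) = K \<alpha>" by (rule topspace_level[OF \<alpha>])
  have Kc: "clopenin (level K \<alpha>) (K \<alpha>)" using clopenin_topspace[of "level K \<alpha>"] by (simp add: top)
  have tv: "total_variation (level K \<alpha>) (trace \<mu> \<alpha>) (proj \<alpha> ` V) = 1"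
    if V: "clopenin T V" "based \<alpha> V" and supp: "\<And>g. T.cm g \<Longrightarrow> \<mu> (\<lambda>x. indicator V x * g x) = \<mu> g" for V
  proof (rule antisym)
    have Vc: "clopenin (level K \<alpha>) (proj \<alpha> ` V)" and Ve: "cyl \<alpha> (proj \<alpha> ` V) = V"
      using V(2) by (auto simp: based_def)
    have "T.modulus \<mu> (indicator V) \<le> T.modulus \<mu> (\<lambda>x. 1)"
      by (intro T.positive_functional_mono[OF T.positive_functional_modulus[OF \<mu>]] T.cm_indicator T.cm_const V(1))
        (simp add: indicator_def)
    then show "total_variation (level K \<alpha>) (trace \<mu> \<alpha>) (proj \<alpha> ` V) \<le> 1"
      using variation_clopen[OF \<alpha> Vc] norm by (simp add: Ve)
    show "1 \<le> total_variation (level K \<alpha>) (trace \<mu> \<alpha>) (proj \<alpha> ` V)"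
    proof (rule field_le_epsilon)
      fix \<epsilon> :: real assume "0 < \<epsilon>"
      then obtain W where W': "clopenin T W" "based \<alpha> W" "1 - \<epsilon> \<le> 2 * \<mu> (indicator W) - \<mu> (\<lambda>x. 1)" using W by blast
      have Wc: "clopenin (level K \<alpha>) (proj \<alpha> ` W)" and We: "cyl \<alpha> (proj \<alpha> ` W) = W"
        using W'(2) by (auto simp: based_def)
      have C: "clopenin T (topspace T - W)" by (rule clopenin_Diff[OF clopenin_topspace W'(1)])
      have 1: "\<mu> (indicator (V \<inter> W)) = \<mu> (indicator W)"
      proof -
        have "\<mu> (\<lambda>x. indicator V x * indicator W x) = \<mu> (indicator W)" by (rule supp[OF T.cm_indicator(1)[OF W'(1)]])
        then show ?thesis by (simp add: indicator_inter_arith[abs_def])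
      qed
      have 2: "\<mu> (indicator (V - W)) = \<mu> (\<lambda>x. 1) - \<mu> (indicator W)"
      proof -
        have "V - W = V \<inter> (topspace T - W)" using clopenin_subset[OF V(1)] by blast
        moreover have "\<mu> (\<lambda>x. indicator V x * indicator (topspace T - W) x) = \<mu> (indicator (topspace T - W))"
          by (rule supp[OF T.cm_indicator(1)[OF C]])
        ultimately show ?thesis using T.bounded_functional_indicator_compl[OF \<mu> W'(1)]
          by (simp add: indicator_inter_arith[abs_def])
      qed
      show "1 \<le> total_variation (level K \<alpha>) (trace \<mu> \<alpha>) (proj \<alpha> ` V) + \<epsilon>"
        using variation_clopen_ge[OF \<alpha> Vc Wc] W'(3) unfolding Ve We 1 2 by linarith
    qed
  qed
  \<comment> \<open>The norm of the trace is the case of \<open>tv\<close> in which V is the whole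
    space.\<close>
  have "proj \<alpha> ` topspace T = K \<alpha>"
    using carrier_surj[OF \<alpha>] \<alpha> by (force simp: topspace_T carrier_def)
  moreover have "based \<alpha> (topspace T)"
    unfolding based_def calculation by (simp add: Kc cyl_K[OF \<alpha>] topspace_T)
  moreover have "\<mu> (\<lambda>x. indicator (topspace T) x * g x) = \<mu> g" if "T.cm g" for g
    using that by (intro T.bounded_functional_cong[OF \<mu>] T.cm_ops T.cm_indicator clopenin_topspace) auto
  ultimately show "mnorm (level K \<alpha>) (trace \<mu> \<alpha>) = 1"
    using tv[of "topspace T"] by (simp add: mnorm_def top)
  show "1/2 \<le> mnorm (level K \<alpha>) (pos_part (level K \<alpha>) (trace \<mu> \<alpha>))" if "0 \<le> \<mu> (\<lambda>x. 1)"
  proof (rule field_le_epsilon)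
    interpret signed_pair "level K \<alpha>" "level_measure 1 \<mu> \<alpha>" "level_measure (-1) \<mu> \<alpha>"
      by (rule signed_pair_level_measure[OF \<alpha>])
    fix \<epsilon> :: real assume "0 < \<epsilon>"
    then obtain W where W': "based \<alpha> W" "1 - \<epsilon> \<le> 2 * \<mu> (indicator W) - \<mu> (\<lambda>x. 1)" using W by blast
    have Wc: "clopenin (level K \<alpha>) (proj \<alpha> ` W)" and We: "cyl \<alpha> (proj \<alpha> ` W) = W"
      using W'(1) by (auto simp: based_def)
    have "\<mu> (indicator W) \<le> mnorm (level K \<alpha>) (pos_part (level K \<alpha>) (trace \<mu> \<alpha>))"
      using mnorm_pos_part_ge[OF clopenin_borel_sets[OF Wc]] trace_clopen[OF \<alpha> Wc] We by (simp add: trace_def)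
    then show "1/2 \<le> mnorm (level K \<alpha>) (pos_part (level K \<alpha>) (trace \<mu> \<alpha>)) + \<epsilon>"
      using W'(2) \<open>0 \<le> \<mu> (\<lambda>x. 1)\<close> \<open>0 < \<epsilon>\<close> by linarith
  qed
  show "\<And>V. clopenin T V \<Longrightarrow> based \<alpha> V \<Longrightarrow> (\<And>g. T.cm g \<Longrightarrow> \<mu> (\<lambda>x. indicator V x * g x) = \<mu> g) \<Longrightarrow>
      total_variation (level K \<alpha>) (trace \<mu> \<alpha>) (proj \<alpha> ` V) = 1"
    by (rule tv)
qed

end

section \<open>Sequences of functionals on disjoint clopen sets\<close>

context
  fixes \<mu> :: "nat \<Rightarrow> (point \<Rightarrow> real) \<Rightarrow> real" and V :: "nat \<Rightarrow> point set"
  assumes \<mu>: "\<And>n. bounded_functional T 1 (\<mu> n)" and norm: "\<And>n. T.modulus (\<mu> n) (\<lambda>x. 1) = 1"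
    and nonneg: "\<And>n. 0 \<le> \<mu> n (\<lambda>x. 1)"
    and V: "\<And>n. clopenin T (V n)" "disjoint_family V"
    and supp: "\<And>n g. T.cm g \<Longrightarrow> \<mu> n (\<lambda>x. indicator (V n) x * g x) = \<mu> n g"
begin

text \<open>The sets V n and the norm witnesses W n j, with errors 1/(j+1), are countably many
  clopen sets and hence cylinders over one countable level \<beta>. There the V n occur in the
  enumeration as U \<beta> \<gamma>, and cofinality of the schedule yields \<theta> >= \<beta> with
  \<eta> \<theta> = (\<beta>, \<gamma>). The traces at \<theta> are then admissible, which gives
  \<delta>; the traces at higher levels are norm-one lifts of them.\<close>

lemma admissible_sequence:
  "\<exists>\<theta> \<delta>. omega0 \<le> \<theta> \<and> (\<forall>\<alpha> n. \<theta> \<le> \<alpha> \<longrightarrow> trace (\<mu> n) \<alpha> \<in> Bset K \<nu> \<theta> \<delta> \<alpha> n)"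
proof -
  define P where "P n j W \<longleftrightarrow> clopenin T W \<and> 1 - 1 / real (Suc j) \<le> 2 * \<mu> n (indicator W) - \<mu> n (\<lambda>x. 1)" for n j W
  have "\<exists>W. P n j W" for n j
  proof (rule T.modulus_one_clopen[OF \<mu>, of "1 / real (Suc j)" n])
    fix W assume "clopenin T W" "T.modulus (\<mu> n) (\<lambda>x. 1) - 1 / real (Suc j) \<le> 2 * \<mu> n (indicator W) - \<mu> n (\<lambda>x. 1)"
    then have "P n j W" using norm[of n] by (simp add: P_def)
    then show ?thesis by blast
  qed simp
  then obtain W where "\<And>n j. P n j (W n j)" by metis
  then have W: "\<And>n j. clopenin T (W n j)"
    "\<And>n j. 1 - 1 / real (Suc j) \<le> 2 * \<mu> n (indicator (W n j)) - \<mu> n (\<lambda>x. 1)" by (simp_all add: P_def)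
  define based_on where "based_on F C \<longleftrightarrow> (\<forall>\<alpha>. omega0 \<le> \<alpha> \<longrightarrow> F \<subseteq> {..<\<alpha>} \<longrightarrow> based \<alpha> C)" for F C
  have ex: "\<exists>F. finite F \<and> based_on F C" if C: "clopenin T C" for C
  proof (rule clopen_is_cyl[OF C])
    fix F :: "omega1 set"
    assume "finite F" "\<And>\<alpha>. omega0 \<le> \<alpha> \<Longrightarrow> F \<subseteq> {..<\<alpha>} \<Longrightarrow> clopenin (level K \<alpha>) (proj \<alpha> ` C) \<and> cyl \<alpha> (proj \<alpha> ` C) = C"
    then show ?thesis unfolding based_on_def based_def by blast
  qed
  obtain F where F: "\<And>n. finite (F n)" "\<And>n. based_on (F n) (V n)" using ex[OF V(1)] by metis
  obtain G where G: "\<And>n j. finite (G n j)" "\<And>n j. based_on (G n j) (W n j)" using ex[OF W(1)] by metis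
  define A where "A = (\<Union>n. F n) \<union> (\<Union>n. \<Union>j. G n j)"
  have "countable A" unfolding A_def using F(1) G(1) by (intro countable_Un countable_UN) (auto intro: countable_finite)
  then obtain \<beta> where \<beta>: "omega0 \<le> \<beta>" "\<And>a. a \<in> A \<Longrightarrow> a < \<beta>" using countable_bounded_omega1 by metis
  have bV: "based \<alpha> (V n)" and bW: "based \<alpha> (W n j)" if "\<beta> \<le> \<alpha>" for \<alpha> n j
  proof -
    have "omega0 \<le> \<alpha>" using that \<beta> by simp
    have "a < \<alpha>" if "a \<in> A" for a using \<beta>(2)[OF that] \<open>\<beta> \<le> \<alpha>\<close> by simp
    then have "F n \<subseteq> {..<\<alpha>}" "G n j \<subseteq> {..<\<alpha>}" unfolding A_def by blast+
    then show "based \<alpha> (V n)" "based \<alpha> (W n j)" using F(2) G(2) \<open>omega0 \<le> \<alpha>\<close> unfolding based_on_def by blast+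
  qed
  have VC: "V n \<subseteq> carrier" for n using clopenin_subset[OF V(1)] by (simp add: topspace_T)
  have V_ne: "V n \<noteq> {}" for n
  proof
    assume "V n = {}"
    have "\<mu> n h \<le> 0" if "T.cm h" for h
      using supp[OF that, of n] T.bounded_functional_simps(5)[OF \<mu>] \<open>V n = {}\<close> by simp
    then have "T.modulus (\<mu> n) (\<lambda>x. 1) \<le> 0" by (intro T.modulus_least[OF \<mu>]) auto
    then show False using norm[of n] by simp
  qed
  have "(\<lambda>n. proj \<beta> ` V n) \<in> {u. disjoint_family u \<and>
    (\<forall>n. u n \<noteq> {} \<and> openin (level K \<beta>) (u n) \<and> closedin (level K \<beta>) (u n))}"
  proof (intro CollectI conjI allI)
    show "disjoint_family (\<lambda>n. proj \<beta> ` V n)"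
      unfolding disjoint_family_on_def
    proof (intro ballI impI)
      fix m n :: nat assume "m \<noteq> n"
      have e: "cyl \<beta> (proj \<beta> ` V k) = V k" for k using bV[of \<beta> k] by (simp add: based_def)
      have "s \<notin> proj \<beta> ` V n" if s: "s \<in> proj \<beta> ` V m" for s
      proof
        assume s': "s \<in> proj \<beta> ` V n"
        obtain t where "t \<in> V m" "s = proj \<beta> t" using s by blast
        then have "t \<in> cyl \<beta> (proj \<beta> ` V n)" using s' VC[of m] by (auto simp: cyl_def)
        then have "t \<in> V m \<inter> V n" using e[of n] \<open>t \<in> V m\<close> by simp
        then show False using V(2) \<open>m \<noteq> n\<close> unfolding disjoint_family_on_def by blast
      qed
      then show "proj \<beta> ` V m \<inter> proj \<beta> ` V n = {}" by blast
    qed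
    show "proj \<beta> ` V n \<noteq> {}" for n using V_ne[of n] by simp
    show "openin (level K \<beta>) (proj \<beta> ` V n)" "closedin (level K \<beta>) (proj \<beta> ` V n)" for n
      using bV[of \<beta> n] by (simp_all add: based_def clopenin_def)
  qed
  then have "(\<lambda>n. proj \<beta> ` V n) \<in> range (U \<beta>)" unfolding U_enum[OF \<beta>(1)] .
  then obtain \<gamma> where \<gamma>: "U \<beta> \<gamma> = (\<lambda>n. proj \<beta> ` V n)" by (metis imageE)
  obtain \<theta> where \<theta>: "\<beta> \<le> \<theta>" "\<eta> \<theta> = (\<beta>, \<gamma>)" using eta_cofinal[OF \<beta>(1), of \<beta> \<gamma>] by blast
  have o\<theta>: "omega0 \<le> \<theta>" using \<theta>(1) \<beta>(1) by simp
  have Vset: "Vset K \<eta> U \<theta> \<theta> n = proj \<theta> ` V n" for n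
  proof
    show "Vset K \<eta> U \<theta> \<theta> n \<subseteq> proj \<theta> ` V n"
    proof
      fix s assume "s \<in> Vset K \<eta> U \<theta> \<theta> n"
      then have s: "proj \<beta> s \<in> proj \<beta> ` V n" "s \<in> K \<theta>" by (auto simp: Vset_def \<theta>(2) \<gamma>)
      obtain t where t: "t \<in> carrier" "proj \<theta> t = s" using carrier_surj[OF o\<theta> s(2)] by blast
      then have "t \<in> cyl \<beta> (proj \<beta> ` V n)" using s(1) proj_proj[OF \<theta>(1), of t] by (simp add: cyl_def)
      then have "t \<in> V n" using bV[of \<beta> n] by (simp add: based_def)
      then show "s \<in> proj \<theta> ` V n" using t by blast
    qed
    show "proj \<theta> ` V n \<subseteq> Vset K \<eta> U \<theta> \<theta> n"
      using VC[of n] o\<theta> \<theta>(1) by (auto simp: Vset_def \<theta>(2) \<gamma> carrier_def proj_proj)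
  qed
  have wit: "\<exists>C. clopenin T C \<and> based \<alpha> C \<and> 1 - \<epsilon> \<le> 2 * \<mu> n (indicator C) - \<mu> n (\<lambda>x. 1)"
    if \<alpha>: "\<theta> \<le> \<alpha>" and \<epsilon>: "\<epsilon> > 0" for \<alpha> n \<epsilon>
  proof -
    obtain j where j: "1 / real (Suc j) < \<epsilon>" using nat_approx_posE[OF \<epsilon>] by blast
    have "\<beta> \<le> \<alpha>" using \<alpha> \<theta>(1) by simp
    then show ?thesis using W(1)[of n j] W(2)[where n=n and j=j] bW[of \<alpha> n j] j by (intro exI[of _ "W n j"]) auto
  qed
  have mn: "mnorm (level K \<alpha>) (trace (\<mu> n) \<alpha>) = 1" if \<alpha>: "\<theta> \<le> \<alpha>" for \<alpha> n
    by (rule mnorm_trace(1)[OF \<mu> order_trans[OF o\<theta> \<alpha>] norm]) (rule wit[OF \<alpha>])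
  have "admissible (level K \<theta>) (Vset K \<eta> U \<theta> \<theta>) (\<lambda>n. trace (\<mu> n) \<theta>)"
    unfolding admissible_def Vset
  proof (intro allI conjI)
    fix n
    show "trace (\<mu> n) \<theta> \<in> radon_measures (level K \<theta>)" by (rule radon_trace[OF \<mu> o\<theta>])
    show "mnorm (level K \<theta>) (trace (\<mu> n) \<theta>) = 1" by (rule mn) simp
    show "total_variation (level K \<theta>) (trace (\<mu> n) \<theta>) (proj \<theta> ` V n) = 1"
      by (rule mnorm_trace(3)[OF \<mu> o\<theta> norm wit V(1) bV[OF \<theta>(1)] supp]) simp_all
    show "1/2 \<le> mnorm (level K \<theta>) (pos_part (level K \<theta>) (trace (\<mu> n) \<theta>))"
      by (rule mnorm_trace(2)[OF \<mu> o\<theta> norm wit nonneg]) simp_all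
  qed
  then have "(\<lambda>n. trace (\<mu> n) \<theta>) \<in> range (\<nu> \<theta>)" unfolding nu_enum[OF o\<theta>] by simp
  then obtain \<delta> where \<delta>: "\<nu> \<theta> \<delta> = (\<lambda>n. trace (\<mu> n) \<theta>)" by (metis imageE)
  have "trace (\<mu> n) \<alpha> \<in> Bset K \<nu> \<theta> \<delta> \<alpha> n" if \<alpha>: "\<theta> \<le> \<alpha>" for \<alpha> n
    unfolding Bset_def
    using radon_trace[OF \<mu> order_trans[OF o\<theta> \<alpha>]] mn[OF \<alpha>] push_forward_trace[OF \<mu> o\<theta> \<alpha>]
    by (simp add: \<delta>)
  with o\<theta> show ?thesis by blast
qed

text \<open>At a stage \<alpha>' scheduled for (\<theta>, \<delta>) the set in (G) is the one on
  which the new coordinate \<alpha>' equals 1. It is clopen, so its cylinder in T can serve as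
  C.\<close>

lemma oscillation:
  obtains C where "clopenin T C" "infinite {n. 1/6 \<le> \<mu> n (indicator C)}" "infinite {n. \<mu> n (indicator C) = 0}"
proof -
  obtain \<theta> \<delta> where \<theta>: "omega0 \<le> \<theta>" and B: "\<And>\<alpha> n. \<theta> \<le> \<alpha> \<Longrightarrow> trace (\<mu> n) \<alpha> \<in> Bset K \<nu> \<theta> \<delta> \<alpha> n"
    using admissible_sequence by blast
  obtain \<alpha>' where \<alpha>': "\<theta> \<le> \<alpha>'" "\<eta> \<alpha>' = (\<theta>, \<delta>)" using eta_cofinal[OF \<theta>, of \<theta> \<delta>] by blast
  define \<alpha> where "\<alpha> = osuc \<alpha>'"
  have o: "omega0 \<le> \<alpha>'" "\<theta> \<le> \<alpha>" "omega0 \<le> \<alpha>" using \<theta> \<alpha>'(1) less_osuc[of \<alpha>'] by (auto simp: \<alpha>_def)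
  have "app1 \<alpha>' (Z \<alpha>') = {t \<in> K \<alpha>. t \<alpha>' = True}"
    unfolding \<alpha>_def K_suc[OF o(1)] by (auto simp: app0_def app1_def)
  moreover have "clopenin (level K \<alpha>) {t \<in> K \<alpha>. t \<alpha>' = True}"
    unfolding level_def by (rule clopenin_coordinate[OF K_ext[OF o(3)]]) (simp add: \<alpha>_def less_osuc)
  ultimately have c: "clopenin (level K \<alpha>) (app1 \<alpha>' (Z \<alpha>'))" by simp
  have eq: "trace (\<mu> n) \<alpha> (app1 \<alpha>' (Z \<alpha>')) = \<mu> n (indicator (cyl \<alpha> (app1 \<alpha>' (Z \<alpha>'))))" for n
    by (rule trace_clopen[OF \<mu> o(3) c])
  have "infinite {n. 1/6 \<le> trace (\<mu> n) \<alpha> (app1 \<alpha>' (Z \<alpha>'))} \<and> infinite {n. trace (\<mu> n) \<alpha> (app1 \<alpha>' (Z \<alpha>')) = 0}"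
    by (rule cond_G[OF o(1) \<alpha>_def \<alpha>'(2)]) (rule B[OF o(2)])
  then show thesis using that[OF clopenin_cyl[OF o(3) c]] unfolding eq by blast
qed

text \<open>A finite family of clopen sets is based on one countable level \<alpha> above \<theta>
  and \<delta>, where the single index set J \<theta> \<delta> \<alpha> makes all of them converge.
  H depends on the family through \<alpha>, whereas N0 and N1 do not.\<close>

lemma common_cluster:
  obtains N M where "N \<inter> M = {}" "\<And>\<W>. finite \<W> \<Longrightarrow> (\<And>W. W \<in> \<W> \<Longrightarrow> clopenin T W) \<Longrightarrow>
    \<exists>H. infinite (H \<inter> N) \<and> infinite (H \<inter> M) \<and>
      (\<forall>W\<in>\<W>. \<exists>l. ((\<lambda>n. \<mu> n (indicator W)) \<longlongrightarrow> l) (inf sequentially (principal H)))"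
proof -
  obtain \<theta> \<delta> where \<theta>: "omega0 \<le> \<theta>" and B: "\<And>\<alpha> n. \<theta> \<le> \<alpha> \<Longrightarrow> trace (\<mu> n) \<alpha> \<in> Bset K \<nu> \<theta> \<delta> \<alpha> n"
    using admissible_sequence by blast
  have main: "\<exists>H. infinite (H \<inter> N0 \<theta> \<delta>) \<and> infinite (H \<inter> N1 \<theta> \<delta>) \<and>
      (\<forall>W\<in>\<W>. \<exists>l. ((\<lambda>n. \<mu> n (indicator W)) \<longlongrightarrow> l) (inf sequentially (principal H)))"
    if \<W>: "finite \<W>" "\<And>W. W \<in> \<W> \<Longrightarrow> clopenin T W" for \<W>
  proof -
    have ex: "\<exists>F. finite F \<and> (\<forall>\<alpha>. omega0 \<le> \<alpha> \<longrightarrow> F \<subseteq> {..<\<alpha>} \<longrightarrow> based \<alpha> C)" if C: "clopenin T C" for C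
    proof (rule clopen_is_cyl[OF C])
      fix F :: "omega1 set"
      assume "finite F" "\<And>\<alpha>. omega0 \<le> \<alpha> \<Longrightarrow> F \<subseteq> {..<\<alpha>} \<Longrightarrow> clopenin (level K \<alpha>) (proj \<alpha> ` C) \<and> cyl \<alpha> (proj \<alpha> ` C) = C"
      then show ?thesis unfolding based_def by blast
    qed
    have "\<forall>W\<in>\<W>. \<exists>F. finite F \<and> (\<forall>\<alpha>. omega0 \<le> \<alpha> \<longrightarrow> F \<subseteq> {..<\<alpha>} \<longrightarrow> based \<alpha> W)" using ex \<W>(2) by blast
    from bchoice[OF this] obtain F where
      F: "\<forall>W\<in>\<W>. finite (F W) \<and> (\<forall>\<alpha>. omega0 \<le> \<alpha> \<longrightarrow> F W \<subseteq> {..<\<alpha>} \<longrightarrow> based \<alpha> W)" ..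
    have "finite ((\<Union>W\<in>\<W>. F W) \<union> {\<theta>, \<delta>})" using F \<W>(1) by simp
    then obtain \<alpha> where \<alpha>: "omega0 \<le> \<alpha>" "\<And>a. a \<in> (\<Union>W\<in>\<W>. F W) \<union> {\<theta>, \<delta>} \<Longrightarrow> a < \<alpha>"
      using countable_bounded_omega1[OF countable_finite] by metis
    have lt: "\<theta> < \<alpha>" "\<delta> < \<alpha>" using \<alpha>(2) by simp_all
    have "weak_star_limit_exists_along (level K \<alpha>) (J \<theta> \<delta> \<alpha>) (\<lambda>n. trace (\<mu> n) \<alpha>)"
      by (rule cond_F[OF \<theta> lt]) (rule B[OF less_imp_le[OF lt(1)]])
    then obtain \<kappa> where \<kappa>: "\<And>f. f \<in> vcarrier (Cont (level K \<alpha>)) \<Longrightarrow>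
        ((\<lambda>n. signed_integral (level K \<alpha>) (trace (\<mu> n) \<alpha>) f) \<longlongrightarrow> signed_integral (level K \<alpha>) \<kappa> f)
          (inf sequentially (principal (J \<theta> \<delta> \<alpha>)))"
      unfolding weak_star_limit_exists_along_def by blast
    have "\<exists>l. ((\<lambda>n. \<mu> n (indicator W)) \<longlongrightarrow> l) (inf sequentially (principal (J \<theta> \<delta> \<alpha>)))" if W: "W \<in> \<W>" for W
    proof -
      have "F W \<subseteq> {..<\<alpha>}" using \<alpha>(2) W by blast
      then have "based \<alpha> W" using F W \<alpha>(1) by blast
      then have c: "clopenin (level K \<alpha>) (proj \<alpha> ` W)" "cyl \<alpha> (proj \<alpha> ` W) = W" by (auto simp: based_def)
      define f :: "point \<Rightarrow> real" where "f = restrict (indicator (proj \<alpha> ` W)) (topspace (level K \<alpha>))"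
      have "continuous_map (level K \<alpha>) euclideanreal f"
        unfolding f_def using continuous_map_indicator[OF c(1)] by (rule continuous_map_eq) simp
      then have "f \<in> vcarrier (Cont (level K \<alpha>))" by (simp add: Cont_def f_def)
      from \<kappa>[OF this] show ?thesis
        using signed_integral_trace[OF \<mu> \<alpha>(1) c(1)] c(2) unfolding f_def by auto
    qed
    moreover have "infinite (J \<theta> \<delta> \<alpha> \<inter> N0 \<theta> \<delta>) \<and> infinite (J \<theta> \<delta> \<alpha> \<inter> N1 \<theta> \<delta>)"
      by (rule cond_C[OF \<theta> lt])
    ultimately show ?thesis by blast
  qed
  show thesis by (rule that[OF cond_B[OF \<theta>]]) (rule main)
qed

end

end


section \<open>Norms of functionals\<close>

context compact_top
begin

lemma finite_cm_bounded:
  assumes "finite \<G>" "\<forall>g\<in>\<G>. cm g"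
  obtains S where "1 \<le> S" "\<And>g x. g \<in> \<G> \<Longrightarrow> x \<in> topspace X \<Longrightarrow> \<bar>g x\<bar> \<le> S"
proof -
  have "\<exists>S\<ge>1. \<forall>g\<in>\<G>. \<forall>x\<in>topspace X. \<bar>g x\<bar> \<le> S"
    using assms
  proof (induction \<G> rule: finite_induct)
    case (insert g \<G>)
    then obtain S where S: "1 \<le> S" "\<forall>g\<in>\<G>. \<forall>x\<in>topspace X. \<bar>g x\<bar> \<le> S" by auto
    obtain s where s: "0 \<le> s" "\<And>x. x \<in> topspace X \<Longrightarrow> \<bar>g x\<bar> \<le> s" using cm_bounded[of g] insert.prems by blast
    show ?case using S s by (intro exI[of _ "max s S"]) (auto simp: le_max_iff_disj)
  qed auto
  then show thesis using that by blast
qed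

lemma bounded_functional_restrict:
  assumes \<phi>: "bounded_functional X b \<phi>" and V: "clopenin X V"
  shows "bounded_functional X b (\<lambda>g. \<phi> (\<lambda>x. indicator V x * g x))"
proof -
  note s = bounded_functional_simps[OF \<phi>]
  have c: "cm (\<lambda>x. indicator V x * g x)" if "cm g" for g
    by (rule cm_ops(3)[OF cm_indicator(2)[OF V] that])
  have "(\<lambda>x. indicator V x * (f x + g x)) = (\<lambda>x. indicator V x * f x + indicator V x * g x)"
    "(\<lambda>x. indicator V x * (a * f x)) = (\<lambda>x. a * (indicator V x * f x))" for f g and a :: real
    by (auto simp: algebra_simps)
  moreover have "\<bar>\<phi> (\<lambda>x. indicator V x * f x)\<bar> \<le> b * t" if "cm f" "0 \<le> t" "\<forall>x\<in>topspace X. \<bar>f x\<bar> \<le> t" for f t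
    by (rule bounded_functionalD[OF \<phi> c[OF that(1)] that(2)]) (use that in \<open>auto simp: indicator_def\<close>)
  ultimately show ?thesis unfolding bounded_functional_def linear_functional_def using c by (simp add: s)
qed

lemma bounded_functional_scale:
  assumes \<phi>: "bounded_functional X b \<phi>"
  shows "bounded_functional X (\<bar>a\<bar> * b) (\<lambda>g. a * \<phi> g)"
proof -
  have "\<bar>a * \<phi> f\<bar> \<le> \<bar>a\<bar> * b * t" if "cm f" "0 \<le> t" "\<forall>x\<in>topspace X. \<bar>f x\<bar> \<le> t" for f t
    using mult_left_mono[OF bounded_functionalD[OF \<phi> that(1,2)], of "\<bar>a\<bar>"] that(3) by (simp add: abs_mult mult.assoc)
  then show ?thesis unfolding bounded_functional_def linear_functional_def
    by (simp add: bounded_functional_simps[OF \<phi>] algebra_simps)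
qed

lemma bounded_functional_diff:
  assumes \<phi>: "bounded_functional X b \<phi>" and \<psi>: "bounded_functional X c \<psi>"
  shows "bounded_functional X (b + c) (\<lambda>g. \<phi> g - \<psi> g)"
proof -
  have "\<bar>\<phi> f - \<psi> f\<bar> \<le> (b + c) * t" if "cm f" "0 \<le> t" "\<forall>x\<in>topspace X. \<bar>f x\<bar> \<le> t" for f t
    using bounded_functionalD[OF \<phi> that(1,2)] bounded_functionalD[OF \<psi> that(1,2)] that(3)
    by (simp add: distrib_right)
  then show ?thesis unfolding bounded_functional_def linear_functional_def
    by (simp add: bounded_functional_simps[OF \<phi>] bounded_functional_simps[OF \<psi>] algebra_simps)
qed

lemma bounded_functional_mono:
  assumes "bounded_functional X b \<phi>" "b \<le> c" shows "bounded_functional X c \<phi>"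
  using assms unfolding bounded_functional_def by (meson mult_right_mono order_trans)

lemma modulus_one_nonneg:
  assumes "bounded_functional X b \<phi>" shows "0 \<le> modulus \<phi> (\<lambda>x. 1)"
  by (rule positive_functional_nonneg[OF positive_functional_modulus[OF assms]]) auto

lemma bounded_functional_modulus_one:
  assumes \<phi>: "bounded_functional X b \<phi>" shows "bounded_functional X (modulus \<phi> (\<lambda>x. 1)) \<phi>"
  unfolding bounded_functional_def
proof (intro conjI allI impI)
  fix f t assume f: "cm f" "0 \<le> (t::real)" "\<forall>x\<in>topspace X. \<bar>f x\<bar> \<le> t"
  have "\<bar>\<phi> f\<bar> \<le> modulus \<phi> (\<lambda>x. t * 1)" using f by (intro modulus_upper[OF \<phi>]) auto
  also have "\<dots> = t * modulus \<phi> (\<lambda>x. 1)"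
    by (rule positive_functional_simps(3)[OF positive_functional_modulus[OF \<phi>] cm_const])
  finally show "\<bar>\<phi> f\<bar> \<le> modulus \<phi> (\<lambda>x. 1) * t" by (simp add: mult.commute)
qed (rule bounded_functional_linear[OF \<phi>])

lemma modulus_one_le:
  assumes "bounded_functional X b \<phi>" shows "modulus \<phi> (\<lambda>x. 1) \<le> b"
  using modulus_le[OF assms, of "\<lambda>x. 1" 1] by simp

lemma modulus_one_scale:
  assumes \<phi>: "bounded_functional X b \<phi>"
  shows "modulus (\<lambda>g. a * \<phi> g) (\<lambda>x. 1) = \<bar>a\<bar> * modulus \<phi> (\<lambda>x. 1)"
proof -
  have le: "modulus (\<lambda>g. a * \<phi> g) (\<lambda>x. 1) \<le> \<bar>a\<bar> * modulus \<phi> (\<lambda>x. 1)"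
    if \<phi>: "bounded_functional X b \<phi>" for a b \<phi>
    by (rule modulus_one_le[OF bounded_functional_scale[OF bounded_functional_modulus_one[OF that]]])
  show ?thesis
  proof (cases "a = 0")
    case True
    then show ?thesis
      using le[OF \<phi>, of 0] modulus_one_nonneg[OF bounded_functional_scale[OF \<phi>], of 0] by simp
  next
    case False
    have "(\<lambda>g. (1 / a) * (a * \<phi> g)) = \<phi>" using False by simp
    then have "modulus \<phi> (\<lambda>x. 1) \<le> \<bar>1 / a\<bar> * modulus (\<lambda>g. a * \<phi> g) (\<lambda>x. 1)"
      using le[OF bounded_functional_scale[OF \<phi>, of a], of "1 / a"] by simp
    then show ?thesis using le[OF \<phi>, of a] False by (simp add: field_simps)
  qed
qed

lemma point_evaluation:
  assumes "x \<in> topspace X"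
  shows "bounded_functional X 1 (\<lambda>f. f x)" "modulus (\<lambda>f. f x) (\<lambda>x. 1) = 1"
proof -
  show b: "bounded_functional X 1 (\<lambda>f. f x)"
    unfolding bounded_functional_def linear_functional_def using assms by simp
  show "modulus (\<lambda>f. f x) (\<lambda>x. 1) = 1"
    using modulus_one_le[OF b] modulus_upper[OF b, of "\<lambda>x. 1" "\<lambda>x. 1"] by simp
qed

text \<open>Banach-Steinhaus by a gliding hump. The k-th step has sup norm at most 3^-k and leaves
  the k-th chosen functional with absolute value at least (2/3) 3^-k times its norm. All later steps
  together have sup norm at most (1/2) 3^-k, so a sixth of 3^-k times the norm survives; the factor
  6 * 3^k in the choice of \<open>n\<close> makes this exceed k.\<close>

lemma uniform_boundedness:
  assumes bf: "\<And>n::nat. bounded_functional X (b n) (\<phi> n)"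
    and pt: "\<And>f. cm f \<Longrightarrow> \<exists>c. \<forall>n. \<bar>\<phi> n f\<bar> \<le> c"
  shows "\<exists>B. \<forall>n. bounded_functional X B (\<phi> n)"
proof -
  define N where "N n = modulus (\<phi> n) (\<lambda>x. 1)" for n
  have bN: "bounded_functional X (N n) (\<phi> n)" for n
    unfolding N_def by (rule bounded_functional_modulus_one[OF bf])
  have "\<exists>B. \<forall>n. N n \<le> B"
  proof (rule ccontr)
    assume "\<nexists>B. \<forall>n. N n \<le> B"
    then have "\<forall>k. \<exists>n. 6 * 3 ^ k * (real k + 1) < N n" by (meson not_le)
    then obtain n where n: "\<And>k. 6 * 3 ^ k * (real k + 1) < N (n k)" by metis
    have pos: "0 < N (n k)" for k
    proof -
      have "0 < 6 * 3 ^ k * (real k + 1)" by (simp add: add_nonneg_pos)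
      then show ?thesis using n[of k] by linarith
    qed
    have hex: "\<exists>h. cm h \<and> (\<forall>x\<in>topspace X. \<bar>h x\<bar> \<le> 1) \<and> (2/3) * N (n k) < \<phi> (n k) h" for k
    proof (rule ccontr)
      assume neg: "\<not> ?thesis"
      have "modulus (\<phi> (n k)) (\<lambda>x. 1) \<le> (2/3) * N (n k)"
      proof (rule modulus_least[OF bf])
        fix h assume "cm h" "\<And>x. x \<in> topspace X \<Longrightarrow> \<bar>h x\<bar> \<le> 1"
        then show "\<phi> (n k) h \<le> (2/3) * N (n k)" using neg by (meson not_le)
      qed auto
      then show False using pos[of k] unfolding N_def by linarith
    qed
    have "\<exists>x. \<forall>k. cm (x k) \<and> ((\<forall>y\<in>topspace X. \<bar>x (Suc k) y - x k y\<bar> \<le> (1/3) ^ k) \<and>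
        (1/3) ^ k * ((2/3) * N (n k)) \<le> \<bar>\<phi> (n k) (x (Suc k))\<bar>)"
    proof (rule dependent_nat_choice)
      fix x k assume x: "cm x"
      obtain h where h: "cm h" "\<And>y. y \<in> topspace X \<Longrightarrow> \<bar>h y\<bar> \<le> 1" "(2/3) * N (n k) < \<phi> (n k) h"
        using hex[of k] by blast
      define v where "v y = (1/3) ^ k * h y" for y
      have v: "cm v" unfolding v_def[abs_def] by (rule cm_ops(3)[OF cm_const h(1)])
      have vle: "\<bar>v y\<bar> \<le> (1/3) ^ k" if "y \<in> topspace X" for y
        using h(2)[OF that] by (simp add: v_def abs_mult mult_left_le)
      have "\<phi> (n k) v = (1/3) ^ k * \<phi> (n k) h"
        unfolding v_def[abs_def] by (rule bounded_functional_simps(3)[OF bf h(1)])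
      then have big: "(1/3) ^ k * ((2/3) * N (n k)) \<le> \<phi> (n k) v" using h(3) by (simp add: less_imp_le)
      have "\<phi> (n k) (\<lambda>y. x y + v y) = \<phi> (n k) x + \<phi> (n k) v" "\<phi> (n k) (\<lambda>y. x y - v y) = \<phi> (n k) x - \<phi> (n k) v"
        by (rule bounded_functional_simps(1)[OF bf x v], rule bounded_functional_simps(2)[OF bf x v])
      \<comment> \<open>The values at x + v and x - v differ by twice the value at v, so one of them
        has at least that absolute value.\<close>
      then have "\<phi> (n k) v \<le> \<bar>\<phi> (n k) (\<lambda>y. x y + v y)\<bar> \<or> \<phi> (n k) v \<le> \<bar>\<phi> (n k) (\<lambda>y. x y - v y)\<bar>" by linarith
      then show "\<exists>y. cm y \<and> ((\<forall>z\<in>topspace X. \<bar>y z - x z\<bar> \<le> (1/3) ^ k) \<and>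
          (1/3) ^ k * ((2/3) * N (n k)) \<le> \<bar>\<phi> (n k) y\<bar>)"
      proof
        assume "\<phi> (n k) v \<le> \<bar>\<phi> (n k) (\<lambda>y. x y + v y)\<bar>"
        then show ?thesis using big vle cm_ops(1)[OF x v] by (intro exI[of _ "\<lambda>y. x y + v y"]) auto
      next
        assume "\<phi> (n k) v \<le> \<bar>\<phi> (n k) (\<lambda>y. x y - v y)\<bar>"
        then show ?thesis using big vle cm_ops(2)[OF x v] by (intro exI[of _ "\<lambda>y. x y - v y"]) auto
      qed
    qed (rule exI[of _ "\<lambda>x. 0"], simp)
    then obtain x where cx: "\<And>k. cm (x k)"
      and step: "\<And>k y. y \<in> topspace X \<Longrightarrow> \<bar>x (Suc k) y - x k y\<bar> \<le> (1/3) ^ k"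
      and large: "\<And>k. (1/3) ^ k * ((2/3) * N (n k)) \<le> \<bar>\<phi> (n k) (x (Suc k))\<bar>" by blast
    have tail: "\<bar>x (k + p) y - x k y\<bar> \<le> (3/2) * (1/3) ^ k * (1 - (1/3) ^ p)" if y: "y \<in> topspace X" for k p y
    proof (induction p)
      case (Suc p)
      have "(3/2) * (1/3) ^ k * (1 - (1/3) ^ p) + (1/3) ^ (k + p) = (3/2) * (1/3::real) ^ k * (1 - (1/3) ^ Suc p)"
        by (simp add: power_add field_simps)
      then show ?case using Suc.IH step[OF y, of "k + p"] unfolding add_Suc_right by linarith
    qed simp
    have tail': "\<bar>x m y - x k y\<bar> \<le> (3/2) * (1/3) ^ k" if "y \<in> topspace X" "k \<le> m" for k m y
    proof -
      have "(3/2) * (1/3) ^ k * (1 - (1/3) ^ (m - k)) \<le> (3/2) * (1/3::real) ^ k * 1"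
        by (intro mult_left_mono) auto
      moreover have "k + (m - k) = m" using that(2) by simp
      ultimately show ?thesis using tail[OF that(1), of k "m - k"] by (simp only: mult_1_right)
    qed
    have small: "\<exists>k. (3/2) * (1/3::real) ^ k < e" if "e > 0" for e
    proof -
      have "(\<lambda>k. (3/2) * (1/3::real) ^ k) \<longlonglongrightarrow> (3/2) * 0" by (intro tendsto_mult tendsto_const LIMSEQ_power_zero) simp
      then have "\<forall>\<^sub>F k in sequentially. (3/2) * (1/3::real) ^ k < e" using that by (intro order_tendstoD) auto
      then show ?thesis by (auto simp: eventually_sequentially)
    qed
    have Cau: "Cauchy (\<lambda>k. x k y)" if y: "y \<in> topspace X" for y
    proof (rule CauchyI)
      fix e :: real assume "e > 0"
      then obtain k where k: "(3/2) * (1/3::real) ^ k < e / 2" using small[of "e/2"] by auto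
      have "norm (x m y - x l y) < e" if "m \<ge> k" "l \<ge> k" for m l
        using tail'[OF y that(1)] tail'[OF y that(2)] k by (simp add: abs_if split: if_splits)
      then show "\<exists>M. \<forall>m\<ge>M. \<forall>l\<ge>M. norm (x m y - x l y) < e" by blast
    qed
    define g where "g y = lim (\<lambda>k. x k y)" for y
    have lim: "(\<lambda>k. x k y) \<longlonglongrightarrow> g y" if "y \<in> topspace X" for y
      unfolding g_def using Cau[OF that] by (simp add: Cauchy_convergent_iff convergent_LIMSEQ_iff)
    have gx: "\<bar>g y - x k y\<bar> \<le> (3/2) * (1/3) ^ k" if y: "y \<in> topspace X" for k y
    proof (rule LIMSEQ_le_const2)
      show "(\<lambda>m. \<bar>x m y - x k y\<bar>) \<longlonglongrightarrow> \<bar>g y - x k y\<bar>" by (intro tendsto_intros lim[OF y])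
      show "\<exists>M. \<forall>m\<ge>M. \<bar>x m y - x k y\<bar> \<le> (3/2) * (1/3) ^ k" using tail'[OF y] by blast
    qed
    have cg: "cm g"
    proof -
      have "continuous_map X Met_TC.mtopology g"
      proof (rule Met_TC.continuous_map_uniform_limit[where F = sequentially and f = x])
        show "\<forall>\<^sub>F k in sequentially. continuous_map X Met_TC.mtopology (x k)" using cx by simp
        show "\<forall>\<^sub>F k in sequentially. \<forall>y\<in>topspace X. g y \<in> UNIV \<and> dist (x k y) (g y) < e" if e: "e > 0" for e
        proof -
          obtain k where k: "(3/2) * (1/3::real) ^ k < e" using small[OF e] by blast
          have "dist (x m y) (g y) < e" if "k \<le> m" "y \<in> topspace X" for m y
          proof -
            have "(1/3::real) ^ m \<le> (1/3) ^ k" using that(1) by (intro power_decreasing) auto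
            then have "\<bar>g y - x m y\<bar> < e" using gx[OF that(2), of m] k by linarith
            then show ?thesis by (simp add: dist_real_def abs_minus_commute)
          qed
          then show ?thesis unfolding eventually_sequentially by blast
        qed
      qed simp
      then show ?thesis by simp
    qed
    obtain c where c: "\<And>m. \<bar>\<phi> m g\<bar> \<le> c" using pt[OF cg] by blast
    obtain k :: nat where k: "c < real k" using reals_Archimedean2 by blast
    have "\<bar>\<phi> (n k) (\<lambda>y. g y - x (Suc k) y)\<bar> \<le> N (n k) * ((3/2) * (1/3) ^ Suc k)"
      by (rule bounded_functionalD[OF bN cm_ops(2)[OF cg cx] _ gx]) simp_all
    moreover have "\<phi> (n k) (\<lambda>y. g y - x (Suc k) y) = \<phi> (n k) g - \<phi> (n k) (x (Suc k))"
      by (rule bounded_functional_simps(2)[OF bf cg cx])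
    moreover have "(1/3) ^ k * ((2/3) * N (n k)) - N (n k) * ((3/2) * (1/3) ^ Suc k) = (1/3) ^ k * N (n k) / 6"
      by (simp add: field_simps)
    ultimately have low: "(1/3) ^ k * N (n k) / 6 \<le> \<bar>\<phi> (n k) g\<bar>" using large[of k] by linarith
    have "(1/3::real) ^ k * (6 * 3 ^ k * (real k + 1)) \<le> (1/3) ^ k * N (n k)"
      using n[of k] by (intro mult_left_mono) auto
    moreover have "(1/3::real) ^ k * (6 * 3 ^ k * (real k + 1)) = 6 * (real k + 1)"
      by (simp add: power_divide)
    ultimately have "6 * (real k + 1) \<le> (1/3) ^ k * N (n k)" by (simp only:)
    then have "6 * (real k + 1) / 6 \<le> (1/3) ^ k * N (n k) / 6" by (rule divide_right_mono) simp
    then have "6 * (real k + 1) / 6 \<le> c" using low c[of "n k"] by (meson order_trans)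
    then show False using k by simp
  qed
  then show ?thesis using bounded_functional_mono[OF bN] by blast
qed

text \<open>A sign s common to the whole subsequence makes the total masses nonnegative, which
  secures the bound 1/2 of admissibility after division by the norms. Convergence of the norms
  allows the passage back from the normalised functionals to the original ones.\<close>

lemma normalising_subsequence:
  assumes \<sigma>: "\<And>k::nat. bounded_functional X b (\<sigma> k)" and c: "0 < c"
    and inf: "infinite {k. c \<le> modulus (\<sigma> k) (\<lambda>x. 1)}"
  shows "\<exists>(q :: nat \<Rightarrow> nat) s l. strict_mono q \<and> \<bar>s\<bar> = 1 \<and> (\<lambda>k. modulus (\<sigma> (q k)) (\<lambda>x. 1)) \<longlonglongrightarrow> l \<and>
    (\<forall>k. c \<le> modulus (\<sigma> (q k)) (\<lambda>x. 1) \<and> 0 \<le> s * \<sigma> (q k) (\<lambda>x. 1))"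
proof -
  define S where "S = {k. c \<le> modulus (\<sigma> k) (\<lambda>x. 1)}"
  define P where "P s = {k \<in> S. 0 \<le> s * \<sigma> k (\<lambda>x. 1)}" for s :: real
  have "S \<subseteq> P 1 \<union> P (-1)" by (auto simp: P_def)
  then have "\<not> (finite (P 1) \<and> finite (P (-1)))"
    using inf finite_subset[of S "P 1 \<union> P (-1)"] unfolding S_def[symmetric] by blast
  then obtain s :: real where s: "\<bar>s\<bar> = 1" "infinite (P s)"
  proof (cases "finite (P 1)")
    case True
    then show thesis using \<open>\<not> (finite (P 1) \<and> finite (P (-1)))\<close> by (intro that[of "-1"]) auto
  next
    case False
    then show thesis by (intro that[of 1]) auto
  qed
  define e where "e = enumerate (P s)"
  have e: "strict_mono e" unfolding e_def by (rule strict_mono_enumerate[OF s(2)])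
  have eS: "e k \<in> P s" for k unfolding e_def by (rule enumerate_in_set[OF s(2)])
  have "bounded (range (\<lambda>k. modulus (\<sigma> (e k)) (\<lambda>x. 1)))"
  proof (rule boundedI)
    fix y assume "y \<in> range (\<lambda>k. modulus (\<sigma> (e k)) (\<lambda>x. 1))"
    then obtain k where "y = modulus (\<sigma> (e k)) (\<lambda>x. 1)" by blast
    then show "norm y \<le> b" using modulus_one_nonneg[OF \<sigma>, of "e k"] modulus_one_le[OF \<sigma>, of "e k"] by simp
  qed
  from bounded_imp_convergent_subsequence[OF this]
  obtain l and r :: "nat \<Rightarrow> nat" where r: "strict_mono r" "((\<lambda>k. modulus (\<sigma> (e k)) (\<lambda>x. 1)) \<circ> r) \<longlonglongrightarrow> l" by blast
  have "strict_mono (e \<circ> r)" by (rule strict_mono_o[OF e r(1)])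
  then show ?thesis using s(1) r(2) eS unfolding P_def S_def
    by (intro exI[of _ "e \<circ> r"] exI[of _ s] exI[of _ l]) (simp add: o_def)
qed

end

section \<open>Consequences for bounded sequences of functionals\<close>

context talagrand_realisation
begin

context
  fixes \<sigma> :: "nat \<Rightarrow> (point \<Rightarrow> real) \<Rightarrow> real" and V :: "nat \<Rightarrow> point set" and b c :: real
  assumes \<sigma>: "\<And>n. bounded_functional T b (\<sigma> n)"
    and V: "\<And>n. clopenin T (V n)" "disjoint_family V"
    and supp: "\<And>n g. T.cm g \<Longrightarrow> \<sigma> n (\<lambda>x. indicator (V n) x * g x) = \<sigma> n g"
    and c: "0 < c" and inf: "infinite {k. c \<le> T.modulus (\<sigma> k) (\<lambda>x. 1)}"
begin

lemma normalised_sequence: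
  "\<exists>(q :: nat \<Rightarrow> nat) s l d. strict_mono q \<and> \<bar>s\<bar> = 1 \<and> d \<longlonglongrightarrow> l \<and> (\<forall>k. c \<le> d k) \<and>
    (\<forall>n. bounded_functional T 1 (\<lambda>g. s / d n * \<sigma> (q n) g)) \<and>
    (\<forall>n. T.modulus (\<lambda>g. s / d n * \<sigma> (q n) g) (\<lambda>x. 1) = 1) \<and>
    (\<forall>n. 0 \<le> s / d n * \<sigma> (q n) (\<lambda>x. 1)) \<and> disjoint_family (\<lambda>n. V (q n))"
proof -
  obtain q :: "nat \<Rightarrow> nat" and s l where q: "strict_mono q" "\<bar>s\<bar> = 1"
    "(\<lambda>k. T.modulus (\<sigma> (q k)) (\<lambda>x. 1)) \<longlonglongrightarrow> l"
    "\<And>k. c \<le> T.modulus (\<sigma> (q k)) (\<lambda>x. 1)" "\<And>k. 0 \<le> s * \<sigma> (q k) (\<lambda>x. 1)"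
    using T.normalising_subsequence[OF \<sigma> c inf] by blast
  define d where "d k = T.modulus (\<sigma> (q k)) (\<lambda>x. 1)" for k
  have d: "0 < d k" for k using q(4)[of k] c by (simp add: d_def)
  have m: "T.modulus (\<lambda>g. s / d n * \<sigma> (q n) g) (\<lambda>x. 1) = 1" for n
    using T.modulus_one_scale[OF \<sigma>, of "s / d n" "q n"] q(2) d[of n] by (simp add: d_def[symmetric])
  have "bounded_functional T 1 (\<lambda>g. s / d n * \<sigma> (q n) g)" for n
    using T.bounded_functional_modulus_one[OF T.bounded_functional_scale[OF \<sigma>, of "s / d n" "q n"]] m[of n] by simp
  moreover have "0 \<le> s / d n * \<sigma> (q n) (\<lambda>x. 1)" for n using q(5)[of n] d[of n] by simp
  moreover have "disjoint_family (\<lambda>n. V (q n))"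
    using V(2) strict_mono_eq[OF q(1)] unfolding disjoint_family_on_def by simp
  ultimately show ?thesis using q(1-4) m unfolding d_def[symmetric] by blast
qed

text \<open>Undoing the division by d k >= c turns the threshold 1/6 of (G) into c/6 and leaves the
  zeros unchanged.\<close>

lemma oscillation_on_clopen:
  obtains C where "clopenin T C" "infinite {k. c / 6 \<le> \<bar>\<sigma> k (indicator C)\<bar>}" "infinite {k. \<sigma> k (indicator C) = 0}"
proof -
  obtain q :: "nat \<Rightarrow> nat" and s l d where q: "strict_mono q" "\<bar>s\<bar> = 1" "\<And>k. c \<le> d k"
    and n: "\<And>n. bounded_functional T 1 (\<lambda>g. s / d n * \<sigma> (q n) g)"
    "\<And>n. T.modulus (\<lambda>g. s / d n * \<sigma> (q n) g) (\<lambda>x. 1) = 1"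
    "\<And>n. 0 \<le> s / d n * \<sigma> (q n) (\<lambda>x. 1)" "disjoint_family (\<lambda>n. V (q n))"
    using normalised_sequence by blast
  have sp: "s / d n * \<sigma> (q n) (\<lambda>x. indicator (V (q n)) x * g x) = s / d n * \<sigma> (q n) g" if "T.cm g" for n g
    using supp[OF that] by simp
  have d: "0 < d k" for k using q(3)[of k] c by simp
  have image_inf: "infinite (q ` A)" if "infinite A" for A
    using that finite_imageD[of q A] inj_on_subset[OF strict_mono_imp_inj_on[OF q(1)]] by blast
  show thesis
  proof (rule oscillation[OF n(1-3) V(1) n(4) sp])
    fix C assume C: "clopenin T C" "infinite {n. 1/6 \<le> s / d n * \<sigma> (q n) (indicator C)}"
      "infinite {n. s / d n * \<sigma> (q n) (indicator C) = 0}"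
    have "q ` {n. 1/6 \<le> s / d n * \<sigma> (q n) (indicator C)} \<subseteq> {k. c / 6 \<le> \<bar>\<sigma> k (indicator C)\<bar>}"
    proof clarify
      fix n assume "1/6 \<le> s / d n * \<sigma> (q n) (indicator C)"
      also have "\<dots> \<le> \<bar>s / d n * \<sigma> (q n) (indicator C)\<bar>" by (rule abs_ge_self)
      also have "\<dots> = \<bar>\<sigma> (q n) (indicator C)\<bar> / d n" using q(2) d[of n] by (simp add: abs_mult)
      finally have "d n / 6 \<le> \<bar>\<sigma> (q n) (indicator C)\<bar>" using d[of n] by (simp add: field_simps)
      then show "c / 6 \<le> \<bar>\<sigma> (q n) (indicator C)\<bar>" using q(3)[of n] by simp
    qed
    then have 1: "infinite {k. c / 6 \<le> \<bar>\<sigma> k (indicator C)\<bar>}" using image_inf[OF C(2)] infinite_super by blast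
    have "q ` {n. s / d n * \<sigma> (q n) (indicator C) = 0} \<subseteq> {k. \<sigma> k (indicator C) = 0}"
    proof clarify
      fix n assume "s / d n * \<sigma> (q n) (indicator C) = 0"
      then show "\<sigma> (q n) (indicator C) = 0" using q(2) d[of n] by auto
    qed
    then have 2: "infinite {k. \<sigma> k (indicator C) = 0}" using image_inf[OF C(3)] infinite_super by blast
    show thesis by (rule that[OF C(1) 1 2])
  qed
qed

text \<open>\<open>common_cluster\<close> carried over to continuous functions and to the
  functionals before normalisation. N and M are fixed before the functions and the tolerance are
  given; only k and j depend on these.\<close>

lemma common_cluster_functions:
  "\<exists>N M. N \<inter> M = {} \<and> (\<forall>\<G> \<epsilon> k0. finite \<G> \<longrightarrow> (\<forall>g\<in>\<G>. T.cm g) \<longrightarrow> 0 < \<epsilon> \<longrightarrow>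
    (\<exists>k\<in>N. \<exists>j\<in>M. k0 \<le> k \<and> k0 \<le> j \<and> (\<forall>g\<in>\<G>. \<bar>\<sigma> k g - \<sigma> j g\<bar> \<le> \<epsilon>)))"
proof -
  obtain q :: "nat \<Rightarrow> nat" and s l d where q: "strict_mono q" "\<bar>s\<bar> = 1" "d \<longlonglongrightarrow> l" "\<And>k. c \<le> d k"
    and n: "\<And>n. bounded_functional T 1 (\<lambda>g. s / d n * \<sigma> (q n) g)"
    "\<And>n. T.modulus (\<lambda>g. s / d n * \<sigma> (q n) g) (\<lambda>x. 1) = 1"
    "\<And>n. 0 \<le> s / d n * \<sigma> (q n) (\<lambda>x. 1)" "disjoint_family (\<lambda>n. V (q n))"
    using normalised_sequence by blast
  define \<mu> where "\<mu> n g = s / d n * \<sigma> (q n) g" for n g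
  have sp: "s / d n * \<sigma> (q n) (\<lambda>x. indicator (V (q n)) x * g x) = s / d n * \<sigma> (q n) g" if "T.cm g" for n g
    using supp[OF that] by simp
  have d: "0 < d k" for k using q(4)[of k] c by simp
  have \<mu>b: "bounded_functional T 1 (\<mu> n)" for n unfolding \<mu>_def using n(1) .
  have \<sigma>\<mu>: "\<sigma> (q k) g = s * d k * \<mu> k g" for k g
  proof -
    have "s * s = 1" using q(2) by (metis abs_mult_self_eq mult_1)
    then show ?thesis using d[of k] by (simp add: \<mu>_def)
  qed
  have "Bseq d" using q(3) convergentI convergent_imp_Bseq by blast
  then obtain D where D: "0 < D" "\<And>k. \<bar>d k\<bar> \<le> D" by (auto elim!: BseqE)
  obtain N M where NM: "N \<inter> M = {}" and cl: "\<And>\<W>. finite \<W> \<Longrightarrow> (\<And>W. W \<in> \<W> \<Longrightarrow> clopenin T W) \<Longrightarrow>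
    \<exists>H. infinite (H \<inter> N) \<and> infinite (H \<inter> M) \<and>
      (\<forall>W\<in>\<W>. \<exists>l. ((\<lambda>n. \<mu> n (indicator W)) \<longlongrightarrow> l) (inf sequentially (principal H)))"
    unfolding \<mu>_def by (rule common_cluster[OF n(1-3) V(1) n(4) sp]) blast+
  have main: "\<exists>k\<in>q ` N. \<exists>j\<in>q ` M. k0 \<le> k \<and> k0 \<le> j \<and> (\<forall>g\<in>\<G>. \<bar>\<sigma> k g - \<sigma> j g\<bar> \<le> \<epsilon>)"
    if \<G>: "finite \<G>" "\<forall>g\<in>\<G>. T.cm g" and \<epsilon>: "0 < \<epsilon>" for \<G> and \<epsilon> :: real and k0
  proof -
    obtain S where S1: "1 \<le> S" and Sb: "\<And>g x. g \<in> \<G> \<Longrightarrow> x \<in> topspace T \<Longrightarrow> \<bar>g x\<bar> \<le> S"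
      using T.finite_cm_bounded[OF \<G>] by blast
    have S: "0 \<le> S" "\<And>g x. g \<in> \<G> \<Longrightarrow> x \<in> topspace T \<Longrightarrow> \<bar>g x\<bar> \<le> S" using S1 Sb by auto
    define \<eta> where "\<eta> = \<epsilon> / (2 * D)"
    have \<eta>: "0 < \<eta>" "D * \<eta> = \<epsilon> / 2" using \<epsilon> D by (auto simp: \<eta>_def)
    define det where "det g \<W> \<delta> \<longleftrightarrow> finite \<W> \<and> (\<forall>W\<in>\<W>. clopenin T W) \<and> 0 < \<delta> \<and>
      (\<forall>\<phi> \<psi>. bounded_functional T 1 \<phi> \<longrightarrow> bounded_functional T 1 \<psi> \<longrightarrow>
        (\<forall>W\<in>\<W>. \<bar>\<phi> (indicator W) - \<psi> (indicator W)\<bar> \<le> \<delta>) \<longrightarrow> \<bar>\<phi> g - \<psi> g\<bar> \<le> \<eta>)" for g \<W> and \<delta> :: real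
    have "\<exists>\<W> \<delta>. det g \<W> \<delta>" if "g \<in> \<G>" for g
    proof (rule T.clopen_determines[of g \<eta> 1])
      show "T.cm g" using \<G>(2) \<open>g \<in> \<G>\<close> by blast
      fix \<W> \<delta> assume "finite \<W>" "\<And>W. W \<in> \<W> \<Longrightarrow> clopenin T W" "0 < (\<delta>::real)"
        "\<And>\<phi> \<psi>. bounded_functional T 1 \<phi> \<Longrightarrow> bounded_functional T 1 \<psi> \<Longrightarrow>
          (\<And>W. W \<in> \<W> \<Longrightarrow> \<bar>\<phi> (indicator W) - \<psi> (indicator W)\<bar> \<le> \<delta>) \<Longrightarrow> \<bar>\<phi> g - \<psi> g\<bar> \<le> \<eta>"
      then have "det g \<W> \<delta>" unfolding det_def by blast
      then show ?thesis by blast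
    qed (use \<eta> in auto)
    then have "\<forall>g\<in>\<G>. \<exists>p. det g (fst p) (snd p)" by auto
    from bchoice[OF this] obtain p where p: "\<forall>g\<in>\<G>. det g (fst (p g)) (snd (p g))" ..
    define \<W> where "\<W> = (\<Union>g\<in>\<G>. fst (p g))"
    define \<delta> where "\<delta> = Min (insert 1 ((\<lambda>g. snd (p g)) ` \<G>))"
    have \<W>: "finite \<W>" "\<And>W. W \<in> \<W> \<Longrightarrow> clopenin T W" using p \<G>(1) unfolding \<W>_def det_def by auto
    have \<delta>: "0 < \<delta>" "\<And>g. g \<in> \<G> \<Longrightarrow> \<delta> \<le> snd (p g)" using p \<G>(1) unfolding \<delta>_def det_def by auto
    obtain H where H: "infinite (H \<inter> N)" "infinite (H \<inter> M)"
      "\<And>W. W \<in> \<W> \<Longrightarrow> \<exists>l. ((\<lambda>n. \<mu> n (indicator W)) \<longlongrightarrow> l) (inf sequentially (principal H))"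
      using cl[OF \<W>] by blast
    have "\<forall>W\<in>\<W>. \<exists>l. \<exists>m. \<forall>n\<ge>m. n \<in> H \<longrightarrow> \<bar>\<mu> n (indicator W) - l\<bar> < \<delta> / 2"
    proof
      fix W assume "W \<in> \<W>"
      then obtain l where l: "((\<lambda>n. \<mu> n (indicator W)) \<longlongrightarrow> l) (inf sequentially (principal H))" using H(3) by blast
      have "\<forall>\<^sub>F n in inf sequentially (principal H). dist (\<mu> n (indicator W)) l < \<delta> / 2"
        using tendstoD[OF l, of "\<delta> / 2"] \<delta>(1) by simp
      then show "\<exists>l. \<exists>m. \<forall>n\<ge>m. n \<in> H \<longrightarrow> \<bar>\<mu> n (indicator W) - l\<bar> < \<delta> / 2"
        unfolding eventually_inf_principal eventually_sequentially dist_real_def by blast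
    qed
    from bchoice[OF this] obtain L where "\<forall>W\<in>\<W>. \<exists>m. \<forall>n\<ge>m. n \<in> H \<longrightarrow> \<bar>\<mu> n (indicator W) - L W\<bar> < \<delta> / 2" ..
    from bchoice[OF this] obtain m where
      m: "\<And>W n. W \<in> \<W> \<Longrightarrow> m W \<le> n \<Longrightarrow> n \<in> H \<Longrightarrow> \<bar>\<mu> n (indicator W) - L W\<bar> < \<delta> / 2" by blast
    have "Cauchy d" using q(3) by (rule LIMSEQ_imp_Cauchy)
    then obtain m1 where m1: "\<And>k j. m1 \<le> k \<Longrightarrow> m1 \<le> j \<Longrightarrow> norm (d k - d j) < \<epsilon> / (2 * (S + 1))"
      using CauchyD[of d "\<epsilon> / (2 * (S + 1))"] \<epsilon> S(1) by auto
    define m0 where "m0 = Max (insert (max k0 m1) (m ` \<W>))"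
    have m0: "k0 \<le> m0" "m1 \<le> m0" "\<And>W. W \<in> \<W> \<Longrightarrow> m W \<le> m0"
      using \<W>(1) unfolding m0_def by (auto simp: Max_ge_iff)
    obtain k where k: "k \<in> H" "k \<in> N" "m0 \<le> k" using H(1) by (metis Int_iff infinite_nat_iff_unbounded_le)
    obtain j where j: "j \<in> H" "j \<in> M" "m0 \<le> j" using H(2) by (metis Int_iff infinite_nat_iff_unbounded_le)
    have close: "\<bar>\<mu> k (indicator W) - \<mu> j (indicator W)\<bar> \<le> \<delta>" if "W \<in> \<W>" for W
      using m[OF that order_trans[OF m0(3)[OF that] k(3)] k(1)] m[OF that order_trans[OF m0(3)[OF that] j(3)] j(1)]
      by linarith
    have "\<bar>\<sigma> (q k) g - \<sigma> (q j) g\<bar> \<le> \<epsilon>" if g: "g \<in> \<G>" for g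
    proof -
      have dg: "det g (fst (p g)) (snd (p g))" using p g by blast
      have "\<bar>\<mu> k (indicator W) - \<mu> j (indicator W)\<bar> \<le> snd (p g)" if "W \<in> fst (p g)" for W
        using close[of W] \<delta>(2)[OF g] that g unfolding \<W>_def by force
      then have 1: "\<bar>\<mu> k g - \<mu> j g\<bar> \<le> \<eta>" using dg \<mu>b unfolding det_def by blast
      have 2: "\<bar>\<mu> k g\<bar> \<le> 1 * S" by (rule T.bounded_functionalD[OF \<mu>b]) (use \<G>(2) g S in auto)
      \<comment> \<open>The first term is small because the factors d converge and |\<mu> k g| <= S;
        the second is at most D \<eta> = \<epsilon> / 2.\<close>
      have "\<sigma> (q k) g - \<sigma> (q j) g = s * ((d k - d j) * \<mu> k g + d j * (\<mu> k g - \<mu> j g))"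
        unfolding \<sigma>\<mu> by (simp add: algebra_simps)
      then have "\<bar>\<sigma> (q k) g - \<sigma> (q j) g\<bar> = \<bar>(d k - d j) * \<mu> k g + d j * (\<mu> k g - \<mu> j g)\<bar>"
        using q(2) by (simp add: abs_mult)
      also have "\<dots> \<le> \<bar>d k - d j\<bar> * \<bar>\<mu> k g\<bar> + \<bar>d j\<bar> * \<bar>\<mu> k g - \<mu> j g\<bar>"
        unfolding abs_mult[symmetric] by (rule abs_triangle_ineq)
      also have "\<dots> \<le> \<epsilon> / (2 * (S + 1)) * S + D * \<eta>"
        using m1[of k j] m0(2) k(3) j(3) 1 2 D S(1) by (intro add_mono mult_mono) auto
      also have "\<epsilon> / (2 * (S + 1)) * S \<le> \<epsilon> / 2" using \<epsilon> S(1) by (simp add: field_simps)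
      finally show ?thesis using \<eta>(2) by simp
    qed
    moreover have "k0 \<le> q k" "k0 \<le> q j" using seq_suble[OF q(1), of k] seq_suble[OF q(1), of j] m0(1) k(3) j(3) by simp_all
    ultimately show ?thesis
      by (intro bexI[of _ "q k"] bexI[of _ "q j"] conjI ballI imageI k(2) j(2)) simp_all
  qed
  have "q ` N \<inter> q ` M = {}"
    using image_Int[OF strict_mono_imp_inj_on[OF q(1)], of N M] NM
    by (metis image_Int image_empty inj_on_subset q(1) strict_mono_imp_inj_on top_greatest)
  then show ?thesis using main by (intro exI[of _ "q ` N"] exI[of _ "q ` M"] conjI allI impI)
qed

end

end


section \<open>Weakly null sequences and inseparable index sets\<close>

context talagrand_realisation
begin

text \<open>If the parts on the V k had norm at least 24 \<kappa> infinitely often, their values on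
  some clopen C would infinitely often have size at least 4 \<kappa> and infinitely often be 0. But
  they stay within \<kappa> of the convergent sequence \<open>u\<close>, whose late terms differ by
  less than \<kappa>, and 4 > 3. So these parts are eventually dropped at the cost of 24 \<kappa>,
  and the total error is 25 \<kappa> = \<epsilon>.\<close>

lemma convergent_sequence_nearly_dominated:
  assumes \<mu>: "\<And>n. bounded_functional T b (\<mu> n)" and lim: "\<And>g. T.cm g \<Longrightarrow> convergent (\<lambda>n. \<mu> n g)"
    and \<epsilon>: "0 < \<epsilon>"
  shows "\<exists>(r :: nat \<Rightarrow> nat) L m f. strict_mono r \<and> positive_functional T L \<and> 0 \<le> m \<and> (\<forall>k. T.cm (f k)) \<and>
    (\<forall>k. \<forall>x\<in>topspace T. \<bar>f k x\<bar> \<le> m) \<and>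
    (\<forall>k g s. T.cm g \<longrightarrow> 0 \<le> s \<longrightarrow> (\<forall>x\<in>topspace T. \<bar>g x\<bar> \<le> s) \<longrightarrow>
      \<bar>\<mu> (r k) g - L (\<lambda>x. f k x * g x)\<bar> \<le> \<epsilon> * s)"
proof -
  define \<kappa> where "\<kappa> = \<epsilon> / 25"
  have \<kappa>: "0 < \<kappa>" using \<epsilon> by (simp add: \<kappa>_def)
  show ?thesis
  proof (rule T.splitting[OF \<mu> \<kappa>])
    fix r :: "nat \<Rightarrow> nat" and V L m f
    assume r: "strict_mono r" and V: "\<And>k. clopenin T (V k)" "disjoint_family V"
      and L: "positive_functional T L" and m: "0 \<le> m" and f: "\<And>k::nat. T.cm (f k)"
      "\<And>k x. x \<in> topspace T \<Longrightarrow> \<bar>f k x\<bar> \<le> m" "\<And>y. T.cm y \<Longrightarrow> convergent (\<lambda>k. L (\<lambda>x. f k x * y x))"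
      and err: "\<And>k g s. T.cm g \<Longrightarrow> 0 \<le> s \<Longrightarrow> (\<And>x. x \<in> topspace T \<Longrightarrow> \<bar>g x\<bar> \<le> s) \<Longrightarrow>
       \<bar>\<mu> (r k) g - \<mu> (r k) (\<lambda>x. indicator (V k) x * g x) - L (\<lambda>x. f k x * g x)\<bar> \<le> \<kappa> * s"
    define \<sigma> where "\<sigma> k g = \<mu> (r k) (\<lambda>x. indicator (V k) x * g x)" for k g
    have \<sigma>: "bounded_functional T b (\<sigma> k)" for k
      unfolding \<sigma>_def by (rule T.bounded_functional_restrict[OF \<mu> V(1)])
    have supp: "\<sigma> k (\<lambda>x. indicator (V k) x * g x) = \<sigma> k g" if "T.cm g" for k g
    proof -
      have "(\<lambda>x. indicator (V k) x * (indicator (V k) x * g x)) = (\<lambda>x. indicator (V k) x * g x)"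
        by (auto simp: indicator_def)
      then show ?thesis by (simp add: \<sigma>_def)
    qed
    have "finite {k. 24 * \<kappa> \<le> T.modulus (\<sigma> k) (\<lambda>x. 1)}"
    proof (rule ccontr)
      assume inf: "infinite {k. 24 * \<kappa> \<le> T.modulus (\<sigma> k) (\<lambda>x. 1)}"
      have c24: "0 < 24 * \<kappa>" using \<kappa> by simp
      show False
      proof (rule oscillation_on_clopen[OF \<sigma> V supp c24 inf])
        fix C assume C: "clopenin T C" "infinite {k. 24 * \<kappa> / 6 \<le> \<bar>\<sigma> k (indicator C)\<bar>}"
          "infinite {k. \<sigma> k (indicator C) = 0}"
        have cC: "T.cm (indicator C)" by (rule T.cm_indicator(1)[OF C(1)])
        define u where "u k = \<mu> (r k) (indicator C) - L (\<lambda>x. f k x * indicator C x)" for k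
        have "convergent (\<lambda>k. \<mu> (r k) (indicator C))"
          using convergent_subseq_convergent[OF lim[OF cC] r] by (simp add: o_def)
        then have "convergent u" unfolding u_def[abs_def] by (rule convergent_diff) (rule f(3)[OF cC])
        then have "Cauchy u" by (rule convergent_Cauchy)
        then obtain k0 where k0: "\<And>k j. k0 \<le> k \<Longrightarrow> k0 \<le> j \<Longrightarrow> norm (u k - u j) < \<kappa>"
          using CauchyD[of u \<kappa>] \<kappa> by auto
        have close: "\<bar>u k - \<sigma> k (indicator C)\<bar> \<le> \<kappa>" for k
          using err[OF cC, of 1 k] by (simp add: u_def \<sigma>_def algebra_simps indicator_def)
        obtain k where k: "k0 \<le> k" "24 * \<kappa> / 6 \<le> \<bar>\<sigma> k (indicator C)\<bar>"
          using C(2) unfolding infinite_nat_iff_unbounded_le by blast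
        obtain j where j: "k0 \<le> j" "\<sigma> j (indicator C) = 0"
          using C(3) unfolding infinite_nat_iff_unbounded_le by blast
        have "\<bar>u k - u j\<bar> < \<kappa>" using k0[OF k(1) j(1)] by simp
        then show False using close[of k] close[of j] k(2) j(2) \<kappa> by linarith
      qed
    qed
    then obtain k0 where k0: "\<And>k. 24 * \<kappa> \<le> T.modulus (\<sigma> k) (\<lambda>x. 1) \<Longrightarrow> k < k0"
      using finite_nat_set_iff_bounded by auto
    have main: "\<bar>\<mu> (r (k + k0)) g - L (\<lambda>x. f (k + k0) x * g x)\<bar> \<le> \<epsilon> * s"
      if g: "T.cm g" "0 \<le> s" "\<And>x. x \<in> topspace T \<Longrightarrow> \<bar>g x\<bar> \<le> s" for k g s
    proof -
      have "T.modulus (\<sigma> (k + k0)) (\<lambda>x. 1) \<le> 24 * \<kappa>" using k0[of "k + k0"] by (meson not_add_less2 linear)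
      then have "bounded_functional T (24 * \<kappa>) (\<sigma> (k + k0))"
        by (rule T.bounded_functional_mono[OF T.bounded_functional_modulus_one[OF \<sigma>]])
      then have "\<bar>\<sigma> (k + k0) g\<bar> \<le> 24 * \<kappa> * s" by (rule T.bounded_functionalD[OF _ g])
      moreover have "\<bar>\<mu> (r (k + k0)) g - \<sigma> (k + k0) g - L (\<lambda>x. f (k + k0) x * g x)\<bar> \<le> \<kappa> * s"
        unfolding \<sigma>_def by (rule err[OF g])
      moreover have "\<epsilon> * s = \<kappa> * s + 24 * \<kappa> * s" by (simp add: \<kappa>_def)
      ultimately show ?thesis by linarith
    qed
    have "strict_mono (\<lambda>k. r (k + k0))" using r by (simp add: strict_mono_def)
    then show ?thesis using L m f(1,2) main
      by (intro exI[of _ "\<lambda>k. r (k + k0)"] exI[of _ L] exI[of _ m] exI[of _ "\<lambda>k. f (k + k0)"] conjI allI impI ballI) simp_all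
  qed
qed

text \<open>\<open>\<Psi>\<close> is a bounded functional on the dual, and
  \<open>\<Psi>_cong\<close> says that it sees only values at continuous functions. Restricted to
  functionals of the form h L it is bounded by B L(|h|), so it has an approximate continuous density
  y with |y| <= B. Then \<Psi> at f L is close to L(y f), hence to \<mu>(y), which tends to
  0.\<close>

lemma null_sequence_weakly_null:
  assumes \<mu>: "\<And>n. bounded_functional T b (\<mu> n)" and lim: "\<And>g. T.cm g \<Longrightarrow> (\<lambda>n. \<mu> n g) \<longlonglongrightarrow> 0"
    and \<Psi>_cong: "\<And>\<phi> \<psi>. (\<And>g. T.cm g \<Longrightarrow> \<phi> g = \<psi> g) \<Longrightarrow> \<Psi> \<phi> = \<Psi> \<psi>"
    and \<Psi>_add: "\<And>\<phi> \<psi> a c. bounded_functional T a \<phi> \<Longrightarrow> bounded_functional T c \<psi> \<Longrightarrow> \<Psi> (\<lambda>g. \<phi> g + \<psi> g) = \<Psi> \<phi> + \<Psi> \<psi>"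
    and \<Psi>_scale: "\<And>\<phi> a c. bounded_functional T a \<phi> \<Longrightarrow> \<Psi> (\<lambda>g. c * \<phi> g) = c * \<Psi> \<phi>"
    and \<Psi>_bound: "\<And>\<phi> a. bounded_functional T a \<phi> \<Longrightarrow> 0 \<le> a \<Longrightarrow> \<bar>\<Psi> \<phi>\<bar> \<le> B * a" and B: "0 \<le> B"
  shows "(\<lambda>n. \<Psi> (\<mu> n)) \<longlonglongrightarrow> 0"
proof (rule ccontr)
  assume "\<not> ?thesis"
  then obtain \<delta> where \<delta>: "0 < \<delta>" "\<And>N. \<exists>n\<ge>N. \<delta> \<le> \<bar>\<Psi> (\<mu> n)\<bar>"
    unfolding LIMSEQ_iff by (auto simp: not_less)
  then have inf: "infinite {n. \<delta> \<le> \<bar>\<Psi> (\<mu> n)\<bar>}" unfolding infinite_nat_iff_unbounded_le by auto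
  define e where "e = enumerate {n. \<delta> \<le> \<bar>\<Psi> (\<mu> n)\<bar>}"
  have e: "strict_mono e" unfolding e_def by (rule strict_mono_enumerate[OF inf])
  have e\<delta>: "\<delta> \<le> \<bar>\<Psi> (\<mu> (e n))\<bar>" for n using enumerate_in_set[OF inf, of n] unfolding e_def by simp
  have lim_e: "(\<lambda>n. \<mu> (e n) g) \<longlonglongrightarrow> 0" if "T.cm g" for g
    using LIMSEQ_subseq_LIMSEQ[OF lim[OF that] e] by (simp add: o_def)
  \<comment> \<open>The budget is B \<epsilon> for \<Psi> at \<mu> - f L, 2 \<epsilon> for the
    density y, \<epsilon> B for the distance from \<mu>(y) to L(f y), and \<epsilon> for \<mu>(y)
    itself; the sum is less than \<delta>.\<close>
  define \<epsilon> where "\<epsilon> = \<delta> / (4 * (B + 1))"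
  have \<epsilon>: "0 < \<epsilon>" "4 * (B + 1) * \<epsilon> = \<delta>" using \<delta>(1) B by (simp_all add: \<epsilon>_def)
  have "\<exists>(r :: nat \<Rightarrow> nat) L m f. strict_mono r \<and> positive_functional T L \<and> 0 \<le> m \<and> (\<forall>k. T.cm (f k)) \<and>
    (\<forall>k. \<forall>x\<in>topspace T. \<bar>f k x\<bar> \<le> m) \<and>
    (\<forall>k g s. T.cm g \<longrightarrow> 0 \<le> s \<longrightarrow> (\<forall>x\<in>topspace T. \<bar>g x\<bar> \<le> s) \<longrightarrow>
      \<bar>\<mu> (e (r k)) g - L (\<lambda>x. f k x * g x)\<bar> \<le> \<epsilon> * s)"
    by (rule convergent_sequence_nearly_dominated[OF \<mu> _ \<epsilon>(1)]) (rule convergentI[OF lim_e])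
  then obtain r :: "nat \<Rightarrow> nat" and L m f where R: "strict_mono r \<and> positive_functional T L \<and> 0 \<le> m \<and> (\<forall>k. T.cm (f k)) \<and>
    (\<forall>k. \<forall>x\<in>topspace T. \<bar>f k x\<bar> \<le> m) \<and>
    (\<forall>k g s. T.cm g \<longrightarrow> 0 \<le> s \<longrightarrow> (\<forall>x\<in>topspace T. \<bar>g x\<bar> \<le> s) \<longrightarrow>
      \<bar>\<mu> (e (r k)) g - L (\<lambda>x. f k x * g x)\<bar> \<le> \<epsilon> * s)"
    by (elim exE) (rule that)
  have r: "strict_mono r" and L: "positive_functional T L" and m: "0 \<le> m" and f: "\<And>k. T.cm (f k)"
    "\<And>k x. x \<in> topspace T \<Longrightarrow> \<bar>f k x\<bar> \<le> m" using R by blast+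
  have err: "\<bar>\<mu> (e (r k)) g - L (\<lambda>x. f k x * g x)\<bar> \<le> \<epsilon> * s"
    if "T.cm g" "0 \<le> s" "\<And>x. x \<in> topspace T \<Longrightarrow> \<bar>g x\<bar> \<le> s" for k g s using R that by blast
  note Ls = T.positive_functional_simps[OF L]
  have \<rho>: "bounded_functional T (L (\<lambda>x. \<bar>h x\<bar>)) (\<lambda>g. L (\<lambda>x. h x * g x))" if h: "T.cm h" for h
    unfolding bounded_functional_def
  proof (intro conjI allI impI)
    show "linear_functional T (\<lambda>g. L (\<lambda>x. h x * g x))"
    proof -
      have "(\<lambda>x. h x * (g x + g' x)) = (\<lambda>x. h x * g x + h x * g' x)" "(\<lambda>x. h x * (a * g x)) = (\<lambda>x. a * (h x * g x))"
        for g g' and a :: real by (auto simp: algebra_simps)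
      then show ?thesis unfolding linear_functional_def using h by (simp add: Ls)
    qed
    fix g s assume g: "T.cm g" "0 \<le> (s::real)" "\<forall>x\<in>topspace T. \<bar>g x\<bar> \<le> s"
    have c: "T.cm (\<lambda>x. s * \<bar>h x\<bar>)" "T.cm (\<lambda>x. h x * g x)" using h g(1) by (auto intro: T.cm_ops)
    have p: "\<bar>h x * g x\<bar> \<le> s * \<bar>h x\<bar>" if "x \<in> topspace T" for x
      using g(3) that mult_right_mono[of "\<bar>g x\<bar>" s "\<bar>h x\<bar>"] by (simp add: abs_mult mult.commute)
    have "L (\<lambda>x. h x * g x) \<le> L (\<lambda>x. s * \<bar>h x\<bar>)"
      by (rule T.positive_functional_mono[OF L c(2,1)]) (use p in \<open>force simp: abs_le_iff\<close>)
    moreover have "L (\<lambda>x. - (h x * g x)) \<le> L (\<lambda>x. s * \<bar>h x\<bar>)"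
      by (rule T.positive_functional_mono[OF L T.cm_ops(7)[OF c(2)] c(1)]) (use p in \<open>force simp: abs_le_iff\<close>)
    moreover have "L (\<lambda>x. s * \<bar>h x\<bar>) = s * L (\<lambda>x. \<bar>h x\<bar>)" by (rule Ls(3)) (rule T.cm_ops(6)[OF h])
    ultimately show "\<bar>L (\<lambda>x. h x * g x)\<bar> \<le> L (\<lambda>x. \<bar>h x\<bar>) * s"
      using Ls(4)[OF c(2)] by (simp add: abs_le_iff mult.commute)
  qed
  define \<tau> where "\<tau> h = \<Psi> (\<lambda>g. L (\<lambda>x. h x * g x))" for h
  have \<tau>lin: "linear_functional T \<tau>"
    unfolding linear_functional_def
  proof (intro conjI allI impI)
    fix h h' assume h: "T.cm h" "T.cm h'"
    have "\<tau> (\<lambda>x. h x + h' x) = \<Psi> (\<lambda>g. L (\<lambda>x. h x * g x) + L (\<lambda>x. h' x * g x))"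
      unfolding \<tau>_def
    proof (rule \<Psi>_cong)
      fix g assume g: "T.cm g"
      have "(\<lambda>x. (h x + h' x) * g x) = (\<lambda>x. h x * g x + h' x * g x)" by (auto simp: algebra_simps)
      then show "L (\<lambda>x. (h x + h' x) * g x) = L (\<lambda>x. h x * g x) + L (\<lambda>x. h' x * g x)"
        using g h by (simp add: Ls)
    qed
    also have "\<dots> = \<tau> h + \<tau> h'" unfolding \<tau>_def by (rule \<Psi>_add[OF \<rho>[OF h(1)] \<rho>[OF h(2)]])
    finally show "\<tau> (\<lambda>x. h x + h' x) = \<tau> h + \<tau> h'" .
  next
    fix c h assume h: "T.cm h"
    have "\<tau> (\<lambda>x. c * h x) = \<Psi> (\<lambda>g. c * L (\<lambda>x. h x * g x))"
      unfolding \<tau>_def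
    proof (rule \<Psi>_cong)
      fix g assume g: "T.cm g"
      have "(\<lambda>x. c * h x * g x) = (\<lambda>x. c * (h x * g x))" by (auto simp: algebra_simps)
      then show "L (\<lambda>x. c * h x * g x) = c * L (\<lambda>x. h x * g x)" using g h by (simp add: Ls)
    qed
    also have "\<dots> = c * \<tau> h" unfolding \<tau>_def by (rule \<Psi>_scale[OF \<rho>[OF h]])
    finally show "\<tau> (\<lambda>x. c * h x) = c * \<tau> h" .
  qed
  \<comment> \<open>The density is applied to f k, whose sup norm may be as large as m, so its
    relative error has to be smaller by that factor.\<close>
  define \<epsilon>' where "\<epsilon>' = \<epsilon> / (m + 1)"
  have \<epsilon>': "0 < \<epsilon>'" "\<epsilon>' * m \<le> \<epsilon>" using \<epsilon>(1) m by (simp_all add: \<epsilon>'_def field_simps)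
  have dom: "\<bar>\<tau> g\<bar> \<le> B * L (\<lambda>x. \<bar>g x\<bar>) + \<epsilon>' * s" if "T.cm g" "0 \<le> s" for g s
  proof -
    have "0 \<le> L (\<lambda>x. \<bar>g x\<bar>)" by (rule T.positive_functional_nonneg[OF L T.cm_ops(6)[OF that(1)]]) simp
    then have "\<bar>\<tau> g\<bar> \<le> B * L (\<lambda>x. \<bar>g x\<bar>)" unfolding \<tau>_def by (rule \<Psi>_bound[OF \<rho>[OF that(1)]])
    moreover have "0 \<le> \<epsilon>' * s" using \<epsilon>'(1) that(2) by simp
    ultimately show ?thesis by linarith
  qed
  show False
  proof (rule T.approximate_density[OF L \<tau>lin B \<epsilon>'(1)])
    show "\<bar>\<tau> g\<bar> \<le> B * L (\<lambda>x. \<bar>g x\<bar>) + \<epsilon>' * s" if "T.cm g" "0 \<le> s" for g s by (rule dom[OF that])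
    fix y assume y: "T.cm y" "\<And>x. x \<in> topspace T \<Longrightarrow> \<bar>y x\<bar> \<le> B"
      "\<And>g s. T.cm g \<Longrightarrow> 0 \<le> s \<Longrightarrow> (\<And>x. x \<in> topspace T \<Longrightarrow> \<bar>g x\<bar> \<le> s) \<Longrightarrow>
        \<bar>\<tau> g - L (\<lambda>x. y x * g x)\<bar> \<le> 2 * \<epsilon>' * s"
    have "(\<lambda>k. \<mu> (e (r k)) y) \<longlonglongrightarrow> 0"
      using LIMSEQ_subseq_LIMSEQ[OF lim_e[OF y(1)] r] by (simp add: o_def)
    then have "\<forall>\<^sub>F k in sequentially. dist (\<mu> (e (r k)) y) 0 < \<epsilon>" using \<epsilon>(1) by (rule tendstoD)
    then obtain k where k: "\<bar>\<mu> (e (r k)) y\<bar> < \<epsilon>" by (auto simp: eventually_sequentially)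
    have 2: "\<bar>\<tau> (f k) - L (\<lambda>x. y x * f k x)\<bar> \<le> 2 * \<epsilon>' * m" by (rule y(3)[OF f(1) m f(2)])
    have 3: "\<bar>\<mu> (e (r k)) y - L (\<lambda>x. f k x * y x)\<bar> \<le> \<epsilon> * B" by (rule err[OF y(1) B y(2)])
    \<comment> \<open>Written as a sum with the factor -1, because additivity and homogeneity are
      what is assumed of \<open>\<Psi>\<close>.\<close>
    let ?d = "\<lambda>g. \<mu> (e (r k)) g + (-1) * L (\<lambda>x. f k x * g x)"
    have neg: "bounded_functional T (\<bar>-1\<bar> * L (\<lambda>x. \<bar>f k x\<bar>)) (\<lambda>g. (-1) * L (\<lambda>x. f k x * g x))"
      by (rule T.bounded_functional_scale[OF \<rho>[OF f(1)]])
    have "bounded_functional T \<epsilon> ?d"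
      unfolding bounded_functional_def
    proof (intro conjI allI impI)
      show "linear_functional T ?d"
        using T.bounded_functional_linear[OF T.bounded_functional_diff[OF \<mu> \<rho>[OF f(1)]], of "e (r k)" k] by simp
      show "\<bar>?d g\<bar> \<le> \<epsilon> * s" if "T.cm g" "0 \<le> s" "\<forall>x\<in>topspace T. \<bar>g x\<bar> \<le> s" for g s
        using err[of g s k] that by simp
    qed
    then have "\<bar>\<Psi> ?d\<bar> \<le> B * \<epsilon>" by (rule \<Psi>_bound) (use \<epsilon> in simp)
    moreover have "\<Psi> ?d = \<Psi> (\<mu> (e (r k))) + \<Psi> (\<lambda>g. (-1) * L (\<lambda>x. f k x * g x))"
      by (rule \<Psi>_add[OF \<mu> neg])
    moreover have "\<Psi> (\<lambda>g. (-1) * L (\<lambda>x. f k x * g x)) = (-1) * \<tau> (f k)"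
      unfolding \<tau>_def by (rule \<Psi>_scale[OF \<rho>[OF f(1)]])
    ultimately have 1: "\<bar>\<Psi> (\<mu> (e (r k))) - \<tau> (f k)\<bar> \<le> B * \<epsilon>" by simp
    have comm: "(\<lambda>x. y x * f k x) = (\<lambda>x. f k x * y x)" by (auto simp: mult.commute)
    have m2: "2 * \<epsilon>' * m \<le> 2 * \<epsilon>" using \<epsilon>'(2) by simp
    define p where "p = B * \<epsilon>"
    have p: "\<delta> = 4 * p + 4 * \<epsilon>" using \<epsilon>(2) by (simp add: p_def algebra_simps)
    have "0 \<le> p" using B \<epsilon> by (simp add: p_def)
    then show False
      using 1 2 3 k m2 e\<delta>[of "r k"] \<epsilon>(1) p unfolding comm mult.commute[of \<epsilon> B] p_def[symmetric] by linarith
  qed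
qed

text \<open>The hypothesis allows a different separation constant for each A. The first half of the
  proof passes to a subsequence on which one constant \<epsilon> serves all subsets. The second half
  splits it with an error small against \<epsilon> and finds indices k in N and j in M that no
  function of the separating family distinguishes by \<epsilon>.\<close>

lemma no_separated_sequence:
  assumes \<mu>: "\<And>n. bounded_functional T b (\<mu> n)"
    and sep: "\<And>A :: nat set. \<exists>\<G> \<epsilon>. finite \<G> \<and> (\<forall>g\<in>\<G>. T.cm g) \<and> 0 < \<epsilon> \<and>
      (\<forall>n\<in>A. \<forall>m\<in>-A. \<exists>g\<in>\<G>. \<epsilon> \<le> \<bar>\<mu> n g - \<mu> m g\<bar>)"
  shows False
proof -
  \<comment> \<open>Test functions are normalised to sup norm 1, since the errors of the splitting
    are proportional to the sup norm; only then are constants of different families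
    comparable.\<close>
  define sp where "sp \<epsilon> A B \<longleftrightarrow> (\<exists>\<G>. finite \<G> \<and> (\<forall>g\<in>\<G>. T.cm g) \<and> (\<forall>g\<in>\<G>. \<forall>x\<in>topspace T. \<bar>g x\<bar> \<le> 1) \<and>
    (\<forall>n\<in>A. \<forall>m\<in>B. \<exists>g\<in>\<G>. \<epsilon> \<le> \<bar>\<mu> n g - \<mu> m g\<bar>))" for \<epsilon> :: real and A B
  have sp_mono: "sp \<epsilon>' A' B'" if "sp \<epsilon> A B" "\<epsilon>' \<le> \<epsilon>" "A' \<subseteq> A" "B' \<subseteq> B" for \<epsilon> \<epsilon>' A A' B B'
  proof -
    obtain \<G> where \<G>: "finite \<G>" "\<forall>g\<in>\<G>. T.cm g" "\<forall>g\<in>\<G>. \<forall>x\<in>topspace T. \<bar>g x\<bar> \<le> 1"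
      "\<forall>n\<in>A. \<forall>m\<in>B. \<exists>g\<in>\<G>. \<epsilon> \<le> \<bar>\<mu> n g - \<mu> m g\<bar>"
      using \<open>sp \<epsilon> A B\<close> unfolding sp_def by (elim exE conjE)
    have "\<exists>g\<in>\<G>. \<epsilon>' \<le> \<bar>\<mu> n g - \<mu> m g\<bar>" if "n \<in> A'" "m \<in> B'" for n m
    proof -
      have "n \<in> A" "m \<in> B" using that \<open>A' \<subseteq> A\<close> \<open>B' \<subseteq> B\<close> by auto
      then obtain g where "g \<in> \<G>" "\<epsilon> \<le> \<bar>\<mu> n g - \<mu> m g\<bar>" using \<G>(4) by blast
      then show ?thesis using \<open>\<epsilon>' \<le> \<epsilon>\<close> by (intro bexI[of _ g]) auto
    qed
    then show ?thesis unfolding sp_def using \<G>(1-3) by (intro exI[of _ \<G>]) blast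
  qed
  have sp_compl: "\<exists>\<epsilon>>0. sp \<epsilon> A (-A)" for A
  proof -
    obtain \<G> \<epsilon> where \<G>: "finite \<G>" "\<forall>g\<in>\<G>. T.cm g" "0 < \<epsilon>" "\<forall>n\<in>A. \<forall>m\<in>-A. \<exists>g\<in>\<G>. \<epsilon> \<le> \<bar>\<mu> n g - \<mu> m g\<bar>"
      using sep[of A] by (elim exE conjE)
    obtain S where S: "1 \<le> S" "\<And>g x. g \<in> \<G> \<Longrightarrow> x \<in> topspace T \<Longrightarrow> \<bar>g x\<bar> \<le> S"
      using T.finite_cm_bounded[OF \<G>(1,2)] by blast
    define N where "N g x = (1 / S) * g x" for g :: "point \<Rightarrow> real" and x
    have "sp (\<epsilon> / S) A (-A)" unfolding sp_def
    proof (intro exI[of _ "N ` \<G>"] conjI ballI)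
      show "finite (N ` \<G>)" using \<G>(1) by simp
      show "T.cm g" if "g \<in> N ` \<G>" for g
      proof -
        obtain h where "h \<in> \<G>" "g = N h" using \<open>g \<in> N ` \<G>\<close> by blast
        then show ?thesis using \<G>(2) T.cm_ops(3)[OF T.cm_const, of h "1 / S"] unfolding N_def[abs_def] by simp
      qed
      show "\<bar>g x\<bar> \<le> 1" if "g \<in> N ` \<G>" "x \<in> topspace T" for g x
      proof -
        obtain h where "h \<in> \<G>" "g = N h" using \<open>g \<in> N ` \<G>\<close> by blast
        then show ?thesis using S(1) S(2)[of h x] that(2) by (simp add: N_def abs_mult)
      qed
      show "\<exists>g\<in>N ` \<G>. \<epsilon> / S \<le> \<bar>\<mu> n g - \<mu> m g\<bar>" if "n \<in> A" "m \<in> -A" for n m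
      proof -
        obtain g where g: "g \<in> \<G>" "\<epsilon> \<le> \<bar>\<mu> n g - \<mu> m g\<bar>" using \<G>(4) \<open>n \<in> A\<close> \<open>m \<in> -A\<close> by blast
        have "\<mu> i (N g) = (1 / S) * \<mu> i g" for i
          unfolding N_def[abs_def] by (rule T.bounded_functional_simps(3)[OF \<mu>]) (use g \<G>(2) in blast)
        then have "\<bar>\<mu> n (N g) - \<mu> m (N g)\<bar> = \<bar>\<mu> n g - \<mu> m g\<bar> / S"
          using S(1) by (simp add: diff_divide_distrib[symmetric])
        moreover have "\<epsilon> / S \<le> \<bar>\<mu> n g - \<mu> m g\<bar> / S" using g(2) S(1) by (intro divide_right_mono) auto
        ultimately show ?thesis using g(1) by (intro bexI[of _ "N g"] imageI) linarith
      qed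
    qed
    moreover have "0 < \<epsilon> / S" using \<G>(3) S(1) by simp
    ultimately show ?thesis by blast
  qed
  \<comment> \<open>Infinitely many disjoint infinite pieces of \<omega>. If each piece E j had a
    subset A j not separated from its rest with constant 1/(j+1), the union of all A j would not be
    separated from its complement with any constant.\<close>
  define E where "E j = range (\<lambda>i. prod_encode (j, i))" for j :: nat
  have "\<exists>j. \<forall>A\<subseteq>E j. sp (1 / real (Suc j)) A (E j - A)"
  proof (rule ccontr)
    assume "\<not> ?thesis"
    then have "\<forall>j. \<exists>A. A \<subseteq> E j \<and> \<not> sp (1 / real (Suc j)) A (E j - A)" by blast
    from choice[OF this] obtain A where A: "\<forall>j. A j \<subseteq> E j \<and> \<not> sp (1 / real (Suc j)) (A j) (E j - A j)" ..
    obtain \<epsilon> where \<epsilon>: "0 < \<epsilon>" "sp \<epsilon> (\<Union>j. A j) (- (\<Union>j. A j))" using sp_compl by blast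
    obtain j where j: "1 / real (Suc j) < \<epsilon>" using nat_approx_posE[OF \<epsilon>(1)] by blast
    have "E j - A j \<subseteq> - (\<Union>j. A j)"
    proof
      fix n assume n: "n \<in> E j - A j"
      have "n \<notin> A i" for i
      proof (cases "i = j")
        case False
        have "E i \<inter> E j = {}" using False by (auto simp: E_def)
        then show ?thesis using n A by blast
      qed (use n in simp)
      then show "n \<in> - (\<Union>j. A j)" by blast
    qed
    then have "sp (1 / real (Suc j)) (A j) (E j - A j)" using j by (intro sp_mono[OF \<epsilon>(2)]) auto
    then show False using A by blast
  qed
  then obtain j where j: "\<And>A. A \<subseteq> E j \<Longrightarrow> sp (1 / real (Suc j)) A (E j - A)" by blast
  define \<epsilon> where "\<epsilon> = 1 / real (Suc j)"
  have \<epsilon>: "0 < \<epsilon>" by (simp add: \<epsilon>_def)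
  define \<mu>' where "\<mu>' i = \<mu> (prod_encode (j, i))" for i
  have \<mu>': "bounded_functional T b (\<mu>' i)" for i unfolding \<mu>'_def by (rule \<mu>)
  have sep': "\<exists>\<G>. finite \<G> \<and> (\<forall>g\<in>\<G>. T.cm g) \<and> (\<forall>g\<in>\<G>. \<forall>x\<in>topspace T. \<bar>g x\<bar> \<le> 1) \<and>
    (\<forall>n\<in>A. \<forall>m\<in>-A. \<exists>g\<in>\<G>. \<epsilon> \<le> \<bar>\<mu>' n g - \<mu>' m g\<bar>)" for A
  proof -
    let ?A = "(\<lambda>i. prod_encode (j, i)) ` A"
    have "?A \<subseteq> E j" by (auto simp: E_def)
    then have "sp (1 / real (Suc j)) ?A (E j - ?A)" by (rule j)
    then obtain \<G> where \<G>: "finite \<G>" "\<forall>g\<in>\<G>. T.cm g" "\<forall>g\<in>\<G>. \<forall>x\<in>topspace T. \<bar>g x\<bar> \<le> 1"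
      "\<forall>n\<in>?A. \<forall>m\<in>E j - ?A. \<exists>g\<in>\<G>. \<epsilon> \<le> \<bar>\<mu> n g - \<mu> m g\<bar>"
      unfolding sp_def \<epsilon>_def by (elim exE conjE)
    have "\<exists>g\<in>\<G>. \<epsilon> \<le> \<bar>\<mu>' n g - \<mu>' m g\<bar>" if "n \<in> A" "m \<in> -A" for n m
    proof -
      have "prod_encode (j, n) \<in> ?A" "prod_encode (j, m) \<in> E j - ?A" using that by (auto simp: E_def)
      then show ?thesis using \<G>(4) unfolding \<mu>'_def by blast
    qed
    then show ?thesis using \<G>(1-3) by blast
  qed
  \<comment> \<open>In the final estimate the two splitting errors, the clopen parts and the
    densities contribute 2 \<kappa>, 2 \<kappa> and \<kappa>, together half of \<epsilon>.\<close>
  define \<kappa> where "\<kappa> = \<epsilon> / 10"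
  have \<kappa>: "0 < \<kappa>" using \<epsilon> by (simp add: \<kappa>_def)
  show False
  proof (rule T.splitting[OF \<mu>' \<kappa>])
    fix r :: "nat \<Rightarrow> nat" and V L m f
    assume r: "strict_mono r" and V: "\<And>k. clopenin T (V k)" "disjoint_family V"
      and L: "positive_functional T L" and m: "0 \<le> m" and f: "\<And>k::nat. T.cm (f k)"
      "\<And>k x. x \<in> topspace T \<Longrightarrow> \<bar>f k x\<bar> \<le> m" "\<And>y. T.cm y \<Longrightarrow> convergent (\<lambda>k. L (\<lambda>x. f k x * y x))"
      and err: "\<And>k g s. T.cm g \<Longrightarrow> 0 \<le> s \<Longrightarrow> (\<And>x. x \<in> topspace T \<Longrightarrow> \<bar>g x\<bar> \<le> s) \<Longrightarrow>
       \<bar>\<mu>' (r k) g - \<mu>' (r k) (\<lambda>x. indicator (V k) x * g x) - L (\<lambda>x. f k x * g x)\<bar> \<le> \<kappa> * s"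
    define \<sigma> where "\<sigma> k g = \<mu>' (r k) (\<lambda>x. indicator (V k) x * g x)" for k g
    have \<sigma>: "bounded_functional T b (\<sigma> k)" for k
      unfolding \<sigma>_def by (rule T.bounded_functional_restrict[OF \<mu>' V(1)])
    have supp: "\<sigma> k (\<lambda>x. indicator (V k) x * g x) = \<sigma> k g" if "T.cm g" for k g
    proof -
      have "(\<lambda>x. indicator (V k) x * (indicator (V k) x * g x)) = (\<lambda>x. indicator (V k) x * g x)"
        by (auto simp: indicator_def)
      then show ?thesis by (simp add: \<sigma>_def)
    qed
    have "\<exists>N M. N \<inter> M = {} \<and> (\<forall>\<G> k0. finite \<G> \<longrightarrow> (\<forall>g\<in>\<G>. T.cm g) \<longrightarrow> (\<forall>g\<in>\<G>. \<forall>x\<in>topspace T. \<bar>g x\<bar> \<le> 1) \<longrightarrow>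
      (\<exists>k\<in>N. \<exists>j\<in>M. k0 \<le> k \<and> k0 \<le> j \<and> (\<forall>g\<in>\<G>. \<bar>\<sigma> k g - \<sigma> j g\<bar> \<le> 2 * \<kappa>)))"
    \<comment> \<open>If the clopen parts are eventually small, any two disjoint infinite sets would
      do, here the even and the odd numbers. Otherwise \<open>common_cluster_functions\<close>
      supplies N and M.\<close>
    proof (cases "finite {k. \<kappa> \<le> T.modulus (\<sigma> k) (\<lambda>x. 1)}")
      case True
      then obtain k1 where k1: "\<And>k. \<kappa> \<le> T.modulus (\<sigma> k) (\<lambda>x. 1) \<Longrightarrow> k < k1"
        using finite_nat_set_iff_bounded by auto
      have small: "\<bar>\<sigma> k g\<bar> \<le> \<kappa> * 1" if "k1 \<le> k" "T.cm g" "\<forall>x\<in>topspace T. \<bar>g x\<bar> \<le> 1" for k g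
      proof -
        have "T.modulus (\<sigma> k) (\<lambda>x. 1) \<le> \<kappa>" using k1[of k] that(1) by (meson linear not_le)
        then have bf: "bounded_functional T \<kappa> (\<sigma> k)"
          by (rule T.bounded_functional_mono[OF T.bounded_functional_modulus_one[OF \<sigma>]])
        show ?thesis by (rule T.bounded_functionalD[OF bf that(2)]) (use that(3) in auto)
      qed
      have ev: "\<exists>k\<in>{k. even k}. \<exists>j\<in>{k. odd k}. k0 \<le> k \<and> k0 \<le> j \<and> (\<forall>g\<in>\<G>. \<bar>\<sigma> k g - \<sigma> j g\<bar> \<le> 2 * \<kappa>)"
        if "\<forall>g\<in>\<G>. T.cm g" "\<forall>g\<in>\<G>. \<forall>x\<in>topspace T. \<bar>g x\<bar> \<le> 1" for \<G> k0
      proof -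
        have "\<bar>\<sigma> (2 * (k0 + k1)) g - \<sigma> (2 * (k0 + k1) + 1) g\<bar> \<le> 2 * \<kappa>" if "g \<in> \<G>" for g
          using small[of "2 * (k0 + k1)" g] small[of "2 * (k0 + k1) + 1" g] that
            \<open>\<forall>g\<in>\<G>. T.cm g\<close> \<open>\<forall>g\<in>\<G>. \<forall>x\<in>topspace T. \<bar>g x\<bar> \<le> 1\<close> by simp
        then show ?thesis
          by (intro bexI[of _ "2 * (k0 + k1)"] bexI[of _ "2 * (k0 + k1) + 1"]) auto
      qed
      have disj: "{k :: nat. even k} \<inter> {k. odd k} = {}" by auto
      show ?thesis
        by (rule exI, rule exI, rule conjI[OF disj]) (intro allI impI, rule ev)
    next
      case False
      have "\<exists>N M. N \<inter> M = {} \<and> (\<forall>\<G> \<epsilon> k0. finite \<G> \<longrightarrow> (\<forall>g\<in>\<G>. T.cm g) \<longrightarrow> 0 < \<epsilon> \<longrightarrow>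
        (\<exists>k\<in>N. \<exists>j\<in>M. k0 \<le> k \<and> k0 \<le> j \<and> (\<forall>g\<in>\<G>. \<bar>\<sigma> k g - \<sigma> j g\<bar> \<le> \<epsilon>)))"
        by (rule common_cluster_functions[OF \<sigma> V _ \<kappa> False]) (rule supp)
      then obtain N M where NM: "N \<inter> M = {}" and cl: "\<forall>\<G> \<epsilon> k0. finite \<G> \<longrightarrow> (\<forall>g\<in>\<G>. T.cm g) \<longrightarrow> 0 < \<epsilon> \<longrightarrow>
        (\<exists>k\<in>N. \<exists>j\<in>M. k0 \<le> k \<and> k0 \<le> j \<and> (\<forall>g\<in>\<G>. \<bar>\<sigma> k g - \<sigma> j g\<bar> \<le> \<epsilon>))"
        by (elim exE conjE)
      have "0 < 2 * \<kappa>" using \<kappa> by simp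
      show ?thesis
      proof (intro exI conjI allI impI)
        show "N \<inter> M = {}" by (rule NM)
        fix \<G> k0 assume "finite \<G>" "\<forall>g\<in>\<G>. T.cm g"
        then show "\<exists>k\<in>N. \<exists>j\<in>M. k0 \<le> k \<and> k0 \<le> j \<and> (\<forall>g\<in>\<G>. \<bar>\<sigma> k g - \<sigma> j g\<bar> \<le> 2 * \<kappa>)"
          using cl \<open>0 < 2 * \<kappa>\<close> by simp
      qed
    qed
    then obtain N M where NM: "N \<inter> M = {}" and close: "\<forall>\<G> k0. finite \<G> \<longrightarrow> (\<forall>g\<in>\<G>. T.cm g) \<longrightarrow>
      (\<forall>g\<in>\<G>. \<forall>x\<in>topspace T. \<bar>g x\<bar> \<le> 1) \<longrightarrow>
      (\<exists>k\<in>N. \<exists>j\<in>M. k0 \<le> k \<and> k0 \<le> j \<and> (\<forall>g\<in>\<G>. \<bar>\<sigma> k g - \<sigma> j g\<bar> \<le> 2 * \<kappa>))" by (elim exE conjE)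
    \<comment> \<open>The subset to be separated is chosen only now, when N is known, and the family
      of functions depends on it. Since r is injective, r j lies outside the image of N for every j
      in M.\<close>
    obtain \<G> where \<G>: "finite \<G>" "\<forall>g\<in>\<G>. T.cm g" "\<forall>g\<in>\<G>. \<forall>x\<in>topspace T. \<bar>g x\<bar> \<le> 1"
      "\<forall>n\<in>r ` N. \<forall>m\<in>- r ` N. \<exists>g\<in>\<G>. \<epsilon> \<le> \<bar>\<mu>' n g - \<mu>' m g\<bar>"
      using sep'[of "r ` N"] by (elim exE conjE)
    have "\<forall>g\<in>\<G>. \<exists>k0. \<forall>k\<ge>k0. \<forall>j\<ge>k0. \<bar>L (\<lambda>x. f k x * g x) - L (\<lambda>x. f j x * g x)\<bar> < \<kappa>"
    proof
      fix g assume "g \<in> \<G>"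
      then have "convergent (\<lambda>k. L (\<lambda>x. f k x * g x))" using \<G>(2) f(3) by blast
      from CauchyD[OF convergent_Cauchy[OF this] \<kappa>]
      show "\<exists>k0. \<forall>k\<ge>k0. \<forall>j\<ge>k0. \<bar>L (\<lambda>x. f k x * g x) - L (\<lambda>x. f j x * g x)\<bar> < \<kappa>" by simp
    qed
    from bchoice[OF this] obtain K0 where
      K0: "\<forall>g\<in>\<G>. \<forall>k\<ge>K0 g. \<forall>j\<ge>K0 g. \<bar>L (\<lambda>x. f k x * g x) - L (\<lambda>x. f j x * g x)\<bar> < \<kappa>" ..
    define k0 where "k0 = Max (insert 0 (K0 ` \<G>))"
    have k0: "K0 g \<le> k0" if "g \<in> \<G>" for g using \<G>(1) that unfolding k0_def by simp
    have "\<exists>k\<in>N. \<exists>j\<in>M. k0 \<le> k \<and> k0 \<le> j \<and> (\<forall>g\<in>\<G>. \<bar>\<sigma> k g - \<sigma> j g\<bar> \<le> 2 * \<kappa>)"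
      using close \<G>(1-3) by simp
    then obtain k j where kj: "k \<in> N" "j \<in> M" "k0 \<le> k" "k0 \<le> j" and "\<forall>g\<in>\<G>. \<bar>\<sigma> k g - \<sigma> j g\<bar> \<le> 2 * \<kappa>"
      by (elim bexE conjE)
    then have kj5: "\<bar>\<sigma> k g - \<sigma> j g\<bar> \<le> 2 * \<kappa>" if "g \<in> \<G>" for g using that by blast
    have "r j \<notin> r ` N" using NM kj(2) strict_mono_eq[OF r] by auto
    then obtain g where g: "g \<in> \<G>" "\<epsilon> \<le> \<bar>\<mu>' (r k) g - \<mu>' (r j) g\<bar>" using \<G>(4) kj(1) by blast
    have e: "\<bar>\<mu>' (r i) g - \<sigma> i g - L (\<lambda>x. f i x * g x)\<bar> \<le> \<kappa> * 1" for i
      unfolding \<sigma>_def by (rule err) (use \<G>(2,3) g(1) in auto)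
    have "\<bar>L (\<lambda>x. f k x * g x) - L (\<lambda>x. f j x * g x)\<bar> < \<kappa>"
      using K0 g(1) order_trans[OF k0[OF g(1)] kj(3)] order_trans[OF k0[OF g(1)] kj(4)] by blast
    then show False using e[of k] e[of j] kj5[OF g(1)] g(2) \<kappa> unfolding \<kappa>_def by linarith
  qed
qed

end


section \<open>Copies of the Stone--Cech compactification of the integers\<close>

text \<open>Records the two properties of \<beta>\<omega> that matter here: compactness, and
  continuous extendability of the indicator of every S. The extension is a coordinate projection of
  the cube in which \<beta>\<omega> is defined, namely the one indexed by that indicator.\<close>

lemma beta_omega_copy:
  assumes A: "A \<subseteq> topspace Y" and hom: "subtopology Y A homeomorphic_space beta_omega"
  shows "compact_space (subtopology Y A)"
    "\<exists>z. range z \<subseteq> A \<and> (\<forall>S. \<exists>h. continuous_map (subtopology Y A) euclideanreal h \<and>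
      (\<forall>n::nat. h (z n) = indicator S n))"
proof -
  let ?D = "discrete_topology (UNIV :: nat set)"
  define U where "U = unit_interval_maps ?D"
  define Q :: "((nat \<Rightarrow> real) \<Rightarrow> real) topology" where "Q = product_topology (\<lambda>_. top_of_set {0..1}) U"
  define e where "e n = (\<lambda>f\<in>U. f n)" for n :: nat
  have bo: "beta_omega = subtopology Q (Q closure_of (range e))"
    unfolding stone_cech_def Let_def Q_def U_def e_def by simp
  have U: "f \<in> U \<longleftrightarrow> (\<forall>n. f n \<in> {0..1})" for f
    unfolding U_def unit_interval_maps_def by (auto simp: continuous_map_in_subtopology)
  have Qc: "compact_space Q"
    unfolding Q_def compact_space_product_topology by (simp add: compact_space_subtopology)
  have "compact_space beta_omega"
    unfolding bo by (intro compact_space_subtopology closedin_compact_space[OF Qc] closedin_closure_of)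
  then show "compact_space (subtopology Y A)" using homeomorphic_compact_space[OF hom] by simp
  have eQ: "range e \<subseteq> topspace Q" using U by (auto simp: Q_def e_def)
  have eb: "e n \<in> topspace beta_omega" for n
    using closure_of_subset[OF eQ] eQ unfolding bo by auto
  obtain F G where FG: "homeomorphic_maps (subtopology Y A) beta_omega F G"
    using hom unfolding homeomorphic_space_def by blast
  have F: "continuous_map (subtopology Y A) beta_omega F" and G: "continuous_map beta_omega (subtopology Y A) G"
    and FGe: "\<And>y. y \<in> topspace beta_omega \<Longrightarrow> F (G y) = y" using FG by (auto simp: homeomorphic_maps_def)
  define z where "z n = G (e n)" for n
  have zA: "z n \<in> A" for n
    using continuous_map_image_subset_topspace[OF G] eb[of n] unfolding z_def by auto
  have "\<exists>h. continuous_map (subtopology Y A) euclideanreal h \<and> (\<forall>n. h (z n) = indicator S n)" for S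
  proof (intro exI conjI allI)
    have iU: "indicator S \<in> U" unfolding U by (auto simp: indicator_def)
    have "continuous_map Q (top_of_set {0..1}) (\<lambda>x. x (indicator S))"
      unfolding Q_def by (rule continuous_map_product_projection[OF iU])
    then have "continuous_map beta_omega euclideanreal (\<lambda>x. x (indicator S))"
      unfolding bo by (intro continuous_map_from_subtopology) (rule continuous_map_into_fulltopology)
    from continuous_map_compose[OF F this]
    show "continuous_map (subtopology Y A) euclideanreal (\<lambda>y. F y (indicator S))" by (simp add: o_def)
    show "F (z n) (indicator S) = indicator S n" for n
      using FGe[OF eb[of n]] iU by (simp add: z_def e_def)
  qed
  then show "\<exists>z. range z \<subseteq> A \<and> (\<forall>S. \<exists>h. continuous_map (subtopology Y A) euclideanreal h \<and>
      (\<forall>n::nat. h (z n) = indicator S n))"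
    using zA by (intro exI[of _ z]) auto
qed

section \<open>The dual of \<open>C(T)\<close>\<close>

context talagrand_realisation
begin

lemma carrier_nonempty: "carrier \<noteq> {}"
proof -
  have "proj omega0 (\<lambda>_. False) \<in> K omega0" unfolding K_omega topspace_cube by (rule proj_extensional)
  then show ?thesis using carrier_surj[OF order_refl] by blast
qed

abbreviation CT :: "(point \<Rightarrow> real) nspace" where "CT \<equiv> Cont T"

lemma CT_carrier: "f \<in> vcarrier CT \<longleftrightarrow> f \<in> extensional carrier \<and> T.cm f"
  by (simp add: Cont_def topspace_T)

lemma CT_cm: "f \<in> vcarrier CT \<Longrightarrow> T.cm f"
  by (simp add: CT_carrier)

lemma CT_add: "vadd CT f g = (\<lambda>x\<in>carrier. f x + g x)" and CT_scale: "vscale CT c f = (\<lambda>x\<in>carrier. c * f x)"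
  by (simp_all add: Cont_def topspace_T)

lemma restrict_CT: "T.cm f \<Longrightarrow> restrict f carrier \<in> vcarrier CT"
  unfolding CT_carrier by (auto intro: continuous_map_eq simp: topspace_T)

lemma CT_norm_le: "(\<And>x. x \<in> carrier \<Longrightarrow> \<bar>f x\<bar> \<le> s) \<Longrightarrow> vnorm CT f \<le> s"
  using carrier_nonempty by (simp add: Cont_def topspace_T cSUP_least)

lemma le_CT_norm:
  assumes "T.cm f" "x \<in> carrier" shows "\<bar>f x\<bar> \<le> vnorm CT f"
proof -
  obtain s where "0 \<le> s" "\<And>x. x \<in> topspace T \<Longrightarrow> \<bar>f x\<bar> \<le> s" using T.cm_bounded[OF assms(1)] by blast
  then have "bdd_above ((\<lambda>x. \<bar>f x\<bar>) ` carrier)" by (auto simp: topspace_T intro!: bdd_aboveI2)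
  then have "\<bar>f x\<bar> \<le> (SUP x\<in>carrier. \<bar>f x\<bar>)" by (rule cSUP_upper[OF assms(2)])
  then show ?thesis by (simp add: Cont_def topspace_T)
qed

lemma CT_norm_nonneg: "T.cm f \<Longrightarrow> 0 \<le> vnorm CT f"
  using le_CT_norm carrier_nonempty by (metis abs_ge_zero all_not_in_conv order_trans)

text \<open>Members of \<open>dual_space\<close> act on extensional functions, whereas the
  functionals of the preceding parts act on all functions continuous on T. \<open>extend\<close> and
  \<open>reduce\<close> pass between the two conventions.\<close>

definition extend :: "((point \<Rightarrow> real) \<Rightarrow> real) \<Rightarrow> (point \<Rightarrow> real) \<Rightarrow> real" where
  "extend \<phi> f = \<phi> (restrict f carrier)"

abbreviation reduce :: "((point \<Rightarrow> real) \<Rightarrow> real) \<Rightarrow> (point \<Rightarrow> real) \<Rightarrow> real" where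
  "reduce \<phi> \<equiv> restrict \<phi> (vcarrier CT)"

lemma dual_iff:
  "\<phi> \<in> vcarrier (dual_space E) \<longleftrightarrow> \<phi> \<in> extensional (vcarrier E) \<and>
          (\<forall>x\<in>vcarrier E. \<forall>y\<in>vcarrier E. \<phi> (vadd E x y) = \<phi> x + \<phi> y) \<and>
          (\<forall>c. \<forall>x\<in>vcarrier E. \<phi> (vscale E c x) = c * \<phi> x) \<and>
          (\<exists>b. \<forall>x\<in>vcarrier E. \<bar>\<phi> x\<bar> \<le> b * vnorm E x)"
  by (simp add: dual_space_def)

lemma extend_restrict_eq: "f \<in> vcarrier CT \<Longrightarrow> extend \<phi> f = \<phi> f"
  by (simp add: extend_def CT_carrier extensional_restrict)

lemma linear_extend:
  assumes \<phi>: "\<phi> \<in> vcarrier (dual_space CT)" shows "linear_functional T (extend \<phi>)"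
  unfolding linear_functional_def
proof (intro conjI allI impI)
  fix f g assume fg: "T.cm f" "T.cm g"
  have "restrict (\<lambda>x. f x + g x) carrier = vadd CT (restrict f carrier) (restrict g carrier)"
    by (auto simp: CT_add fun_eq_iff restrict_def)
  then show "extend \<phi> (\<lambda>x. f x + g x) = extend \<phi> f + extend \<phi> g"
    using \<phi> restrict_CT[OF fg(1)] restrict_CT[OF fg(2)] unfolding extend_def dual_iff by simp
next
  fix c f assume f: "T.cm f"
  have "restrict (\<lambda>x. c * f x) carrier = vscale CT c (restrict f carrier)"
    by (auto simp: CT_scale fun_eq_iff restrict_def)
  then show "extend \<phi> (\<lambda>x. c * f x) = c * extend \<phi> f"
    using \<phi> restrict_CT[OF f] unfolding extend_def dual_iff by simp
qed

lemma bounded_extend: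
  assumes \<phi>: "\<phi> \<in> vcarrier (dual_space CT)" shows "\<exists>b. bounded_functional T b (extend \<phi>)"
proof -
  obtain b where b: "\<And>f. f \<in> vcarrier CT \<Longrightarrow> \<bar>\<phi> f\<bar> \<le> b * vnorm CT f" using \<phi> unfolding dual_iff by blast
  have "\<bar>extend \<phi> f\<bar> \<le> \<bar>b\<bar> * s" if f: "T.cm f" "0 \<le> s" "\<forall>x\<in>topspace T. \<bar>f x\<bar> \<le> s" for f s
  proof -
    let ?f = "restrict f carrier"
    have n: "vnorm CT ?f \<le> s" "0 \<le> vnorm CT ?f"
      using f(3) CT_norm_nonneg[OF CT_cm[OF restrict_CT[OF f(1)]]] by (auto intro!: CT_norm_le simp: topspace_T)
    have "\<bar>extend \<phi> f\<bar> \<le> b * vnorm CT ?f" unfolding extend_def by (rule b[OF restrict_CT[OF f(1)]])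
    also have "\<dots> \<le> \<bar>b\<bar> * vnorm CT ?f" using n(2) by (intro mult_right_mono) auto
    also have "\<dots> \<le> \<bar>b\<bar> * s" using n(1) by (intro mult_left_mono) auto
    finally show ?thesis .
  qed
  then show ?thesis unfolding bounded_functional_def using linear_extend[OF \<phi>] by blast
qed

lemma reduce_dual:
  assumes \<phi>: "bounded_functional T b \<phi>" and b: "0 \<le> b"
  shows "reduce \<phi> \<in> vcarrier (dual_space CT)" "vnorm (dual_space CT) (reduce \<phi>) \<le> b"
proof -
  have cl: "vadd CT f g \<in> vcarrier CT" "\<phi> (vadd CT f g) = \<phi> f + \<phi> g"
    if "f \<in> vcarrier CT" "g \<in> vcarrier CT" for f g
  proof -
    have fg: "T.cm (\<lambda>x. f x + g x)" using that by (intro T.cm_ops CT_cm)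
    show 1: "vadd CT f g \<in> vcarrier CT" unfolding CT_add by (rule restrict_CT[OF fg])
    have "\<phi> (vadd CT f g) = \<phi> (\<lambda>x. f x + g x)"
      by (rule T.bounded_functional_cong[OF \<phi> CT_cm[OF 1] fg]) (simp add: CT_add topspace_T)
    then show "\<phi> (vadd CT f g) = \<phi> f + \<phi> g"
      using T.bounded_functional_simps(1)[OF \<phi> CT_cm[OF that(1)] CT_cm[OF that(2)]] by simp
  qed
  have cs: "vscale CT c f \<in> vcarrier CT" "\<phi> (vscale CT c f) = c * \<phi> f" if "f \<in> vcarrier CT" for c f
  proof -
    have fg: "T.cm (\<lambda>x. c * f x)" using that by (intro T.cm_ops CT_cm T.cm_const)
    show 1: "vscale CT c f \<in> vcarrier CT" unfolding CT_scale by (rule restrict_CT[OF fg])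
    have "\<phi> (vscale CT c f) = \<phi> (\<lambda>x. c * f x)"
      by (rule T.bounded_functional_cong[OF \<phi> CT_cm[OF 1] fg]) (simp add: CT_scale topspace_T)
    then show "\<phi> (vscale CT c f) = c * \<phi> f"
      using T.bounded_functional_simps(3)[OF \<phi> CT_cm[OF that]] by simp
  qed
  have bd: "\<bar>\<phi> f\<bar> \<le> b * vnorm CT f" if f: "f \<in> vcarrier CT" for f
    by (rule T.bounded_functionalD[OF \<phi> CT_cm[OF f] CT_norm_nonneg[OF CT_cm[OF f]]])
      (simp add: le_CT_norm[OF CT_cm[OF f]] topspace_T)
  show "reduce \<phi> \<in> vcarrier (dual_space CT)"
    unfolding dual_iff using cl cs by (auto intro!: exI[of _ b] bd)
  have "vnorm (dual_space CT) (reduce \<phi>) = Sup {\<bar>reduce \<phi> x\<bar> |x. x \<in> vcarrier CT \<and> vnorm CT x \<le> 1}"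
    by (simp add: dual_space_def)
  also have "\<dots> \<le> b"
  proof (rule cSup_least)
    have "restrict (\<lambda>x. 0) carrier \<in> vcarrier CT" by (rule restrict_CT) simp
    moreover have "vnorm CT (restrict (\<lambda>x. 0) carrier) \<le> 1" by (rule CT_norm_le) simp
    ultimately show "{\<bar>reduce \<phi> x\<bar> |x. x \<in> vcarrier CT \<and> vnorm CT x \<le> 1} \<noteq> {}" by blast
    fix y assume "y \<in> {\<bar>reduce \<phi> x\<bar> |x. x \<in> vcarrier CT \<and> vnorm CT x \<le> 1}"
    then obtain f where f: "f \<in> vcarrier CT" "vnorm CT f \<le> 1" "y = \<bar>\<phi> f\<bar>" by auto
    have "b * vnorm CT f \<le> b * 1" using f(2) b by (rule mult_left_mono)
    then show "y \<le> b" using bd[OF f(1)] f(3) by simp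
  qed
  finally show "vnorm (dual_space CT) (reduce \<phi>) \<le> b" .
qed

lemma reduce_extend:
  assumes "\<phi> \<in> vcarrier (dual_space CT)" shows "reduce (extend \<phi>) = \<phi>"
proof
  fix f
  show "reduce (extend \<phi>) f = \<phi> f"
  proof (cases "f \<in> vcarrier CT")
    case False
    then show ?thesis using assms unfolding dual_iff by (auto simp: extensional_def)
  qed (simp add: extend_restrict_eq)
qed

lemma unit_ball_bounded_extend:
  assumes \<phi>: "\<phi> \<in> vcarrier (dual_space CT)" "vnorm (dual_space CT) \<phi> \<le> 1"
  shows "bounded_functional T 1 (extend \<phi>)"
proof -
  obtain b where b: "bounded_functional T b (extend \<phi>)" using bounded_extend[OF \<phi>(1)] by blast
  have norm: "vnorm (dual_space CT) \<phi> = Sup {\<bar>\<phi> x\<bar> |x. x \<in> vcarrier CT \<and> vnorm CT x \<le> 1}"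
    by (simp add: dual_space_def)
  have up: "\<bar>\<phi> f\<bar> \<le> 1" if f: "f \<in> vcarrier CT" "vnorm CT f \<le> 1" for f
  proof -
    have "\<bar>\<phi> f\<bar> \<le> Sup {\<bar>\<phi> x\<bar> |x. x \<in> vcarrier CT \<and> vnorm CT x \<le> 1}"
    proof (rule cSup_upper)
      show "bdd_above {\<bar>\<phi> x\<bar> |x. x \<in> vcarrier CT \<and> vnorm CT x \<le> 1}"
      proof (rule bdd_aboveI[of _ "b * 1"], clarify)
        fix g assume g: "g \<in> vcarrier CT" "vnorm CT g \<le> 1"
        have "\<bar>extend \<phi> g\<bar> \<le> b * 1"
          by (rule T.bounded_functionalD[OF b CT_cm[OF g(1)]])
            (use g(2) le_CT_norm[OF CT_cm[OF g(1)]] order_trans in \<open>auto simp: topspace_T\<close>)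
        then show "\<bar>\<phi> g\<bar> \<le> b * 1" by (simp add: extend_restrict_eq[OF g(1)])
      qed
    qed (use f in blast)
    then show ?thesis using \<phi>(2) norm by simp
  qed
  have "T.modulus (extend \<phi>) (\<lambda>x. 1) \<le> 1"
  proof (rule T.modulus_least[OF b])
    fix h assume h: "T.cm h" "\<And>x. x \<in> topspace T \<Longrightarrow> \<bar>h x\<bar> \<le> 1"
    have "vnorm CT (restrict h carrier) \<le> 1" using h(2) by (intro CT_norm_le) (simp add: topspace_T)
    then have "\<bar>extend \<phi> h\<bar> \<le> 1" unfolding extend_def by (rule up[OF restrict_CT[OF h(1)]])
    then show "extend \<phi> h \<le> 1" by simp
  qed auto
  then show ?thesis by (rule T.bounded_functional_mono[OF T.bounded_functional_modulus_one[OF b]])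
qed

lemma weak_star_limit:
  "limitin (weak_star_topology CT) \<phi> \<psi> sequentially \<Longrightarrow>
    \<psi> \<in> vcarrier (dual_space CT) \<and> (\<forall>f\<in>vcarrier CT. (\<lambda>n. \<phi> n f) \<longlonglongrightarrow> \<psi> f)"
  unfolding weak_star_topology_def limitin_subtopology limitin_componentwise by simp

lemma weak_limitI:
  assumes "range \<phi> \<subseteq> vcarrier E" "\<psi> \<in> vcarrier E"
    and lim: "\<And>\<Phi>. \<Phi> \<in> vcarrier (dual_space E) \<Longrightarrow> (\<lambda>n. \<Phi> (\<phi> n)) \<longlonglongrightarrow> \<Phi> \<psi>"
  shows "limitin (weak_topology E) \<phi> \<psi> sequentially"
proof -
  define ev where "ev x = (\<lambda>\<Phi>\<in>vcarrier (dual_space E). \<Phi> x)" for x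
  let ?P = "product_topology (\<lambda>_. euclideanreal) (vcarrier (dual_space E))"
  have wt: "weak_topology E = pullback_topology (vcarrier E) ev ?P"
    unfolding weak_topology_def ev_def[abs_def] ..
  have evP: "ev x \<in> topspace ?P" for x by (simp add: ev_def)
  have L: "limitin ?P (\<lambda>n. ev (\<phi> n)) (ev \<psi>) sequentially"
    unfolding limitin_componentwise using lim by (simp add: ev_def)
  show ?thesis unfolding limitin_def
  proof (intro conjI allI impI)
    show "\<psi> \<in> topspace (weak_topology E)"
      unfolding wt topspace_pullback_topology using assms(2) evP by blast
    fix U assume "openin (weak_topology E) U \<and> \<psi> \<in> U"
    then obtain W where W: "openin ?P W" "U = ev -` W \<inter> vcarrier E" "\<psi> \<in> U"
      unfolding wt openin_pullback_topology by blast
    then have "\<forall>\<^sub>F n in sequentially. ev (\<phi> n) \<in> W" using L unfolding limitin_def by blast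
    then show "\<forall>\<^sub>F n in sequentially. \<phi> n \<in> U"
      by (rule eventually_mono) (use W(2) assms(1) in auto)
  qed
qed

text \<open>Pointwise convergence gives a uniform norm bound by \<open>uniform_boundedness\<close>.
  After subtraction of the weak-star limit, each element of the bidual, transported by
  \<open>reduce\<close>, is a \<open>\<Psi>\<close> as in \<open>null_sequence_weakly_null\<close>.
  The weak limit is thus the weak-star limit itself.\<close>

theorem grothendieck_CT: "grothendieck_property CT"
  unfolding grothendieck_property_def
proof (intro allI impI, elim exE)
  fix \<phi> :: "nat \<Rightarrow> (point \<Rightarrow> real) \<Rightarrow> real" and \<psi>
  assume \<phi>r: "range \<phi> \<subseteq> vcarrier (dual_space CT)" and lim: "limitin (weak_star_topology CT) \<phi> \<psi> sequentially"
  have \<phi>: "\<phi> n \<in> vcarrier (dual_space CT)" for n using \<phi>r by blast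
  have \<psi>: "\<psi> \<in> vcarrier (dual_space CT)" and lim': "\<And>f. f \<in> vcarrier CT \<Longrightarrow> (\<lambda>n. \<phi> n f) \<longlonglongrightarrow> \<psi> f"
    using weak_star_limit[OF lim] by auto
  have lim_ext: "(\<lambda>n. extend (\<phi> n) f) \<longlonglongrightarrow> extend \<psi> f" if "T.cm f" for f
    unfolding extend_def by (rule lim'[OF restrict_CT[OF that]])
  have "\<forall>n. \<exists>b. bounded_functional T b (extend (\<phi> n))" using bounded_extend[OF \<phi>] by blast
  from choice[OF this] obtain b where b: "\<And>n. bounded_functional T (b n) (extend (\<phi> n))" by blast
  have "\<exists>B. \<forall>n. bounded_functional T B (extend (\<phi> n))"
  proof (rule T.uniform_boundedness[OF b])
    fix f assume "T.cm f"
    then have "Bseq (\<lambda>n. extend (\<phi> n) f)" using lim_ext convergentI convergent_imp_Bseq by blast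
    then show "\<exists>c. \<forall>n. \<bar>extend (\<phi> n) f\<bar> \<le> c" unfolding Bseq_def real_norm_def by blast
  qed
  then obtain B where B: "\<And>n. bounded_functional T B (extend (\<phi> n))" by blast
  obtain C where C: "bounded_functional T C (extend \<psi>)" using bounded_extend[OF \<psi>] by blast
  define \<mu> where "\<mu> n g = extend (\<phi> n) g - extend \<psi> g" for n g
  have \<mu>: "bounded_functional T (B + C) (\<mu> n)" for n
    unfolding \<mu>_def by (rule T.bounded_functional_diff[OF B C])
  have \<mu>lim: "(\<lambda>n. \<mu> n g) \<longlonglongrightarrow> 0" if "T.cm g" for g
    unfolding \<mu>_def using tendsto_diff[OF lim_ext[OF that] tendsto_const[of "extend \<psi> g"]] by simp
  have "limitin (weak_topology (dual_space CT)) \<phi> \<psi> sequentially"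
  proof (rule weak_limitI[OF \<phi>r \<psi>])
    fix \<Phi> assume \<Phi>: "\<Phi> \<in> vcarrier (dual_space (dual_space CT))"
    define \<Psi> where "\<Psi> \<xi> = \<Phi> (reduce \<xi>)" for \<xi>
    have red: "reduce \<xi> \<in> vcarrier (dual_space CT)" "vnorm (dual_space CT) (reduce \<xi>) \<le> max a 0"
      if "bounded_functional T a \<xi>" for \<xi> a
      using reduce_dual[OF T.bounded_functional_mono[OF that, of "max a 0"]] by simp_all
    have dadd: "vadd (dual_space CT) (reduce \<xi>) (reduce \<omega>) = reduce (\<lambda>g. \<xi> g + \<omega> g)" for \<xi> \<omega>
      by (auto simp: dual_space_def fun_eq_iff restrict_def)
    have dscale: "vscale (dual_space CT) c (reduce \<xi>) = reduce (\<lambda>g. c * \<xi> g)" for \<xi> c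
      by (auto simp: dual_space_def fun_eq_iff restrict_def)
    have \<Psi>_add: "\<Psi> (\<lambda>g. \<xi> g + \<omega> g) = \<Psi> \<xi> + \<Psi> \<omega>"
      if "bounded_functional T a \<xi>" "bounded_functional T c \<omega>" for \<xi> \<omega> a c
      using \<Phi> red(1)[OF that(1)] red(1)[OF that(2)] unfolding \<Psi>_def dual_iff[of \<Phi>] dadd[symmetric] by blast
    have \<Psi>_scale: "\<Psi> (\<lambda>g. c * \<xi> g) = c * \<Psi> \<xi>" if "bounded_functional T a \<xi>" for \<xi> a c
      using \<Phi> red(1)[OF that] unfolding \<Psi>_def dual_iff[of \<Phi>] dscale[symmetric] by blast
    obtain D where D: "\<And>\<xi>. \<xi> \<in> vcarrier (dual_space CT) \<Longrightarrow> \<bar>\<Phi> \<xi>\<bar> \<le> D * vnorm (dual_space CT) \<xi>"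
      using \<Phi> unfolding dual_iff[of \<Phi>] by blast
    have \<Psi>_bound: "\<bar>\<Psi> \<xi>\<bar> \<le> \<bar>D\<bar> * a" if \<xi>: "bounded_functional T a \<xi>" "0 \<le> a" for \<xi> a
    proof -
      \<comment> \<open>The constant D comes without a sign, so the norm must be known to be
        nonnegative before D is replaced by its absolute value.\<close>
      have norm0: "0 \<le> vnorm (dual_space CT) (reduce \<xi>)"
      proof -
        have "\<bar>reduce \<xi> (restrict (\<lambda>x. 0) carrier)\<bar> \<le> Sup {\<bar>reduce \<xi> x\<bar> |x. x \<in> vcarrier CT \<and> vnorm CT x \<le> 1}"
        proof (rule cSup_upper)
          have "restrict (\<lambda>x. 0) carrier \<in> vcarrier CT" by (rule restrict_CT) simp
          moreover have "vnorm CT (restrict (\<lambda>x. 0) carrier) \<le> 1" by (rule CT_norm_le) simp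
          ultimately show "\<bar>reduce \<xi> (restrict (\<lambda>x. 0) carrier)\<bar> \<in> {\<bar>reduce \<xi> x\<bar> |x. x \<in> vcarrier CT \<and> vnorm CT x \<le> 1}" by blast
          show "bdd_above {\<bar>reduce \<xi> x\<bar> |x. x \<in> vcarrier CT \<and> vnorm CT x \<le> 1}"
          proof (rule bdd_aboveI[of _ "a * 1"], clarify)
            fix g assume g: "g \<in> vcarrier CT" "vnorm CT g \<le> 1"
            have "\<bar>\<xi> g\<bar> \<le> a * 1"
              by (rule T.bounded_functionalD[OF \<xi>(1) CT_cm[OF g(1)]])
                (use g(2) le_CT_norm[OF CT_cm[OF g(1)]] order_trans in \<open>auto simp: topspace_T\<close>)
            then show "\<bar>reduce \<xi> g\<bar> \<le> a * 1" using g(1) by simp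
          qed
        qed
        then show ?thesis by (simp add: dual_space_def)
      qed
      have "\<bar>\<Psi> \<xi>\<bar> \<le> D * vnorm (dual_space CT) (reduce \<xi>)" unfolding \<Psi>_def by (rule D[OF red(1)[OF \<xi>(1)]])
      also have "\<dots> \<le> \<bar>D\<bar> * vnorm (dual_space CT) (reduce \<xi>)" using norm0 by (intro mult_right_mono) auto
      also have "\<dots> \<le> \<bar>D\<bar> * a" using red(2)[OF \<xi>(1)] \<xi>(2) by (intro mult_left_mono) auto
      finally show ?thesis .
    qed
    have \<Psi>_cong: "\<Psi> \<xi> = \<Psi> \<omega>" if "\<And>g. T.cm g \<Longrightarrow> \<xi> g = \<omega> g" for \<xi> \<omega>
    proof -
      have "reduce \<xi> = reduce \<omega>" using that CT_cm by (auto simp: restrict_def fun_eq_iff)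
      then show ?thesis by (simp add: \<Psi>_def)
    qed
    have "(\<lambda>n. \<Psi> (\<mu> n)) \<longlonglongrightarrow> 0"
      by (rule null_sequence_weakly_null[OF \<mu> \<mu>lim \<Psi>_cong \<Psi>_add \<Psi>_scale \<Psi>_bound abs_ge_zero])
    moreover have "\<Psi> (\<mu> n) = \<Phi> (\<phi> n) - \<Phi> \<psi>" for n
    proof -
      have "bounded_functional T (\<bar>-1\<bar> * C) (\<lambda>g. (-1) * extend \<psi> g)" by (rule T.bounded_functional_scale[OF C])
      from \<Psi>_add[OF B this, of n]
      have "\<Psi> (\<lambda>g. extend (\<phi> n) g + (-1) * extend \<psi> g) = \<Psi> (extend (\<phi> n)) + (-1) * \<Psi> (extend \<psi>)"
        using \<Psi>_scale[OF C, of "-1"] by simp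
      moreover have "\<mu> n = (\<lambda>g. extend (\<phi> n) g + (-1) * extend \<psi> g)" by (simp add: \<mu>_def[abs_def])
      ultimately show ?thesis by (simp add: \<Psi>_def reduce_extend \<phi> \<psi>)
    qed
    ultimately have "(\<lambda>n. \<Phi> (\<phi> n) - \<Phi> \<psi>) \<longlonglongrightarrow> 0" by simp
    then show "(\<lambda>n. \<Phi> (\<phi> n)) \<longlonglongrightarrow> \<Phi> \<psi>" by (rule LIM_zero_cancel)
  qed
  then show "\<exists>\<psi>. limitin (weak_topology (dual_space CT)) \<phi> \<psi> sequentially" by blast
qed

end


section \<open>Excluding copies of \<beta>\<omega>, convergent sequences and 2DCP\<close>

context talagrand_realisation
begin

lemma dual_ball_iff: "topspace (dual_ball CT) = {\<phi> \<in> vcarrier (dual_space CT). vnorm (dual_space CT) \<phi> \<le> 1}"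
proof -
  have "vcarrier (dual_space CT) \<subseteq> extensional (vcarrier CT)" by (auto simp: dual_iff)
  then show ?thesis unfolding dual_ball_def weak_star_topology_def by (auto simp: PiE_def)
qed

lemma continuous_map_dual_ball_eval:
  assumes "f \<in> vcarrier CT" shows "continuous_map (dual_ball CT) euclideanreal (\<lambda>\<phi>. \<phi> f)"
  unfolding dual_ball_def weak_star_topology_def
  by (intro continuous_map_from_subtopology continuous_map_product_projection assms)

text \<open>In a copy of \<beta>\<omega> every set S of integers has a continuous indicator h. The
  points with h = 1 and those with h = 0 form compact sets C 1 and C 0, and compactness of their
  product provides the finite family and the constant required by
  \<open>no_separated_sequence\<close>.\<close>

theorem dual_ball_no_beta_omega: "\<not> contains_copy (dual_ball CT) beta_omega"
proof
  assume "contains_copy (dual_ball CT) beta_omega"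
  then obtain A where A: "A \<subseteq> topspace (dual_ball CT)" "subtopology (dual_ball CT) A homeomorphic_space beta_omega"
    unfolding contains_copy_def by blast
  define Y where "Y = subtopology (dual_ball CT) A"
  have Yc: "compact_space Y" unfolding Y_def by (rule beta_omega_copy(1)[OF A])
  obtain z where z: "range z \<subseteq> A" and h: "\<forall>S. \<exists>h. continuous_map Y euclideanreal h \<and>
      (\<forall>n::nat. h (z n) = indicator S n)" using beta_omega_copy(2)[OF A] unfolding Y_def by (elim exE conjE)
  have topY: "topspace Y = A" using A(1) by (auto simp: Y_def)
  have zA: "z n \<in> A" for n using z by blast
  have dual: "\<phi> \<in> vcarrier (dual_space CT)" "vnorm (dual_space CT) \<phi> \<le> 1" if "\<phi> \<in> A" for \<phi>
    using A(1) that unfolding dual_ball_iff by auto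
  have eval: "continuous_map Y euclideanreal (\<lambda>\<phi>. \<phi> f)" if "f \<in> vcarrier CT" for f
    unfolding Y_def by (rule continuous_map_from_subtopology[OF continuous_map_dual_ball_eval[OF that]])
  show False
  proof (rule no_separated_sequence[of 1 "\<lambda>n. extend (z n)"])
    show "bounded_functional T 1 (extend (z n))" for n by (rule unit_ball_bounded_extend[OF dual[OF zA]])
    fix S :: "nat set"
    obtain h where h: "continuous_map Y euclideanreal h" "\<And>n. h (z n) = indicator S n" using h by blast
    define C where "C c = {s \<in> topspace Y. h s \<in> {c}}" for c
    have C: "compactin Y (C c)" for c
      unfolding C_def by (rule closedin_compact_space[OF Yc closedin_continuous_map_preimage[OF h(1)]]) simp
    let ?Y2 = "prod_topology Y Y"
    define O' where "O' p = {q \<in> topspace ?Y2. \<bar>fst q (fst p) - snd q (fst p)\<bar> \<in> {1 / real (Suc (snd p))<..}}"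
      for p :: "(point \<Rightarrow> real) \<times> nat"
    have open_O: "openin ?Y2 (O' p)" if p: "fst p \<in> vcarrier CT" for p
    proof -
      have "continuous_map ?Y2 euclideanreal (\<lambda>q. fst q (fst p))"
        using continuous_map_compose[OF continuous_map_fst eval[OF p]] by (simp add: o_def)
      moreover have "continuous_map ?Y2 euclideanreal (\<lambda>q. snd q (fst p))"
        using continuous_map_compose[OF continuous_map_snd eval[OF p]] by (simp add: o_def)
      ultimately have "continuous_map ?Y2 euclideanreal (\<lambda>q. \<bar>fst q (fst p) - snd q (fst p)\<bar>)"
        by (intro continuous_map_real_abs continuous_map_diff)
      then show ?thesis unfolding O'_def by (rule openin_continuous_map_preimage) simp
    qed
    \<comment> \<open>Distinct functionals differ at some f by more than some 1/(k+1). This covers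
      the product by the open sets O' (f, k), and a finite subcover gives finitely many f and a
      least value 1/(k+1).\<close>
    have "C 1 \<times> C 0 \<subseteq> \<Union>(O' ` (vcarrier CT \<times> UNIV))"
    proof
      fix q assume "q \<in> C 1 \<times> C 0"
      then obtain s t where q: "q = (s, t)" "s \<in> A" "t \<in> A" "h s = 1" "h t = 0" by (auto simp: C_def topY)
      have "s \<noteq> t" using q by auto
      have "s \<in> extensional (vcarrier CT)" "t \<in> extensional (vcarrier CT)"
        using dual(1)[OF q(2)] dual(1)[OF q(3)] by (simp_all add: dual_iff)
      then obtain f where f: "f \<in> vcarrier CT" "s f \<noteq> t f" using \<open>s \<noteq> t\<close> extensionalityI by metis
      then have "0 < \<bar>s f - t f\<bar>" by simp
      then obtain k where "1 / real (Suc k) < \<bar>s f - t f\<bar>" using nat_approx_posE by blast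
      then have "q \<in> O' (f, k)" using q by (simp add: O'_def topY)
      then show "q \<in> \<Union>(O' ` (vcarrier CT \<times> UNIV))" using f(1) by blast
    qed
    moreover have "openin ?Y2 W" if "W \<in> O' ` (vcarrier CT \<times> UNIV)" for W
      using that open_O by auto
    moreover have "compactin ?Y2 (C 1 \<times> C 0)" using C by (simp add: compactin_Times)
    ultimately obtain \<F> where \<F>: "finite \<F>" "\<F> \<subseteq> O' ` (vcarrier CT \<times> UNIV)" "C 1 \<times> C 0 \<subseteq> \<Union>\<F>"
      unfolding compactin_def by meson
    obtain P where P: "P \<subseteq> vcarrier CT \<times> UNIV" "finite P" "\<F> = O' ` P" using finite_subset_image[OF \<F>(1,2)] by blast
    define \<epsilon> where "\<epsilon> = Min (insert 1 ((\<lambda>p. 1 / real (Suc (snd p))) ` P))"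
    have \<epsilon>: "0 < \<epsilon>" "\<And>p. p \<in> P \<Longrightarrow> \<epsilon> \<le> 1 / real (Suc (snd p))"
      using P(2) unfolding \<epsilon>_def by auto
    show "\<exists>\<G> \<epsilon>. finite \<G> \<and> (\<forall>g\<in>\<G>. T.cm g) \<and> 0 < \<epsilon> \<and>
      (\<forall>n\<in>S. \<forall>m\<in>-S. \<exists>g\<in>\<G>. \<epsilon> \<le> \<bar>extend (z n) g - extend (z m) g\<bar>)"
    proof (intro exI conjI ballI)
      show "finite (fst ` P)" using P(2) by simp
      show "T.cm g" if "g \<in> fst ` P" for g using that P(1) CT_cm by auto
      show "0 < \<epsilon>" by (rule \<epsilon>(1))
      fix n m assume "n \<in> S" "m \<in> - S"
      then have "(z n, z m) \<in> C 1 \<times> C 0" using h(2) zA by (simp add: C_def topY)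
      then obtain p where p: "p \<in> P" "(z n, z m) \<in> O' p" using \<F>(3) P(3) by blast
      then have "\<epsilon> \<le> \<bar>z n (fst p) - z m (fst p)\<bar>" using \<epsilon>(2)[OF p(1)] by (simp add: O'_def)
      moreover have "fst p \<in> vcarrier CT" using p(1) P(1) by auto
      ultimately show "\<exists>g\<in>fst ` P. \<epsilon> \<le> \<bar>extend (z n) g - extend (z m) g\<bar>"
        using p(1) by (intro bexI[of _ "fst p"] imageI) (simp_all add: extend_restrict_eq)
    qed
  qed
qed

lemma clopen_separation:
  assumes "x \<in> carrier" "openin T D" "x \<in> D"
  obtains V where "clopenin T V" "x \<in> V" "V \<subseteq> D"
  using T.clopen_base[OF assms(2,3)] by blast

lemma closedin_point: "x \<in> carrier \<Longrightarrow> closedin T {x}"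
  using closedin_Hausdorff_sing_eq[OF Hausdorff_T] by (simp add: topspace_T)

text \<open>Point evaluations embed a compact subset of T into the dual ball, so a copy in T would
  give one there.\<close>

theorem T_no_beta_omega: "\<not> contains_copy T beta_omega"
proof
  assume "contains_copy T beta_omega"
  then obtain A where A: "A \<subseteq> topspace T" "subtopology T A homeomorphic_space beta_omega"
    unfolding contains_copy_def by blast
  define \<Delta> where "\<Delta> x = reduce (\<lambda>f. f x)" for x
  have topA: "topspace (subtopology T A) = A" using A(1) by auto
  have AC: "x \<in> carrier" if "x \<in> A" for x using A(1) that by (auto simp: topspace_T)
  have ball: "\<Delta> x \<in> topspace (dual_ball CT)" if "x \<in> carrier" for x
  proof -
    have "bounded_functional T 1 (\<lambda>f. f x)" by (rule T.point_evaluation(1)) (simp add: that topspace_T)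
    from reduce_dual[OF this] show ?thesis unfolding dual_ball_iff \<Delta>_def by simp
  qed
  have cont: "continuous_map (subtopology T A) (dual_ball CT) \<Delta>"
    unfolding dual_ball_def weak_star_topology_def continuous_map_in_subtopology continuous_map_componentwise
  proof (intro conjI ballI)
    show "\<Delta> ` topspace (subtopology T A) \<subseteq> extensional (vcarrier CT)" by (auto simp: \<Delta>_def)
    fix f assume f: "f \<in> vcarrier CT"
    have "(\<lambda>x. \<Delta> x f) = f" using f by (simp add: \<Delta>_def)
    then show "continuous_map (subtopology T A) euclideanreal (\<lambda>x. \<Delta> x f)"
      using continuous_map_from_subtopology[OF CT_cm[OF f], of A] by simp
  next
    show "\<Delta> \<in> topspace (subtopology T A) \<rightarrow> vcarrier (dual_space CT)"
      using ball AC unfolding topA dual_ball_iff by blast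
    show "\<Delta> \<in> topspace (subtopology T A) \<rightarrow> {\<phi> \<in> vcarrier (dual_space CT). vnorm (dual_space CT) \<phi> \<le> 1}"
      using ball AC unfolding topA dual_ball_iff by blast
  qed
  have inj: "inj_on \<Delta> (topspace (subtopology T A))"
  proof (rule inj_onI, rule ccontr)
    fix x y assume xy: "x \<in> topspace (subtopology T A)" "y \<in> topspace (subtopology T A)" "\<Delta> x = \<Delta> y" "x \<noteq> y"
    then have c: "x \<in> carrier" "y \<in> carrier" using AC unfolding topA by auto
    have "openin T (topspace T - {y})" using closedin_point[OF c(2)] by (rule openin_diff[OF openin_topspace])
    then obtain V where V: "clopenin T V" "x \<in> V" "V \<subseteq> topspace T - {y}"
      using clopen_separation[OF c(1), of "topspace T - {y}"] c xy(4) by (auto simp: topspace_T)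
    define f :: "point \<Rightarrow> real" where "f = restrict (indicator V) carrier"
    have f: "f \<in> vcarrier CT" unfolding f_def by (rule restrict_CT[OF T.cm_indicator(1)[OF V(1)]])
    have "\<Delta> x f = \<Delta> y f" using xy(3) by simp
    then have "f x = f y" using f by (simp add: \<Delta>_def)
    then show False using V(2,3) c by (auto simp: f_def indicator_def)
  qed
  have Haus: "Hausdorff_space (dual_ball CT)"
    unfolding dual_ball_def weak_star_topology_def
    by (intro Hausdorff_space_subtopology) (simp add: Hausdorff_space_product_topology)
  have "embedding_map (subtopology T A) (dual_ball CT) \<Delta>"
    by (rule continuous_imp_embedding_map[OF cont beta_omega_copy(1)[OF A] Haus inj])
  then have "subtopology T A homeomorphic_space
      subtopology (dual_ball CT) (\<Delta> ` topspace (subtopology T A))"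
    by (rule embedding_map_imp_homeomorphic_space)
  then have "subtopology (dual_ball CT) (\<Delta> ` A) homeomorphic_space subtopology T A"
    unfolding topA by (rule homeomorphic_space_sym[THEN iffD1])
  then have "subtopology (dual_ball CT) (\<Delta> ` A) homeomorphic_space beta_omega"
    by (rule homeomorphic_space_trans) (rule A(2))
  moreover have "\<Delta> ` A \<subseteq> topspace (dual_ball CT)" using ball AC by blast
  ultimately show False using dual_ball_no_beta_omega unfolding contains_copy_def by blast
qed

text \<open>(G) is applied to point masses at terms with disjoint clopen neighbourhoods. It yields a
  clopen C that infinitely many terms enter and infinitely many avoid; but C or its complement is a
  neighbourhood of the limit.\<close>

theorem no_convergent_sequence: "\<not> nontrivial_convergent_sequence T"
proof
  assume "nontrivial_convergent_sequence T"
  then obtain x :: "nat \<Rightarrow> point" and l where xr: "range x \<subseteq> carrier" and lim: "limitin T x l sequentially"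
    and nt: "\<not> eventually (\<lambda>n. x n = l) sequentially"
    unfolding nontrivial_convergent_sequence_def topspace_T by blast
  have x: "x n \<in> carrier" for n using xr by blast
  have l: "l \<in> carrier" using limitin_topspace[OF lim] by (simp add: topspace_T)
  have ev: "\<exists>N. \<forall>n\<ge>N. x n \<in> D" if "openin T D" "l \<in> D" for D
    using lim that unfolding limitin_def eventually_sequentially by blast
  \<comment> \<open>G is the union of the neighbourhoods chosen so far. It is closed and misses l,
    so the sequence eventually leaves it, and a later term other than l has a clopen neighbourhood
    that avoids both G and l.\<close>
  have step: "\<exists>m>n. \<exists>V. clopenin T V \<and> x m \<in> V \<and> V \<inter> G = {} \<and> l \<notin> V" if G: "clopenin T G" "l \<notin> G" for n G
  proof -
    have o: "openin T (topspace T - G)" using clopenin_Diff[OF clopenin_topspace G(1)] by (simp add: clopenin_def)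
    have "l \<in> topspace T - G" using l G(2) by (simp add: topspace_T)
    then obtain N where N: "\<And>n. n \<ge> N \<Longrightarrow> x n \<in> topspace T - G" using ev[OF o] by blast
    obtain m where m: "m \<ge> max N (Suc n)" "x m \<noteq> l" using nt unfolding eventually_sequentially by blast
    have "openin T (topspace T - G - {l})" by (rule openin_diff[OF o closedin_point[OF l]])
    moreover have "x m \<in> topspace T - G - {l}" using N[of m] m by simp
    ultimately obtain V where "clopenin T V" "x m \<in> V" "V \<subseteq> topspace T - G - {l}"
      by (rule clopen_separation[OF x])
    then show ?thesis using m(1) by (intro exI[of _ m] conjI exI[of _ V]) auto
  qed
  define P where "P s = (case s of (n::nat, V, G) \<Rightarrow> clopenin T G \<and> l \<notin> G \<and> clopenin T V \<and> x n \<in> V \<and> V \<subseteq> G)" for s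
  define Q where "Q s s' = (case (s, s') of ((n::nat, V::point set, G::point set), (n'::nat, V', G')) \<Rightarrow>
    n < n' \<and> G \<subseteq> G' \<and> V' \<inter> G = {})" for s s'
  have "\<exists>F. \<forall>k::nat. P (F k) \<and> Q (F k) (F (Suc k))"
  proof (rule dependent_nat_choice)
    obtain m V where "clopenin T V" "x m \<in> V" "l \<notin> V" using step[OF clopenin_empty, of 0] by auto
    then have "P (m, V, V)" by (simp add: P_def)
    then show "\<exists>s. P s" by blast
    fix s assume "P s"
    obtain n V G where s: "s = (n, V, G)" by (metis prod.exhaust)
    have G: "clopenin T G" "l \<notin> G" using \<open>P s\<close> by (auto simp: s P_def)
    obtain m V' where V': "n < m" "clopenin T V'" "x m \<in> V'" "V' \<inter> G = {}" "l \<notin> V'" using step[OF G, of n] by blast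
    then have "P (m, V', G \<union> V') \<and> Q s (m, V', G \<union> V')" using G by (auto simp: P_def Q_def s)
    then show "\<exists>s'. P s' \<and> Q s s'" by blast
  qed
  then obtain F where F: "\<And>k. P (F k)" "\<And>k. Q (F k) (F (Suc k))" by blast
  define n V G where "n k = fst (F k)" and "V k = fst (snd (F k))" and "G k = snd (snd (F k))" for k
  have FF: "F k = (n k, V k, G k)" for k by (simp add: n_def V_def G_def)
  have p: "clopenin T (V k)" "x (n k) \<in> V k" "V k \<subseteq> G k" for k using F(1)[of k] by (auto simp: FF P_def)
  have q: "n k < n (Suc k)" "G k \<subseteq> G (Suc k)" "V (Suc k) \<inter> G k = {}" for k using F(2)[of k] by (auto simp: FF Q_def)
  have n: "strict_mono n" using q(1) by (simp add: strict_mono_Suc_iff)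
  have Gm: "G i \<subseteq> G j" if "i \<le> j" for i j using lift_Suc_mono_le[of G, OF q(2) that] .
  have dis: "V i \<inter> V j = {}" if "i < j" for i j
  proof (cases j)
    case (Suc j')
    then have "V i \<subseteq> G j'" using p(3)[of i] Gm[of i j'] that by auto
    then show ?thesis using q(3)[of j'] Suc by auto
  qed (use that in simp)
  have disj: "disjoint_family V" unfolding disjoint_family_on_def
    using dis by (metis Int_commute nat_neq_iff)
  have xT: "x (n k) \<in> topspace T" for k using x by (simp add: topspace_T)
  show False
  proof (rule oscillation[of "\<lambda>k f. f (x (n k))" V])
    show "bounded_functional T 1 (\<lambda>f. f (x (n k)))" "T.modulus (\<lambda>f. f (x (n k))) (\<lambda>x. 1) = 1" for k
      by (rule T.point_evaluation[OF xT])+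
    show "clopenin T (V k)" for k by (rule p(1))
    show "disjoint_family V" by (rule disj)
    show "indicator (V k) (x (n k)) * g (x (n k)) = g (x (n k))" for k and g :: "point \<Rightarrow> real"
      using p(2)[of k] by simp
    fix C assume C: "clopenin T C" "infinite {k. 1/6 \<le> (indicator C (x (n k)) :: real)}"
      "infinite {k. (indicator C (x (n k)) :: real) = 0}"
    have large: "\<exists>k\<ge>N. x (n k) \<in> C" "\<exists>k\<ge>N. x (n k) \<notin> C" for N
      using C(2,3) by (auto simp: infinite_nat_iff_unbounded_le indicator_def of_bool_def split: if_splits)
    have "(\<exists>N. \<forall>k\<ge>N. x k \<in> C) \<or> (\<exists>N. \<forall>k\<ge>N. x k \<notin> C)"
    proof (cases "l \<in> C")
      case True
      then show ?thesis using ev[of C] C(1) by (simp add: clopenin_def)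
    next
      case False
      have "openin T (topspace T - C)" using clopenin_Diff[OF clopenin_topspace C(1)] by (simp add: clopenin_def)
      then show ?thesis using ev[of "topspace T - C"] l False by (auto simp: topspace_T)
    qed
    then show False
    proof (elim disjE exE)
      fix N assume "\<forall>k\<ge>N. x k \<in> C"
      then show False using large(2)[of N] seq_suble[OF n] order_trans by blast
    next
      fix N assume "\<forall>k\<ge>N. x k \<notin> C"
      then show False using large(1)[of N] seq_suble[OF n] order_trans by blast
    qed
  qed simp
qed

theorem not_two_disjoint_copies:
  assumes rigid: "\<And>A B. closedin T A \<Longrightarrow> closedin T B \<Longrightarrow> A \<inter> B = {} \<Longrightarrow>
           \<not> metrizable_space (subtopology T A) \<Longrightarrow> \<not> metrizable_space (subtopology T B) \<Longrightarrow>
           \<not> subtopology T A homeomorphic_space subtopology T B"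
  shows "\<not> two_disjoint_copies T"
proof
  assume "two_disjoint_copies T"
  then obtain C :: "nat \<Rightarrow> point set" where C: "\<And>n. C n \<noteq> {}" "\<And>n. compactin T (C n)"
    and AB: "\<And>n. \<exists>A B. A \<subseteq> C n \<and> B \<subseteq> C n \<and> A \<inter> B = {} \<and>
           subtopology T A homeomorphic_space subtopology T (C (Suc n)) \<and>
           subtopology T B homeomorphic_space subtopology T (C (Suc n))"
    unfolding two_disjoint_copies_def by blast
  have CT: "C n \<subseteq> topspace T" for n by (rule compactin_subset_topspace[OF C(2)])
  have closed: "closedin T A" if "A \<subseteq> C n" "subtopology T A homeomorphic_space subtopology T (C (Suc n))" for A n
  proof -
    have "compact_space (subtopology T (C (Suc n)))" by (rule compact_space_subtopology[OF C(2)])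
    then have "compact_space (subtopology T A)" using homeomorphic_compact_space[OF that(2)] by simp
    then have "compactin T A" using that(1) CT[of n] by (simp add: compactin_subspace)
    then show ?thesis by (rule compactin_imp_closedin[OF Hausdorff_T])
  qed
  have "metrizable_space (subtopology T (C 1))"
  proof (rule ccontr)
    assume nm: "\<not> metrizable_space (subtopology T (C 1))"
    obtain A B where *: "A \<subseteq> C 0" "B \<subseteq> C 0" "A \<inter> B = {}"
      "subtopology T A homeomorphic_space subtopology T (C (Suc 0))"
      "subtopology T B homeomorphic_space subtopology T (C (Suc 0))" using AB[of 0] by blast
    have "\<not> metrizable_space (subtopology T A)" "\<not> metrizable_space (subtopology T B)"
      using nm homeomorphic_metrizable_space[OF *(4)] homeomorphic_metrizable_space[OF *(5)] by simp_all
    then have "\<not> subtopology T A homeomorphic_space subtopology T B"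
      by (rule rigid[OF closed[OF *(1,4)] closed[OF *(2,5)] *(3)])
    then show False
      using homeomorphic_space_trans[OF *(4) homeomorphic_space_sym[THEN iffD1, OF *(5)]] by contradiction
  qed
  then obtain M d where M: "Metric_space M d" and top: "subtopology T (C 1) = Metric_space.mtopology M d"
    unfolding metrizable_space_def by blast
  interpret Metric_space M d by (rule M)
  have MC: "M = C 1" using top CT[of 1] topspace_mtopology by (metis inf.absorb2 topspace_subtopology)
  have bij: "\<exists>f. bij_betw f A (C (Suc n))"
    if "A \<subseteq> C n" "subtopology T A homeomorphic_space subtopology T (C (Suc n))" for A n
  proof -
    obtain f where f: "homeomorphic_map (subtopology T A) (subtopology T (C (Suc n))) f"
      using \<open>subtopology T A homeomorphic_space subtopology T (C (Suc n))\<close> homeomorphic_space by blast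
    have "topspace (subtopology T A) = A" "topspace (subtopology T (C (Suc n))) = C (Suc n)"
      using \<open>A \<subseteq> C n\<close> CT[of n] CT[of "Suc n"] by auto
    then have "bij_betw f A (C (Suc n))"
      using homeomorphic_imp_injective_map[OF f] homeomorphic_imp_surjective_map[OF f] by (simp add: bij_betw_def)
    then show ?thesis by blast
  qed
  \<comment> \<open>Two disjoint copies of the next set at least halve a finite cardinality.
    Starting from a finite C 1, after card (C 1) steps a non-empty set would give 2^n <= n with n =
    card (C 1).\<close>
  have half: "finite (C (Suc n)) \<and> 2 * card (C (Suc n)) \<le> card (C n)" if fin: "finite (C n)" for n
  proof -
    obtain A B where *: "A \<subseteq> C n" "B \<subseteq> C n" "A \<inter> B = {}"
      "subtopology T A homeomorphic_space subtopology T (C (Suc n))"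
      "subtopology T B homeomorphic_space subtopology T (C (Suc n))" using AB[of n] by blast
    obtain f where f: "bij_betw f A (C (Suc n))" using bij[OF *(1,4)] by blast
    obtain g where g: "bij_betw g B (C (Suc n))" using bij[OF *(2,5)] by blast
    have finAB: "finite A" "finite B" using * fin finite_subset by blast+
    have "card A + card B = card (A \<union> B)" using finAB *(3) by (simp add: card_Un_disjoint)
    also have "\<dots> \<le> card (C n)" using * fin by (intro card_mono) auto
    finally show ?thesis
      using bij_betw_same_card[OF f] bij_betw_same_card[OF g] bij_betw_finite[OF f] finAB by simp
  qed
  have inf: "infinite (C 1)"
  proof
    assume fin: "finite (C 1)"
    have "finite (C (Suc n)) \<and> 2 ^ n * card (C (Suc n)) \<le> card (C 1)" for n
    proof (induction n)
      case (Suc n)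
      have "2 ^ Suc n * card (C (Suc (Suc n))) = 2 ^ n * (2 * card (C (Suc (Suc n))))" by simp
      also have "\<dots> \<le> 2 ^ n * card (C (Suc n))" using half Suc by (intro mult_left_mono) auto
      also have "\<dots> \<le> card (C 1)" using Suc by (rule conjunct2)
      finally show ?case using conjunct1[OF half[OF conjunct1[OF Suc]]] by (rule conjI[rotated])
    qed (use fin in simp)
    then have f: "finite (C (Suc (card (C 1))))" and c: "2 ^ card (C 1) * card (C (Suc (card (C 1)))) \<le> card (C 1)" by blast+
    have "1 \<le> card (C (Suc (card (C 1))))" using f C(1) by (simp add: Suc_le_eq card_gt_0_iff)
    then have "2 ^ card (C 1) * 1 \<le> 2 ^ card (C 1) * card (C (Suc (card (C 1))))" by (rule mult_le_mono2)
    then have "2 ^ card (C 1) \<le> card (C 1)" using c by (metis mult_1_right order_trans)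
    then show False using less_exp[of "card (C 1)"] by linarith
  qed
  obtain \<sigma> :: "nat \<Rightarrow> point" where \<sigma>: "inj \<sigma>" "range \<sigma> \<subseteq> C 1" using infinite_countable_subset[OF inf] by blast
  have "compact_space mtopology" using compact_space_subtopology[OF C(2)[of 1]] top by simp
  then obtain l r where lr: "strict_mono (r :: nat \<Rightarrow> nat)" "limitin mtopology (\<sigma> \<circ> r) l sequentially"
    using \<sigma>(2) MC unfolding compact_space_sequentially by blast
  have "limitin T (\<sigma> \<circ> r) l sequentially" using lr(2) unfolding top[symmetric] limitin_subtopology by blast
  moreover have "range (\<sigma> \<circ> r) \<subseteq> topspace T" using \<sigma>(2) CT[of 1] by auto
  moreover have "\<not> eventually (\<lambda>n. (\<sigma> \<circ> r) n = l) sequentially"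
  proof
    assume "eventually (\<lambda>n. (\<sigma> \<circ> r) n = l) sequentially"
    then obtain N where N: "\<And>n. n \<ge> N \<Longrightarrow> \<sigma> (r n) = l" by (auto simp: eventually_sequentially)
    have "\<sigma> (r N) = \<sigma> (r (Suc N))" using N[of N] N[of "Suc N"] by simp
    then have "r N = r (Suc N)" using \<sigma>(1) by (simp add: inj_eq)
    then show False using strict_mono_eq[OF lr(1)] by simp
  qed
  ultimately show False using no_convergent_sequence unfolding nontrivial_convergent_sequence_def by blast
qed

end

theorem theorem2:
  fixes S :: "omega1 set"
    and T :: "point topology"
  assumes "stationary S" and "stationary (- S)" and "diamond S"
    and "talagrand_realisation K Y Z \<eta> U \<nu> I J N0 N1"
    and "T = final_compactum K"
    and "\<And>A B. closedin T A \<Longrightarrow> closedin T B \<Longrightarrow> A \<inter> B = {} \<Longrightarrow>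
           \<not> metrizable_space (subtopology T A) \<Longrightarrow> \<not> metrizable_space (subtopology T B) \<Longrightarrow>
           \<not> subtopology T A homeomorphic_space subtopology T B"
  shows "\<not> two_disjoint_copies T \<and>
         grothendieck_property (Cont T) \<and>
         \<not> contains_copy (dual_ball (Cont T)) beta_omega \<and>
         \<not> nontrivial_convergent_sequence T \<and>
         \<not> contains_copy T beta_omega"
proof -
  interpret talagrand_realisation K Y Z \<eta> U \<nu> I J N0 N1 by (rule assms(4))
  have "\<not> two_disjoint_copies (final_compactum K)"
    by (rule not_two_disjoint_copies) (rule assms(6)[unfolded assms(5)])
  then show ?thesis
    unfolding assms(5)
    using grothendieck_CT dual_ball_no_beta_omega no_convergent_sequence T_no_beta_omega by blast
qed


end
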